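(* Let $1<\alpha<2$, $\gamma=1/\alpha$, $T>0$, let $X,m,A$ be as in the context, let $u_0\in V_\gamma$, $u_1\in L^2(X)$ and $$f\in C([0,T];V_{-\gamma})\cap L^q((0,T);L^2(X)),\qquad \text{for } \frac1p+\frac1q=1 \text{ and } 1\le p<\frac{1}{2-\alpha}.$$ Then the linear system $$\mathbb D_t^\alpha u(x,t)+Au(x,t)=f(x,t)\ \text{ in } X\times(0,T),\qquad u(\cdot,0)=u_0,\quad \partial_tu(\cdot,0)=u_1\ \text{ in } X,$$ has a unique weak solution $u$ on $(0,T)$ (in the sense defined in the context), given by $$u(\cdot,t)=\sum_{n=1}^\infty (u_0,\varphi_n)E_{\alpha,1}(-\lambda_nt^\alpha)\varphi_n+\sum_{n=1}^\infty (u_1,\varphi_n)tE_{\alpha,2}(-\lambda_nt^\alpha)\varphi_n+\sum_{n=1}^\infty\left(\int_0^t (f(\cdot,\tau),\varphi_n)(t-\tau)^{\alpha-1}E_{\alpha,\alpha}(-\lambda_n(t-\tau)^\alpha)\,d\tau\right)\varphi_n .$$ Moreover, there is a constant $C>0$ such that for all $t\in[0,T]$, $$\|u(\cdot,t)\|_{V_\gamma}+\|\partial_tu(\cdot,t)\|_{L^2(X)}\le C\left(\|u_0\|_{V_\gamma}+\|u_1\|_{L^2(X)}+t^{\frac1p+\alpha-2}\|f\|_{L^q((0,T);L^2(X))}\right)$$ and $$\|\mathbb D_t^\alpha u(\cdot,t)\|_{V_{-\gamma}}\le C\left(\|u_0\|_{V_\gamma}+t^{2-\alpha}\|u_1\|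_{L^2(X)}+t^{\frac1p}\|f\|_{L^q((0,T);L^2(X))}+\|f\|_{C([0,T];V_{-\gamma})}\right).$$
   Context: Setting. $X$ is a relatively compact metric space and $m$ is a Radon measure on $X$ with $\mathrm{supp}(m)=X$ and $m(X)<\infty$; $L^p(X)=L^p(X,m)$ (real-valued), and $(\cdot,\cdot)$ is the inner product of $L^2(X)$; "a.e. in $X$" means $m$-a.e. A Dirichlet form on $L^2(X)$ is a symmetric, non-negative, bilinear form $\mathcal E_A:V_{1/2}\times V_{1/2}\to\mathbb R$ whose domain $V_{1/2}=D(\mathcal E_A)$ is a dense linear subspace of $L^2(X)$, which is closed ($V_{1/2}$ is complete for the inner product $\mathcal E_A(u,v)+\lambda(u,v)$, $\lambda>0$) and Markovian: for each $\epsilon>0$ there is $\phi_\epsilon\in C^\infty(\mathbb R)$ with $\phi_\epsilon(t)=t$ on $[0,1]$, $-\epsilon\le\phi_\epsilon\le1+\epsilon$, $0\le\phi_\epsilon(t)-\phi_\epsilon(\tau)\le t-\tau$ for $\tau<t$, such that $u\in V_{1/2}$ implies $\phi_\epsilon(u)\in V_{1/2}$ and $\mathcal E_A(\phi_\epsilon(u),\phi_\epsilon(u))\le\mathcal E_A(u,u)$. Assumptions on $A$. $A$ is the non-negative self-adjoint operator on $L^2(X)$ associated with a Dirichlet form $\mathcal E_A$, i.e. $V_{1/2}=D(A^{1/2})$ and $\mathcal E_A(u,v)=(Au,v)$ for $u\in D(A)$, $v\in V_{1/2}$. It is assumed that $V_{1/2}$ embeds compactly in $L^2(X)$ and that $V_{1/2}\hookrightarrow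 L^{2q_A}(X)$ continuously for some $q_A>1$. Then $A$ has discrete spectrum $\lambda_1\le\lambda_2\le\dots\to+\infty$; throughout, $\lambda_1>0$. $(\varphi_n)_{n\in\mathbb N}$ is an orthonormal basis of $L^2(X)$ of eigenfunctions, $A\varphi_n=\lambda_n\varphi_n$. Spaces. For $s\ge0$, $V_s:=D(A^s)=\{h\in L^2(X):\sum_n|(h,\varphi_n)|^2\lambda_n^{2s}<\infty\}$, with norm $\|h\|_{V_s}=(\sum_n|(h,\varphi_n)|^2\lambda_n^{2s})^{1/2}$. Identifying $L^2(X)$ with its dual, $V_{-s}:=(V_s)^*$, with norm $(\sum_n|\langle h,\varphi_n\rangle|^2\lambda_n^{-2s})^{1/2}$; $\langle\cdot,\cdot\rangle_{V_{-s},V_s}$ is the duality bracket. Mittag-Leffler functions: $E_{\alpha,\beta}(z)=\sum_{n=0}^\infty \frac{z^n}{\Gamma(\alpha n+\beta)}$. Caputo derivative: $\mathbb D_t^\alpha u(x,t)=\frac1{\Gamma(2-\alpha)}\int_0^t(t-s)^{1-\alpha}\partial_s^2u(x,s)\,ds$, which for sufficiently smooth $u$ is equivalent to the weaker form $\frac{1}{\Gamma(2-\alpha)}\partial_t^2\int_0^t(t-s)^{1-\alpha}\big(u(x,s)-u(x,0)-s\,\partial_su(x,0)\big)ds$ (which requires less smoothness of $u$). Weak solution of the linear system on $(0,T)$. A function $u$ such that: (1) $u\in C([0,T];V_\gamma)\cap C^1([0,T];L^2(X))$ and $\mathbb D_t^\alpha u\in C([0,T];V_{-\gamma})$; (2)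 $u(\cdot,0)=u_0$ and $\partial_tu(\cdot,0)=u_1$ a.e. in $X$, and $\lim_{t\to0^+}\|u(\cdot,t)-u_0\|_{V_\sigma}=0$, $\lim_{t\to0^+}\|\partial_tu(\cdot,t)-u_1\|_{V_{-\beta}}=0$ for some $\frac1\alpha>\sigma\ge0$ and $1-\frac1\alpha\ge\beta>0$; (3) for every $\varphi\in V_\gamma\hookrightarrow V_{1/2}$ and a.e. $t\in(0,T)$, $\langle\mathbb D_t^\alpha u(\cdot,t),\varphi\rangle_{V_{-\gamma},V_\gamma}+\mathcal E_A(u(\cdot,t),\varphi)=(f(\cdot,t),\varphi)$. *)

theory Defs
  imports "HOL-Analysis.Analysis" "HOL-Probability.Essential_Supremum"
begin

section \<open>The measure space\<close>

text \<open>The metric space \<open>X\<close> is a subset of an ambient metric space (a type of class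
  \<^class>\<open>metric_space\<close>), and a measure on it is a measure with space \<open>X\<close>, defined on the
  Borel sets of the subspace \<open>X\<close>.\<close>

definition radon_measure_on :: "'a::metric_space set \<Rightarrow> 'a measure \<Rightarrow> bool" where
  "radon_measure_on X m \<longleftrightarrow>
     space m = X \<and> sets m = sets (restrict_space borel X) \<and>
     (\<forall>K. compact K \<and> K \<subseteq> X \<longrightarrow> emeasure m K < \<infinity>) \<and>
     (\<forall>B\<in>sets m. emeasure m B = (SUP K\<in>{K. compact K \<and> K \<subseteq> B}. emeasure m K))"

definition measure_support :: "'a::metric_space set \<Rightarrow> 'a measure \<Rightarrow> 'a set" where
  "measure_support X m = {x\<in>X. \<forall>U. open U \<and> x \<in> U \<longrightarrow> 0 < emeasure m (U \<inter> X)}"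

section \<open>The space L2\<close>

text \<open>Elements of \<open>L\<^sup>2(X)\<close> are represented by square integrable functions; equality in
  \<open>L\<^sup>2(X)\<close> is equality almost everywhere.  Subspaces of \<open>L\<^sup>2(X)\<close> are therefore
  required to be closed under almost everywhere equality, and forms and operators to respect it.\<close>

definition L2 :: "'a measure \<Rightarrow> ('a \<Rightarrow> real) set" where
  "L2 m = {u \<in> borel_measurable m. integrable m (\<lambda>x. (u x)\<^sup>2)}"

definition L2_inner :: "'a measure \<Rightarrow> ('a \<Rightarrow> real) \<Rightarrow> ('a \<Rightarrow> real) \<Rightarrow> real" where
  "L2_inner m u v = (LINT x|m. u x * v x)"

definition L2_norm :: "'a measure \<Rightarrow> ('a \<Rightarrow> real) \<Rightarrow> real" where
  "L2_norm m u = sqrt (L2_inner m u u)"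

definition ae_eq :: "'a measure \<Rightarrow> ('a \<Rightarrow> real) \<Rightarrow> ('a \<Rightarrow> real) \<Rightarrow> bool" where
  "ae_eq m u v \<longleftrightarrow> (AE x in m. u x = v x)"

definition L2_subspace :: "'a measure \<Rightarrow> ('a \<Rightarrow> real) set \<Rightarrow> bool" where
  "L2_subspace m V \<longleftrightarrow>
     V \<subseteq> L2 m \<and> (\<lambda>x. 0) \<in> V \<and>
     (\<forall>u\<in>V. \<forall>v\<in>V. \<forall>a b. (\<lambda>x. a * u x + b * v x) \<in> V) \<and>
     (\<forall>u\<in>V. \<forall>v\<in>borel_measurable m. ae_eq m u v \<longrightarrow> v \<in> V)"

definition L2_dense :: "'a measure \<Rightarrow> ('a \<Rightarrow> real) set \<Rightarrow> bool" where
  "L2_dense m V \<longleftrightarrow> (\<forall>h\<in>L2 m. \<forall>e>0. \<exists>v\<in>V. L2_norm m (\<lambda>x. h x - v x) < e)"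

text \<open>\<open>s\<close> is the sum in \<open>L\<^sup>2(X)\<close> of the series \<open>\<Sum>n. c n \<phi> n\<close>.\<close>

definition L2_sums ::
  "'a measure \<Rightarrow> (nat \<Rightarrow> 'a \<Rightarrow> real) \<Rightarrow> (nat \<Rightarrow> real) \<Rightarrow> ('a \<Rightarrow> real) \<Rightarrow> bool" where
  "L2_sums m \<phi> c s \<longleftrightarrow> s \<in> L2 m \<and>
     (\<lambda>N. L2_norm m (\<lambda>x. (\<Sum>n<N. c n * \<phi> n x) - s x)) \<longlonglongrightarrow> 0"

section \<open>Dirichlet forms and the associated operator\<close>

definition form_norm ::
  "'a measure \<Rightarrow> (('a \<Rightarrow> real) \<Rightarrow> ('a \<Rightarrow> real) \<Rightarrow> real) \<Rightarrow> real \<Rightarrow> ('a \<Rightarrow> real) \<Rightarrow> real" where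
  "form_norm m E l u = sqrt (E u u + l * L2_inner m u u)"

definition closed_form ::
  "'a measure \<Rightarrow> ('a \<Rightarrow> real) set \<Rightarrow> (('a \<Rightarrow> real) \<Rightarrow> ('a \<Rightarrow> real) \<Rightarrow> real) \<Rightarrow> bool" where
  "closed_form m V E \<longleftrightarrow> (\<forall>l>0. \<forall>w. (\<forall>n::nat. w n \<in> V) \<and>
     (\<forall>e>0. \<exists>N. \<forall>i\<ge>N. \<forall>j\<ge>N. form_norm m E l (\<lambda>x. w i x - w j x) < e) \<longrightarrow>
     (\<exists>u\<in>V. (\<lambda>n. form_norm m E l (\<lambda>x. w n x - u x)) \<longlonglongrightarrow> 0))"

definition markovian_form ::
  "('a \<Rightarrow> real) set \<Rightarrow> (('a \<Rightarrow> real) \<Rightarrow> ('a \<Rightarrow> real) \<Rightarrow> real) \<Rightarrow> bool" where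
  "markovian_form V E \<longleftrightarrow> (\<forall>e>0. \<exists>\<psi> :: real \<Rightarrow> real.
     (\<forall>k t. ((deriv ^^ k) \<psi>) differentiable (at t)) \<and>
     (\<forall>t\<in>{0..1}. \<psi> t = t) \<and>
     (\<forall>t. - e \<le> \<psi> t \<and> \<psi> t \<le> 1 + e) \<and>
     (\<forall>r t. r < t \<longrightarrow> 0 \<le> \<psi> t - \<psi> r \<and> \<psi> t - \<psi> r \<le> t - r) \<and>
     (\<forall>u\<in>V. (\<lambda>x. \<psi> (u x)) \<in> V \<and> E (\<lambda>x. \<psi> (u x)) (\<lambda>x. \<psi> (u x)) \<le> E u u))"

definition dirichlet_form ::
  "'a measure \<Rightarrow> ('a \<Rightarrow> real) set \<Rightarrow> (('a \<Rightarrow> real) \<Rightarrow> ('a \<Rightarrow> real) \<Rightarrow> real) \<Rightarrow> bool" where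
  "dirichlet_form m V E \<longleftrightarrow>
     L2_subspace m V \<and> L2_dense m V \<and>
     (\<forall>u\<in>V. \<forall>u'\<in>V. \<forall>v\<in>V. ae_eq m u u' \<longrightarrow> E u v = E u' v) \<and>
     (\<forall>u\<in>V. \<forall>v\<in>V. E u v = E v u) \<and>
     (\<forall>u\<in>V. 0 \<le> E u u) \<and>
     (\<forall>u\<in>V. \<forall>v\<in>V. \<forall>w\<in>V. \<forall>a b. E (\<lambda>x. a * u x + b * v x) w = a * E u w + b * E v w) \<and>
     closed_form m V E \<and> markovian_form V E"

definition compactly_embedded ::
  "'a measure \<Rightarrow> ('a \<Rightarrow> real) set \<Rightarrow> (('a \<Rightarrow> real) \<Rightarrow> ('a \<Rightarrow> real) \<Rightarrow> real) \<Rightarrow> bool" where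
  "compactly_embedded m V E \<longleftrightarrow>
     (\<forall>w. (\<forall>n::nat. w n \<in> V) \<and> (\<exists>B. \<forall>n. form_norm m E 1 (w n) \<le> B) \<longrightarrow>
       (\<exists>h\<in>L2 m. \<exists>r::nat \<Rightarrow> nat. strict_mono r \<and>
         (\<lambda>n. L2_norm m (\<lambda>x. w (r n) x - h x)) \<longlonglongrightarrow> 0))"

definition embedded_in_Lp ::
  "'a measure \<Rightarrow> ('a \<Rightarrow> real) set \<Rightarrow> (('a \<Rightarrow> real) \<Rightarrow> ('a \<Rightarrow> real) \<Rightarrow> real) \<Rightarrow> real \<Rightarrow> bool" where
  "embedded_in_Lp m V E r \<longleftrightarrow> (\<exists>C. \<forall>u\<in>V.
     integrable m (\<lambda>x. \<bar>u x\<bar> powr r) \<and>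
     (LINT x|m. \<bar>u x\<bar> powr r) powr (1 / r) \<le> C * form_norm m E 1 u)"

text \<open>The last conjunct says that \<open>A\<close> coincides with its adjoint, domains included:
  \<open>v \<in> D(A*)\<close> and \<open>A* v = h\<close> iff \<open>v \<in> D(A)\<close> and \<open>A v = h\<close>.\<close>

definition selfadjoint_operator ::
  "'a measure \<Rightarrow> ('a \<Rightarrow> real) set \<Rightarrow> (('a \<Rightarrow> real) \<Rightarrow> ('a \<Rightarrow> real)) \<Rightarrow> bool" where
  "selfadjoint_operator m D A \<longleftrightarrow>
     L2_subspace m D \<and> L2_dense m D \<and> (\<forall>u\<in>D. A u \<in> L2 m) \<and>
     (\<forall>u\<in>D. \<forall>v\<in>D. ae_eq m u v \<longrightarrow> ae_eq m (A u) (A v)) \<and>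
     (\<forall>u\<in>D. \<forall>v\<in>D. \<forall>a b.
        ae_eq m (A (\<lambda>x. a * u x + b * v x)) (\<lambda>x. a * A u x + b * A v x)) \<and>
     (\<forall>v\<in>L2 m. \<forall>h\<in>L2 m.
        (\<forall>u\<in>D. L2_inner m (A u) v = L2_inner m u h) \<longleftrightarrow> v \<in> D \<and> ae_eq m (A v) h)"

definition nonneg_operator ::
  "'a measure \<Rightarrow> ('a \<Rightarrow> real) set \<Rightarrow> (('a \<Rightarrow> real) \<Rightarrow> ('a \<Rightarrow> real)) \<Rightarrow> bool" where
  "nonneg_operator m D A \<longleftrightarrow> (\<forall>u\<in>D. 0 \<le> L2_inner m (A u) u)"

text \<open>The eigenvalues are numbered from \<open>0\<close>, so that \<open>\<Lambda> n\<close> is the eigenvalue usually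
  called \<open>\<lambda>\<^sub>n\<^sub>+\<^sub>1\<close>.\<close>

definition eigenbasis ::
  "'a measure \<Rightarrow> ('a \<Rightarrow> real) set \<Rightarrow> (('a \<Rightarrow> real) \<Rightarrow> ('a \<Rightarrow> real)) \<Rightarrow>
   (nat \<Rightarrow> real) \<Rightarrow> (nat \<Rightarrow> 'a \<Rightarrow> real) \<Rightarrow> bool" where
  "eigenbasis m D A \<Lambda> \<phi> \<longleftrightarrow>
     (\<forall>n. \<phi> n \<in> D \<and> ae_eq m (A (\<phi> n)) (\<lambda>x. \<Lambda> n * \<phi> n x)) \<and>
     (\<forall>i j. L2_inner m (\<phi> i) (\<phi> j) = (if i = j then 1 else 0)) \<and>
     (\<forall>h\<in>L2 m. L2_sums m \<phi> (\<lambda>n. L2_inner m h (\<phi> n)) h) \<and>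
     incseq \<Lambda> \<and> filterlim \<Lambda> at_top sequentially"

section \<open>The scale of spaces\<close>

definition Vs ::
  "'a measure \<Rightarrow> (nat \<Rightarrow> real) \<Rightarrow> (nat \<Rightarrow> 'a \<Rightarrow> real) \<Rightarrow> real \<Rightarrow> ('a \<Rightarrow> real) set" where
  "Vs m \<Lambda> \<phi> s = {h \<in> L2 m. summable (\<lambda>n. (L2_inner m h (\<phi> n))\<^sup>2 * \<Lambda> n powr (2 * s))}"

definition Vs_norm ::
  "'a measure \<Rightarrow> (nat \<Rightarrow> real) \<Rightarrow> (nat \<Rightarrow> 'a \<Rightarrow> real) \<Rightarrow> real \<Rightarrow> ('a \<Rightarrow> real) \<Rightarrow> real" where
  "Vs_norm m \<Lambda> \<phi> s h = sqrt (\<Sum>n. (L2_inner m h (\<phi> n))\<^sup>2 * \<Lambda> n powr (2 * s))"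

text \<open>\<open>Vdual m \<Lambda> \<phi> s\<close> is the dual \<open>V\<^sub>-\<^sub>s\<close> of \<open>V\<^sub>s\<close>; the duality bracket of \<open>F\<close> and \<open>v\<close> is
  \<open>F v\<close>.  Boundedness forces \<open>F\<close> to respect almost everywhere equality, and the
  values of \<open>F\<close> outside \<open>V\<^sub>s\<close> are irrelevant.\<close>

definition Vdual ::
  "'a measure \<Rightarrow> (nat \<Rightarrow> real) \<Rightarrow> (nat \<Rightarrow> 'a \<Rightarrow> real) \<Rightarrow> real \<Rightarrow> (('a \<Rightarrow> real) \<Rightarrow> real) set" where
  "Vdual m \<Lambda> \<phi> s = {F.
     (\<forall>u\<in>Vs m \<Lambda> \<phi> s. \<forall>v\<in>Vs m \<Lambda> \<phi> s. \<forall>a b. F (\<lambda>x. a * u x + b * v x) = a * F u + b * F v) \<and>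
     (\<exists>C. \<forall>v\<in>Vs m \<Lambda> \<phi> s. \<bar>F v\<bar> \<le> C * Vs_norm m \<Lambda> \<phi> s v)}"

definition Vdual_norm ::
  "(nat \<Rightarrow> real) \<Rightarrow> (nat \<Rightarrow> 'a \<Rightarrow> real) \<Rightarrow> real \<Rightarrow> (('a \<Rightarrow> real) \<Rightarrow> real) \<Rightarrow> real" where
  "Vdual_norm \<Lambda> \<phi> s F = sqrt (\<Sum>n. (F (\<phi> n))\<^sup>2 * \<Lambda> n powr (- 2 * s))"

section \<open>Paths\<close>

text \<open>The following two notions are used both for functions on \<open>X\<close> and for functionals on
  functions on \<open>X\<close>: \<open>V\<close> is a vector space of real functions with (semi)norm \<open>N\<close>.\<close>

definition cont_path ::
  "('b \<Rightarrow> real) set \<Rightarrow> (('b \<Rightarrow> real) \<Rightarrow> real) \<Rightarrow> real \<Rightarrow> (real \<Rightarrow> 'b \<Rightarrow> real) \<Rightarrow> bool" where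
  "cont_path V N T w \<longleftrightarrow> (\<forall>t\<in>{0..T}. w t \<in> V \<and>
     ((\<lambda>s. N (\<lambda>x. w s x - w t x)) \<longlongrightarrow> 0) (at t within {0..T}))"

definition deriv_path ::
  "('b \<Rightarrow> real) set \<Rightarrow> (('b \<Rightarrow> real) \<Rightarrow> real) \<Rightarrow> real \<Rightarrow>
   (real \<Rightarrow> 'b \<Rightarrow> real) \<Rightarrow> (real \<Rightarrow> 'b \<Rightarrow> real) \<Rightarrow> bool" where
  "deriv_path V N T w w' \<longleftrightarrow> (\<forall>t\<in>{0..T}. w t \<in> V \<and> w' t \<in> V \<and>
     ((\<lambda>s. N (\<lambda>x. (w s x - w t x) / (s - t) - w' t x)) \<longlongrightarrow> 0) (at t within {0..T}))"

definition C1_path ::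
  "('b \<Rightarrow> real) set \<Rightarrow> (('b \<Rightarrow> real) \<Rightarrow> real) \<Rightarrow> real \<Rightarrow>
   (real \<Rightarrow> 'b \<Rightarrow> real) \<Rightarrow> (real \<Rightarrow> 'b \<Rightarrow> real) \<Rightarrow> bool" where
  "C1_path V N T w w' \<longleftrightarrow> deriv_path V N T w w' \<and> cont_path V N T w'"

text \<open>\<open>L\<^sup>q((0,T); L\<^sup>2(X))\<close> for \<open>0 < q \<le> \<infinity>\<close>.  Measurability is Bochner measurability: almost
  everywhere approximation in norm by simple functions.\<close>

definition bochner_measurable :: "'a measure \<Rightarrow> real \<Rightarrow> (real \<Rightarrow> 'a \<Rightarrow> real) \<Rightarrow> bool" where
  "bochner_measurable m T g \<longleftrightarrow> (\<exists>s. (\<forall>k::nat. simple_function (lebesgue_on {0<..<T}) (s k) \<and>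
       (\<forall>t\<in>{0<..<T}. s k t \<in> L2 m)) \<and>
     (AE t in lebesgue_on {0<..<T}. (\<lambda>k. L2_norm m (\<lambda>x. s k t x - g t x)) \<longlonglongrightarrow> 0))"

definition LqL2 :: "'a measure \<Rightarrow> real \<Rightarrow> ennreal \<Rightarrow> (real \<Rightarrow> 'a \<Rightarrow> real) set" where
  "LqL2 m T q = {g. (AE t in lebesgue_on {0<..<T}. g t \<in> L2 m) \<and> bochner_measurable m T g \<and>
     (if q = \<infinity> then esssup (lebesgue_on {0<..<T}) (\<lambda>t. ereal (L2_norm m (g t))) < \<infinity>
      else integrable (lebesgue_on {0<..<T}) (\<lambda>t. L2_norm m (g t) powr enn2real q))}"

definition LqL2_norm :: "'a measure \<Rightarrow> real \<Rightarrow> ennreal \<Rightarrow> (real \<Rightarrow> 'a \<Rightarrow> real) \<Rightarrow> real" where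
  "LqL2_norm m T q g =
     (if q = \<infinity> then real_of_ereal (esssup (lebesgue_on {0<..<T}) (\<lambda>t. ereal (L2_norm m (g t))))
      else (LINT t|lebesgue_on {0<..<T}. L2_norm m (g t) powr enn2real q) powr (1 / enn2real q))"

section \<open>The fractional problem\<close>

definition mittag_leffler :: "real \<Rightarrow> real \<Rightarrow> real \<Rightarrow> real" where
  "mittag_leffler \<alpha> \<beta> z = (\<Sum>n. z ^ n / Gamma (\<alpha> * real n + \<beta>))"

text \<open>A weak solution is only once differentiable in time with values in \<open>L\<^sup>2(X)\<close>, so the Caputo
  derivative is taken in its weaker form: the second time derivative, in \<open>V\<^sub>-\<^sub>\<gamma>\<close>, of
  \<open>1/\<Gamma>(2-\<alpha>) \<integral>\<^sub>0\<^sup>t (t-s)\<^bsup>1-\<alpha>\<^esup> (u(s) - u(0) - s u'(0)) ds\<close>.  Here \<open>u'\<close> is the time derivative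
  of \<open>u\<close>, the function under the integral is continuous with values in \<open>L\<^sup>2(X)\<close> up to the scalar
  kernel, and the integral is the element of \<open>V\<^sub>-\<^sub>\<gamma>\<close> obtained by pairing it with \<open>v \<in> V\<^sub>\<gamma>\<close>.\<close>

definition caputo_integral ::
  "'a measure \<Rightarrow> real \<Rightarrow> (real \<Rightarrow> 'a \<Rightarrow> real) \<Rightarrow> (real \<Rightarrow> 'a \<Rightarrow> real) \<Rightarrow>
   real \<Rightarrow> ('a \<Rightarrow> real) \<Rightarrow> real" where
  "caputo_integral m \<alpha> u u' t v = 1 / Gamma (2 - \<alpha>) *
     (LINT s:{0..t}|lebesgue. (t - s) powr (1 - \<alpha>) *
        L2_inner m (\<lambda>x. u s x - u 0 x - s * u' 0 x) v)"

definition caputo_derivative ::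
  "'a measure \<Rightarrow> (nat \<Rightarrow> real) \<Rightarrow> (nat \<Rightarrow> 'a \<Rightarrow> real) \<Rightarrow> real \<Rightarrow> real \<Rightarrow> real \<Rightarrow>
   (real \<Rightarrow> 'a \<Rightarrow> real) \<Rightarrow> (real \<Rightarrow> 'a \<Rightarrow> real) \<Rightarrow> (real \<Rightarrow> ('a \<Rightarrow> real) \<Rightarrow> real) \<Rightarrow> bool" where
  "caputo_derivative m \<Lambda> \<phi> \<gamma> T \<alpha> u u' w \<longleftrightarrow> (\<exists>J'.
     deriv_path (Vdual m \<Lambda> \<phi> \<gamma>) (Vdual_norm \<Lambda> \<phi> \<gamma>) T (caputo_integral m \<alpha> u u') J' \<and>
     deriv_path (Vdual m \<Lambda> \<phi> \<gamma>) (Vdual_norm \<Lambda> \<phi> \<gamma>) T J' w)"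

text \<open>An element \<open>f\<close> of \<open>C([0,T]; V\<^sub>-\<^sub>\<gamma>) \<inter> L\<^sup>q((0,T); L\<^sup>2(X))\<close> is given by two representatives:
  \<open>f\<close> with values in \<open>V\<^sub>-\<^sub>\<gamma>\<close>, and \<open>g\<close> with values in \<open>L\<^sup>2(X)\<close>, which agree at almost every time
  under the embedding of \<open>L\<^sup>2(X)\<close> into \<open>V\<^sub>-\<^sub>\<gamma>\<close>.\<close>

definition source_term ::
  "'a measure \<Rightarrow> (nat \<Rightarrow> real) \<Rightarrow> (nat \<Rightarrow> 'a \<Rightarrow> real) \<Rightarrow> real \<Rightarrow> real \<Rightarrow> ennreal \<Rightarrow>
   (real \<Rightarrow> ('a \<Rightarrow> real) \<Rightarrow> real) \<Rightarrow> (real \<Rightarrow> 'a \<Rightarrow> real) \<Rightarrow> bool" where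
  "source_term m \<Lambda> \<phi> \<gamma> T q f g \<longleftrightarrow>
     cont_path (Vdual m \<Lambda> \<phi> \<gamma>) (Vdual_norm \<Lambda> \<phi> \<gamma>) T f \<and>
     g \<in> LqL2 m T q \<and>
     (AE t in lebesgue_on {0<..<T}. \<forall>v\<in>Vs m \<Lambda> \<phi> \<gamma>. f t v = L2_inner m (g t) v)"

definition weak_solution ::
  "'a measure \<Rightarrow> (('a \<Rightarrow> real) \<Rightarrow> ('a \<Rightarrow> real) \<Rightarrow> real) \<Rightarrow> (nat \<Rightarrow> real) \<Rightarrow>
   (nat \<Rightarrow> 'a \<Rightarrow> real) \<Rightarrow> real \<Rightarrow> real \<Rightarrow> real \<Rightarrow> ('a \<Rightarrow> real) \<Rightarrow> ('a \<Rightarrow> real) \<Rightarrow>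
   (real \<Rightarrow> 'a \<Rightarrow> real) \<Rightarrow> (real \<Rightarrow> 'a \<Rightarrow> real) \<Rightarrow> bool" where
  "weak_solution m E \<Lambda> \<phi> \<gamma> T \<alpha> u\<^sub>0 u\<^sub>1 g u \<longleftrightarrow> (\<exists>u' w.
     cont_path (Vs m \<Lambda> \<phi> \<gamma>) (Vs_norm m \<Lambda> \<phi> \<gamma>) T u \<and>
     C1_path (L2 m) (L2_norm m) T u u' \<and>
     caputo_derivative m \<Lambda> \<phi> \<gamma> T \<alpha> u u' w \<and>
     cont_path (Vdual m \<Lambda> \<phi> \<gamma>) (Vdual_norm \<Lambda> \<phi> \<gamma>) T w \<and>
     ae_eq m (u 0) u\<^sub>0 \<and> ae_eq m (u' 0) u\<^sub>1 \<and>
     (\<exists>\<sigma> \<beta>. 0 \<le> \<sigma> \<and> \<sigma> < 1 / \<alpha> \<and> 0 < \<beta> \<and> \<beta> \<le> 1 - 1 / \<alpha> \<and>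
        ((\<lambda>t. Vs_norm m \<Lambda> \<phi> \<sigma> (\<lambda>x. u t x - u\<^sub>0 x)) \<longlongrightarrow> 0) (at_right 0) \<and>
        ((\<lambda>t. Vdual_norm \<Lambda> \<phi> \<beta> (\<lambda>v. L2_inner m (\<lambda>x. u' t x - u\<^sub>1 x) v)) \<longlongrightarrow> 0) (at_right 0)) \<and>
     (\<forall>\<eta>\<in>Vs m \<Lambda> \<phi> \<gamma>. AE t in lebesgue_on {0<..<T}.
        w t \<eta> + E (u t) \<eta> = L2_inner m (g t) \<eta>))"

end

theory Submission
  imports Defs "HOL-Complex_Analysis.Complex_Analysis" "HOL-Real_Asymp.Real_Asymp"
begin

text \<open>The eigenfunctions diagonalise the problem.  Tested with \<open>\<phi> n\<close>, the equation becomes the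
scalar fractional equation for \<open>y t = (u(t), \<phi> n)\<close> with the eigenvalue
\<open>\<Lambda> n\<close> and the source \<open>(f(t), \<phi> n)\<close>. The proof solves the scalar
equations, estimates their solutions uniformly in the eigenvalue and sums the squares.

Scalar equation.  Let \<open>I\<close> denote the fractional integral of order \<open>\<alpha>\<close>.  A
function \<open>y\<close> with initial value \<open>c\<close> and initial slope \<open>d\<close> has the
Caputo derivative \<open>w\<close> only if \<open>y = c + d t + I w\<close>
(\<open>caputo_imp_volterra\<close>), so the equation leads to the Volterra equation
\<open>y = c + d t + I (f - l y)\<close>.  This has at most one solution, since iterating it produces the
rapidly decreasing terms of a Mittag-Leffler series (\<open>volterra_homogeneous_zero\<close>).  The
convolution with the Mittag-Leffler kernel is the Neumann series of the Volterra equation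
(\<open>ml_conv_sums\<close>); therefore the explicit formula solves it (\<open>frac_sol_volterra\<close>),
and its derivative is explicit, too (\<open>frac_sol_has_derivative\<close>).

Uniform estimates.  Everything rests on the decay of \<open>E\<^sub>\<alpha>\<^sub>,\<^sub>\<beta>(-x)\<close>
as \<open>x\<close> tends to infinity (\<open>mittag_leffler_bounds\<close>).  The Laplace transform of
\<open>t\<^sup>\<beta>\<^sup>-\<^sup>1 E\<^sub>\<alpha>\<^sub>,\<^sub>\<beta>(-t\<^sup>\<alpha>)\<close> is
\<open>s\<^sup>\<alpha>\<^sup>-\<^sup>\<beta> / (s\<^sup>\<alpha> + 1)\<close>.  For
\<open>\<alpha> < 2\<close> the denominator has no zero with real part at least \<open>0\<close> and is
comparable to \<open>1 + \<bar>s\<bar>\<^sup>\<alpha>\<close>, so the inversion integral along the imaginary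
axis converges absolutely, possibly after multiplication by \<open>t\<close>, which squares the denominator.
By homogeneity the kernels of all modes satisfy the same bounds (\<open>mittag_leffler_kernel_bounds\<close>),
and a duality argument bounds the weighted square sums of the modes of the solution by the data and a
convolution of \<open>(t - \<tau>)\<^sup>\<alpha>\<^sup>-\<^sup>2\<close> with the norm of the source
(\<open>ex_solution_bounds\<close>).  The condition \<open>p < 1 / (2 - \<alpha>)\<close> says that this
kernel lies in \<open>L\<^sup>p\<close>; Hoelder's inequality yields the factor
\<open>t\<^sup>1\<^sup>/\<^sup>p\<^sup>+\<^sup>\<alpha>\<^sup>-\<^sup>2\<close>
(\<open>source_convolution_bound\<close>).  Applied to the tails of the data, the same estimate shows that the
tails of the solution are small uniformly in time (\<open>x_tail\<close>).

From modes to functions.  \<open>L\<^sup>2\<close>, \<open>V\<^sub>s\<close> and the dual of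
\<open>V\<^sub>s\<close> are spaces of weighted square summable sequences of coordinates, and the form is
\<open>E u v = \<Sum>n. \<Lambda> n * (u, \<phi> n) * (v, \<phi> n)\<close> (\<open>form_sums\<close>).  A
path in one of these spaces is continuous if its modes are continuous and its tails are uniformly small; it is
differentiable if its modes are and their derivatives form a continuous path, by the mean value inequality
(\<open>l2_coordinates\<close>).  Thus the element with the explicit modes is a weak solution, whose Caputo
derivative has the modes \<open>(f, \<phi> n) - \<Lambda> n * (u, \<phi> n)\<close>
(\<open>U_weak_solution\<close>).  Conversely the modes of any weak solution satisfy the scalar equations
(\<open>weak_solution_coordinates\<close>), which gives uniqueness.\<close>

section \<open>Decay of the Mittag-Leffler functions\<close>

text \<open>The substitution \<open>y = exp (- t)\<close> turns the integrals in the hypothesis into moments on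
\<open>{0..1}\<close>.  Polynomials are uniformly dense in the continuous functions there, so the integral of
\<open>H\<close> against every continuous function of \<open>exp (- t)\<close> vanishes; a bump concentrated
near a point with \<open>H t \<noteq> 0\<close> contradicts this.\<close>

lemma laplace_injective:
  fixes H :: "real \<Rightarrow> real"
  assumes cont: "continuous_on {0<..} H"
    and int: "set_integrable lborel {0<..} H"
    and zero: "\<And>n::nat. (LBINT t:{0<..}. exp (- t) ^ n * H t) = 0"
    and "t > 0"
  shows "H t = 0"
proof (rule ccontr)
  assume nz: "H t \<noteq> 0"
  have poly: "(LBINT t:{0<..}. g (exp (- t)) * H t) = 0"
    and poly_int: "set_integrable lborel {0<..} (\<lambda>t. g (exp (- t)) * H t)"
    if g: "continuous_on {0..1} g" for g :: "real \<Rightarrow> real"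
  proof -
    have cont_int: "set_integrable lborel {0<..} (\<lambda>t. r (exp (- t)) * H t)"
      if r: "continuous_on {0..1} r" for r :: "real \<Rightarrow> real"
    proof -
      have "compact (r ` {0..1})" by (rule compact_continuous_image[OF r]) simp
      then have "bounded (r ` {0..1})" by (rule compact_imp_bounded)
      then obtain B where B: "\<And>x. x \<in> {0..1} \<Longrightarrow> \<bar>r x\<bar> \<le> B"
        unfolding bounded_iff by (metis imageI real_norm_def)
      have c: "continuous_on {0<..} (\<lambda>t. r (exp (- t)) * H t)"
        by (intro continuous_intros cont continuous_on_compose2[OF r]) auto
      have m: "set_borel_measurable lborel {0<..} (\<lambda>t. r (exp (- t)) * H t)"
        unfolding set_borel_measurable_def
        using borel_measurable_continuous_on_indicator[OF _ c] by simp
      have i: "set_integrable lborel {0<..} (\<lambda>t. B * H t)" using int by simp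
      show ?thesis
      proof (rule set_integrable_bound[OF i m])
        show "AE t in lborel. t \<in> {0<..} \<longrightarrow> norm (r (exp (- t)) * H t) \<le> norm (B * H t)"
        proof (intro always_eventually allI impI)
          fix t :: real assume "t \<in> {0<..}"
          then have "\<bar>r (exp (- t))\<bar> \<le> B" by (intro B) auto
          then show "norm (r (exp (- t)) * H t) \<le> norm (B * H t)"
            by (simp add: abs_mult mult_right_mono)
        qed
      qed
    qed
    show "set_integrable lborel {0<..} (\<lambda>t. g (exp (- t)) * H t)" by (rule cont_int[OF g])
    define J where "J = (LBINT t:{0<..}. \<bar>H t\<bar>)"
    have J: "J \<ge> 0" unfolding J_def set_lebesgue_integral_def by (intro Bochner_Integration.integral_nonneg) auto
    have "\<bar>LBINT t:{0<..}. g (exp (- t)) * H t\<bar> \<le> e * J" if e: "e > 0" for e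
    proof -
      obtain r where r: "real_polynomial_function r" and ra: "\<And>x. x \<in> {0..1} \<Longrightarrow> \<bar>g x - r x\<bar> < e"
        using Stone_Weierstrass_real_polynomial_function[OF _ g e] by auto
      obtain a n where rs: "r = (\<lambda>x. \<Sum>i\<le>n. a i * x ^ i)"
        using r real_polynomial_function_iff_sum by auto
      have rc: "continuous_on {0..1} r" unfolding rs by (intro continuous_intros)
      have pin: "set_integrable lborel {0<..} (\<lambda>t. a i * (exp (- t) ^ i * H t))" for i
        by (intro set_integrable_mult_right cont_int[of "\<lambda>x. x ^ i"]) (auto intro!: continuous_intros)
      have "(LBINT t:{0<..}. r (exp (- t)) * H t) = (LBINT t:{0<..}. (\<Sum>i\<le>n. a i * (exp (- t) ^ i * H t)))"
        unfolding rs by (simp add: sum_distrib_right mult.assoc)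
      also have "\<dots> = (\<Sum>i\<le>n. LBINT t:{0<..}. a i * (exp (- t) ^ i * H t))"
        using pin unfolding set_lebesgue_integral_def set_integrable_def scaleR_sum_right
        by (intro Bochner_Integration.integral_sum) auto
      also have "\<dots> = 0" using zero by simp
      finally have r0: "(LBINT t:{0<..}. r (exp (- t)) * H t) = 0" .
      have "(LBINT t:{0<..}. g (exp (- t)) * H t) =
            (LBINT t:{0<..}. g (exp (- t)) * H t) - (LBINT t:{0<..}. r (exp (- t)) * H t)"
        using r0 by simp
      also have "\<dots> = (LBINT t:{0<..}. g (exp (- t)) * H t - r (exp (- t)) * H t)"
        by (rule set_integral_diff(2)[symmetric]) (auto intro: cont_int g rc)
      finally have "\<bar>LBINT t:{0<..}. g (exp (- t)) * H t\<bar> = 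
          norm (LBINT t:{0<..}. g (exp (- t)) * H t - r (exp (- t)) * H t)" by simp
      also have "\<dots> \<le> (LBINT t:{0<..}. norm (g (exp (- t)) * H t - r (exp (- t)) * H t))"
        by (rule set_integral_norm_bound) (intro set_integral_diff(1) cont_int g rc)
      also have "\<dots> \<le> (LBINT t:{0<..}. e * \<bar>H t\<bar>)"
      proof (rule set_integral_mono)
        show "set_integrable lborel {0<..} (\<lambda>t. norm (g (exp (- t)) * H t - r (exp (- t)) * H t))"
          by (intro set_integrable_norm set_integral_diff(1)) (auto intro: cont_int g rc)
        show "set_integrable lborel {0<..} (\<lambda>t. e * \<bar>H t\<bar>)"
          using set_integrable_norm[OF int] by simp
        fix t :: real assume "t \<in> {0<..}"
        then have "\<bar>g (exp (- t)) - r (exp (- t))\<bar> \<le> e" by (intro less_imp_le ra) auto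
        then show "norm (g (exp (- t)) * H t - r (exp (- t)) * H t) \<le> e * \<bar>H t\<bar>"
          by (simp add: abs_mult mult_right_mono flip: left_diff_distrib)
      qed
      also have "\<dots> = e * J" unfolding J_def by simp
      finally show ?thesis .
    qed
    then have "\<bar>LBINT t:{0<..}. g (exp (- t)) * H t\<bar> \<le> 0 + e" if "e > 0" for e
    proof -
      assume *: "\<And>e. e > 0 \<Longrightarrow> \<bar>LBINT t:{0<..}. g (exp (- t)) * H t\<bar> \<le> e * J"
      have "\<bar>LBINT t:{0<..}. g (exp (- t)) * H t\<bar> \<le> (e / (J + 1)) * J"
        using that J by (intro *) auto
      also have "\<dots> \<le> e" using that J by (simp add: field_simps)
      finally show ?thesis by simp
    qed
    then show "(LBINT t:{0<..}. g (exp (- t)) * H t) = 0"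
      using field_le_epsilon[of "\<bar>LBINT t:{0<..}. g (exp (- t)) * H t\<bar>" 0] by fastforce
  qed
  \<comment> \<open>multiplying by the sign of \<open>H t\<close> lets the integrand be nonnegative\<close>
  define S where "S = sgn (H t)"
  have "isCont H t" using cont \<open>t > 0\<close> by (simp add: continuous_on_eq_continuous_at)
  then have "isCont (\<lambda>s. S * H s) t" by (intro continuous_intros)
  moreover have "S * H t > 0" using nz unfolding S_def by (simp add: sgn_mult_abs abs_sgn[symmetric] mult.commute)
  ultimately have ev: "eventually (\<lambda>s. S * H s > 0) (nhds t)"
    by (metis isCont_def order_tendsto_iff tendsto_at_iff_tendsto_nhds)
  have ev2: "eventually (\<lambda>s. s > 0 \<and> S * H s > 0) (nhds t)"
    using ev eventually_gt_at_top \<open>t > 0\<close> by (auto intro: eventually_conj order_tendstoD(1)[OF filterlim_ident])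
  obtain d0 where d0: "d0 > 0" "\<And>s. dist s t < d0 \<Longrightarrow> s > 0 \<and> S * H s > 0"
    using ev2 unfolding eventually_nhds_metric by auto
  have "isCont ln (exp (- t))" by (intro isCont_ln) simp
  then obtain d where d: "d > 0" "\<And>y. dist y (exp (- t)) < d \<Longrightarrow> dist (ln y) (- t) < d0"
    using d0(1) unfolding continuous_at_eps_delta by (metis ln_exp)
  \<comment> \<open>a tent function, positive only where \<open>H\<close> has the sign of \<open>H t\<close>\<close>
  define g where "g y = max 0 (d - \<bar>y - exp (- t)\<bar>)" for y
  have gc: "continuous_on {0..1} g" unfolding g_def by (intro continuous_intros)
  have z: "(LBINT s:{0<..}. S * (g (exp (- s)) * H s)) = 0" using poly[OF gc] by simp
  have i: "set_integrable lborel {0<..} (\<lambda>s. S * (g (exp (- s)) * H s))" using poly_int[OF gc] by simp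
  have pos: "S * (g (exp (- s)) * H s) \<ge> 0" if "s > 0" for s
  proof (cases "g (exp (- s)) = 0")
    case False
    then have "dist (exp (- s)) (exp (- t)) < d" unfolding g_def dist_real_def by auto
    then have "dist (ln (exp (- s))) (- t) < d0" by (rule d(2))
    then have "dist s t < d0" by (simp add: dist_real_def)
    then have "S * H s > 0" using d0(2) by blast
    moreover have "g (exp (- s)) \<ge> 0" unfolding g_def by simp
    ultimately have "g (exp (- s)) * (S * H s) \<ge> 0" by simp
    then show ?thesis by (simp add: ac_simps)
  qed simp
  have ae: "AE s in lborel. indicator {0<..} s * (S * (g (exp (- s)) * H s)) = 0"
  proof (rule integral_nonneg_eq_0_iff_AE[THEN iffD1])
    show "integrable lborel (\<lambda>s. indicator {0<..} s * (S * (g (exp (- s)) * H s)))"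
      using i unfolding set_integrable_def by simp
    show "AE s in lborel. 0 \<le> indicator {0<..} s * (S * (g (exp (- s)) * H s))"
      using pos by (auto simp: indicator_def)
    show "(LBINT s. indicator {0<..} s * (S * (g (exp (- s)) * H s))) = 0"
      using z unfolding set_lebesgue_integral_def by simp
  qed
  have "isCont (\<lambda>s. exp (- s)) t" by (intro continuous_intros)
  then obtain d1 where d1: "d1 > 0" "\<And>s. dist s t < d1 \<Longrightarrow> dist (exp (- s)) (exp (- t)) < d"
    using d(1) unfolding continuous_at_eps_delta by metis
  define m where "m = min d0 d1"
  have m: "m > 0" using d0 d1 m_def by simp
  have nz2: "indicator {0<..} s * (S * (g (exp (- s)) * H s)) \<noteq> 0" if "s \<in> {t - m<..<t + m}" for s
  proof -
    have "dist s t < d0" "dist s t < d1" using that m_def by (auto simp: dist_real_def)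
    then have "s > 0" "S * H s > 0" "\<bar>exp (- s) - exp (- t)\<bar> < d"
      using d0(2) d1(2) by (auto simp: dist_real_def)
    then show ?thesis by (auto simp: g_def)
  qed
  obtain N where N: "{s \<in> space lborel. indicator {0<..} s * (S * (g (exp (- s)) * H s)) \<noteq> 0} \<subseteq> N"
     "N \<in> null_sets lborel"
    using ae by (auto elim!: AE_E simp: null_sets_def)
  have "{t - m<..<t + m} \<subseteq> N" using N(1) nz2 by fastforce
  then have "emeasure lborel {t - m<..<t + m} = 0"
    using N(2) by (metis emeasure_mono null_setsD1 null_setsD2 le_zero_eq)
  then show False using m by simp
qed

lemma laplace_powr:
  fixes b x :: real
  assumes "b > 0" "x > 0"
  shows "set_integrable lborel {0<..} (\<lambda>t. exp (- x * t) * (t powr (b - 1) / Gamma b))"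
    and "(LBINT t:{0<..}. exp (- x * t) * (t powr (b - 1) / Gamma b)) = x powr (- b)"
proof -
  have G: "Gamma b > 0" using assms by simp
  have G0: "Gamma b \<noteq> 0" using G by linarith
  have "ennreal (Gamma b) = (\<integral>\<^sup>+t. ennreal (indicator {0..} t * t powr (b - 1) / exp t) \<partial>lborel)"
    by (rule Gamma_conv_nn_integral_real[OF assms(1)])
  also have "\<dots> = \<bar>x\<bar> * (\<integral>\<^sup>+t. ennreal (indicator {0..} (0 + x * t) * (0 + x * t) powr (b - 1) / exp (0 + x * t)) \<partial>lborel)"
    using assms by (intro nn_integral_real_affine) auto
  also have "\<dots> = (\<integral>\<^sup>+t. ennreal (Gamma b * x powr b) * ennreal (indicator {0<..} t * (exp (- x * t) * (t powr (b - 1) / Gamma b))) \<partial>lborel)"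
  proof -
    have "\<bar>x\<bar> * (indicator {0..} (0 + x * t) * (0 + x * t) powr (b - 1) / exp (0 + x * t)) =
       (Gamma b * x powr b) * (indicator {0<..} t * (exp (- x * t) * (t powr (b - 1) / Gamma b)))" for t
    proof (cases "t > 0")
      case True
      have "x * x powr (b - 1) = x powr b" using assms by (simp add: powr_diff)
      then show ?thesis using True assms G0
        by (simp add: powr_mult exp_minus field_simps indicator_def zero_le_mult_iff)
    next
      case False
      then show ?thesis using assms by (cases "t = 0") (auto simp: indicator_def zero_le_mult_iff)
    qed
    moreover have "Gamma b * x powr b \<ge> 0" using G by simp
    ultimately show ?thesis
      by (subst nn_integral_cmult[symmetric])
         (auto intro!: nn_integral_cong simp del: times_divide_eq_right simp flip: ennreal_mult')
  qed
  also have "\<dots> = ennreal (Gamma b * x powr b) * (\<integral>\<^sup>+t. ennreal (indicator {0<..} t * (exp (- x * t) * (t powr (b - 1) / Gamma b))) \<partial>lborel)"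
    by (subst nn_integral_cmult) auto
  finally have eq: "ennreal (Gamma b) = ennreal (Gamma b * x powr b) * (\<integral>\<^sup>+t. ennreal (indicator {0<..} t * (exp (- x * t) * (t powr (b - 1) / Gamma b))) \<partial>lborel)" (is "_ = _ * ?I") .
  have "?I = ennreal (x powr (- b)) * ennreal (x powr b) * ?I"
    using assms by (simp flip: ennreal_mult' powr_add)
  also have "\<dots> = ennreal (x powr (-b) / Gamma b) * (ennreal (Gamma b * x powr b) * ?I)"
    using G by (simp add: mult.assoc[symmetric] flip: ennreal_mult')
  also have "\<dots> = ennreal (x powr (-b) / Gamma b) * ennreal (Gamma b)" by (simp only: eq[symmetric])
  also have "\<dots> = ennreal (x powr (-b))" using G by (simp flip: ennreal_mult')
  finally have I: "?I = ennreal (x powr (-b))" .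
  have "has_bochner_integral lborel (\<lambda>t. indicator {0<..} t * (exp (- x * t) * (t powr (b - 1) / Gamma b))) (x powr (-b))"
    using G by (intro has_bochner_integral_nn_integral I) auto
  then show "set_integrable lborel {0<..} (\<lambda>t. exp (- x * t) * (t powr (b - 1) / Gamma b))"
    and "(LBINT t:{0<..}. exp (- x * t) * (t powr (b - 1) / Gamma b)) = x powr (- b)"
    by (auto simp: set_integrable_def set_lebesgue_integral_def has_bochner_integral_iff)
qed


text \<open>Cauchy's formula for \<open>x\<close> in the rectangle with vertical sides on \<open>Re s = \<sigma>\<close>
and \<open>Re s = R\<close>.  The decay of \<open>F\<close> with exponent \<open>b > 1\<close> makes the
contributions of the horizontal sides and of the right side tend to \<open>0\<close> as \<open>R\<close>
grows, so only the vertical line through \<open>\<sigma>\<close> remains.\<close>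

lemma Cauchy_formula_halfplane:
  fixes F :: "complex \<Rightarrow> complex" and B d \<sigma> x :: real
  assumes holo: "F holomorphic_on {s. Re s > 0}"
    and bound: "\<And>s. Re s > 0 \<Longrightarrow> cmod (F s) \<le> B * cmod s powr (- b)"
    and b: "b > 1" and \<sigma>: "0 < \<sigma>" "\<sigma> < x"
  shows "integrable lborel (\<lambda>w. F (Complex \<sigma> w))"
    and "integrable lborel (\<lambda>w. F (Complex \<sigma> w) / (x - Complex \<sigma> w))"
    and "(LBINT w. F (Complex \<sigma> w) / (x - Complex \<sigma> w)) = 2 * pi * F x"
proof -
  have B0: "B \<ge> 0" using bound[of 1] by simp (meson norm_ge_zero order_trans)
  have cF: "continuous_on UNIV (\<lambda>w. F (Complex \<sigma> w))"
    by (rule continuous_on_compose2[OF holomorphic_on_imp_continuous_on[OF holo]])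
       (auto intro!: continuous_intros simp: Complex_eq \<sigma>)
  have mF[measurable]: "(\<lambda>w. F (Complex \<sigma> w)) \<in> borel_measurable borel"
    using cF by (rule borel_measurable_continuous_onI)
  have mC[measurable]: "(\<lambda>w. Complex \<sigma> w) \<in> borel_measurable borel"
    unfolding Complex_eq by (intro borel_measurable_continuous_onI continuous_intros)
  \<comment> \<open>an integrable majorant of \<open>F\<close> on the line\<close>
  define K where "K w = (if \<bar>w\<bar> \<le> 1 then B * \<sigma> powr (- b) else B * \<bar>w\<bar> powr (- b))" for w :: real
  have K: "integrable lborel K"
  proof -
    have i1: "set_integrable lborel {-1..1} (\<lambda>w::real. B * \<sigma> powr (- b))"
      by (rule borel_integrable_atLeastAtMost') (intro continuous_intros)
    have "set_integrable lborel {1<..} (\<lambda>w::real. w powr (- b))"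
    proof -
      have "((\<lambda>w::real. w powr (- b)) has_integral - (1 powr (- b + 1)) / (- b + 1)) {1..}"
        using b by (intro has_integral_powr_to_inf) auto
      then have "(\<lambda>w::real. w powr (- b)) absolutely_integrable_on {1..}"
        by (intro nonnegative_absolutely_integrable_1) auto
      then have "set_integrable lborel {1..} (\<lambda>w::real. w powr (- b))"
        unfolding set_integrable_def by (subst (asm) integrable_completion) auto
      then show ?thesis by (rule set_integrable_subset) auto
    qed
    then have "integrable lborel (\<lambda>w. indicator {1<..} w * w powr (- b))"
      by (simp add: set_integrable_def)
    then have i2: "integrable lborel (\<lambda>w. B * (indicator {1<..} w * w powr (- b)))" by simp
    have i3: "integrable lborel (\<lambda>w. B * (indicator {1<..} (0 + (-1) * w) * (0 + (-1) * w) powr (- b)))"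
      using lborel_integrable_real_affine[OF i2, of "-1" 0] by simp
    have "K = (\<lambda>w. indicator {-1..1} w *\<^sub>R (B * \<sigma> powr (- b)) + B * (indicator {1<..} w * w powr (- b))
         + B * (indicator {1<..} (0 + (-1) * w) * (0 + (-1) * w) powr (- b)))"
      by (auto simp: K_def fun_eq_iff indicator_def)
    then show ?thesis using i1[unfolded set_integrable_def] i2 i3 by simp
  qed
  have FK: "cmod (F (Complex \<sigma> w)) \<le> K w" for w
  proof -
    have "cmod (F (Complex \<sigma> w)) \<le> B * cmod (Complex \<sigma> w) powr (- b)" using \<sigma> by (intro bound) simp
    also have "\<dots> \<le> K w"
    proof -
      have "\<sigma> \<le> cmod (Complex \<sigma> w)" using complex_Re_le_cmod[of "Complex \<sigma> w"] by simp
      moreover have "\<bar>w\<bar> \<le> cmod (Complex \<sigma> w)" using abs_Im_le_cmod[of "Complex \<sigma> w"] by simp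
      ultimately show ?thesis using B0 b \<sigma> unfolding K_def
        by (auto intro!: mult_left_mono powr_mono2')
    qed
    finally show ?thesis .
  qed
  show iF: "integrable lborel (\<lambda>w. F (Complex \<sigma> w))"
    by (rule Bochner_Integration.integrable_bound[OF K]) (use FK in \<open>auto intro!: always_eventually order_trans[OF _ abs_ge_self]\<close>)
  have xs: "cmod (x - Complex \<sigma> w) \<ge> x - \<sigma>" for w
    using complex_Re_le_cmod[of "x - Complex \<sigma> w"] by simp
  have xs0: "x - Complex \<sigma> w \<noteq> 0" for w using xs[of w] \<sigma> by auto
  show iG: "integrable lborel (\<lambda>w. F (Complex \<sigma> w) / (x - Complex \<sigma> w))"
  proof (rule Bochner_Integration.integrable_bound)
    show "integrable lborel (\<lambda>w. F (Complex \<sigma> w) / of_real (x - \<sigma>))" using iF by simp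
    show "AE w in lborel. norm (F (Complex \<sigma> w) / (x - Complex \<sigma> w)) \<le> norm (F (Complex \<sigma> w) / of_real (x - \<sigma>))"
    proof (intro always_eventually allI)
      fix w
      show "norm (F (Complex \<sigma> w) / (x - Complex \<sigma> w)) \<le> norm (F (Complex \<sigma> w) / of_real (x - \<sigma>))"
        using xs[of w] \<sigma> unfolding norm_divide norm_of_real by (intro frac_le) auto
    qed
  qed simp
  define G where "G w = F (Complex \<sigma> w) / (x - Complex \<sigma> w)" for w
  have mG[measurable]: "G \<in> borel_measurable borel" unfolding G_def by measurable
  have lim1: "(\<lambda>n::nat. LBINT w. indicator {- real n..real n} w *\<^sub>R G w) \<longlonglongrightarrow> (LBINT w. G w)"
  proof (rule integral_dominated_convergence)
    show "integrable lborel (\<lambda>w. cmod (G w))" using iG unfolding G_def by (rule integrable_norm)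
    show "AE w in lborel. (\<lambda>n. indicator {- real n..real n} w *\<^sub>R G w) \<longlonglongrightarrow> G w"
    proof (intro always_eventually allI)
      fix w :: real
      have "eventually (\<lambda>n. real n \<ge> \<bar>w\<bar>) sequentially"
        using eventually_ge_at_top[of "nat \<lceil>\<bar>w\<bar>\<rceil>"] by eventually_elim linarith
      then have "eventually (\<lambda>n. indicator {- real n..real n} w *\<^sub>R G w = G w) sequentially"
        by eventually_elim (auto simp: indicator_def)
      then show "(\<lambda>n. indicator {- real n..real n} w *\<^sub>R G w) \<longlonglongrightarrow> G w"
        by (rule tendsto_eventually)
    qed
  qed (auto simp: indicator_def)
  have est: "cmod ((LBINT w. indicator {-R..R} w *\<^sub>R G w) - 2 * pi * F x) \<le> 2 * (B * R powr (- b)) + 2 * (B * R powr (- b) * R / (R - x))"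
    if R: "R > x" for R
  proof -
    define h where "h w = F w / (w - x)" for w
    define a1 a2 a3 a4 where "a1 = Complex \<sigma> (-R)" and "a2 = Complex R (-R)" and "a3 = Complex R R" and "a4 = Complex \<sigma> R"
    have rp: "rectpath a1 a3 = linepath a1 a2 +++ linepath a2 a3 +++ linepath a3 a4 +++ linepath a4 a1"
      by (simp add: rectpath_def Let_def a1_def a2_def a3_def a4_def)
    have R0: "R > 0" using R \<sigma> by simp
    have bx: "complex_of_real x \<in> box a1 a3" using R \<sigma> by (auto simp: in_box_complex_iff a1_def a3_def)
    have le: "Re a1 \<le> Re a3" "Im a1 \<le> Im a3" using R \<sigma> by (auto simp: a1_def a3_def)
    have "(h has_contour_integral (2*pi * \<i> * winding_number (rectpath a1 a3) x * F x)) (rectpath a1 a3)"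
      unfolding h_def
    proof (rule Cauchy_integral_formula_convex_simple[OF _ holo])
      show "convex {s. Re s > 0}" by (rule convex_halfspace_Re_gt)
      show "complex_of_real x \<in> interior {s. Re s > 0}"
        using \<sigma> by (subst interior_open) (auto simp: open_halfspace_Re_gt)
      show "path_image (rectpath a1 a3) \<subseteq> {s. Re s > 0} - {complex_of_real x}"
        unfolding path_image_rectpath[OF le] using \<sigma> R by (auto simp: a1_def a3_def)
    qed auto
    then have tot: "(h has_contour_integral (2*pi * \<i> * F x)) (rectpath a1 a3)"
      by (simp add: winding_number_rectpath[OF bx])
    have ch: "continuous_on ({s. Re s > 0} - {complex_of_real x}) h"
      unfolding h_def by (intro continuous_intros continuous_on_subset[OF holomorphic_on_imp_continuous_on[OF holo]]) auto
    have seg: "closed_segment a1 a2 = {z. Im z = -R \<and> Re z \<in> {\<sigma>..R}}"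
              "closed_segment a2 a3 = {z. Re z = R \<and> Im z \<in> {-R..R}}"
              "closed_segment a3 a4 = {z. Im z = R \<and> Re z \<in> {\<sigma>..R}}"
              "closed_segment a4 a1 = {z. Re z = \<sigma> \<and> Im z \<in> {-R..R}}"
      using R \<sigma> by (auto simp: closed_segment_same_Re closed_segment_same_Im closed_segment_eq_real_ivl
           a1_def a2_def a3_def a4_def)
    have ci: "h contour_integrable_on (linepath a1 a2)" "h contour_integrable_on (linepath a2 a3)"
             "h contour_integrable_on (linepath a3 a4)" "h contour_integrable_on (linepath a4 a1)"
      by (rule contour_integrable_continuous_linepath; rule continuous_on_subset[OF ch]; use R \<sigma> in \<open>auto simp: seg\<close>)+
    have sumc: "2*pi * \<i> * F x = contour_integral (linepath a1 a2) h + contour_integral (linepath a2 a3) h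
       + contour_integral (linepath a3 a4) h + contour_integral (linepath a4 a1) h"
      using contour_integral_unique[OF tot] ci unfolding rp by (simp add: contour_integrable_joinI add.assoc)
    have hb: "cmod (h z) \<le> B * R powr (- b) / c" if "Re z > 0" "cmod z \<ge> R" "cmod (z - x) \<ge> c" "c > 0" for z c
    proof -
      have "cmod (F z) \<le> B * cmod z powr (- b)" by (rule bound) fact
      also have "\<dots> \<le> B * R powr (- b)" using B0 that R0 b by (intro mult_left_mono powr_mono2') auto
      finally have "cmod (F z) \<le> B * R powr (- b)" .
      then show ?thesis unfolding h_def norm_divide using that B0 by (intro frac_le) auto
    qed
    have e1: "cmod (contour_integral (linepath a1 a2) h) \<le> B * R powr (- b) / R * cmod (a2 - a1)"
    proof (rule contour_integral_bound_linepath[OF ci(1)])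
      fix z assume "z \<in> closed_segment a1 a2"
      then show "cmod (h z) \<le> B * R powr (- b) / R"
        using abs_Im_le_cmod[of z] abs_Im_le_cmod[of "z - x"] R0 \<sigma> by (intro hb) (auto simp: seg)
    qed (use B0 R0 in auto)
    have e3: "cmod (contour_integral (linepath a3 a4) h) \<le> B * R powr (- b) / R * cmod (a4 - a3)"
    proof (rule contour_integral_bound_linepath[OF ci(3)])
      fix z assume "z \<in> closed_segment a3 a4"
      then show "cmod (h z) \<le> B * R powr (- b) / R"
        using abs_Im_le_cmod[of z] abs_Im_le_cmod[of "z - x"] R0 \<sigma> by (intro hb) (auto simp: seg)
    qed (use B0 R0 in auto)
    have e2: "cmod (contour_integral (linepath a2 a3) h) \<le> B * R powr (- b) / (R - x) * cmod (a3 - a2)"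
    proof (rule contour_integral_bound_linepath[OF ci(2)])
      fix z assume "z \<in> closed_segment a2 a3"
      then show "cmod (h z) \<le> B * R powr (- b) / (R - x)"
        using complex_Re_le_cmod[of z] complex_Re_le_cmod[of "z - x"] R0 R by (intro hb) (auto simp: seg)
    qed (use B0 R0 R in auto)
    have n: "cmod (a2 - a1) \<le> R" "cmod (a4 - a3) \<le> R" "cmod (a3 - a2) = 2 * R"
      using R \<sigma> by (simp_all add: a1_def a2_def a3_def a4_def complex_eq_iff cmod_def real_sqrt_mult)
    have e1': "cmod (contour_integral (linepath a1 a2) h) \<le> B * R powr (- b)"
      using order_trans[OF e1 mult_left_mono[OF n(1), of "B * R powr (- b) / R"]] B0 R0 by simp
    have e3': "cmod (contour_integral (linepath a3 a4) h) \<le> B * R powr (- b)"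
      using order_trans[OF e3 mult_left_mono[OF n(2), of "B * R powr (- b) / R"]] B0 R0 by simp
    have e2': "cmod (contour_integral (linepath a2 a3) h) \<le> 2 * (B * R powr (- b) * R / (R - x))"
      using e2 unfolding n(3) by (simp add: algebra_simps)
    have "contour_integral (linepath a4 a1) h = - contour_integral (linepath a1 a4) h"
      using contour_integral_reversepath[of "linepath a1 a4" h] by simp
    also have "contour_integral (linepath a1 a4) h = \<i> * integral {-R..R} (\<lambda>w. h (Complex \<sigma> w))"
      by (rule contour_integral_linepath_same_Re) (use R0 in \<open>auto simp: a1_def a4_def\<close>)
    also have "(\<lambda>w. h (Complex \<sigma> w)) = (\<lambda>w. - G w)"
    proof
      fix w show "h (Complex \<sigma> w) = - G w" using xs0[of w] unfolding h_def G_def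
        by (metis minus_diff_eq minus_divide_right)
    qed
    also have "integral {-R..R} (\<lambda>w. - G w) = - integral {-R..R} G" by simp
    also have "integral {-R..R} G = (LBINT w. indicator {-R..R} w *\<^sub>R G w)"
    proof -
      have "set_integrable lborel {-R..R} G"
        unfolding set_integrable_def
        using iG[folded G_def] by (rule integrable_mult_indicator[rotated]) simp
      from set_borel_integral_eq_integral(2)[OF this] show ?thesis
        by (simp add: set_lebesgue_integral_def)
    qed
    finally have c4: "contour_integral (linepath a4 a1) h = \<i> * (LBINT w. indicator {-R..R} w *\<^sub>R G w)" by simp
    define I where "I = (LBINT w. indicator {-R..R} w *\<^sub>R G w)"
    have "\<i> * (I - 2 * pi * F x) = - (contour_integral (linepath a1 a2) h + contour_integral (linepath a2 a3) h
       + contour_integral (linepath a3 a4) h)"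
      using sumc unfolding c4 I_def[symmetric] by (simp add: algebra_simps)
    then have "cmod (\<i> * (I - 2 * pi * F x)) \<le> cmod (contour_integral (linepath a1 a2) h) + cmod (contour_integral (linepath a2 a3) h)
       + cmod (contour_integral (linepath a3 a4) h)"
      by (metis norm_minus_cancel norm_triangle_le norm_triangle_mono order_refl)
    then have "cmod (I - 2 * pi * F x) \<le> cmod (contour_integral (linepath a1 a2) h) + cmod (contour_integral (linepath a2 a3) h)
       + cmod (contour_integral (linepath a3 a4) h)"
      by (simp add: norm_mult)
    then show ?thesis using e1' e2' e3' unfolding I_def by linarith
  qed
  have "((\<lambda>R. 2 * (B * R powr (- b)) + 2 * (B * R powr (- b) * R / (R - x))) \<longlongrightarrow> 0) at_top"
    using b by real_asymp
  then have z: "(\<lambda>n::nat. 2 * (B * real n powr (- b)) + 2 * (B * real n powr (- b) * real n / (real n - x))) \<longlonglongrightarrow> 0"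
    by (rule filterlim_compose[OF _ filterlim_real_sequentially])
  have "eventually (\<lambda>n::nat. real n > x) sequentially"
    using filterlim_real_sequentially by (simp add: filterlim_at_top_dense)
  then have "(\<lambda>n::nat. (LBINT w. indicator {- real n..real n} w *\<^sub>R G w) - 2 * pi * F x) \<longlonglongrightarrow> 0"
    by (intro Lim_null_comparison[OF _ z]) (erule eventually_mono, rule est)
  then have "(\<lambda>n::nat. LBINT w. indicator {- real n..real n} w *\<^sub>R G w) \<longlonglongrightarrow> 2 * pi * F x"
    by (simp add: LIM_zero_iff)
  from LIMSEQ_unique[OF lim1 this] show "(LBINT w. F (Complex \<sigma> w) / (x - Complex \<sigma> w)) = 2 * pi * F x"
    by (simp add: G_def)
qed

text \<open>This gives the ratio test for series with denominators \<open>Gamma (\<alpha> * real j + \<beta>)\<close>.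
Beyond \<open>y = 1/2\<close> the sum \<open>y + \<alpha>\<close> with \<open>\<alpha> \<ge> 1\<close> lies
where the Gamma function is increasing.\<close>

lemma Gamma_add_ge:
  fixes y :: real
  assumes "y \<ge> 1/2" "\<alpha> \<ge> 1"
  shows "y * Gamma y \<le> Gamma (y + \<alpha>)"
proof -
  have "y \<notin> \<int>\<^sub>\<le>\<^sub>0" using assms by (auto elim!: nonpos_Ints_cases)
  then have "y * Gamma y = Gamma (y + 1)" by (simp add: Gamma_plus1)
  also have "\<dots> \<le> Gamma (y + \<alpha>)"
    using Gamma_real_strict_mono[of "y + 1" "y + \<alpha>"] assms by (cases "\<alpha> = 1") auto
  finally show ?thesis .
qed

text \<open>The factor \<open>real j + 1\<close> makes room for the coefficients of \<open>1 / (1 + z)\<^sup>2\<close>,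
which occur next to those of the geometric series.\<close>

lemma mittag_leffler_summable_deriv:
  fixes \<alpha> \<beta> z :: real
  assumes "\<alpha> \<ge> 1" "\<beta> > 0"
  shows "summable (\<lambda>j. (real j + 1) * z ^ j / Gamma (\<alpha> * real j + \<beta>))"
proof -
  define N where "N = max 1 (nat \<lceil>4 * \<bar>z\<bar>\<rceil>)"
  have "norm ((real (Suc n) + 1) * z ^ Suc n / Gamma (\<alpha> * real (Suc n) + \<beta>)) \<le>
        (1/2) * norm ((real n + 1) * z ^ n / Gamma (\<alpha> * real n + \<beta>))" if n: "n \<ge> N" for n
  proof -
    have n1: "real n \<ge> 1" "real n \<ge> 4 * \<bar>z\<bar>" using n unfolding N_def by linarith+
    define y where "y = \<alpha> * real n + \<beta>"
    have "1 * real n \<le> \<alpha> * real n" using assms n1 by (intro mult_right_mono) auto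
    then have yn: "y \<ge> real n" unfolding y_def using assms by simp
    have y: "y \<ge> 1/2" "y > 0" using yn n1 by linarith+
    have G: "Gamma y > 0" using y by simp
    have G2: "y * Gamma y \<le> Gamma (y + \<alpha>)" using y assms by (intro Gamma_add_ge)
    have eq: "\<alpha> * real (Suc n) + \<beta> = y + \<alpha>" by (simp add: y_def algebra_simps)
    have "norm ((real (Suc n) + 1) * z ^ Suc n / Gamma (\<alpha> * real (Suc n) + \<beta>)) = 
      (real n + 2) * (\<bar>z\<bar> * \<bar>z\<bar> ^ n) / Gamma (y + \<alpha>)"
      unfolding eq using y assms by (simp add: abs_mult power_abs)
    also have "\<dots> \<le> (real n + 2) * (\<bar>z\<bar> * \<bar>z\<bar> ^ n) / (y * Gamma y)"
      using G2 mult_pos_pos[OF y(2) G] less_le_trans[OF mult_pos_pos[OF y(2) G] G2]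
      by (intro divide_left_mono mult_pos_pos[OF _ mult_pos_pos[OF y(2) G]]) auto
    also have "\<dots> \<le> (2 * (real n + 1)) * ((y / 4) * \<bar>z\<bar> ^ n) / (y * Gamma y)"
      using G y n1 yn by (intro divide_right_mono mult_mono mult_right_mono) auto
    also have "\<dots> = (1/2) * ((real n + 1) * \<bar>z\<bar> ^ n / Gamma y)"
      using y G by (simp add: divide_simps)
    also have "\<dots> = (1/2) * norm ((real n + 1) * z ^ n / Gamma (\<alpha> * real n + \<beta>))"
      using G by (simp add: abs_mult power_abs y_def)
    finally show ?thesis .
  qed
  then show ?thesis by (intro summable_ratio_test[where c="1/2" and N=N]) auto
qed

lemma mittag_leffler_summable:
  fixes \<alpha> \<beta> z :: real
  assumes "\<alpha> \<ge> 1" "\<beta> > 0"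
  shows "summable (\<lambda>j. z ^ j / Gamma (\<alpha> * real j + \<beta>))"
proof (rule summable_comparison_test[OF _ mittag_leffler_summable_deriv[OF assms, of "\<bar>z\<bar>"]])
  have "norm (z ^ j / Gamma (\<alpha> * real j + \<beta>)) \<le> (real j + 1) * \<bar>z\<bar> ^ j / Gamma (\<alpha> * real j + \<beta>)" for j
  proof -
    have "\<alpha> * real j + \<beta> > 0" using assms by (simp add: add_nonneg_pos)
    then have G: "Gamma (\<alpha> * real j + \<beta>) > 0" by simp
    have "\<bar>z\<bar> ^ j \<le> (real j + 1) * \<bar>z\<bar> ^ j" by (simp add: algebra_simps)
    then show ?thesis using G by (simp add: power_abs divide_right_mono)
  qed
  then show "\<exists>N. \<forall>n\<ge>N. norm (z ^ n / Gamma (\<alpha> * real n + \<beta>)) \<le> (real n + 1) * \<bar>z\<bar> ^ n / Gamma (\<alpha> * real n + \<beta>)"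
    by blast
qed

lemma isCont_mittag_leffler:
  assumes "\<alpha> \<ge> 1" "\<beta> > 0"
  shows "isCont (mittag_leffler \<alpha> \<beta>) z"
  using isCont_powser_converges_everywhere[of "\<lambda>j. 1 / Gamma (\<alpha> * real j + \<beta>)" z]
    mittag_leffler_summable[OF assms] unfolding mittag_leffler_def[abs_def] by simp

text \<open>The term with index \<open>j\<close> has the Laplace transform
\<open>a j * x powr (- (\<alpha> * real j + \<beta>))\<close>.  If \<open>a j\<close> are the coefficients of
\<open>1 / (1 + z) ^ d\<close>, the transform of the whole series is therefore
\<open>x powr (- \<beta>) / (1 + x powr (- \<alpha>)) ^ d\<close>, which continues holomorphically to the
right half-plane.  For \<open>d = 1\<close> the series is \<open>t powr (\<beta> - 1)\<close> times a
Mittag-Leffler function of \<open>- (t powr \<alpha>)\<close>.\<close>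

definition gamma_series :: "(nat \<Rightarrow> real) \<Rightarrow> real \<Rightarrow> real \<Rightarrow> real \<Rightarrow> real" where
  "gamma_series a \<alpha> \<beta> t = (\<Sum>j. a j * t powr (\<alpha> * real j + \<beta> - 1) / Gamma (\<alpha> * real j + \<beta>))"

lemma gamma_series_summable:
  assumes "\<alpha> \<ge> 1" "\<beta> > 0" "\<And>j. \<bar>a j\<bar> \<le> real j + 1" "t > 0"
  shows "summable (\<lambda>j. norm (a j * t powr (\<alpha> * real j + \<beta> - 1) / Gamma (\<alpha> * real j + \<beta>)))"
proof (rule summable_comparison_test[OF _ summable_mult[OF mittag_leffler_summable_deriv[OF assms(1,2), of "t powr \<alpha>"], of "t powr (\<beta> - 1)"]])
  have "norm (a j * t powr (\<alpha> * real j + \<beta> - 1) / Gamma (\<alpha> * real j + \<beta>))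
     \<le> t powr (\<beta> - 1) * ((real j + 1) * (t powr \<alpha>) ^ j / Gamma (\<alpha> * real j + \<beta>))" for j
  proof -
    have "\<alpha> * real j + \<beta> > 0" using assms by (simp add: add_nonneg_pos)
    then have G: "Gamma (\<alpha> * real j + \<beta>) > 0" by simp
    have "t powr (\<alpha> * real j + \<beta> - 1) = t powr (\<beta> - 1) * (t powr \<alpha>) ^ j"
      using assms(4) by (simp add: powr_powr powr_add[symmetric] algebra_simps flip: powr_realpow)
    then show ?thesis using G assms(3)[of j]
      by (auto simp: abs_mult mult.left_commute[of "\<bar>a j\<bar>"] intro!: divide_right_mono mult_left_mono mult_right_mono)
  qed
  then show "\<exists>N. \<forall>n\<ge>N. norm (norm (a n * t powr (\<alpha> * real n + \<beta> - 1) / Gamma (\<alpha> * real n + \<beta>)))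
      \<le> t powr (\<beta> - 1) * ((real n + 1) * (t powr \<alpha>) ^ n / Gamma (\<alpha> * real n + \<beta>))"
    by (simp only: real_norm_def abs_abs) blast
qed

lemma gamma_series_eq_powser:
  assumes "t > 0" and "summable (\<lambda>j. a j / Gamma (\<alpha> * real j + \<beta>) * (t powr \<alpha>) ^ j)"
  shows "gamma_series a \<alpha> \<beta> t = t powr (\<beta> - 1) * (\<Sum>j. a j / Gamma (\<alpha> * real j + \<beta>) * (t powr \<alpha>) ^ j)"
proof -
  have "t powr (\<alpha> * real j + \<beta> - 1) = t powr (\<beta> - 1) * (t powr \<alpha>) ^ j" for j
    using assms by (simp add: powr_powr powr_add[symmetric] algebra_simps flip: powr_realpow)
  then show ?thesis unfolding gamma_series_def using assms(2)
    by (subst suminf_mult[symmetric]) (auto simp: ac_simps)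
qed

lemma gamma_series_coeff_summable:
  assumes "\<alpha> \<ge> 1" "\<beta> > 0" "\<And>j. \<bar>a j\<bar> \<le> real j + 1"
  shows "summable (\<lambda>j. a j / Gamma (\<alpha> * real j + \<beta>) * z ^ j)"
proof (rule summable_comparison_test[OF _ mittag_leffler_summable_deriv[OF assms(1,2), of "\<bar>z\<bar>"]])
  have "norm (a j / Gamma (\<alpha> * real j + \<beta>) * z ^ j) \<le> (real j + 1) * \<bar>z\<bar> ^ j / Gamma (\<alpha> * real j + \<beta>)" for j
  proof -
    have "\<alpha> * real j + \<beta> > 0" using assms by (simp add: add_nonneg_pos)
    then have G: "Gamma (\<alpha> * real j + \<beta>) > 0" by simp
    then show ?thesis using assms(3)[of j]
      by (simp add: abs_mult divide_right_mono mult_right_mono power_abs)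
  qed
  then show "\<exists>N. \<forall>n\<ge>N. norm (a n / Gamma (\<alpha> * real n + \<beta>) * z ^ n) \<le> (real n + 1) * \<bar>z\<bar> ^ n / Gamma (\<alpha> * real n + \<beta>)"
    by blast
qed

lemma continuous_on_gamma_series:
  assumes "\<alpha> \<ge> 1" "\<beta> > 0" "\<And>j. \<bar>a j\<bar> \<le> real j + 1"
  shows "continuous_on {0<..} (gamma_series a \<alpha> \<beta>)"
proof -
  define P where "P z = (\<Sum>j. a j / Gamma (\<alpha> * real j + \<beta>) * z ^ j)" for z
  have "isCont P z" for z unfolding P_def
    by (rule isCont_powser_converges_everywhere[OF gamma_series_coeff_summable[OF assms]])
  then have P: "continuous_on UNIV P" by (simp add: continuous_on_eq_continuous_at)
  have "continuous_on {0<..} (\<lambda>t. t powr (\<beta> - 1) * P (t powr \<alpha>))"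
    by (intro continuous_intros continuous_on_compose2[OF P]) auto
  then show ?thesis
    by (rule continuous_on_eq)
       (simp add: gamma_series_eq_powser[OF _ gamma_series_coeff_summable[OF assms]] P_def)
qed

lemma laplace_gamma_series:
  assumes \<alpha>: "\<alpha> \<ge> 1" and \<beta>: "\<beta> > 0" and a: "\<And>j. \<bar>a j\<bar> \<le> real j + 1" and x: "x > 1"
  shows "set_integrable lborel {0<..} (\<lambda>t. exp (- x * t) * gamma_series a \<alpha> \<beta> t)"
    and "(\<lambda>j. a j * x powr (- (\<alpha> * real j + \<beta>))) sums (LBINT t:{0<..}. exp (- x * t) * gamma_series a \<alpha> \<beta> t)"
proof -
  define f where "f j t = indicator {0<..} t * (a j * (exp (- x * t) * (t powr ((\<alpha> * real j + \<beta>) - 1) / Gamma (\<alpha> * real j + \<beta>))))" for j t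
  have b: "\<alpha> * real j + \<beta> > 0" for j using \<alpha> \<beta> by (simp add: add_nonneg_pos)
  have x0: "x > 0" using x by simp
  note L = laplace_powr[OF b x0]
  have fi: "integrable lborel (f j)" for j
    using set_integrable_mult_right[OF L(1), of "a j" j] unfolding f_def set_integrable_def by simp
  have nf: "norm (f j t) = \<bar>a j\<bar> * (indicator {0<..} t * (exp (- x * t) * (t powr ((\<alpha> * real j + \<beta>) - 1) / Gamma (\<alpha> * real j + \<beta>))))" for j t
    using b[of j] unfolding f_def by (auto simp: abs_mult indicator_def)
  have fn: "(LBINT t. norm (f j t)) = \<bar>a j\<bar> * x powr (- (\<alpha> * real j + \<beta>))" for j
    unfolding nf Bochner_Integration.integral_mult_right_zero using L(2)[of j] unfolding set_lebesgue_integral_def real_scaleR_def by simp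
  have f2: "(LBINT t. f j t) = a j * x powr (- (\<alpha> * real j + \<beta>))" for j
    unfolding f_def mult.left_commute[of _ "a j"] Bochner_Integration.integral_mult_right_zero using L(2)[of j] unfolding set_lebesgue_integral_def real_scaleR_def by simp
  have eq: "f j t = exp (- x * t) * indicator {0<..} t * (a j * t powr (\<alpha> * real j + \<beta> - 1) / Gamma (\<alpha> * real j + \<beta>))" for j t
    by (simp add: f_def)
  have s1: "summable (\<lambda>j. norm (f j t))" for t
  proof (cases "t > 0")
    case True
    then show ?thesis unfolding eq norm_mult
      using gamma_series_summable[OF \<alpha> \<beta> a True] by (intro summable_mult) (simp add: abs_mult)
  qed (simp add: f_def)
  have s2: "summable (\<lambda>j. LBINT t. norm (f j t))"
  proof (rule summable_comparison_test)
    have "norm (x powr - \<alpha>) < 1" using x \<alpha> powr_less_mono[of "-\<alpha>" 0 x] by simp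
    from geometric_deriv_sums[OF this]
    show "summable (\<lambda>j. x powr (- \<beta>) * (of_nat (Suc j) * (x powr - \<alpha>) ^ j))"
      by (intro summable_mult) (rule sums_summable)
    have "norm (LBINT t. norm (f j t)) \<le> x powr (- \<beta>) * (of_nat (Suc j) * (x powr - \<alpha>) ^ j)" for j
    proof -
      have "x powr (- (\<alpha> * real j + \<beta>)) = x powr (- \<beta>) * (x powr - \<alpha>) ^ j"
        using x0 by (simp add: powr_powr powr_add[symmetric] algebra_simps flip: powr_realpow)
      then show ?thesis unfolding fn using a[of j]
        by (auto simp: abs_mult mult.left_commute[of "\<bar>a j\<bar>"] add.commute intro!: mult_left_mono mult_right_mono)
    qed
    then show "\<exists>N. \<forall>j\<ge>N. norm (LBINT t. norm (f j t)) \<le> x powr (- \<beta>) * (of_nat (Suc j) * (x powr - \<alpha>) ^ j)" by blast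
  qed
  have sf: "(\<Sum>j. f j t) = indicator {0<..} t *\<^sub>R (exp (- x * t) * gamma_series a \<alpha> \<beta> t)" for t
  proof (cases "t > 0")
    case True
    then show ?thesis unfolding eq gamma_series_def
      using summable_norm_cancel[OF gamma_series_summable[OF \<alpha> \<beta> a True]] by (subst suminf_mult) auto
  qed (simp add: f_def)
  have i: "integrable lborel (\<lambda>t. \<Sum>j. f j t)"
    by (rule integrable_suminf[OF fi _ s2]) (intro always_eventually allI s1)
  then show "set_integrable lborel {0<..} (\<lambda>t. exp (- x * t) * gamma_series a \<alpha> \<beta> t)"
    unfolding set_integrable_def sf .
  have "(\<lambda>j. LBINT t. f j t) sums (LBINT t. \<Sum>j. f j t)"
    by (rule sums_integral[OF fi _ s2]) (intro always_eventually allI s1)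
  then show "(\<lambda>j. a j * x powr (- (\<alpha> * real j + \<beta>))) sums (LBINT t:{0<..}. exp (- x * t) * gamma_series a \<alpha> \<beta> t)"
    unfolding f2 sf set_lebesgue_integral_def .
qed


lemma set_integrable_exp_neg:
  fixes c :: real
  assumes "c > 0"
  shows "set_integrable lborel {0<..} (\<lambda>t. exp (- c * t))"
proof -
  have "set_integrable lborel {0<..} (\<lambda>t. exp (- c * t) * (t powr (1 - 1) / Gamma 1))"
    by (rule laplace_powr(1)) (use assms in auto)
  moreover have eq: "indicator {0<..} t *\<^sub>R (exp (- c * t) * (t powr (1 - 1) / Gamma 1)) = indicator {0<..} t *\<^sub>R exp (- c * t)" for t
    by (auto simp: indicator_def)
  ultimately show ?thesis unfolding set_integrable_def eq by blast
qed

lemma laplace_exp: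
  fixes z :: complex
  assumes z: "Re z > 0"
  shows "set_integrable lborel {0<..} (\<lambda>t. exp (- z * of_real t))"
    and "(LBINT t:{0<..}. exp (- z * of_real t)) = 1 / z"
proof -
  have z0: "z \<noteq> 0" using z by auto
  have m[measurable]: "(\<lambda>t::real. exp (- z * of_real t)) \<in> borel_measurable borel"
    by (intro borel_measurable_continuous_onI continuous_intros)
  have r: "integrable lborel (\<lambda>t. indicator {0<..} t * exp (- Re z * t))"
    using set_integrable_exp_neg[OF z] unfolding set_integrable_def by simp
  have nb: "norm (indicator {0<..} t *\<^sub>R exp (- z * of_real t)) \<le> indicator {0<..} t * exp (- Re z * t)" for t :: real
    by (auto simp: indicator_def norm_exp_eq_Re)
  show i: "set_integrable lborel {0<..} (\<lambda>t. exp (- z * of_real t))"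
    unfolding set_integrable_def
    by (rule Bochner_Integration.integrable_bound[OF r]) (use nb in \<open>auto intro!: always_eventually order_trans[OF _ abs_ge_self]\<close>)
  have lim: "(\<lambda>n::nat. LBINT t. indicator {0<..real n} t *\<^sub>R exp (- z * of_real t)) \<longlonglongrightarrow> (LBINT t. indicator {0<..} t *\<^sub>R exp (- z * of_real t))"
  proof (rule integral_dominated_convergence[OF _ _ r])
    show "AE t in lborel. (\<lambda>n. indicator {0<..real n} t *\<^sub>R exp (- z * of_real t)) \<longlonglongrightarrow> indicator {0<..} t *\<^sub>R exp (- z * of_real t)"
    proof (intro always_eventually allI)
      fix t :: real
      have "eventually (\<lambda>n. real n \<ge> t) sequentially"
        using eventually_ge_at_top[of "nat \<lceil>t\<rceil>"] by eventually_elim linarith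
      then have "eventually (\<lambda>n. indicator {0<..real n} t *\<^sub>R exp (- z * of_real t) = indicator {0<..} t *\<^sub>R exp (- z * of_real t)) sequentially"
        by eventually_elim (auto simp: indicator_def)
      then show "(\<lambda>n. indicator {0<..real n} t *\<^sub>R exp (- z * of_real t)) \<longlonglongrightarrow> indicator {0<..} t *\<^sub>R exp (- z * of_real t)"
        by (rule tendsto_eventually)
    qed
  qed (auto simp: indicator_def norm_exp_eq_Re)
  have val: "(LBINT t. indicator {0<..real n} t *\<^sub>R exp (- z * of_real t)) = (1 - exp (- z * of_real (real n))) / z" for n
  proof -
    have s: "set_integrable lborel {0<..real n} (\<lambda>t. exp (- z * of_real t))"
      by (rule set_integrable_subset[OF i]) auto
    have "((\<lambda>t. exp (- z * of_real t)) has_integral (- exp (- z * of_real (real n)) / z) - (- exp (- z * of_real 0) / z)) {0..real n}"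
      using z0 by (intro fundamental_theorem_of_calculus)
         (auto intro!: derivative_eq_intros has_vector_derivative_real_field simp: field_simps)
    then have "((\<lambda>t. exp (- z * of_real t)) has_integral (1 - exp (- z * of_real (real n))) / z) {0..real n}"
      by (simp add: diff_divide_distrib)
    then have "((\<lambda>t. exp (- z * of_real t)) has_integral (1 - exp (- z * of_real (real n))) / z) {0<..real n}"
      by (rule has_integral_spike_set_eq[THEN iffD1, rotated 2]) (auto intro: negligible_subset[of "{0}"])
    then show ?thesis
      using set_borel_integral_eq_integral(2)[OF s] by (simp add: set_lebesgue_integral_def integral_unique)
  qed
  have "(\<lambda>n::nat. (1 - exp (- z * of_real (real n))) / z) \<longlonglongrightarrow> (1 - 0) / z"
  proof (intro tendsto_intros z0)
    have "(\<lambda>n::nat. exp (- Re z * real n)) \<longlonglongrightarrow> 0" using z by real_asymp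
    then show "(\<lambda>n::nat. exp (- z * of_real (real n))) \<longlonglongrightarrow> 0"
      by (rule Lim_null_comparison[rotated]) (simp add: norm_exp_eq_Re)
  qed
  from LIMSEQ_unique[OF lim[unfolded val] this] show "(LBINT t:{0<..}. exp (- z * of_real t)) = 1 / z"
    unfolding set_lebesgue_integral_def by simp
qed

text \<open>Inversion of the Laplace transform along \<open>Re s = \<sigma>\<close>.  By Fubini and Cauchy's formula on
the half-plane, the real part of the inversion integral, divided by \<open>2 * pi\<close>, has the transform
of \<open>h\<close>, and is therefore \<open>h\<close>.  The integral is at most
\<open>exp (\<sigma> * t)\<close> times the integral of \<open>K\<close>, and letting \<open>\<sigma>\<close>
tend to \<open>0\<close> removes the exponential.\<close>

lemma bounded_if_laplace_transform_integrable:
  fixes h :: "real \<Rightarrow> real" and F :: "complex \<Rightarrow> complex"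
  assumes cont: "continuous_on {0<..} h"
    and int: "\<And>x. x > 1 \<Longrightarrow> set_integrable lborel {0<..} (\<lambda>t. exp (- x * t) * h t)"
    and lap: "\<And>x. x > 1 \<Longrightarrow> F (of_real x) = of_real (LBINT t:{0<..}. exp (- x * t) * h t)"
    and holo: "F holomorphic_on {s. Re s > 0}"
    and bound: "\<And>s. Re s > 0 \<Longrightarrow> cmod (F s) \<le> B * cmod s powr (- b)" and b: "b > 1"
    and K: "integrable lborel K"
    and FK: "\<And>\<sigma> w. 0 < \<sigma> \<Longrightarrow> \<sigma> < 1 \<Longrightarrow> w \<noteq> 0 \<Longrightarrow> cmod (F (Complex \<sigma> w)) \<le> K w"
    and t: "t > 0"
  shows "\<bar>h t\<bar> \<le> (LBINT w. K w) / (2 * pi)"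
proof -
  define M where "M = (LBINT w. K w) / (2 * pi)"
  have main: "\<bar>h t\<bar> \<le> exp (\<sigma> * t) * M" if \<sigma>: "0 < \<sigma>" "\<sigma> < 1" for \<sigma>
  proof -
    define f where "f w = F (Complex \<sigma> w)" for w
    have fi: "integrable lborel f"
      unfolding f_def using \<sigma> by (intro Cauchy_formula_halfplane(1)[OF holo bound b, of \<sigma> 1]) auto
    have fm[measurable]: "f \<in> borel_measurable borel" using fi by auto
    define g where "g t = (LBINT w. exp (Complex \<sigma> w * of_real t) * f w)" for t :: real
    have nexp: "cmod (exp (Complex \<sigma> w * of_real t)) = exp (\<sigma> * t)" for w t by (simp add: norm_exp_eq_Re)
    have em[measurable]: "(\<lambda>(t::real, w). exp (Complex \<sigma> w * of_real t)) \<in> borel_measurable (borel \<Otimes>\<^sub>M borel)"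
      unfolding borel_prod split_def Complex_eq
      by (intro borel_measurable_continuous_onI continuous_intros)
    have em2[measurable]: "(\<lambda>w. exp (Complex \<sigma> w * of_real t)) \<in> borel_measurable borel" for t :: real
      unfolding Complex_eq
      by (intro borel_measurable_continuous_onI continuous_intros)
    have gb: "cmod (g t) \<le> exp (\<sigma> * t) * (LBINT w. cmod (f w))" for t
    proof -
      have "cmod (g t) \<le> (LBINT w. cmod (exp (Complex \<sigma> w * of_real t) * f w))"
        unfolding g_def by (rule integral_norm_bound)
      also have "\<dots> = exp (\<sigma> * t) * (LBINT w. cmod (f w))" by (simp add: norm_mult nexp)
      finally show ?thesis .
    qed
    have gc: "continuous_on {0<..} g"
    proof (subst continuous_on_eq_continuous_at, simp, intro ballI)
      fix t :: real assume "t \<in> {0<..}"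
      show "isCont g t" unfolding continuous_at_sequentially comp_def
      proof (intro allI impI)
        fix X :: "nat \<Rightarrow> real" assume X: "X \<longlonglongrightarrow> t"
        have "bounded (range X)" using X by (rule convergent_imp_bounded)
        then obtain C where C: "\<And>n. \<bar>X n\<bar> \<le> C" unfolding bounded_iff by auto
        show "(\<lambda>n. g (X n)) \<longlonglongrightarrow> g t" unfolding g_def
        proof (rule integral_dominated_convergence)
          show "integrable lborel (\<lambda>w. exp C * cmod (f w))" using fi by auto
          show "AE w in lborel. (\<lambda>n. exp (Complex \<sigma> w * of_real (X n)) * f w) \<longlonglongrightarrow> exp (Complex \<sigma> w * of_real t) * f w"
            by (intro always_eventually allI tendsto_intros X)
          fix n
          show "AE w in lborel. norm (exp (Complex \<sigma> w * of_real (X n)) * f w) \<le> exp C * cmod (f w)"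
          proof (intro always_eventually allI)
            fix w
            have "\<sigma> * X n \<le> \<sigma> * C" using C[of n] \<sigma> by (intro mult_left_mono) auto
            also have "\<dots> \<le> C" using \<sigma> C[of n] by (simp add: mult_left_le_one_le)
            finally show "norm (exp (Complex \<sigma> w * of_real (X n)) * f w) \<le> exp C * cmod (f w)"
              by (simp add: norm_mult nexp mult_right_mono)
          qed
        qed auto
      qed
    qed
    have gL: "set_integrable lborel {0<..} (\<lambda>t. exp (- x * t) * Re (g t))"
         "(LBINT t:{0<..}. exp (- x * t) * Re (g t)) = 2 * pi * Re (F x)" if x: "x > 1" for x :: real
    proof -
      have mx[measurable]: "(\<lambda>(t::real, w). indicator {0<..} t *\<^sub>R (exp (- x * t) *\<^sub>R (exp (Complex \<sigma> w * of_real t) * f w))) \<in> borel_measurable (lborel \<Otimes>\<^sub>M lborel)"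
        by measurable
      have rexp: "set_integrable lborel {0<..} (\<lambda>t. exp (- (x - \<sigma>) * t))"
        by (rule set_integrable_exp_neg) (use x \<sigma> in simp)
      have P: "integrable (lborel \<Otimes>\<^sub>M lborel) (\<lambda>(t::real, w). indicator {0<..} t *\<^sub>R (exp (- x * t) *\<^sub>R (exp (Complex \<sigma> w * of_real t) * f w)))"
      proof (rule lborel_pair.Fubini_integrable[OF mx])
        have ee: "exp (- x * t) * exp (\<sigma> * t) = exp (- (x - \<sigma>) * t)" for t
          by (simp add: exp_add[symmetric] algebra_simps)
        have "norm (indicator {0<..} t *\<^sub>R (exp (- x * t) *\<^sub>R (exp (Complex \<sigma> w * of_real t) * f w)))
          = indicator {0<..} t *\<^sub>R exp (- (x - \<sigma>) * t) * cmod (f w)" for t :: real and w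
          unfolding ee[symmetric] by (simp add: norm_mult nexp)
        then have ie: "(LBINT w. norm (indicator {0<..} t *\<^sub>R (exp (- x * t) *\<^sub>R (exp (Complex \<sigma> w * of_real t) * f w))))
          = indicator {0<..} t *\<^sub>R exp (- (x - \<sigma>) * t) * (LBINT w. cmod (f w))" for t :: real
          by (simp only: Bochner_Integration.integral_mult_right_zero)
        show "integrable lborel (\<lambda>t. LBINT w. norm (case (t, w) of (t::real, w) \<Rightarrow> indicator {0<..} t *\<^sub>R (exp (- x * t) *\<^sub>R (exp (Complex \<sigma> w * of_real t) * f w))))"
          unfolding prod.case ie using rexp[unfolded set_integrable_def] by (intro integrable_mult_left)
        have "integrable lborel (\<lambda>w. exp (Complex \<sigma> w * of_real t) * f w)" for t :: real
        proof (rule Bochner_Integration.integrable_bound)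
          show "integrable lborel (\<lambda>w. exp (\<sigma> * t) * cmod (f w))" using fi by auto
        qed (auto simp: norm_mult nexp)
        then show "AE t in lborel. integrable lborel (\<lambda>w. case (t, w) of (t::real, w) \<Rightarrow> indicator {0<..} t *\<^sub>R (exp (- x * t) *\<^sub>R (exp (Complex \<sigma> w * of_real t) * f w)))"
          by auto
      qed
      have inner: "(LBINT w. indicator {0<..} t *\<^sub>R (exp (- x * t) *\<^sub>R (exp (Complex \<sigma> w * of_real t) * f w)))
           = indicator {0<..} t *\<^sub>R (exp (- x * t) *\<^sub>R g t)" for t :: real
        unfolding g_def by simp
      have gi: "integrable lborel (\<lambda>t. indicator {0<..} t *\<^sub>R (exp (- x * t) *\<^sub>R g t))"
        using lborel_pair.integrable_fst[OF P] unfolding inner .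
      have re: "Re (indicator {0<..} t *\<^sub>R (exp (- x * t) *\<^sub>R g t)) = indicator {0<..} t *\<^sub>R (exp (- x * t) * Re (g t))" for t
        by simp
      have "integrable lborel (\<lambda>t. Re (indicator {0<..} t *\<^sub>R (exp (- x * t) *\<^sub>R g t)))"
        using gi by (rule integrable_Re)
      then show "set_integrable lborel {0<..} (\<lambda>t. exp (- x * t) * Re (g t))"
        unfolding set_integrable_def re .
      have "(LBINT t. indicator {0<..} t *\<^sub>R (exp (- x * t) *\<^sub>R g t)) =
         (LBINT w. LBINT t. indicator {0<..} t *\<^sub>R (exp (- x * t) *\<^sub>R (exp (Complex \<sigma> w * of_real t) * f w)))"
        using lborel_pair.Fubini_integral[OF P] unfolding inner by simp
      also have "\<dots> = (LBINT w. F (Complex \<sigma> w) / (x - Complex \<sigma> w))"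
      proof (rule Bochner_Integration.integral_cong[OF refl])
        fix w
        have ez: "exp (- (of_real x - Complex \<sigma> w) * of_real t) = exp (- x * t) *\<^sub>R exp (Complex \<sigma> w * of_real t)" for t :: real
          unfolding scaleR_conv_of_real exp_of_real[symmetric] exp_add[symmetric] by (simp add: algebra_simps)
        have "(LBINT t. indicator {0<..} t *\<^sub>R (exp (- x * t) *\<^sub>R (exp (Complex \<sigma> w * of_real t) * f w)))
          = (LBINT t:{0<..}. exp (- (of_real x - Complex \<sigma> w) * of_real t) * f w)"
          unfolding set_lebesgue_integral_def
          by (intro Bochner_Integration.integral_cong)
             (simp_all only: ez refl scaleR_scaleR mult_scaleR_left)
        also have "\<dots> = 1 / (of_real x - Complex \<sigma> w) * f w"
          using laplace_exp[of "of_real x - Complex \<sigma> w"] x \<sigma>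
          by (subst set_integral_mult_left) (auto simp: Complex_eq)
        finally show "(LBINT t. indicator {0<..} t *\<^sub>R (exp (- x * t) *\<^sub>R (exp (Complex \<sigma> w * of_real t) * f w)))
          = F (Complex \<sigma> w) / (x - Complex \<sigma> w)" by (simp add: f_def)
      qed
      also have "\<dots> = 2 * pi * F x"
        by (rule Cauchy_formula_halfplane(3)[OF holo bound b]) (use \<sigma> x in auto)
      finally have "Re (LBINT t. indicator {0<..} t *\<^sub>R (exp (- x * t) *\<^sub>R g t)) = 2 * pi * Re (F x)" by simp
      then show "(LBINT t:{0<..}. exp (- x * t) * Re (g t)) = 2 * pi * Re (F x)"
        unfolding set_lebesgue_integral_def re[symmetric] using integral_Re[OF gi] by simp
    qed
    \<comment> \<open>the factor \<open>exp (- 2 * t)\<close> shifts all integer points into the range \<open>x > 1\<close> of the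
hypotheses\<close>
    define H where "H t = exp (- 2 * t) * (h t - Re (g t) / (2 * pi))" for t
    have "H t = 0"
    proof (rule laplace_injective[OF _ _ _ t])
      show "continuous_on {0<..} H" unfolding H_def by (intro continuous_intros cont gc) auto
      have Hn: "exp (- t) ^ n * H t = exp (- (real n + 2) * t) * h t - (1 / (2 * pi)) * (exp (- (real n + 2) * t) * Re (g t))" for n t
        by (simp add: H_def algebra_simps exp_of_nat_mult[symmetric] diff_divide_distrib flip: exp_add)
      have i: "set_integrable lborel {0<..} (\<lambda>t. exp (- (real n + 2) * t) * h t)"
           "set_integrable lborel {0<..} (\<lambda>t. (1 / (2 * pi)) * (exp (- (real n + 2) * t) * Re (g t)))" for n
        by (rule int, simp) (intro set_integrable_mult_right gL, simp)
      have Heq: "H = (\<lambda>t. exp (- (real 0 + 2) * t) * h t - (1 / (2 * pi)) * (exp (- (real 0 + 2) * t) * Re (g t)))"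
        by (rule ext) (insert Hn[of _ 0], simp only: power_0 mult_1_left)
      show "set_integrable lborel {0<..} H"
        unfolding Heq by (rule set_integral_diff(1)[OF i(1)[of 0] i(2)[of 0]])
      show "(LBINT t:{0<..}. exp (- t) ^ n * H t) = 0" for n
        unfolding Hn set_integral_diff(2)[OF i] set_integral_mult_right
        using gL(2)[of "real n + 2"] lap[of "real n + 2"] by simp
    qed
    then have "h t = Re (g t) / (2 * pi)" by (simp add: H_def)
    then have "\<bar>h t\<bar> = \<bar>Re (g t)\<bar> / (2 * pi)" by (simp add: abs_divide)
    also have "\<dots> \<le> cmod (g t) / (2 * pi)" using abs_Re_le_cmod by (intro divide_right_mono) auto
    also have "\<dots> \<le> exp (\<sigma> * t) * (LBINT w. cmod (f w)) / (2 * pi)"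
      by (intro divide_right_mono gb) auto
    also have "\<dots> \<le> exp (\<sigma> * t) * (LBINT w. K w) / (2 * pi)"
    proof (intro divide_right_mono mult_left_mono integral_mono_AE K)
      show "integrable lborel (\<lambda>w. cmod (f w))" using fi by auto
      show "AE w in lborel. cmod (f w) \<le> K w"
        using AE_lborel_singleton[of 0] by eventually_elim (auto simp: f_def intro: FK \<sigma>)
    qed auto
    finally show ?thesis by (simp add: M_def)
  qed
  have "((\<lambda>\<sigma>. exp (\<sigma> * t) * M) \<longlongrightarrow> exp (0 * t) * M) (at_right 0)" by (intro tendsto_intros)
  moreover have "eventually (\<lambda>\<sigma>. \<bar>h t\<bar> \<le> exp (\<sigma> * t) * M) (at_right (0::real))"
    unfolding eventually_at_right_field by (intro exI[of _ 1]) (auto intro: main)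
  ultimately have "\<bar>h t\<bar> \<le> exp (0 * t) * M" by (rule tendsto_lowerbound) simp
  then show ?thesis by (simp add: M_def)
qed


text \<open>The argument of \<open>s powr \<alpha>\<close> stays within \<open>\<alpha> * pi / 2 < pi\<close>, so
\<open>s powr \<alpha>\<close> avoids a sector around the negative axis.  For \<open>\<alpha> = 2\<close> the
symbol would vanish at \<open>\<i>\<close>, and the solutions would oscillate without decay.\<close>

lemma resolvent_symbol_lower_bound:
  assumes "1 < \<alpha>" "\<alpha> < 2"
  obtains c where "c > 0" "\<And>s. Re s > 0 \<Longrightarrow> c * (1 + cmod s powr \<alpha>) \<le> cmod (s powr of_real \<alpha> + 1)"
proof -
  define \<kappa> where "\<kappa> = cos (\<alpha> * pi / 2)"
  have k: "\<kappa> > -1" unfolding \<kappa>_def using assms cos_monotone_0_pi[of "\<alpha> * pi / 2" pi] by simp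
  have k0: "\<kappa> \<le> 0" unfolding \<kappa>_def using assms cos_monotone_0_pi_le[of "pi/2" "\<alpha> * pi / 2"] by (simp add: mult.commute)
  \<comment> \<open>\<open>1 + 2 r cos \<psi> + r\<^sup>2\<close> with \<open>cos \<psi> \<ge> \<kappa>\<close> and
\<open>\<kappa> \<le> 0\<close> dominates \<open>(1 + \<kappa>) (1 + r)\<^sup>2 / 2\<close>\<close>
  define c where "c = sqrt ((1 + \<kappa>) / 2)"
  have c: "c > 0" unfolding c_def using k by simp
  moreover have "c * (1 + cmod s powr \<alpha>) \<le> cmod (s powr of_real \<alpha> + 1)" if s: "Re s > 0" for s
  proof -
    have s0: "s \<noteq> 0" using s by auto
    define r \<psi> where "r = cmod s powr \<alpha>" and "\<psi> = \<alpha> * Im (Ln s)"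
    have r: "r \<ge> 0" by (simp add: r_def)
    have w: "s powr of_real \<alpha> = of_real r * exp (\<i> * of_real \<psi>)"
    proof -
      have "s powr of_real \<alpha> = exp (of_real \<alpha> * Ln s)" using s0 by (simp add: powr_def)
      also have "of_real \<alpha> * Ln s = of_real (\<alpha> * ln (cmod s)) + \<i> * of_real \<psi>"
        using s0 by (simp add: complex_eq_iff \<psi>_def)
      also have "exp \<dots> = of_real (exp (\<alpha> * ln (cmod s))) * exp (\<i> * of_real \<psi>)"
        unfolding exp_add exp_of_real ..
      finally show ?thesis using s0 by (simp add: r_def powr_def)
    qed
    have "\<bar>Im (Ln s)\<bar> \<le> pi / 2" using Re_Ln_pos_lt[OF s0] s by auto
    then have p: "\<bar>\<psi>\<bar> \<le> \<alpha> * pi / 2" unfolding \<psi>_def using assms mult_left_mono[of "\<bar>Im (Ln s)\<bar>" "pi/2" \<alpha>] by (simp add: abs_mult)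
    have cp: "\<kappa> \<le> cos \<psi>"
      using cos_monotone_0_pi_le[of "\<bar>\<psi>\<bar>" "\<alpha> * pi / 2"] p assms unfolding \<kappa>_def by simp
    have "(c * (1 + r))\<^sup>2 = (1 + \<kappa>) / 2 * (1 + r)\<^sup>2" using k by (simp add: c_def power_mult_distrib)
    also have "\<dots> = (1 + \<kappa>) * (1 + r\<^sup>2) - (1 + \<kappa>) / 2 * (1 - r)\<^sup>2" by (simp add: power2_eq_square field_simps)
    also have "\<dots> \<le> (1 + \<kappa>) * (1 + r\<^sup>2)" using k by simp
    also have "\<dots> = 1 + 2 * r * \<kappa> + r\<^sup>2 + \<kappa> * (1 - r)\<^sup>2" by (simp add: power2_eq_square field_simps)
    also have "\<dots> \<le> 1 + 2 * r * \<kappa> + r\<^sup>2" using k0 by (simp add: mult_nonpos_nonneg)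
    also have "\<dots> \<le> 1 + 2 * r * cos \<psi> + r\<^sup>2" using cp r by (simp add: mult_left_mono)
    also have "\<dots> = (cmod (s powr of_real \<alpha> + 1))\<^sup>2"
    proof -
      have "(cmod (s powr of_real \<alpha> + 1))\<^sup>2 = (r * cos \<psi> + 1)\<^sup>2 + (r * sin \<psi>)\<^sup>2"
        unfolding w cmod_power2 by (simp add: Re_exp Im_exp)
      also have "\<dots> = 1 + 2 * r * cos \<psi> + r\<^sup>2"
        unfolding power_mult_distrib sin_squared_eq by (simp add: power2_eq_square algebra_simps)
      finally show ?thesis by simp
    qed
    finally show ?thesis unfolding r_def by (rule power2_le_imp_le) simp
  qed
  ultimately show thesis by (rule that)
qed

text \<open>On vertical lines close to the imaginary axis the transforms below behave like
\<open>\<bar>w\<bar> powr e\<close> near \<open>0\<close> and like \<open>\<bar>w\<bar> powr (- b)\<close> at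
infinity.\<close>

lemma integrable_powr_majorant:
  fixes e b :: real
  assumes e: "e > -1" and b: "b > 1"
  shows "integrable lborel (\<lambda>w::real. if \<bar>w\<bar> \<le> 1 then \<bar>w\<bar> powr e else \<bar>w\<bar> powr (- b))"
proof -
  have "((\<lambda>w::real. w powr (- b)) has_integral - (1 powr (- b + 1)) / (- b + 1)) {1..}"
    using b by (intro has_integral_powr_to_inf) auto
  then have "(\<lambda>w::real. w powr (- b)) absolutely_integrable_on {1..}"
    by (intro nonnegative_absolutely_integrable_1) auto
  then have "set_integrable lborel {1..} (\<lambda>w::real. w powr (- b))"
    unfolding set_integrable_def by (subst (asm) integrable_completion) auto
  then have "set_integrable lborel {1<..} (\<lambda>w::real. w powr (- b))"
    by (rule set_integrable_subset) auto
  moreover have "(\<lambda>w::real. w powr e) absolutely_integrable_on {0..1}"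
    using e by (intro nonnegative_absolutely_integrable_1 integrable_on_powr_from_0) auto
  then have "set_integrable lborel {0..1} (\<lambda>w::real. w powr e)"
    unfolding set_integrable_def by (subst (asm) integrable_completion) auto
  ultimately have i: "integrable lborel (\<lambda>w. indicator {0..1} w *\<^sub>R w powr e + indicator {1<..} w *\<^sub>R w powr (- b))" (is "integrable _ ?g")
    unfolding set_integrable_def by (intro Bochner_Integration.integrable_add)
  have i2: "integrable lborel (\<lambda>w. ?g (0 + (-1) * w))" by (rule lborel_integrable_real_affine[OF i]) simp
  have eq: "(if \<bar>w\<bar> \<le> 1 then \<bar>w\<bar> powr e else \<bar>w\<bar> powr (- b)) = ?g w + ?g (0 + (-1) * w)" for w :: real
    by (auto simp: indicator_def)
  show ?thesis unfolding eq by (intro Bochner_Integration.integrable_add i i2)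
qed

text \<open>The transform is \<open>s powr (\<alpha> * d - b) / (s powr \<alpha> + 1) ^ d\<close>.  The two conditions on
\<open>b\<close> say that it is integrable along the imaginary axis: \<open>b > 1\<close> at infinity,
\<open>b < \<alpha> * d + 1\<close> at the origin.\<close>

lemma gamma_series_bounded:
  assumes \<alpha>: "1 < \<alpha>" "\<alpha> < 2" and b: "1 < b" "b < \<alpha> * real d + 1"
    and a: "\<And>j. \<bar>a j\<bar> \<le> real j + 1"
    and gen: "\<And>z. 0 < z \<Longrightarrow> z < 1 \<Longrightarrow> (\<lambda>j. a j * z ^ j) sums (1 / (1 + z) ^ d)"
  shows "\<exists>M. \<forall>t>0. \<bar>gamma_series a \<alpha> b t\<bar> \<le> M"
proof -
  obtain c where c: "c > 0" "\<And>s. Re s > 0 \<Longrightarrow> c * (1 + cmod s powr \<alpha>) \<le> cmod (s powr of_real \<alpha> + 1)"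
    using resolvent_symbol_lower_bound[OF \<alpha>] by blast
  define e where "e = \<alpha> * real d - b"
  have e: "e > -1" using b by (simp add: e_def)
  define F :: "complex \<Rightarrow> complex" where "F s = s powr of_real e / (s powr of_real \<alpha> + 1) ^ d" for s
  have nz: "s powr of_real \<alpha> + 1 \<noteq> 0" if "Re s > 0" for s
  proof
    assume "s powr complex_of_real \<alpha> + 1 = 0"
    then have "c * (1 + cmod s powr \<alpha>) \<le> 0" using c(2)[OF that] by simp
    moreover have "c * (1 + cmod s powr \<alpha>) > 0" using c(1) by (intro mult_pos_pos add_pos_nonneg) auto
    ultimately show False by simp
  qed
  have holo: "F holomorphic_on {s. Re s > 0}"
    unfolding F_def using nz by (intro holomorphic_intros) (auto simp: complex_nonpos_Reals_iff)
  have Fb: "cmod (F s) \<le> cmod s powr e / (c * (1 + cmod s powr \<alpha>)) ^ d" if "Re s > 0" for s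
  proof -
    have "0 < c * (1 + cmod s powr \<alpha>)" using c(1) by (intro mult_pos_pos add_pos_nonneg) auto
    then show ?thesis unfolding F_def norm_divide norm_power
      using c(2)[OF that] by (intro frac_le power_mono zero_less_power) (auto simp: norm_powr_real_powr')
  qed
  have F1: "cmod (F s) \<le> (1 / c ^ d) * cmod s powr (- b)" if s: "Re s > 0" for s
  proof -
    have s0: "cmod s > 0" using s by auto
    have "cmod s powr e / (c * (1 + cmod s powr \<alpha>)) ^ d \<le> cmod s powr e / (c * cmod s powr \<alpha>) ^ d"
      using c s0 by (intro divide_left_mono power_mono mult_left_mono mult_pos_pos zero_less_power add_pos_nonneg) auto
    also have "\<dots> = (1 / c ^ d) * (cmod s powr e / cmod s powr (\<alpha> * real d))"
      using s0 by (simp add: power_mult_distrib powr_powr flip: powr_realpow)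
    also have "cmod s powr e / cmod s powr (\<alpha> * real d) = cmod s powr (- b)"
      by (simp add: e_def flip: powr_diff)
    finally show ?thesis using Fb[OF s] by simp
  qed
  have F2: "cmod (F s) \<le> (1 / c ^ d) * cmod s powr e" if s: "Re s > 0" for s
  proof -
    have "cmod s powr e / (c * (1 + cmod s powr \<alpha>)) ^ d \<le> cmod s powr e / (c * 1) ^ d"
      using c by (intro divide_left_mono power_mono mult_left_mono mult_pos_pos zero_less_power add_pos_nonneg) auto
    then show ?thesis using Fb[OF s] by simp
  qed
  \<comment> \<open>for \<open>\<bar>w\<bar> \<le> 1\<close> and \<open>\<sigma> < 1\<close> the modulus lies between
\<open>\<bar>w\<bar>\<close> and \<open>2\<close>, whence the factor \<open>2 powr \<bar>e\<bar>\<close>\<close>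
  define K where "K w = (1 / c ^ d * 2 powr \<bar>e\<bar>) * (if \<bar>w\<bar> \<le> 1 then \<bar>w\<bar> powr (min e 0) else \<bar>w\<bar> powr (- b))" for w :: real
  have K: "integrable lborel K" unfolding K_def using e b
    by (intro integrable_mult_right integrable_powr_majorant) auto
  have FK: "cmod (F (Complex \<sigma> w)) \<le> K w" if "0 < \<sigma>" "\<sigma> < 1" "w \<noteq> 0" for \<sigma> w
  proof -
    let ?s = "Complex \<sigma> w"
    have re: "Re ?s > 0" using that by simp
    have lo: "\<bar>w\<bar> \<le> cmod ?s" using abs_Im_le_cmod[of ?s] by simp
    have up: "cmod ?s \<le> \<sigma> + \<bar>w\<bar>" using cmod_le[of ?s] that by simp
    have p1: "1 \<le> 2 powr \<bar>e\<bar>" by (simp add: ge_one_powr_ge_zero)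
    show ?thesis
    proof (cases "\<bar>w\<bar> \<le> 1")
      case True
      have "cmod ?s powr e \<le> 2 powr \<bar>e\<bar> * \<bar>w\<bar> powr (min e 0)"
      proof (cases "e \<ge> 0")
        case True
        have "cmod ?s powr e \<le> 2 powr e" using True up that \<open>\<bar>w\<bar> \<le> 1\<close> by (intro powr_mono2) auto
        then show ?thesis using True that by (simp add: min_def)
      next
        case False
        have "cmod ?s powr e \<le> \<bar>w\<bar> powr e" using False lo that by (intro powr_mono2') auto
        also have "\<dots> \<le> 2 powr \<bar>e\<bar> * \<bar>w\<bar> powr e" using p1 by (simp add: mult_right_mono mult_le_cancel_right1)
        finally show ?thesis using False by (simp add: min_def)
      qed
      then have "(1 / c ^ d) * cmod ?s powr e \<le> (1 / c ^ d) * (2 powr \<bar>e\<bar> * \<bar>w\<bar> powr (min e 0))"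
        using c(1) by (intro mult_left_mono) auto
      with F2[OF re] show ?thesis using True by (simp add: K_def)
    next
      case False
      have "cmod ?s powr (- b) \<le> \<bar>w\<bar> powr (- b)" using lo that b by (intro powr_mono2') auto
      also have "\<dots> \<le> 2 powr \<bar>e\<bar> * \<bar>w\<bar> powr (- b)" using p1 by (simp add: mult_right_mono mult_le_cancel_right1)
      finally have "(1 / c ^ d) * cmod ?s powr (- b) \<le> (1 / c ^ d) * (2 powr \<bar>e\<bar> * \<bar>w\<bar> powr (- b))"
        using c(1) by (intro mult_left_mono) auto
      with F1[OF re] show ?thesis using False by (simp add: K_def)
    qed
  qed
  have lap: "F (of_real x) = of_real (LBINT t:{0<..}. exp (- x * t) * gamma_series a \<alpha> b t)" if x: "x > 1" for x
  proof -
    have x0: "x > 0" using x by simp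
    have q: "0 < x powr - \<alpha>" "x powr - \<alpha> < 1" using x \<alpha> powr_less_mono[of "-\<alpha>" 0 x] by auto
    have "(\<lambda>j. x powr (- b) * (a j * (x powr - \<alpha>) ^ j)) sums (x powr (- b) * (1 / (1 + x powr - \<alpha>) ^ d))"
      by (intro sums_mult gen q)
    moreover have "x powr (- b) * (a j * (x powr - \<alpha>) ^ j) = a j * x powr (- (\<alpha> * real j + b))" for j
    proof -
      have "x powr (- (\<alpha> * real j + b)) = x powr (- b) * (x powr - \<alpha>) ^ j"
        using x0 by (simp add: powr_powr powr_add[symmetric] algebra_simps flip: powr_realpow)
      then show ?thesis by simp
    qed
    ultimately have "(LBINT t:{0<..}. exp (- x * t) * gamma_series a \<alpha> b t) = x powr (- b) * (1 / (1 + x powr - \<alpha>) ^ d)"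
      using laplace_gamma_series(2)[OF _ _ a x, of \<alpha> b] \<alpha> b sums_unique2 by fastforce
    also have "\<dots> = x powr e / (x powr \<alpha> + 1) ^ d"
    proof -
      have "x powr \<alpha> + 1 = x powr \<alpha> * (1 + x powr - \<alpha>)" using x0 by (simp add: distrib_left flip: powr_add)
      moreover have "(x powr \<alpha>) ^ d = x powr (\<alpha> * real d)" using x0 by (simp add: powr_powr flip: powr_realpow)
      moreover have "x powr e = x powr (\<alpha> * real d) * x powr (- b)" by (simp add: e_def flip: powr_add)
      ultimately show ?thesis using x0 by (simp add: power_mult_distrib)
    qed
    finally show ?thesis using x0 by (simp add: F_def powr_of_real)
  qed
  have "\<bar>gamma_series a \<alpha> b t\<bar> \<le> (LBINT w. K w) / (2 * pi)" if t: "t > 0" for t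
  proof (rule bounded_if_laplace_transform_integrable[OF _ _ lap holo F1 b(1) K FK t])
    show "continuous_on {0<..} (gamma_series a \<alpha> b)" using \<alpha> b a by (intro continuous_on_gamma_series) auto
    show "set_integrable lborel {0<..} (\<lambda>t. exp (- x * t) * gamma_series a \<alpha> b t)" if "x > 1" for x
      using \<alpha> b a that by (intro laplace_gamma_series(1)) auto
  qed
  then show ?thesis by blast
qed

lemma gamma_series_geometric:
  assumes "t > 0" "\<alpha> \<ge> 1" "\<beta> > 0"
  shows "gamma_series (\<lambda>j. (-1) ^ j) \<alpha> \<beta> t = t powr (\<beta> - 1) * mittag_leffler \<alpha> \<beta> (- (t powr \<alpha>))"
proof -
  have "(-1) ^ j * t powr (\<alpha> * real j + \<beta> - 1) / Gamma (\<alpha> * real j + \<beta>) =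
      t powr (\<beta> - 1) * ((- (t powr \<alpha>)) ^ j / Gamma (\<alpha> * real j + \<beta>))" for j
  proof -
    have "t powr (\<alpha> * real j + \<beta> - 1) = t powr (\<beta> - 1) * (t powr \<alpha>) ^ j"
      using assms by (simp add: powr_powr powr_add[symmetric] algebra_simps flip: powr_realpow)
    then show ?thesis by (simp add: power_minus[of "t powr \<alpha>"])
  qed
  then have "gamma_series (\<lambda>j. (-1) ^ j) \<alpha> \<beta> t = (\<Sum>j. t powr (\<beta> - 1) * ((- (t powr \<alpha>)) ^ j / Gamma (\<alpha> * real j + \<beta>)))"
    unfolding gamma_series_def by (rule suminf_cong)
  then show ?thesis unfolding mittag_leffler_def suminf_mult[OF mittag_leffler_summable[OF assms(2,3)]] .
qed

text \<open>Multiplication by \<open>t\<close> corresponds to differentiation of the transform and thus raises the power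
of the denominator from one to two.  On coefficients it is the splitting
\<open>\<alpha> j + \<beta> = \<alpha> (j + 1) + (\<beta> - \<alpha>)\<close> of the factor by which
\<open>Gamma (\<alpha> j + \<beta> + 1)\<close> exceeds \<open>Gamma (\<alpha> j + \<beta>)\<close>.\<close>

lemma gamma_series_shift:
  assumes "t > 0" "\<alpha> \<ge> 1" "\<beta> > 0"
  shows "t * gamma_series (\<lambda>j. (-1) ^ j) \<alpha> \<beta> t =
    \<alpha> * gamma_series (\<lambda>j. (-1) ^ j * (real j + 1)) \<alpha> (\<beta> + 1) t + (\<beta> - \<alpha>) * gamma_series (\<lambda>j. (-1) ^ j) \<alpha> (\<beta> + 1) t"
proof -
  have s: "summable (\<lambda>j. (-1) ^ j * t powr (\<alpha> * real j + b - 1) / Gamma (\<alpha> * real j + b))"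
      and s': "summable (\<lambda>j. (-1) ^ j * (real j + 1) * t powr (\<alpha> * real j + b - 1) / Gamma (\<alpha> * real j + b))"
    if "b > 0" for b
    by (rule summable_norm_cancel[OF gamma_series_summable]; use assms that in \<open>simp add: abs_mult power_abs\<close>)+
  have "t * ((-1) ^ j * t powr (\<alpha> * real j + \<beta> - 1) / Gamma (\<alpha> * real j + \<beta>)) =
     \<alpha> * ((-1) ^ j * (real j + 1) * t powr (\<alpha> * real j + (\<beta> + 1) - 1) / Gamma (\<alpha> * real j + (\<beta> + 1)))
     + (\<beta> - \<alpha>) * ((-1) ^ j * t powr (\<alpha> * real j + (\<beta> + 1) - 1) / Gamma (\<alpha> * real j + (\<beta> + 1)))" for j
  proof -
    define y where "y = \<alpha> * real j + \<beta>"
    have y: "y > 0" using assms by (simp add: y_def add_nonneg_pos)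
    then have G: "Gamma y > 0" by simp
    have "y \<notin> \<int>\<^sub>\<le>\<^sub>0" using y by (auto elim!: nonpos_Ints_cases)
    then have Gp: "Gamma (\<alpha> * real j + (\<beta> + 1)) = y * Gamma y"
      using Gamma_plus1[of y] by (simp add: y_def add.assoc)
    have tp: "t powr (\<alpha> * real j + (\<beta> + 1) - 1) = t * t powr (y - 1)"
      using assms by (simp add: y_def powr_diff)
    define Z where "Z = (-1) ^ j * (t * t powr (y - 1)) / (y * Gamma y)"
    have "(-1) ^ j * (real j + 1) * (t * t powr (y - 1)) / (y * Gamma y) = (real j + 1) * Z" by (simp add: Z_def)
    then have "\<alpha> * ((-1) ^ j * (real j + 1) * (t * t powr (y - 1)) / (y * Gamma y)) + (\<beta> - \<alpha>) * ((-1) ^ j * (t * t powr (y - 1)) / (y * Gamma y))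
       = \<alpha> * ((real j + 1) * Z) + (\<beta> - \<alpha>) * Z"
      by (simp only: Z_def)
    also have "\<dots> = y * Z" by (simp add: y_def algebra_simps)
    also have "\<dots> = t * ((-1) ^ j * t powr (y - 1) / Gamma y)"
      using y by (simp add: Z_def)
    finally show ?thesis unfolding Gp tp y_def[symmetric] by simp
  qed
  note eq = this
  have b: "\<beta> + 1 > 0" using assms by simp
  show ?thesis unfolding gamma_series_def
      suminf_mult[OF s[OF assms(3)], symmetric] suminf_mult[OF s[OF b], symmetric] suminf_mult[OF s'[OF b], symmetric]
      suminf_add[OF summable_mult[OF s'[OF b]] summable_mult[OF s[OF b]]]
    by (rule suminf_cong) (rule eq)
qed

text \<open>On \<open>{0..1}\<close> the bounds hold by continuity.  For \<open>x = t powr \<alpha> > 1\<close> each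
left-hand side is controlled by \<open>t powr (\<beta> - 1)\<close> or \<open>t powr \<beta>\<close> times a
Mittag-Leffler function, hence by a bounded series.  The first power suffices for \<open>\<beta> = 2\<close>
only; the factor \<open>t\<close> in the other cases is paid for by the squared denominator.  For
\<open>\<beta> = \<alpha>\<close> the second summand of the shifted series drops out, and this cancellation
gives the decay of order \<open>1 / x\<close>.\<close>

lemma mittag_leffler_bounds:
  assumes \<alpha>: "1 < \<alpha>" "\<alpha> < 2"
  obtains C where "C > 0"
    "\<And>x. x \<ge> 0 \<Longrightarrow> \<bar>mittag_leffler \<alpha> 1 (- x)\<bar> \<le> C"
    "\<And>x. x \<ge> 0 \<Longrightarrow> (1 + x powr (1 / \<alpha>)) * \<bar>mittag_leffler \<alpha> 2 (- x)\<bar> \<le> C"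
    "\<And>x. x \<ge> 0 \<Longrightarrow> (1 + x) * \<bar>mittag_leffler \<alpha> \<alpha> (- x)\<bar> \<le> C"
    "\<And>x. x \<ge> 0 \<Longrightarrow> \<bar>mittag_leffler \<alpha> (\<alpha> - 1) (- x)\<bar> \<le> C"
proof -
  let ?a = "\<lambda>j::nat. (-1::real) ^ j" and ?b = "\<lambda>j::nat. (-1::real) ^ j * (real j + 1)"
  have ga: "(\<lambda>j. ?a j * z ^ j) sums (1 / (1 + z) ^ 1)" if "0 < z" "z < 1" for z :: real
  proof -
    have "?a j * z ^ j = (- z) ^ j" for j by (simp add: power_minus[of z])
    then show ?thesis using geometric_sums[of "-z"] that by simp
  qed
  have gb: "(\<lambda>j. ?b j * z ^ j) sums (1 / (1 + z) ^ 2)" if "0 < z" "z < 1" for z :: real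
  proof -
    have "?b j * z ^ j = of_nat (Suc j) * (- z) ^ j" for j by (simp add: power_minus[of z])
    then show ?thesis using geometric_deriv_sums[of "-z"] that by simp
  qed
  have A: "\<exists>M. \<forall>t>0. \<bar>gamma_series ?a \<alpha> b t\<bar> \<le> M" if "1 < b" "b < \<alpha> + 1" for b
    by (rule gamma_series_bounded[OF \<alpha> _ _ _ ga]) (use that in \<open>auto simp: power_abs\<close>)
  have B: "\<exists>M. \<forall>t>0. \<bar>gamma_series ?b \<alpha> b t\<bar> \<le> M" if "1 < b" "b < 2 * \<alpha> + 1" for b
    by (rule gamma_series_bounded[OF \<alpha> _ _ _ gb]) (use that in \<open>auto simp: power_abs abs_mult\<close>)
  have scaled: "\<exists>M. \<forall>t>0. t powr \<beta> * \<bar>mittag_leffler \<alpha> \<beta> (- (t powr \<alpha>))\<bar> \<le> M" if \<beta>: "0 < \<beta>" "\<beta> < \<alpha>" for \<beta>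
  proof -
    obtain M1 where M1: "\<And>t. t > 0 \<Longrightarrow> \<bar>gamma_series ?b \<alpha> (\<beta> + 1) t\<bar> \<le> M1" using B[of "\<beta> + 1"] \<alpha> \<beta> by auto
    obtain M2 where M2: "\<And>t. t > 0 \<Longrightarrow> \<bar>gamma_series ?a \<alpha> (\<beta> + 1) t\<bar> \<le> M2" using A[of "\<beta> + 1"] \<alpha> \<beta> by auto
    have "t powr \<beta> * \<bar>mittag_leffler \<alpha> \<beta> (- (t powr \<alpha>))\<bar> \<le> \<alpha> * M1 + \<bar>\<beta> - \<alpha>\<bar> * M2" if t: "t > 0" for t
    proof -
      have "t powr \<beta> * \<bar>mittag_leffler \<alpha> \<beta> (- (t powr \<alpha>))\<bar> = \<bar>t * gamma_series ?a \<alpha> \<beta> t\<bar>"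
        using t \<alpha> \<beta> by (simp add: gamma_series_geometric abs_mult powr_diff)
      also have "\<dots> = \<bar>\<alpha> * gamma_series ?b \<alpha> (\<beta> + 1) t + (\<beta> - \<alpha>) * gamma_series ?a \<alpha> (\<beta> + 1) t\<bar>"
        using t \<alpha> \<beta> by (subst gamma_series_shift) auto
      also have "\<dots> \<le> \<alpha> * \<bar>gamma_series ?b \<alpha> (\<beta> + 1) t\<bar> + \<bar>\<beta> - \<alpha>\<bar> * \<bar>gamma_series ?a \<alpha> (\<beta> + 1) t\<bar>"
        using \<alpha> abs_triangle_ineq[of "\<alpha> * gamma_series ?b \<alpha> (\<beta> + 1) t" "(\<beta> - \<alpha>) * gamma_series ?a \<alpha> (\<beta> + 1) t"]
        by (simp add: abs_mult)
      also have "\<dots> \<le> \<alpha> * M1 + \<bar>\<beta> - \<alpha>\<bar> * M2"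
        using M1[OF t] M2[OF t] \<alpha> by (intro add_mono mult_left_mono) auto
      finally show ?thesis .
    qed
    then show ?thesis by blast
  qed
  obtain M1 where M1: "\<And>t. t > 0 \<Longrightarrow> t powr 1 * \<bar>mittag_leffler \<alpha> 1 (- (t powr \<alpha>))\<bar> \<le> M1"
    using scaled[of 1] \<alpha> by auto
  obtain M2 where M2: "\<And>t. t > 0 \<Longrightarrow> \<bar>gamma_series ?a \<alpha> 2 t\<bar> \<le> M2" using A[of 2] \<alpha> by auto
  obtain M3 where M3: "\<And>t. t > 0 \<Longrightarrow> \<bar>gamma_series ?b \<alpha> (\<alpha> + 1) t\<bar> \<le> M3" using B[of "\<alpha> + 1"] \<alpha> by auto
  obtain M4 where M4: "\<And>t. t > 0 \<Longrightarrow> t powr (\<alpha> - 1) * \<bar>mittag_leffler \<alpha> (\<alpha> - 1) (- (t powr \<alpha>))\<bar> \<le> M4"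
    using scaled[of "\<alpha> - 1"] \<alpha> by auto
  have near: "\<exists>M. \<forall>x\<in>{0..1}. \<bar>mittag_leffler \<alpha> \<beta> (- x)\<bar> \<le> M" if "\<beta> > 0" for \<beta>
  proof -
    have "continuous_on UNIV (mittag_leffler \<alpha> \<beta>)"
      using isCont_mittag_leffler[of \<alpha> \<beta>] \<alpha> that by (simp add: continuous_on_eq_continuous_at)
    then have "continuous_on {0..1} (\<lambda>x. mittag_leffler \<alpha> \<beta> (- x))"
      by (rule continuous_on_compose2) (auto intro!: continuous_intros)
    then have "compact ((\<lambda>x. mittag_leffler \<alpha> \<beta> (- x)) ` {0..1})" by (rule compact_continuous_image) simp
    then have "bounded ((\<lambda>x. mittag_leffler \<alpha> \<beta> (- x)) ` {0..1})" by (rule compact_imp_bounded)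
    then show ?thesis unfolding bounded_iff by auto
  qed
  obtain N1 where N1: "\<And>x. x \<in> {0..1} \<Longrightarrow> \<bar>mittag_leffler \<alpha> 1 (- x)\<bar> \<le> N1" using near[of 1] zero_less_one by blast
  obtain N2 where N2: "\<And>x. x \<in> {0..1} \<Longrightarrow> \<bar>mittag_leffler \<alpha> 2 (- x)\<bar> \<le> N2" using near[of 2] zero_less_numeral by blast
  obtain N3 where N3: "\<And>x. x \<in> {0..1} \<Longrightarrow> \<bar>mittag_leffler \<alpha> \<alpha> (- x)\<bar> \<le> N3" using near[of \<alpha>] \<alpha> by (meson less_trans zero_less_one)
  obtain N4 where N4: "\<And>x. x \<in> {0..1} \<Longrightarrow> \<bar>mittag_leffler \<alpha> (\<alpha> - 1) (- x)\<bar> \<le> N4" using near[of "\<alpha> - 1"] \<alpha> by (meson diff_gt_0_iff_gt)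
  \<comment> \<open>absolute values, so that \<open>C\<close> dominates each entry whatever its sign\<close>
  define C where "C = 1 + (\<Sum>v\<leftarrow>[M1, 2 * M2, 2 * \<alpha> * M3, M4, N1, 2 * N2, 2 * N3, N4]. \<bar>v\<bar>)"
  have Cge: "\<bar>v\<bar> \<le> C" if "v \<in> set [M1, 2 * M2, 2 * \<alpha> * M3, M4, N1, 2 * N2, 2 * N3, N4]" for v
  proof -
    have "\<bar>v\<bar> \<le> (\<Sum>v\<leftarrow>[M1, 2 * M2, 2 * \<alpha> * M3, M4, N1, 2 * N2, 2 * N3, N4]. \<bar>v\<bar>)"
      by (rule member_le_sum_list) (use that in auto)
    then show ?thesis by (simp add: C_def)
  qed
  have C0: "C > 0" unfolding C_def by (intro add_pos_nonneg sum_list_nonneg) auto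
  have sub: "\<exists>t\<ge>1. x = t powr \<alpha> \<and> x powr (1 / \<alpha>) = t" if "x > 1" for x
    using that \<alpha> by (intro exI[of _ "x powr (1 / \<alpha>)"]) (auto simp: powr_powr ge_one_powr_ge_zero)
  have c1: "\<bar>mittag_leffler \<alpha> 1 (- x)\<bar> \<le> C" if "x \<ge> 0" for x
  proof (cases "x \<le> 1")
    case True
    then show ?thesis using N1[of x] that Cge[of N1] by simp
  next
    case False
    then obtain t where t: "t \<ge> 1" "x = t powr \<alpha>" using sub[of x] by auto
    have "\<bar>mittag_leffler \<alpha> 1 (- x)\<bar> \<le> t powr 1 * \<bar>mittag_leffler \<alpha> 1 (- x)\<bar>" using t by (simp add: mult_le_cancel_right1)
    also have "\<dots> \<le> M1" unfolding t by (rule M1) (use t in simp)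
    finally show ?thesis using Cge[of M1] by simp
  qed
  have c2: "(1 + x powr (1 / \<alpha>)) * \<bar>mittag_leffler \<alpha> 2 (- x)\<bar> \<le> C" if "x \<ge> 0" for x
  proof (cases "x \<le> 1")
    case True
    have "x powr (1 / \<alpha>) \<le> 1" using True that \<alpha> by (intro powr_le1) auto
    then have "(1 + x powr (1 / \<alpha>)) * \<bar>mittag_leffler \<alpha> 2 (- x)\<bar> \<le> 2 * \<bar>N2\<bar>"
      using N2[of x] True that by (intro mult_mono) auto
    then show ?thesis using Cge[of "2 * N2"] by simp
  next
    case False
    then obtain t where t: "t \<ge> 1" "x = t powr \<alpha>" "x powr (1 / \<alpha>) = t" using sub[of x] by auto
    have "(1 + x powr (1 / \<alpha>)) * \<bar>mittag_leffler \<alpha> 2 (- x)\<bar> \<le> (2 * t) * \<bar>mittag_leffler \<alpha> 2 (- x)\<bar>"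
      unfolding t(3) using t by (intro mult_right_mono) auto
    also have "\<dots> = 2 * \<bar>gamma_series ?a \<alpha> 2 t\<bar>" unfolding t(2) using t(1) \<alpha> by (simp add: gamma_series_geometric abs_mult)
    also have "\<dots> \<le> 2 * M2" using M2[of t] t by simp
    finally show ?thesis using Cge[of "2 * M2"] by simp
  qed
  have c3: "(1 + x) * \<bar>mittag_leffler \<alpha> \<alpha> (- x)\<bar> \<le> C" if "x \<ge> 0" for x
  proof (cases "x \<le> 1")
    case True
    have "(1 + x) * \<bar>mittag_leffler \<alpha> \<alpha> (- x)\<bar> \<le> 2 * \<bar>N3\<bar>"
      using N3[of x] True that by (intro mult_mono) auto
    then show ?thesis using Cge[of "2 * N3"] by simp
  next
    case False
    then obtain t where t: "t \<ge> 1" "x = t powr \<alpha>" "x powr (1 / \<alpha>) = t" using sub[of x] by auto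
    have "(1 + x) * \<bar>mittag_leffler \<alpha> \<alpha> (- x)\<bar> \<le> (2 * x) * \<bar>mittag_leffler \<alpha> \<alpha> (- x)\<bar>"
      using False by (intro mult_right_mono) auto
    also have "\<dots> = 2 * \<bar>t * gamma_series ?a \<alpha> \<alpha> t\<bar>" unfolding t(2) using t(1) \<alpha>
      by (simp add: gamma_series_geometric abs_mult powr_diff)
    also have "t * gamma_series ?a \<alpha> \<alpha> t = \<alpha> * gamma_series ?b \<alpha> (\<alpha> + 1) t"
      using t \<alpha> by (subst gamma_series_shift) auto
    also have "2 * \<bar>\<alpha> * gamma_series ?b \<alpha> (\<alpha> + 1) t\<bar> \<le> 2 * (\<alpha> * M3)" using M3[of t] t \<alpha> by (simp add: abs_mult)
    also have "\<dots> = 2 * \<alpha> * M3" by simp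
    finally show ?thesis using Cge[of "2 * \<alpha> * M3"] by simp
  qed
  have c4: "\<bar>mittag_leffler \<alpha> (\<alpha> - 1) (- x)\<bar> \<le> C" if "x \<ge> 0" for x
  proof (cases "x \<le> 1")
    case True
    then show ?thesis using N4[of x] that Cge[of N4] by simp
  next
    case False
    then obtain t where t: "t \<ge> 1" "x = t powr \<alpha>" using sub[of x] by auto
    have "t powr (\<alpha> - 1) \<ge> 1" using t \<alpha> by (intro ge_one_powr_ge_zero) auto
    then have "\<bar>mittag_leffler \<alpha> (\<alpha> - 1) (- x)\<bar> \<le> t powr (\<alpha> - 1) * \<bar>mittag_leffler \<alpha> (\<alpha> - 1) (- x)\<bar>" by (simp add: mult_le_cancel_right1)
    also have "\<dots> \<le> M4" unfolding t by (rule M4) (use t in simp)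
    finally show ?thesis using Cge[of M4] by simp
  qed
  show thesis by (rule that[OF C0 c1 c2 c3 c4])
qed

section \<open>Fractional integrals\<close>

lemma beta_integral:
  fixes a b t :: real
  assumes "a > 0" "b > 0" "t \<ge> 0"
  shows "((\<lambda>s. (t - s) powr (a - 1) * s powr (b - 1)) has_integral
           Gamma a * Gamma b / Gamma (a + b) * t powr (a + b - 1)) {0..t}"
proof (cases "t = 0")
  case True
  then show ?thesis using has_integral_refl(2)[of "\<lambda>s. (0 - s) powr (a - 1) * s powr (b - 1)" 0] by simp
next
  case False
  then have t: "t > 0" using assms by simp
  have B: "((\<lambda>u. u powr (b - 1) * (1 - u) powr (a - 1)) has_integral Beta b a) (cbox 0 1)"
    using has_integral_Beta_real[of b a] assms by simp
  have "((\<lambda>s. (1 / t * s) powr (b - 1) * (1 - 1 / t * s) powr (a - 1)) has_integral t * Beta b a) ((\<lambda>x. t * x) ` {0..1})"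
    using has_integral_affinity[OF B, of "1 / t" 0] t by simp
  also have "(\<lambda>x. t * x) ` {0..1} = {0..t}" using t by (auto simp: image_mult_atLeastAtMost)
  finally have h: "((\<lambda>s. t powr (a + b - 2) * ((1 / t * s) powr (b - 1) * (1 - 1 / t * s) powr (a - 1))) has_integral
      t powr (a + b - 2) * (t * Beta b a)) {0..t}" by (rule has_integral_mult_right)
  have eq: "t powr (a + b - 2) * ((1 / t * s) powr (b - 1) * (1 - 1 / t * s) powr (a - 1))
     = (t - s) powr (a - 1) * s powr (b - 1)" if "s \<in> {0..t}" for s
  proof -
    have "1 - 1 / t * s = (t - s) / t" using t by (simp add: field_simps)
    then have "(1 / t * s) powr (b - 1) * (1 - 1 / t * s) powr (a - 1)
        = s powr (b - 1) * (t - s) powr (a - 1) / (t powr (b - 1) * t powr (a - 1))"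
      using t that by (simp add: powr_divide)
    also have "t powr (b - 1) * t powr (a - 1) = t powr (a + b - 2)"
      by (simp add: powr_add[symmetric] algebra_simps)
    finally show ?thesis using t by simp
  qed
  have eq2: "t powr (a + b - 2) * (t * Beta b a) = Gamma a * Gamma b / Gamma (a + b) * t powr (a + b - 1)"
  proof -
    have "t powr (a + b - 2) * t = t powr (a + b - 1)" using t by (simp add: powr_diff power2_eq_square)
    then show ?thesis by (simp add: Beta_def add.commute mult.commute mult.left_commute)
  qed
  show ?thesis using has_integral_eq[OF eq h] unfolding eq2 .
qed

lemma continuous_on_powr_pos:
  fixes a :: real
  assumes "a > 0"
  shows "continuous_on {0..T} (\<lambda>s. s powr a)"
  using assms by (intro continuous_on_powr' continuous_intros) auto

text \<open>The Riemann--Liouville integral of order \<open>a\<close>.\<close>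

definition frac_int :: "real \<Rightarrow> (real \<Rightarrow> real) \<Rightarrow> real \<Rightarrow> real" where
  "frac_int a f t = 1 / Gamma a * (LINT s:{0..t}|lebesgue. (t - s) powr (a - 1) * f s)"

lemma frac_kernel:
  fixes a t :: real
  assumes "a > 0" "t \<ge> 0"
  shows "set_integrable lebesgue {0..t} (\<lambda>s. (t - s) powr (a - 1))"
    and "(LINT s:{0..t}|lebesgue. (t - s) powr (a - 1)) = t powr a / a"
proof -
  have a0: "a \<notin> \<int>\<^sub>\<le>\<^sub>0" using assms by (auto elim!: nonpos_Ints_cases)
  have "Gamma (a + 1) = a * Gamma a" using Gamma_plus1[OF a0] .
  then have "Gamma a * Gamma 1 / Gamma (a + 1) * t powr (a + 1 - 1) = t powr a / a"
    using assms Gamma_real_pos[OF assms(1)] by (simp del: Gamma_real_pos)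
  then have "((\<lambda>s. (t - s) powr (a - 1) * s powr (1 - 1)) has_integral t powr a / a) {0..t}"
    using beta_integral[of a 1 t] assms by simp
  then have h: "((\<lambda>s. (t - s) powr (a - 1)) has_integral t powr a / a) {0..t}"
    by (rule has_integral_spike_finite[of "{0}", rotated 2]) auto
  then show i: "set_integrable lebesgue {0..t} (\<lambda>s. (t - s) powr (a - 1))"
    by (intro nonnegative_absolutely_integrable_1) (auto simp: integrable_on_def)
  show "(LINT s:{0..t}|lebesgue. (t - s) powr (a - 1)) = t powr a / a"
    using set_lebesgue_integral_eq_integral(2)[OF i] h by (simp add: integral_unique)
qed

lemma continuous_image_bounded:
  fixes f :: "real \<Rightarrow> real"
  assumes "continuous_on {0..T} f"
  obtains B where "B > 0" "\<And>s. s \<in> {0..T} \<Longrightarrow> \<bar>f s\<bar> \<le> B"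
proof -
  have "bounded (f ` {0..T})" by (intro compact_imp_bounded compact_continuous_image assms compact_Icc)
  then show thesis unfolding bounded_pos using that by auto
qed

lemma frac_integrand_integrable:
  fixes a t :: real and f :: "real \<Rightarrow> real"
  assumes "a > 0" "t \<ge> 0" "continuous_on {0..t} f"
  shows "set_integrable lebesgue {0..t} (\<lambda>s. (t - s) powr (a - 1) * f s)"
proof -
  have "(\<lambda>s. f s * (t - s) powr (a - 1)) absolutely_integrable_on {0..t}"
  proof (rule absolutely_integrable_bounded_measurable_product_real)
    show "f \<in> borel_measurable (lebesgue_on {0..t})"
      by (intro continuous_imp_measurable_on_sets_lebesgue assms) auto
    show "bounded (f ` {0..t})" by (intro compact_imp_bounded compact_continuous_image assms compact_Icc)
  qed (use frac_kernel(1)[OF assms(1,2)] in auto)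
  moreover have "(\<lambda>s. f s * (t - s) powr (a - 1)) = (\<lambda>s. (t - s) powr (a - 1) * f s)" by (simp add: mult.commute)
  ultimately show ?thesis by simp
qed

lemma frac_int_cong:
  assumes "\<And>s. s \<in> {0..t} \<Longrightarrow> f s = g s"
  shows "frac_int a f t = frac_int a g t"
  unfolding frac_int_def using assms by (intro arg_cong2[of _ _ _ _ "(*)"] refl set_lebesgue_integral_cong) auto

lemma frac_int_cmult: "frac_int a (\<lambda>s. c * f s) t = c * frac_int a f t"
  unfolding frac_int_def by (simp add: mult.left_commute)

lemma frac_int_add:
  assumes "a > 0" "t \<ge> 0" "continuous_on {0..t} f" "continuous_on {0..t} g"
  shows "frac_int a (\<lambda>s. f s + g s) t = frac_int a f t + frac_int a g t"
  unfolding frac_int_def using assms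
  by (simp add: distrib_left set_integral_add frac_integrand_integrable)

lemma frac_int_diff:
  assumes "a > 0" "t \<ge> 0" "continuous_on {0..t} f" "continuous_on {0..t} g"
  shows "frac_int a (\<lambda>s. f s - g s) t = frac_int a f t - frac_int a g t"
  unfolding frac_int_def using assms
  by (simp add: right_diff_distrib set_integral_diff frac_integrand_integrable)

lemma frac_int_sum:
  assumes "a > 0" "t \<ge> 0" "\<And>i. i \<in> I \<Longrightarrow> continuous_on {0..t} (f i)"
  shows "frac_int a (\<lambda>s. \<Sum>i\<in>I. f i s) t = (\<Sum>i\<in>I. frac_int a (f i) t)"
  using assms(3)
proof (induction I rule: infinite_finite_induct)
  case (insert i I)
  then show ?case using assms(1,2) by (simp add: frac_int_add continuous_on_sum)
qed (auto simp: frac_int_def)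

lemma frac_int_bound:
  assumes "a > 0" "t \<ge> 0" "continuous_on {0..t} f" "\<And>s. s \<in> {0..t} \<Longrightarrow> \<bar>f s\<bar> \<le> B"
  shows "\<bar>frac_int a f t\<bar> \<le> B * t powr a / Gamma (a + 1)"
proof -
  have a0: "a \<notin> \<int>\<^sub>\<le>\<^sub>0" using assms by (auto elim!: nonpos_Ints_cases)
  have G: "Gamma a > 0" "Gamma (a + 1) = a * Gamma a" using assms Gamma_plus1[OF a0] by auto
  note i = frac_integrand_integrable[OF assms(1-3)]
  have "\<bar>LINT s:{0..t}|lebesgue. (t - s) powr (a - 1) * f s\<bar> \<le> (LINT s:{0..t}|lebesgue. norm ((t - s) powr (a - 1) * f s))"
    using set_integral_norm_bound[OF i] by simp
  also have "\<dots> \<le> (LINT s:{0..t}|lebesgue. B * (t - s) powr (a - 1))"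
  proof (rule set_integral_mono)
    show "set_integrable lebesgue {0..t} (\<lambda>s. norm ((t - s) powr (a - 1) * f s))" using i by (rule set_integrable_norm)
    show "set_integrable lebesgue {0..t} (\<lambda>s. B * (t - s) powr (a - 1))"
      using frac_kernel(1)[OF assms(1,2)] by simp
    fix s assume "s \<in> {0..t}"
    then show "norm ((t - s) powr (a - 1) * f s) \<le> B * (t - s) powr (a - 1)"
      using assms(4)[of s] by (simp add: abs_mult mult.commute[of B] mult_left_mono)
  qed
  also have "\<dots> = B * (t powr a / a)" using frac_kernel(2)[OF assms(1,2)] by simp
  finally have "\<bar>LINT s:{0..t}|lebesgue. (t - s) powr (a - 1) * f s\<bar> \<le> B * (t powr a / a)" .
  then have "1 / Gamma a * \<bar>LINT s:{0..t}|lebesgue. (t - s) powr (a - 1) * f s\<bar> \<le> 1 / Gamma a * (B * (t powr a / a))"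
    using G(1) by (intro mult_left_mono) auto
  then show ?thesis unfolding frac_int_def G(2) using G(1) by (simp add: abs_mult mult.commute)
qed

lemma frac_int_powr:
  assumes "a > 0" "b > 0" "t \<ge> 0"
  shows "frac_int a (\<lambda>s. s powr (b - 1)) t = Gamma b / Gamma (a + b) * t powr (a + b - 1)"
proof -
  have h: "((\<lambda>s. (t - s) powr (a - 1) * s powr (b - 1)) has_integral
           Gamma a * Gamma b / Gamma (a + b) * t powr (a + b - 1)) {0..t}"
    by (rule beta_integral[OF assms])
  then have i: "set_integrable lebesgue {0..t} (\<lambda>s. (t - s) powr (a - 1) * s powr (b - 1))"
    by (intro nonnegative_absolutely_integrable_1) (auto simp: integrable_on_def)
  have "Gamma a > 0" using assms by simp
  then show ?thesis unfolding frac_int_def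
    using set_lebesgue_integral_eq_integral(2)[OF i] integral_unique[OF h] by simp
qed

lemma frac_int_monom:
  assumes "a > 0" "t \<ge> 0"
  shows "frac_int a (\<lambda>s. s ^ k) t = fact k / Gamma (a + real k + 1) * t powr (a + real k)"
proof -
  have "frac_int a (\<lambda>s. s ^ k) t = frac_int a (\<lambda>s. s powr ((real k + 1) - 1)) t"
    unfolding frac_int_def
  proof (intro arg_cong2[of _ _ _ _ "(*)"] refl set_lebesgue_integral_cong_AE)
    have "AE s in lebesgue. s \<noteq> (0::real)" by (rule AE_completion) (rule AE_lborel_singleton)
    then show "AE s in lebesgue. s \<in> {0..t} \<longrightarrow> (t - s) powr (a - 1) * s ^ k = (t - s) powr (a - 1) * s powr (real k + 1 - 1)"
      by eventually_elim (auto simp: powr_realpow)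
  qed (auto intro!: measurable_completion)
  also have "frac_int a (\<lambda>s. s powr ((real k + 1) - 1)) t = Gamma (real k + 1) / Gamma (a + (real k + 1)) * t powr (a + (real k + 1) - 1)"
    by (rule frac_int_powr) (use assms in auto)
  finally have "frac_int a (\<lambda>s. s ^ k) t = Gamma (real k + 1) / Gamma (a + (real k + 1)) * t powr (a + (real k + 1) - 1)" .
  moreover have "Gamma (real k + 1) = fact k" by (metis Gamma_fact add.commute)
  ultimately show ?thesis by (simp add: add.assoc)
qed

lemma near_polynomial:
  fixes f :: "real \<Rightarrow> real"
  assumes "continuous_on {0..T} f" "e > 0"
  obtains c n where "\<And>s. s \<in> {0..T} \<Longrightarrow> \<bar>f s - (\<Sum>i\<le>n. c i * s ^ i)\<bar> \<le> e"
proof -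
  obtain g where g: "real_polynomial_function g" "\<And>x. x \<in> {0..T} \<Longrightarrow> \<bar>f x - g x\<bar> < e"
    using Stone_Weierstrass_real_polynomial_function[OF _ assms] by auto
  obtain c n where "g = (\<lambda>x. \<Sum>i\<le>n. c i * x ^ i)" using g(1) real_polynomial_function_iff_sum by auto
  then show thesis using g(2) that[of c n] by (auto intro: less_imp_le)
qed

text \<open>For monomials the fractional integral is a power of \<open>t\<close>; continuous functions follow by uniform
approximation, because the integral is bounded in the uniform norm.\<close>

lemma continuous_on_frac_int:
  assumes a: "a > 0" and f: "continuous_on {0..T} f"
  shows "continuous_on {0..T} (frac_int a f)"
proof (cases "T \<ge> 0")
  case False
  then show ?thesis by simp
next
  case T: True
  have "\<exists>g. continuous_on {0..T} g \<and> (\<forall>t\<in>{0..T}. dist (g t) (frac_int a f t) < e)" if e: "e > 0" for e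
  proof -
    define M where "M = T powr a / Gamma (a + 1)"
    have M: "M \<ge> 0" unfolding M_def using a by simp
    obtain c n where p: "\<And>s. s \<in> {0..T} \<Longrightarrow> \<bar>f s - (\<Sum>i\<le>n. c i * s ^ i)\<bar> \<le> e / (M + 1)"
      using near_polynomial[OF f, of "e / (M + 1)"] e M by auto
    define P where "P s = (\<Sum>i\<le>n. c i * s ^ i)" for s :: real
    have Pc: "continuous_on A P" for A unfolding P_def by (intro continuous_intros)
    \<comment> \<open>the fractional integral of the polynomial \<open>P\<close>\<close>
    define g where "g t = (\<Sum>i\<le>n. c i * (fact i / Gamma (a + real i + 1) * t powr (a + real i)))" for t
    have gP: "frac_int a P t = g t" if "t \<ge> 0" for t
      unfolding P_def g_def using a that
      by (subst frac_int_sum) (auto intro!: continuous_intros sum.cong simp: frac_int_cmult frac_int_monom)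
    have "continuous_on {0..T} g" unfolding g_def using a
      by (intro continuous_on_sum continuous_on_mult_left continuous_on_powr_pos) auto
    moreover have "dist (g t) (frac_int a f t) < e" if t: "t \<in> {0..T}" for t
    proof -
      have fc: "continuous_on {0..t} f" using f t by (auto intro: continuous_on_subset)
      have "\<bar>frac_int a (\<lambda>s. f s - P s) t\<bar> \<le> e / (M + 1) * t powr a / Gamma (a + 1)"
        by (rule frac_int_bound) (use a t p fc Pc in \<open>auto intro!: continuous_intros simp: P_def\<close>)
      also have "\<dots> \<le> e / (M + 1) * T powr a / Gamma (a + 1)"
        using a t e M by (intro divide_right_mono mult_left_mono powr_mono2) auto
      also have "\<dots> = e * (M / (M + 1))" by (simp add: M_def)
      also have "\<dots> < e * 1" using e M by (intro mult_strict_left_mono) auto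
      also have "frac_int a (\<lambda>s. f s - P s) t = frac_int a f t - g t"
        using a t fc Pc gP by (subst frac_int_diff) auto
      finally show ?thesis by (simp add: dist_real_def abs_minus_commute)
    qed
    ultimately show ?thesis by blast
  qed
  then have "\<forall>n::nat. \<exists>g. continuous_on {0..T} g \<and> (\<forall>t\<in>{0..T}. dist (g t) (frac_int a f t) < 1 / (real n + 1))"
    by simp
  then obtain g where g: "\<And>n::nat. continuous_on {0..T} (g n)"
     "\<And>n t. t \<in> {0..T} \<Longrightarrow> dist (g n t) (frac_int a f t) < 1 / (real n + 1)" by metis
  have "uniform_limit {0..T} g (frac_int a f) sequentially"
  proof (rule uniform_limitI)
    fix e :: real assume "e > 0"
    have "(\<lambda>n. 1 / (real n + 1)) \<longlonglongrightarrow> 0" by real_asymp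
    then have "eventually (\<lambda>n. 1 / (real n + 1) < e) sequentially" using \<open>e > 0\<close> by (rule order_tendstoD)
    then show "\<forall>\<^sub>F n in sequentially. \<forall>t\<in>{0..T}. dist (g n t) (frac_int a f t) < e"
      by eventually_elim (use g(2) in \<open>meson less_trans\<close>)
  qed
  then show ?thesis by (rule uniform_limit_theorem[rotated]) (use g(1) in auto)
qed

text \<open>The semigroup law.  On monomials it is the Beta integral, and both sides are continuous in the uniform norm of
\<open>f\<close>.\<close>

lemma frac_int_frac_int:
  assumes a: "a > 0" and b: "b > 0" and f: "continuous_on {0..t} f" and t: "t \<ge> 0"
  shows "frac_int a (frac_int b f) t = frac_int (a + b) f t"
proof -
  \<comment> \<open>the sum of the operator norms of the two sides on \<open>{0..t}\<close>\<close>
  define M where "M = t powr b / Gamma (b + 1) * t powr a / Gamma (a + 1) + t powr (a + b) / Gamma (a + b + 1)"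
  have M: "M \<ge> 0" unfolding M_def using a b by (intro add_nonneg_nonneg) auto
  have "\<bar>frac_int a (frac_int b f) t - frac_int (a + b) f t\<bar> \<le> 0 + e" if e: "e > 0" for e
  proof -
    define d where "d = e / (M + 1)"
    have d: "d > 0" using e M by (simp add: d_def)
    obtain c n where p: "\<And>s. s \<in> {0..t} \<Longrightarrow> \<bar>f s - (\<Sum>i\<le>n. c i * s ^ i)\<bar> \<le> d"
      using near_polynomial[OF f d] by auto
    define P where "P s = (\<Sum>i\<le>n. c i * s ^ i)" for s :: real
    have Pc: "continuous_on A P" for A unfolding P_def by (intro continuous_intros)
    have P1: "frac_int b P s = (\<Sum>i\<le>n. c i * (fact i / Gamma (b + real i + 1) * s powr (b + real i)))" if "s \<ge> 0" for s
      unfolding P_def using b that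
      by (subst frac_int_sum) (auto intro!: continuous_intros sum.cong simp: frac_int_cmult frac_int_monom)
    have P2: "frac_int a (frac_int b P) t = frac_int (a + b) P t"
    proof -
      have "frac_int a (frac_int b P) t = frac_int a (\<lambda>s. \<Sum>i\<le>n. c i * (fact i / Gamma (b + real i + 1) * s powr (b + real i))) t"
        by (rule frac_int_cong) (simp add: P1)
      also have "\<dots> = (\<Sum>i\<le>n. c i * (fact i / Gamma (b + real i + 1) * frac_int a (\<lambda>s. s powr ((b + real i + 1) - 1)) t))"
        using a b t by (subst frac_int_sum)
          (auto intro!: continuous_on_mult_left continuous_on_powr_pos sum.cong simp: frac_int_cmult simp del: times_divide_eq_left times_divide_eq_right)
      also have "\<dots> = (\<Sum>i\<le>n. c i * (fact i / Gamma (a + b + real i + 1) * t powr (a + b + real i)))"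
      proof (rule sum.cong[OF refl])
        fix i
        have G: "Gamma (b + real i + 1) > 0" using b by simp
        have "frac_int a (\<lambda>s. s powr ((b + real i + 1) - 1)) t = 
          Gamma (b + real i + 1) / Gamma (a + (b + real i + 1)) * t powr (a + (b + real i + 1) - 1)"
          by (rule frac_int_powr) (use a b t in auto)
        then show "c i * (fact i / Gamma (b + real i + 1) * frac_int a (\<lambda>s. s powr ((b + real i + 1) - 1)) t) =
          c i * (fact i / Gamma (a + b + real i + 1) * t powr (a + b + real i))"
          using G by (simp add: add.assoc)
      qed
      also have "\<dots> = frac_int (a + b) P t"
        unfolding P_def using a b t
        by (subst frac_int_sum) (auto intro!: continuous_intros sum.cong simp: frac_int_cmult frac_int_monom)
      finally show ?thesis .
    qed
    have fPc: "continuous_on {0..s} (\<lambda>s. f s - P s)" if "s \<le> t" for s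
      using that by (intro continuous_intros Pc continuous_on_subset[OF f]) auto
    have e1: "\<bar>frac_int b (\<lambda>s. f s - P s) s\<bar> \<le> d * (t powr b / Gamma (b + 1))" if "s \<in> {0..t}" for s
    proof -
      have "\<bar>frac_int b (\<lambda>s. f s - P s) s\<bar> \<le> d * s powr b / Gamma (b + 1)"
        by (rule frac_int_bound) (use b that p fPc in \<open>auto simp: P_def\<close>)
      also have "\<dots> \<le> d * t powr b / Gamma (b + 1)"
        using b that d by (intro divide_right_mono mult_left_mono powr_mono2) auto
      finally show ?thesis by simp
    qed
    have e2: "\<bar>frac_int a (frac_int b (\<lambda>s. f s - P s)) t\<bar> \<le> d * (t powr b / Gamma (b + 1)) * t powr a / Gamma (a + 1)"
      by (rule frac_int_bound) (use a b t e1 fPc[of t] in \<open>auto intro!: continuous_on_frac_int\<close>)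
    have e3: "\<bar>frac_int (a + b) (\<lambda>s. f s - P s) t\<bar> \<le> d * t powr (a + b) / Gamma (a + b + 1)"
      by (rule frac_int_bound) (use a b t p fPc[of t] in \<open>auto simp: P_def\<close>)
    have "frac_int a (frac_int b (\<lambda>s. f s - P s)) t = frac_int a (\<lambda>s. frac_int b f s - frac_int b P s) t"
      by (rule frac_int_cong) (use b in \<open>auto intro!: frac_int_diff Pc continuous_on_subset[OF f]\<close>)
    also have "\<dots> = frac_int a (frac_int b f) t - frac_int a (frac_int b P) t"
      using a b t f Pc by (intro frac_int_diff continuous_on_frac_int) auto
    also have "frac_int a (frac_int b P) t = frac_int (a + b) f t - frac_int (a + b) (\<lambda>s. f s - P s) t"
      unfolding P2 using a b t f Pc by (subst frac_int_diff) auto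
    finally have "\<bar>frac_int a (frac_int b f) t - frac_int (a + b) f t\<bar> \<le>
      d * (t powr b / Gamma (b + 1)) * t powr a / Gamma (a + 1) + d * t powr (a + b) / Gamma (a + b + 1)"
      using e2 e3 by linarith
    also have "\<dots> = d * M" unfolding M_def by (simp add: distrib_left)
    also have "\<dots> = e * (M / (M + 1))" by (simp add: d_def)
    also have "\<dots> \<le> e * 1" using e M by (intro mult_left_mono) auto
    finally show ?thesis by simp
  qed
  then have "\<bar>frac_int a (frac_int b f) t - frac_int (a + b) f t\<bar> \<le> 0" by (rule field_le_epsilon)
  then show ?thesis by simp
qed

lemma frac_int_1:
  assumes "t \<ge> 0" "continuous_on {0..t} f"
  shows "frac_int 1 f t = integral {0..t} f"
proof -
  have "(LINT s:{0..t}|lebesgue. (t - s) powr (1 - 1) * f s) = integral {0..t} (\<lambda>s. (t - s) powr (1 - 1) * f s)"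
    by (rule set_lebesgue_integral_eq_integral(2)[OF frac_integrand_integrable]) (use assms in auto)
  also have "\<dots> = integral {0..t} f"
    by (rule integral_spike[of "{t}"]) auto
  finally show ?thesis by (simp add: frac_int_def)
qed

lemma frac_int_1_has_derivative:
  assumes "continuous_on {0..T} f" "t \<in> {0..T}"
  shows "(frac_int 1 f has_real_derivative f t) (at t within {0..T})"
proof -
  have "((\<lambda>u. integral {0..u} f) has_real_derivative f t) (at t within {0..T})"
    by (rule integral_has_real_derivative[OF assms])
  then show ?thesis
  proof (rule has_field_derivative_transform_within[OF _ zero_less_one assms(2)])
    fix x assume "x \<in> {0..T}"
    then show "integral {0..x} f = frac_int 1 f x"
      using assms(1) by (intro frac_int_1[symmetric]) (auto intro: continuous_on_subset)
  qed
qed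

lemma eq_frac_int_1_of_derivative:
  assumes "\<And>t. t \<in> {0..T} \<Longrightarrow> (g has_real_derivative f t) (at t within {0..T})"
    and f: "continuous_on {0..T} f" and "g 0 = 0" "t \<in> {0..T}"
  shows "g t = frac_int 1 f t"
proof -
  have "(f has_integral g t - g 0) {0..t}"
  proof (rule fundamental_theorem_of_calculus)
    fix x assume "x \<in> {0..t}"
    then have "(g has_real_derivative f x) (at x within {0..t})"
      using assms(1)[of x] assms(4) by (auto intro: DERIV_subset)
    then show "(g has_vector_derivative f x) (at x within {0..t})"
      by (simp add: has_real_derivative_iff_has_vector_derivative)
  qed (use assms in auto)
  then show ?thesis using assms by (subst frac_int_1) (auto intro: continuous_on_subset simp: integral_unique)
qed

lemma frac_int_1_inject:
  assumes T: "T > 0" and "continuous_on {0..T} f" "continuous_on {0..T} g"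
    and eq: "\<And>t. t \<in> {0..T} \<Longrightarrow> frac_int 1 f t = frac_int 1 g t" and t: "t \<in> {0..T}"
  shows "f t = g t"
proof -
  have "(frac_int 1 f has_real_derivative f t) (at t within {0..T})"
    by (rule frac_int_1_has_derivative) (use assms in auto)
  moreover have "(frac_int 1 g has_real_derivative g t) (at t within {0..T})"
    by (rule frac_int_1_has_derivative) (use assms in auto)
  then have "(frac_int 1 f has_real_derivative g t) (at t within {0..T})"
    by (rule has_field_derivative_transform_within[OF _ zero_less_one t]) (use eq in auto)
  moreover have "at t within {0..T} \<noteq> bot"
    using T t by (simp add: trivial_limit_within islimpt_Icc)
  ultimately show ?thesis
    unfolding has_real_derivative_iff_has_vector_derivative
    by (intro vector_derivative_unique_within)
qed


lemma frac_int_commute: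
  assumes "a > 0" "b > 0" "0 \<le> t" "t \<le> T" "continuous_on {0..T} f"
  shows "frac_int a (frac_int b f) t = frac_int b (frac_int a f) t"
proof -
  have "continuous_on {0..t} f" using assms by (auto intro: continuous_on_subset)
  then show ?thesis using assms by (simp add: frac_int_frac_int add.commute)
qed

section \<open>The scalar fractional equation\<close>

lemma powr_mult_add: "t \<ge> 0 \<Longrightarrow> t powr (\<alpha> * real j + \<beta>) = t powr \<beta> * (t powr \<alpha>) ^ j" for t :: real
  by (cases "t = 0") (auto simp: powr_powr powr_add[symmetric] algebra_simps simp flip: powr_realpow)

text \<open>Iterating the equation expresses \<open>z\<close> by arbitrarily high fractional integrals of itself.  These
are bounded by the terms of a convergent Mittag-Leffler series, which tend to \<open>0\<close>.\<close>

lemma volterra_homogeneous_zero: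
  assumes \<alpha>: "\<alpha> \<ge> 1" and z: "continuous_on {0..T} z"
    and eq: "\<And>t. t \<in> {0..T} \<Longrightarrow> z t = - l * frac_int \<alpha> z t" and t: "t \<in> {0..T}"
  shows "z t = 0"
proof -
  obtain B where B: "\<And>s. s \<in> {0..T} \<Longrightarrow> \<bar>z s\<bar> \<le> B" using continuous_image_bounded[OF z] by blast
  have zc: "continuous_on {0..s} z" if "s \<in> {0..T}" for s using z that by (auto intro: continuous_on_subset)
  have it: "\<forall>s\<in>{0..T}. z s = (- l) ^ Suc n * frac_int (\<alpha> * real (Suc n)) z s" for n
  proof (induction n)
    case (Suc n)
    show ?case
    proof
      fix s assume s: "s \<in> {0..T}"
      have "z s = - l * frac_int \<alpha> z s" by (rule eq[OF s])
      also have "frac_int \<alpha> z s = frac_int \<alpha> (\<lambda>r. (- l) ^ Suc n * frac_int (\<alpha> * real (Suc n)) z r) s"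
        by (rule frac_int_cong) (use Suc s in auto)
      also have "\<dots> = (- l) ^ Suc n * frac_int (\<alpha> + \<alpha> * real (Suc n)) z s"
        using \<alpha> s zc by (subst frac_int_cmult, subst frac_int_frac_int) auto
      finally show "z s = (- l) ^ Suc (Suc n) * frac_int (\<alpha> * real (Suc (Suc n))) z s"
        by (simp add: algebra_simps)
    qed
  qed (use eq in simp)
  define y where "y = \<bar>l\<bar> * t powr \<alpha>"
  have bd: "\<bar>z t\<bar> \<le> B * (y ^ Suc n / Gamma (\<alpha> * real (Suc n) + 1))" for n
  proof -
    have "\<bar>z t\<bar> = \<bar>l\<bar> ^ Suc n * \<bar>frac_int (\<alpha> * real (Suc n)) z t\<bar>"
      using it[of n] t by (metis abs_minus abs_mult power_abs)
    also have "\<dots> \<le> \<bar>l\<bar> ^ Suc n * (B * t powr (\<alpha> * real (Suc n)) / Gamma (\<alpha> * real (Suc n) + 1))"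
      using \<alpha> t B by (intro mult_left_mono frac_int_bound zc) auto
    also have "t powr (\<alpha> * real (Suc n)) = (t powr \<alpha>) ^ Suc n"
      using powr_mult_add[of t \<alpha> "Suc n" 0] t \<alpha> by (cases "t = 0") auto
    also have "\<bar>l\<bar> ^ Suc n * (B * (t powr \<alpha>) ^ Suc n / Gamma (\<alpha> * real (Suc n) + 1)) = B * (y ^ Suc n / Gamma (\<alpha> * real (Suc n) + 1))"
      by (simp add: y_def power_mult_distrib)
    finally show ?thesis .
  qed
  have "(\<lambda>n. y ^ n / Gamma (\<alpha> * real n + 1)) \<longlonglongrightarrow> 0"
    by (rule summable_LIMSEQ_zero[OF mittag_leffler_summable[OF \<alpha>]]) simp
  then have "(\<lambda>n. B * (y ^ Suc n / Gamma (\<alpha> * real (Suc n) + 1))) \<longlonglongrightarrow> B * 0"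
    by (intro tendsto_intros LIMSEQ_Suc)
  then have "\<bar>z t\<bar> \<le> B * 0" by (rule LIMSEQ_le_const) (use bd in blast)
  then show ?thesis by simp
qed

text \<open>Here \<open>y\<close> stands for a function minus its initial value and its initial slope times
\<open>s\<close>, so that \<open>w\<close> is its Caputo derivative in the weak form.  The bound
\<open>small\<close> makes both constants of integration vanish: the fractional integral of order
\<open>2 - \<alpha>\<close> of \<open>y\<close> is the second antiderivative of \<open>w\<close> that is
\<open>0\<close> to first order at \<open>0\<close>.  Applying the integral of order \<open>\<alpha>\<close>
to both sides turns this into the equality of the second antiderivatives of \<open>y\<close> and of
\<open>frac_int \<alpha> w\<close>.\<close>

lemma caputo_imp_volterra:
  assumes \<alpha>: "1 < \<alpha>" "\<alpha> < 2" and T: "T > 0"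
    and y: "continuous_on {0..T} y" and w: "continuous_on {0..T} w"
    and J: "\<And>t. t \<in> {0..T} \<Longrightarrow> (frac_int (2 - \<alpha>) y has_real_derivative j t) (at t within {0..T})"
    and j: "\<And>t. t \<in> {0..T} \<Longrightarrow> (j has_real_derivative w t) (at t within {0..T})"
    and small: "\<And>s. s \<in> {0..T} \<Longrightarrow> \<bar>y s\<bar> \<le> M * s"
    and t: "t \<in> {0..T}"
  shows "y t = frac_int \<alpha> w t"
proof -
  have jc: "continuous_on {0..T} j" using j by (rule DERIV_continuous_on)
  have yc: "continuous_on {0..s} y" if "s \<in> {0..T}" for s using y that by (auto intro: continuous_on_subset)
  have wc: "continuous_on {0..s} w" if "s \<in> {0..T}" for s using w that by (auto intro: continuous_on_subset)
  have J0: "frac_int (2 - \<alpha>) y 0 = 0"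
    using frac_int_bound[of "2 - \<alpha>" 0 y "M * 0"] \<alpha> T small[of 0] yc[of 0] by simp
  have Jb: "\<bar>frac_int (2 - \<alpha>) y s\<bar> \<le> s * (M * s powr (2 - \<alpha>) / Gamma (2 - \<alpha> + 1))" if s: "s \<in> {0..T}" for s
  proof -
    have M0: "M \<ge> 0" using small[of T] T by (smt (verit) atLeastAtMost_iff mult_neg_pos)
    have "\<bar>y r\<bar> \<le> M * s" if "r \<in> {0..s}" for r
      using small[of r] that s M0 by (smt (verit) atLeastAtMost_iff mult_left_mono)
    then have "\<bar>frac_int (2 - \<alpha>) y s\<bar> \<le> (M * s) * s powr (2 - \<alpha>) / Gamma (2 - \<alpha> + 1)"
      using \<alpha> s by (intro frac_int_bound yc) auto
    then show ?thesis by (simp add: mult.commute mult.left_commute)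
  qed
  \<comment> \<open>by \<open>Jb\<close> the difference quotient at \<open>0\<close> is of order
\<open>s powr (2 - \<alpha>)\<close>\<close>
  have j0: "j 0 = 0"
  proof -
    have "((\<lambda>s. (frac_int (2 - \<alpha>) y s - frac_int (2 - \<alpha>) y 0) / (s - 0)) \<longlongrightarrow> j 0) (at 0 within {0..T})"
      using J[of 0] T unfolding has_field_derivative_iff by simp
    moreover have "((\<lambda>s. (frac_int (2 - \<alpha>) y s - frac_int (2 - \<alpha>) y 0) / (s - 0)) \<longlongrightarrow> 0) (at 0 within {0..T})"
    proof (rule Lim_null_comparison)
      show "\<forall>\<^sub>F s in at 0 within {0..T}. norm ((frac_int (2 - \<alpha>) y s - frac_int (2 - \<alpha>) y 0) / (s - 0))
          \<le> M * s powr (2 - \<alpha>) / Gamma (2 - \<alpha> + 1)"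
      proof (subst eventually_at_filter, intro always_eventually allI impI)
        fix s :: real assume "s \<noteq> 0" "s \<in> {0..T}"
        then show "norm ((frac_int (2 - \<alpha>) y s - frac_int (2 - \<alpha>) y 0) / (s - 0)) \<le> M * s powr (2 - \<alpha>) / Gamma (2 - \<alpha> + 1)"
          using Jb[of s] J0 by (simp add: abs_divide divide_le_eq mult.commute)
      qed
      have "continuous_on {0..T} (\<lambda>s. M / Gamma (2 - \<alpha> + 1) * s powr (2 - \<alpha>))"
        using \<alpha> by (intro continuous_on_mult_left continuous_on_powr_pos) auto
      then have "((\<lambda>s. M / Gamma (2 - \<alpha> + 1) * s powr (2 - \<alpha>)) \<longlongrightarrow> M / Gamma (2 - \<alpha> + 1) * 0 powr (2 - \<alpha>)) (at 0 within {0..T})"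
        unfolding continuous_on_def by (rule bspec) (use T in simp)
      then show "((\<lambda>s. M * s powr (2 - \<alpha>) / Gamma (2 - \<alpha> + 1)) \<longlongrightarrow> 0) (at 0 within {0..T})" by simp
    qed
    moreover have "at 0 within {0..T} \<noteq> bot" using T by (simp add: trivial_limit_within)
    ultimately show ?thesis by (rule tendsto_unique[rotated 1])
  qed
  have J2: "frac_int (2 - \<alpha>) y s = frac_int 2 w s" if s: "s \<in> {0..T}" for s
  proof -
    have "frac_int (2 - \<alpha>) y s = frac_int 1 j s" by (rule eq_frac_int_1_of_derivative[OF J jc J0 s])
    also have "\<dots> = frac_int 1 (frac_int 1 w) s"
      by (rule frac_int_cong) (use s in \<open>auto intro!: eq_frac_int_1_of_derivative[OF j w j0]\<close>)
    also have "\<dots> = frac_int 2 w s" using s wc by (simp add: frac_int_frac_int)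
    finally show ?thesis .
  qed
  have e2: "frac_int 1 (frac_int 1 y) s = frac_int 1 (frac_int 1 (frac_int \<alpha> w)) s" if s: "s \<in> {0..T}" for s
  proof -
    have "frac_int 1 (frac_int 1 y) s = frac_int \<alpha> (frac_int (2 - \<alpha>) y) s"
      using \<alpha> s yc by (simp add: frac_int_frac_int)
    also have "\<dots> = frac_int \<alpha> (frac_int 2 w) s" by (rule frac_int_cong) (use s J2 in auto)
    also have "\<dots> = frac_int 2 (frac_int \<alpha> w) s" using \<alpha> s w by (intro frac_int_commute) auto
    also have "\<dots> = frac_int 1 (frac_int 1 (frac_int \<alpha> w)) s"
      using \<alpha> s wc by (simp add: frac_int_frac_int continuous_on_frac_int)
    finally show ?thesis .
  qed
  have c: "continuous_on {0..T} (frac_int \<alpha> w)" using \<alpha> w by (intro continuous_on_frac_int) auto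
  have e1: "frac_int 1 y s = frac_int 1 (frac_int \<alpha> w) s" if s: "s \<in> {0..T}" for s
    by (rule frac_int_1_inject[OF T _ _ e2 s]) (use y c in \<open>auto intro!: continuous_on_frac_int\<close>)
  show ?thesis by (rule frac_int_1_inject[OF T y c e1 t])
qed

definition ml_conv :: "real \<Rightarrow> real \<Rightarrow> real \<Rightarrow> (real \<Rightarrow> real) \<Rightarrow> real \<Rightarrow> real" where
  "ml_conv \<alpha> l \<beta> h t = (LINT \<tau>:{0..t}|lebesgue.
     h \<tau> * (t - \<tau>) powr (\<beta> - 1) * mittag_leffler \<alpha> \<beta> (- l * (t - \<tau>) powr \<alpha>))"

text \<open>\<open>ml_conv \<alpha> l \<beta> h\<close> is the Neumann series for
\<open>I (1 + l J)\<^sup>-\<^sup>1 h\<close>, where \<open>I\<close> and \<open>J\<close> are the fractional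
integrals of orders \<open>\<beta>\<close> and \<open>\<alpha>\<close>.  This is how the Mittag-Leffler kernel
solves the Volterra equation; the rules below rearrange the series.\<close>

lemma ml_conv_sums:
  assumes \<alpha>: "\<alpha> \<ge> 1" and \<beta>: "\<beta> > 0" and t: "t \<ge> 0" and h: "continuous_on {0..t} h"
  shows "(\<lambda>j. (- l) ^ j * frac_int (\<alpha> * real j + \<beta>) h t) sums ml_conv \<alpha> l \<beta> h t"
proof -
  define f where "f j \<tau> = indicator {0..t} \<tau> *\<^sub>R ((- l) ^ j / Gamma (\<alpha> * real j + \<beta>) * ((t - \<tau>) powr ((\<alpha> * real j + \<beta>) - 1) * h \<tau>))" for j \<tau>
  have b: "\<alpha> * real j + \<beta> > 0" for j using \<alpha> \<beta> by (simp add: add_nonneg_pos)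
  have G: "Gamma (\<alpha> * real j + \<beta>) > 0" for j using b by simp
  obtain B where B: "B > 0" "\<And>s. s \<in> {0..t} \<Longrightarrow> \<bar>h s\<bar> \<le> B" using continuous_image_bounded[OF h] by blast
  note si = frac_integrand_integrable[OF b t h]
  have fi: "integrable lebesgue (f j)" for j
    using set_integrable_mult_right[OF si, of "(- l) ^ j / Gamma (\<alpha> * real j + \<beta>)" j] unfolding f_def set_integrable_def by simp
  have fI: "(LINT \<tau>|lebesgue. f j \<tau>) = (- l) ^ j * frac_int (\<alpha> * real j + \<beta>) h t" for j
    unfolding f_def frac_int_def set_lebesgue_integral_def[symmetric] by simp
  have sm: "summable (\<lambda>j. norm (f j \<tau>))" for \<tau>
  proof (cases "\<tau> \<in> {0..t}")
    case True
    have "norm (f j \<tau>) = norm ((t - \<tau>) powr (\<beta> - 1) * h \<tau>) * ((\<bar>l\<bar> * (t - \<tau>) powr \<alpha>) ^ j / Gamma (\<alpha> * real j + \<beta>))" for j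
    proof -
      have "(t - \<tau>) powr ((\<alpha> * real j + \<beta>) - 1) = (t - \<tau>) powr (\<beta> - 1) * ((t - \<tau>) powr \<alpha>) ^ j"
        using powr_mult_add[of "t - \<tau>" \<alpha> j "\<beta> - 1"] True unfolding add_diff_eq by simp
      then show ?thesis using True G[of j] by (simp add: f_def abs_mult power_abs power_mult_distrib)
    qed
    then show ?thesis using mittag_leffler_summable[OF \<alpha> \<beta>] by (simp only: summable_mult)
  qed (simp add: f_def)
  have sI: "summable (\<lambda>j. LINT \<tau>|lebesgue. norm (f j \<tau>))"
  proof (rule summable_comparison_test)
    show "summable (\<lambda>j. B * t powr \<beta> * ((\<bar>l\<bar> * t powr \<alpha>) ^ j / Gamma (\<alpha> * real j + (\<beta> + 1))))"
      using mittag_leffler_summable[OF \<alpha>, of "\<beta> + 1"] \<beta> by (intro summable_mult) auto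
    have "norm (LINT \<tau>|lebesgue. norm (f j \<tau>)) \<le> B * t powr \<beta> * ((\<bar>l\<bar> * t powr \<alpha>) ^ j / Gamma (\<alpha> * real j + (\<beta> + 1)))" for j
    proof -
      have "(LINT \<tau>|lebesgue. norm (f j \<tau>)) = \<bar>l\<bar> ^ j * frac_int (\<alpha> * real j + \<beta>) (\<lambda>\<tau>. \<bar>h \<tau>\<bar>) t"
      proof -
        have "norm (f j \<tau>) = indicator {0..t} \<tau> *\<^sub>R (\<bar>l\<bar> ^ j / Gamma (\<alpha> * real j + \<beta>) * ((t - \<tau>) powr ((\<alpha> * real j + \<beta>) - 1) * \<bar>h \<tau>\<bar>))" for \<tau>
          using G[of j] by (simp add: f_def abs_mult power_abs)
        then show ?thesis
          unfolding frac_int_def by (simp only: set_lebesgue_integral_def[symmetric] set_integral_mult_right) simp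
      qed
      also have "\<dots> \<le> \<bar>l\<bar> ^ j * (B * t powr (\<alpha> * real j + \<beta>) / Gamma (\<alpha> * real j + \<beta> + 1))"
      proof (rule mult_left_mono)
        have "\<bar>frac_int (\<alpha> * real j + \<beta>) (\<lambda>\<tau>. \<bar>h \<tau>\<bar>) t\<bar> \<le> B * t powr (\<alpha> * real j + \<beta>) / Gamma (\<alpha> * real j + \<beta> + 1)"
          by (rule frac_int_bound[OF b t]) (use B h in \<open>auto intro!: continuous_intros\<close>)
        then show "frac_int (\<alpha> * real j + \<beta>) (\<lambda>\<tau>. \<bar>h \<tau>\<bar>) t \<le> B * t powr (\<alpha> * real j + \<beta>) / Gamma (\<alpha> * real j + \<beta> + 1)" by linarith
      qed simp
      also have "\<dots> = B * t powr \<beta> * ((\<bar>l\<bar> * t powr \<alpha>) ^ j / Gamma (\<alpha> * real j + (\<beta> + 1)))"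
        using powr_mult_add[OF t, of \<alpha> j \<beta>] by (simp add: power_mult_distrib add.assoc)
      finally show ?thesis by (simp add: integral_nonneg_AE)
    qed
    then show "\<exists>N. \<forall>j\<ge>N. norm (LINT \<tau>|lebesgue. norm (f j \<tau>)) \<le> B * t powr \<beta> * ((\<bar>l\<bar> * t powr \<alpha>) ^ j / Gamma (\<alpha> * real j + (\<beta> + 1)))" by blast
  qed
  have sf: "(\<Sum>j. f j \<tau>) = indicator {0..t} \<tau> *\<^sub>R (h \<tau> * (t - \<tau>) powr (\<beta> - 1) * mittag_leffler \<alpha> \<beta> (- l * (t - \<tau>) powr \<alpha>))" for \<tau>
  proof (cases "\<tau> \<in> {0..t}")
    case True
    have "f j \<tau> = (h \<tau> * (t - \<tau>) powr (\<beta> - 1)) * ((- l * (t - \<tau>) powr \<alpha>) ^ j / Gamma (\<alpha> * real j + \<beta>))" for j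
    proof -
      have "(t - \<tau>) powr ((\<alpha> * real j + \<beta>) - 1) = (t - \<tau>) powr (\<beta> - 1) * ((t - \<tau>) powr \<alpha>) ^ j"
        using powr_mult_add[of "t - \<tau>" \<alpha> j "\<beta> - 1"] True unfolding add_diff_eq by simp
      then show ?thesis using True by (simp add: f_def power_mult_distrib[of "-l", simplified])
    qed
    then have "(\<Sum>j. f j \<tau>) = (\<Sum>j. (h \<tau> * (t - \<tau>) powr (\<beta> - 1)) * ((- l * (t - \<tau>) powr \<alpha>) ^ j / Gamma (\<alpha> * real j + \<beta>)))"
      by (rule suminf_cong)
    also have "\<dots> = (h \<tau> * (t - \<tau>) powr (\<beta> - 1)) * mittag_leffler \<alpha> \<beta> (- l * (t - \<tau>) powr \<alpha>)"
      unfolding mittag_leffler_def by (rule suminf_mult[OF mittag_leffler_summable[OF \<alpha> \<beta>]])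
    finally show ?thesis using True by simp
  qed (simp add: f_def)
  have "(\<lambda>j. LINT \<tau>|lebesgue. f j \<tau>) sums (LINT \<tau>|lebesgue. (\<Sum>j. f j \<tau>))"
    by (rule sums_integral[OF fi _ sI]) (intro always_eventually allI sm)
  then show ?thesis unfolding fI sf ml_conv_def set_lebesgue_integral_def .
qed

lemma ml_conv_uniform_limit:
  assumes \<alpha>: "\<alpha> \<ge> 1" and \<beta>: "\<beta> > 0" and h: "continuous_on {0..T} h"
  shows "uniform_limit {0..T} (\<lambda>n t. \<Sum>j<n. (- l) ^ j * frac_int (\<alpha> * real j + \<beta>) h t) (ml_conv \<alpha> l \<beta> h) sequentially"
proof -
  obtain B where B: "B > 0" "\<And>s. s \<in> {0..T} \<Longrightarrow> \<bar>h s\<bar> \<le> B" using continuous_image_bounded[OF h] by blast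
  have b: "\<alpha> * real j + \<beta> > 0" for j using \<alpha> \<beta> by (simp add: add_nonneg_pos)
  have hc: "continuous_on {0..t} h" if "t \<in> {0..T}" for t using h that by (auto intro: continuous_on_subset)
  have "uniform_limit {0..T} (\<lambda>n t. \<Sum>j<n. (- l) ^ j * frac_int (\<alpha> * real j + \<beta>) h t)
     (\<lambda>t. \<Sum>j. (- l) ^ j * frac_int (\<alpha> * real j + \<beta>) h t) sequentially"
  proof (rule Weierstrass_m_test)
    show "summable (\<lambda>j. B * T powr \<beta> * ((\<bar>l\<bar> * T powr \<alpha>) ^ j / Gamma (\<alpha> * real j + (\<beta> + 1))))"
      using mittag_leffler_summable[OF \<alpha>, of "\<beta> + 1"] \<beta> by (intro summable_mult) auto
    fix j t assume t: "t \<in> {0..T}"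
    have G: "Gamma (\<alpha> * real j + \<beta> + 1) > 0" using b[of j] by simp
    have "norm ((- l) ^ j * frac_int (\<alpha> * real j + \<beta>) h t) \<le> \<bar>l\<bar> ^ j * (B * t powr (\<alpha> * real j + \<beta>) / Gamma (\<alpha> * real j + \<beta> + 1))"
      unfolding norm_mult norm_power using t B hc
      by (intro mult_mono) (auto intro!: frac_int_bound b)
    also have "\<dots> \<le> \<bar>l\<bar> ^ j * (B * T powr (\<alpha> * real j + \<beta>) / Gamma (\<alpha> * real j + \<beta> + 1))"
      using t B(1) b[of j] G by (intro mult_left_mono divide_right_mono powr_mono2) auto
    also have "\<dots> = B * T powr \<beta> * ((\<bar>l\<bar> * T powr \<alpha>) ^ j / Gamma (\<alpha> * real j + (\<beta> + 1)))"
      using powr_mult_add[of T \<alpha> j \<beta>] t by (simp add: power_mult_distrib add.assoc)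
    finally show "norm ((- l) ^ j * frac_int (\<alpha> * real j + \<beta>) h t) \<le> B * T powr \<beta> * ((\<bar>l\<bar> * T powr \<alpha>) ^ j / Gamma (\<alpha> * real j + (\<beta> + 1)))" .
  qed
  moreover have "ml_conv \<alpha> l \<beta> h t = (\<Sum>j. (- l) ^ j * frac_int (\<alpha> * real j + \<beta>) h t)" if "t \<in> {0..T}" for t
    using sums_unique[OF ml_conv_sums[OF \<alpha> \<beta> _ hc[OF that]]] that by auto
  ultimately show ?thesis
    by (subst uniform_limit_cong'[OF refl]) auto
qed

lemma continuous_on_ml_conv:
  assumes \<alpha>: "\<alpha> \<ge> 1" and \<beta>: "\<beta> > 0" and h: "continuous_on {0..T} h"
  shows "continuous_on {0..T} (ml_conv \<alpha> l \<beta> h)"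
proof (rule uniform_limit_theorem[OF _ ml_conv_uniform_limit[OF assms]])
  show "\<forall>\<^sub>F n in sequentially. continuous_on {0..T} (\<lambda>t. \<Sum>j<n. (- l) ^ j * frac_int (\<alpha> * real j + \<beta>) h t)"
    using \<alpha> \<beta> h by (intro always_eventually allI continuous_intros continuous_on_frac_int) (auto simp: add_nonneg_pos)
qed simp

lemma frac_int_uniform_limit:
  assumes a: "a > 0" and t: "t \<ge> 0" and u: "uniform_limit {0..t} f g sequentially"
    and f: "\<And>n. continuous_on {0..t} (f n)"
  shows "(\<lambda>n. frac_int a (f n) t) \<longlonglongrightarrow> frac_int a g t"
proof -
  have g: "continuous_on {0..t} g" by (rule uniform_limit_theorem[OF _ u]) (use f in auto)
  define M where "M = t powr a / Gamma (a + 1)"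
  have M: "M \<ge> 0" unfolding M_def using a by simp
  show ?thesis
  proof (rule LIMSEQ_I)
    fix e :: real assume e: "e > 0"
    then have "eventually (\<lambda>n. \<forall>s\<in>{0..t}. dist (f n s) (g s) < e / (M + 1)) sequentially"
      using M by (intro uniform_limitD[OF u]) auto
    then obtain N where N: "\<And>n s. n \<ge> N \<Longrightarrow> s \<in> {0..t} \<Longrightarrow> \<bar>f n s - g s\<bar> \<le> e / (M + 1)"
      unfolding eventually_sequentially dist_real_def by (meson less_imp_le)
    have "norm (frac_int a (f n) t - frac_int a g t) < e" if "n \<ge> N" for n
    proof -
      have "norm (frac_int a (f n) t - frac_int a g t) = \<bar>frac_int a (\<lambda>s. f n s - g s) t\<bar>"
        using a t f g by (simp add: frac_int_diff)
      also have "\<dots> \<le> e / (M + 1) * t powr a / Gamma (a + 1)"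
        by (rule frac_int_bound[OF a t]) (use N[OF that] f g in \<open>auto intro!: continuous_intros\<close>)
      also have "\<dots> = e * (M / (M + 1))" by (simp add: M_def)
      also have "\<dots> < e * 1" using e M by (intro mult_strict_left_mono) auto
      finally show ?thesis by simp
    qed
    then show "\<exists>no. \<forall>n\<ge>no. norm (frac_int a (f n) t - frac_int a g t) < e" by blast
  qed
qed

lemma frac_int_ml_conv:
  assumes \<alpha>: "\<alpha> \<ge> 1" and \<beta>: "\<beta> > 0" and a: "a > 0" and t: "t \<ge> 0" and h: "continuous_on {0..t} h"
  shows "frac_int a (ml_conv \<alpha> l \<beta> h) t = ml_conv \<alpha> l (\<beta> + a) h t"
proof -
  have b: "\<alpha> * real j + \<beta> > 0" for j using \<alpha> \<beta> by (simp add: add_nonneg_pos)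
  have c: "continuous_on {0..t} (frac_int (\<alpha> * real j + \<beta>) h)" for j using b h by (rule continuous_on_frac_int)
  have "(\<lambda>n. frac_int a (\<lambda>t. \<Sum>j<n. (- l) ^ j * frac_int (\<alpha> * real j + \<beta>) h t) t) \<longlonglongrightarrow> frac_int a (ml_conv \<alpha> l \<beta> h) t"
    by (rule frac_int_uniform_limit[OF a t ml_conv_uniform_limit[OF \<alpha> \<beta> h]]) (intro continuous_intros c)
  moreover have "frac_int a (\<lambda>t. \<Sum>j<n. (- l) ^ j * frac_int (\<alpha> * real j + \<beta>) h t) t
     = (\<Sum>j<n. (- l) ^ j * frac_int (\<alpha> * real j + (\<beta> + a)) h t)" for n
  proof -
    have "frac_int a (\<lambda>t. \<Sum>j<n. (- l) ^ j * frac_int (\<alpha> * real j + \<beta>) h t) t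
      = (\<Sum>j<n. (- l) ^ j * frac_int a (frac_int (\<alpha> * real j + \<beta>) h) t)"
      using a t by (subst frac_int_sum) (auto intro!: continuous_intros c simp: frac_int_cmult)
    also have "\<dots> = (\<Sum>j<n. (- l) ^ j * frac_int (\<alpha> * real j + (\<beta> + a)) h t)"
      using a t b h by (intro sum.cong refl) (simp add: frac_int_frac_int add.commute[of a] add.assoc)
    finally show ?thesis .
  qed
  ultimately have "(\<lambda>j. (- l) ^ j * frac_int (\<alpha> * real j + (\<beta> + a)) h t) sums frac_int a (ml_conv \<alpha> l \<beta> h) t"
    unfolding sums_def by simp
  moreover have "(\<lambda>j. (- l) ^ j * frac_int (\<alpha> * real j + (\<beta> + a)) h t) sums ml_conv \<alpha> l (\<beta> + a) h t"
    by (rule ml_conv_sums) (use \<alpha> \<beta> a t h in auto)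
  ultimately show ?thesis by (rule sums_unique2)
qed

lemma ml_conv_unfold:
  assumes \<alpha>: "\<alpha> \<ge> 1" and \<beta>: "\<beta> > 0" and t: "t \<ge> 0" and h: "continuous_on {0..t} h"
  shows "ml_conv \<alpha> l \<beta> h t = frac_int \<beta> h t - l * ml_conv \<alpha> l (\<beta> + \<alpha>) h t"
proof -
  have "(\<lambda>j. (- l) * ((- l) ^ j * frac_int (\<alpha> * real j + (\<beta> + \<alpha>)) h t)) sums ((- l) * ml_conv \<alpha> l (\<beta> + \<alpha>) h t)"
    by (intro sums_mult ml_conv_sums) (use \<alpha> \<beta> t h in auto)
  moreover have "(- l) * ((- l) ^ j * frac_int (\<alpha> * real j + (\<beta> + \<alpha>)) h t) = (- l) ^ Suc j * frac_int (\<alpha> * real (Suc j) + \<beta>) h t" for j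
  proof -
    have "\<alpha> * real j + (\<beta> + \<alpha>) = \<alpha> * real (Suc j) + \<beta>" by (simp add: algebra_simps)
    then show ?thesis by (simp only: power_Suc mult.assoc)
  qed
  ultimately have "(\<lambda>j. (- l) ^ Suc j * frac_int (\<alpha> * real (Suc j) + \<beta>) h t) sums ((- l) * ml_conv \<alpha> l (\<beta> + \<alpha>) h t)" by (simp only:)
  then have "(\<lambda>j. (- l) ^ j * frac_int (\<alpha> * real j + \<beta>) h t) sums ((- l) * ml_conv \<alpha> l (\<beta> + \<alpha>) h t + (- l) ^ 0 * frac_int (\<alpha> * real 0 + \<beta>) h t)"
    by (rule sums_Suc)
  from sums_unique2[OF ml_conv_sums[OF \<alpha> \<beta> t h] this] show ?thesis by simp
qed

lemma ml_conv_1: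
  assumes \<alpha>: "\<alpha> \<ge> 1" and \<beta>: "\<beta> > 0" and t: "t \<ge> 0"
  shows "ml_conv \<alpha> l \<beta> (\<lambda>_. 1) t = t powr \<beta> * mittag_leffler \<alpha> (\<beta> + 1) (- l * t powr \<alpha>)"
proof -
  have b: "\<alpha> * real j + \<beta> > 0" for j using \<alpha> \<beta> by (simp add: add_nonneg_pos)
  have "(- l) ^ j * frac_int (\<alpha> * real j + \<beta>) (\<lambda>_. 1) t = t powr \<beta> * ((- l * t powr \<alpha>) ^ j / Gamma (\<alpha> * real j + (\<beta> + 1)))" for j
  proof -
    have "frac_int (\<alpha> * real j + \<beta>) (\<lambda>_. 1) t = t powr (\<alpha> * real j + \<beta>) / Gamma (\<alpha> * real j + \<beta> + 1)"
      using frac_int_monom[OF b t, of j 0] by simp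
    then show ?thesis using powr_mult_add[OF t, of \<alpha> j \<beta>] by (simp add: power_mult_distrib[of "-l", simplified] add.assoc)
  qed
  moreover have "(\<lambda>j. t powr \<beta> * ((- l * t powr \<alpha>) ^ j / Gamma (\<alpha> * real j + (\<beta> + 1)))) sums (t powr \<beta> * mittag_leffler \<alpha> (\<beta> + 1) (- l * t powr \<alpha>))"
    unfolding mittag_leffler_def by (intro sums_mult summable_sums mittag_leffler_summable) (use \<alpha> \<beta> in auto)
  ultimately have "(\<lambda>j. (- l) ^ j * frac_int (\<alpha> * real j + \<beta>) (\<lambda>_. 1) t) sums (t powr \<beta> * mittag_leffler \<alpha> (\<beta> + 1) (- l * t powr \<alpha>))"
    by simp
  then show ?thesis using ml_conv_sums[OF \<alpha> \<beta> t, of "\<lambda>_. 1" l] sums_unique2 by auto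
qed


lemma mittag_leffler_head:
  assumes "\<alpha> \<ge> 1" "\<beta> > 0"
  shows "mittag_leffler \<alpha> \<beta> z = 1 / Gamma \<beta> + z * mittag_leffler \<alpha> (\<beta> + \<alpha>) z"
proof -
  have "mittag_leffler \<alpha> \<beta> z = z ^ 0 / Gamma (\<alpha> * real 0 + \<beta>) + (\<Sum>j. z ^ Suc j / Gamma (\<alpha> * real (Suc j) + \<beta>))"
    unfolding mittag_leffler_def using suminf_split_head[OF mittag_leffler_summable[OF assms], of z] by simp
  also have "(\<Sum>j. z ^ Suc j / Gamma (\<alpha> * real (Suc j) + \<beta>)) = (\<Sum>j. z * (z ^ j / Gamma (\<alpha> * real j + (\<beta> + \<alpha>))))"
  proof (rule suminf_cong)
    fix j
    have "\<alpha> * real j + (\<beta> + \<alpha>) = \<alpha> * real (Suc j) + \<beta>" by (simp add: algebra_simps)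
    then show "z ^ Suc j / Gamma (\<alpha> * real (Suc j) + \<beta>) = z * (z ^ j / Gamma (\<alpha> * real j + (\<beta> + \<alpha>)))"
      by (simp only: power_Suc times_divide_eq_right)
  qed
  also have "\<dots> = z * mittag_leffler \<alpha> (\<beta> + \<alpha>) z"
    unfolding mittag_leffler_def by (rule suminf_mult[OF mittag_leffler_summable]) (use assms in auto)
  finally show ?thesis by simp
qed

text \<open>One mode of the solution formula, for the eigenvalue \<open>l\<close>, the initial value \<open>c\<close>, the
initial velocity \<open>d\<close> and the source \<open>f\<close>.\<close>

definition frac_sol :: "real \<Rightarrow> real \<Rightarrow> real \<Rightarrow> real \<Rightarrow> (real \<Rightarrow> real) \<Rightarrow> real \<Rightarrow> real" where
  "frac_sol \<alpha> l c d f t = c * mittag_leffler \<alpha> 1 (- l * t powr \<alpha>)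
     + d * t * mittag_leffler \<alpha> 2 (- l * t powr \<alpha>) + ml_conv \<alpha> l \<alpha> f t"

definition frac_sol' :: "real \<Rightarrow> real \<Rightarrow> real \<Rightarrow> real \<Rightarrow> (real \<Rightarrow> real) \<Rightarrow> real \<Rightarrow> real" where
  "frac_sol' \<alpha> l c d f t = c * (- l * t powr (\<alpha> - 1) * mittag_leffler \<alpha> \<alpha> (- l * t powr \<alpha>))
     + d * mittag_leffler \<alpha> 1 (- l * t powr \<alpha>) + ml_conv \<alpha> l (\<alpha> - 1) f t"

text \<open>The contributions of the initial data are convolutions of the Mittag-Leffler kernel with the constant
\<open>1\<close>, so one calculus serves all three summands.\<close>

lemma frac_sol_conv:
  assumes \<alpha>: "1 < \<alpha>" and t: "t \<ge> 0"
  shows "frac_sol \<alpha> l c d f t = c * (1 - l * ml_conv \<alpha> l \<alpha> (\<lambda>_. 1) t) + d * ml_conv \<alpha> l 1 (\<lambda>_. 1) t + ml_conv \<alpha> l \<alpha> f t"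
    and "frac_sol' \<alpha> l c d f t = c * (- l * ml_conv \<alpha> l (\<alpha> - 1) (\<lambda>_. 1) t) + d * (1 - l * ml_conv \<alpha> l \<alpha> (\<lambda>_. 1) t) + ml_conv \<alpha> l (\<alpha> - 1) f t"
proof -
  have A: "mittag_leffler \<alpha> 1 (- l * t powr \<alpha>) = 1 - l * ml_conv \<alpha> l \<alpha> (\<lambda>_. 1) t"
    using mittag_leffler_head[of \<alpha> 1 "- l * t powr \<alpha>"] ml_conv_1[of \<alpha> \<alpha> t l] \<alpha> t by (simp add: add.commute)
  have B: "t * mittag_leffler \<alpha> 2 (- l * t powr \<alpha>) = ml_conv \<alpha> l 1 (\<lambda>_. 1) t"
    using ml_conv_1[of \<alpha> 1 t l] \<alpha> t by simp
  have D: "t powr (\<alpha> - 1) * mittag_leffler \<alpha> \<alpha> (- l * t powr \<alpha>) = ml_conv \<alpha> l (\<alpha> - 1) (\<lambda>_. 1) t"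
    using ml_conv_1[of \<alpha> "\<alpha> - 1" t l] \<alpha> t by simp
  show "frac_sol \<alpha> l c d f t = c * (1 - l * ml_conv \<alpha> l \<alpha> (\<lambda>_. 1) t) + d * ml_conv \<alpha> l 1 (\<lambda>_. 1) t + ml_conv \<alpha> l \<alpha> f t"
    unfolding frac_sol_def A B[symmetric] by simp
  show "frac_sol' \<alpha> l c d f t = c * (- l * ml_conv \<alpha> l (\<alpha> - 1) (\<lambda>_. 1) t) + d * (1 - l * ml_conv \<alpha> l \<alpha> (\<lambda>_. 1) t) + ml_conv \<alpha> l (\<alpha> - 1) f t"
    unfolding frac_sol'_def A D[symmetric] by simp
qed

lemma continuous_on_frac_sol:
  assumes \<alpha>: "1 < \<alpha>" and f: "continuous_on {0..T} f"
  shows "continuous_on {0..T} (frac_sol \<alpha> l c d f)" "continuous_on {0..T} (frac_sol' \<alpha> l c d f)"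
proof -
  have "continuous_on {0..T} (\<lambda>t. c * (1 - l * ml_conv \<alpha> l \<alpha> (\<lambda>_. 1) t) + d * ml_conv \<alpha> l 1 (\<lambda>_. 1) t + ml_conv \<alpha> l \<alpha> f t)"
    using \<alpha> f by (intro continuous_intros continuous_on_ml_conv) auto
  then show "continuous_on {0..T} (frac_sol \<alpha> l c d f)"
    by (rule continuous_on_eq) (simp add: frac_sol_conv \<alpha>)
  have "continuous_on {0..T} (\<lambda>t. c * (- l * ml_conv \<alpha> l (\<alpha> - 1) (\<lambda>_. 1) t) + d * (1 - l * ml_conv \<alpha> l \<alpha> (\<lambda>_. 1) t) + ml_conv \<alpha> l (\<alpha> - 1) f t)"
    using \<alpha> f by (intro continuous_intros continuous_on_ml_conv) auto
  then show "continuous_on {0..T} (frac_sol' \<alpha> l c d f)"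
    by (rule continuous_on_eq) (simp add: frac_sol_conv \<alpha>)
qed

lemma frac_sol_0:
  assumes "1 < \<alpha>"
  shows "frac_sol \<alpha> l c d f 0 = c" "frac_sol' \<alpha> l c d f 0 = d"
proof -
  have "mittag_leffler \<alpha> 1 0 = 1" using mittag_leffler_head[of \<alpha> 1 0] assms by simp
  moreover have "ml_conv \<alpha> l b f 0 = 0" for b
  proof -
    have "ml_conv \<alpha> l b f 0 = (LINT \<tau>:{0..0::real}|lebesgue. 0)"
      unfolding ml_conv_def by (rule set_lebesgue_integral_cong) auto
    then show ?thesis by simp
  qed
  ultimately show "frac_sol \<alpha> l c d f 0 = c" "frac_sol' \<alpha> l c d f 0 = d"
    unfolding frac_sol_def frac_sol'_def by simp_all
qed

lemma frac_sol_volterra: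
  assumes \<alpha>: "1 < \<alpha>" and f: "continuous_on {0..t} f" and t: "t \<ge> 0"
  shows "frac_sol \<alpha> l c d f t - c - d * t = frac_int \<alpha> (\<lambda>s. f s - l * frac_sol \<alpha> l c d f s) t"
proof -
  let ?A = "ml_conv \<alpha> l \<alpha> (\<lambda>_. 1)" and ?B = "ml_conv \<alpha> l 1 (\<lambda>_. 1)" and ?K = "ml_conv \<alpha> l \<alpha> f"
  have \<alpha>1: "\<alpha> \<ge> 1" "\<alpha> > 0" using \<alpha> by auto
  have one: "continuous_on {0..t} (\<lambda>_. 1::real)" by simp
  have cA: "continuous_on {0..t} ?A" "continuous_on {0..t} ?B" "continuous_on {0..t} ?K"
    using \<alpha> f by (intro continuous_on_ml_conv; simp)+
  have "frac_int \<alpha> (\<lambda>s. f s - l * frac_sol \<alpha> l c d f s) t = frac_int \<alpha> (\<lambda>s. f s - l * ((c * (1 - l * ?A s) + d * ?B s) + ?K s)) t"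
    by (rule frac_int_cong) (simp add: frac_sol_conv \<alpha>)
  also have "\<dots> = frac_int \<alpha> f t - l * ((c * (frac_int \<alpha> (\<lambda>_. 1) t - l * frac_int \<alpha> ?A t) + d * frac_int \<alpha> ?B t) + frac_int \<alpha> ?K t)"
  proof -
    have c0: "continuous_on {0..t} (\<lambda>s. l * ?A s)" by (intro continuous_intros cA)
    have c1: "continuous_on {0..t} (\<lambda>s. c * (1 - l * ?A s))" by (intro continuous_intros cA)
    have c2: "continuous_on {0..t} (\<lambda>s. d * ?B s)" by (intro continuous_intros cA)
    have c3: "continuous_on {0..t} (\<lambda>s. c * (1 - l * ?A s) + d * ?B s)" by (intro continuous_intros cA)
    have c4: "continuous_on {0..t} (\<lambda>s. l * ((c * (1 - l * ?A s) + d * ?B s) + ?K s))" by (intro continuous_intros cA)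
    show ?thesis
      by (simp only: frac_int_diff[OF \<alpha>1(2) t f c4] frac_int_cmult[of \<alpha> l] frac_int_add[OF \<alpha>1(2) t c3 cA(3)]
          frac_int_add[OF \<alpha>1(2) t c1 c2] frac_int_cmult[of \<alpha> c] frac_int_cmult[of \<alpha> d] frac_int_diff[OF \<alpha>1(2) t one c0])
  qed
  also have "\<dots> = c * (- l * ?A t) + d * (?B t - t) + ?K t"
  proof -
    have e1: "frac_int \<alpha> ?A t = ml_conv \<alpha> l (\<alpha> + \<alpha>) (\<lambda>_. 1) t" by (rule frac_int_ml_conv[OF \<alpha>1 \<alpha>1(2) t one])
    have e2: "frac_int \<alpha> ?B t = ml_conv \<alpha> l (1 + \<alpha>) (\<lambda>_. 1) t" by (rule frac_int_ml_conv[OF \<alpha>1(1) _ \<alpha>1(2) t one]) simp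
    have e3: "frac_int \<alpha> ?K t = ml_conv \<alpha> l (\<alpha> + \<alpha>) f t" by (rule frac_int_ml_conv[OF \<alpha>1 \<alpha>1(2) t f])
    have u1: "?A t = frac_int \<alpha> (\<lambda>_. 1) t - l * ml_conv \<alpha> l (\<alpha> + \<alpha>) (\<lambda>_. 1) t" by (rule ml_conv_unfold[OF \<alpha>1 t one])
    have u2: "?B t = frac_int 1 (\<lambda>_. 1) t - l * ml_conv \<alpha> l (1 + \<alpha>) (\<lambda>_. 1) t" by (rule ml_conv_unfold[OF \<alpha>1(1) _ t one]) simp
    have u3: "?K t = frac_int \<alpha> f t - l * ml_conv \<alpha> l (\<alpha> + \<alpha>) f t" by (rule ml_conv_unfold[OF \<alpha>1 t f])
    have "frac_int 1 (\<lambda>_. 1) t = t" using t by (simp add: frac_int_1)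
    then show ?thesis unfolding u1 u2 u3 e1 e2 e3 by (simp add: algebra_simps)
  qed
  also have "\<dots> = frac_sol \<alpha> l c d f t - c - d * t"
    unfolding frac_sol_conv[OF \<alpha> t] by (simp add: algebra_simps)
  finally show ?thesis by simp
qed

lemma frac_sol_has_derivative:
  assumes \<alpha>: "1 < \<alpha>" and f: "continuous_on {0..T} f" and t: "t \<in> {0..T}"
  shows "(frac_sol \<alpha> l c d f has_real_derivative frac_sol' \<alpha> l c d f t) (at t within {0..T})"
proof -
  have "frac_sol \<alpha> l c d f s = c + frac_int 1 (frac_sol' \<alpha> l c d f) s" if s: "s \<in> {0..T}" for s
  proof -
    let ?A = "ml_conv \<alpha> l \<alpha> (\<lambda>_. 1)" and ?A' = "ml_conv \<alpha> l (\<alpha> - 1) (\<lambda>_. 1)" and ?K' = "ml_conv \<alpha> l (\<alpha> - 1) f"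
    have s0: "s \<ge> 0" and \<alpha>1: "\<alpha> \<ge> 1" "\<alpha> > 0" "\<alpha> - 1 > 0" using \<alpha> s by auto
    have one: "continuous_on {0..s} (\<lambda>_. 1::real)" by simp
    have fs: "continuous_on {0..s} f" using f s by (auto intro: continuous_on_subset)
    have cA: "continuous_on {0..s} ?A" "continuous_on {0..s} ?A'" "continuous_on {0..s} ?K'"
      using \<alpha> fs by (intro continuous_on_ml_conv; simp)+
    have "frac_int 1 (frac_sol' \<alpha> l c d f) s = frac_int 1 (\<lambda>r. (c * (- l * ?A' r) + d * (1 - l * ?A r)) + ?K' r) s"
      by (rule frac_int_cong) (simp add: frac_sol_conv \<alpha>)
    also have "\<dots> = (c * (- l * frac_int 1 ?A' s) + d * (frac_int 1 (\<lambda>_. 1) s - l * frac_int 1 ?A s)) + frac_int 1 ?K' s"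
    proof -
      have c0: "continuous_on {0..s} (\<lambda>s. l * ?A s)" by (intro continuous_intros cA)
      have c1: "continuous_on {0..s} (\<lambda>s. c * (- l * ?A' s))" by (intro continuous_intros cA)
      have c2: "continuous_on {0..s} (\<lambda>s. d * (1 - l * ?A s))" by (intro continuous_intros cA)
      have c3: "continuous_on {0..s} (\<lambda>s. c * (- l * ?A' s) + d * (1 - l * ?A s))" by (intro continuous_intros cA)
      show ?thesis
        by (simp only: frac_int_add[OF zero_less_one s0 c3 cA(3)] frac_int_add[OF zero_less_one s0 c1 c2]
            frac_int_cmult[of 1 c] frac_int_cmult[of 1 d] frac_int_cmult[of 1 "- l"] frac_int_diff[OF zero_less_one s0 one c0] frac_int_cmult[of 1 l])
    qed
    also have "frac_int 1 ?A' s = ?A s" using frac_int_ml_conv[OF \<alpha>1(1,3) _ s0 one, of 1 l] by simp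
    also have "frac_int 1 ?K' s = ml_conv \<alpha> l \<alpha> f s" using frac_int_ml_conv[OF \<alpha>1(1,3) _ s0 fs, of 1 l] by simp
    also have "frac_int 1 (\<lambda>_. 1) s - l * frac_int 1 ?A s = ml_conv \<alpha> l 1 (\<lambda>_. 1) s"
      using frac_int_ml_conv[OF \<alpha>1(1,2) _ s0 one, of 1 l] ml_conv_unfold[OF \<alpha>1(1) _ s0 one, of 1 l] by (simp add: add.commute)
    finally show ?thesis unfolding frac_sol_conv[OF \<alpha> s0] by (simp add: algebra_simps)
  qed
  note eq = this
  have "((\<lambda>s. c + frac_int 1 (frac_sol' \<alpha> l c d f) s) has_real_derivative 0 + frac_sol' \<alpha> l c d f t) (at t within {0..T})"
    by (rule DERIV_add[OF DERIV_const frac_int_1_has_derivative[OF continuous_on_frac_sol(2)[OF \<alpha> f] t]])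
  then have "((\<lambda>s. c + frac_int 1 (frac_sol' \<alpha> l c d f) s) has_real_derivative frac_sol' \<alpha> l c d f t) (at t within {0..T})"
    by simp
  then show ?thesis
    by (rule has_field_derivative_transform_within[OF _ zero_less_one t]) (simp add: eq)
qed

section \<open>Estimates uniform in the eigenvalues\<close>

text \<open>Norms of sequences are handled through \<open>L2_set\<close> over finite sets \<open>K\<close> of modes.
Bounds that do not depend on \<open>K\<close> pass to the full sequence.\<close>

lemma L2_set_bound_imp_summable:
  assumes "\<And>K. finite K \<Longrightarrow> L2_set y K \<le> B"
  shows "summable (\<lambda>n. (y n)\<^sup>2)" "sqrt (\<Sum>n. (y n)\<^sup>2) \<le> B"
proof -
  have B: "B \<ge> 0" using assms[of "{}"] by simp
  have b: "(\<Sum>n<N. (y n)\<^sup>2) \<le> B\<^sup>2" for N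
  proof -
    have "sqrt (\<Sum>n<N. (y n)\<^sup>2) \<le> B" using assms[of "{..<N}"] by (simp add: L2_set_def)
    then show ?thesis using B by (metis real_sqrt_le_iff real_sqrt_unique)
  qed
  show s: "summable (\<lambda>n. (y n)\<^sup>2)" by (rule summableI_nonneg_bounded[OF _ b]) simp
  have "(\<Sum>n. (y n)\<^sup>2) \<le> B\<^sup>2" by (rule suminf_le_const[OF s b])
  then show "sqrt (\<Sum>n. (y n)\<^sup>2) \<le> B" using B real_le_lsqrt by blast
qed

lemma L2_set_le_sqrt_suminf:
  assumes "summable (\<lambda>n. (y n)\<^sup>2)" "finite K"
  shows "L2_set y K \<le> sqrt (\<Sum>n. (y n)\<^sup>2)"
  unfolding L2_set_def using assms by (intro real_sqrt_le_mono sum_le_suminf) auto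

lemma L2_set_tail_le:
  assumes s: "summable (\<lambda>n. (y n)\<^sup>2)" and e: "e > 0"
  obtains N where "\<And>K. finite K \<Longrightarrow> K \<subseteq> {N..} \<Longrightarrow> L2_set y K \<le> e"
proof -
  obtain N where N: "\<And>n. n \<ge> N \<Longrightarrow> norm (\<Sum>i. (y (i + n))\<^sup>2) < e\<^sup>2"
    using suminf_exist_split[OF _ s, of "e\<^sup>2"] e by auto
  have "L2_set y K \<le> e" if K: "finite K" "K \<subseteq> {N..}" for K
  proof -
    have "(\<Sum>n\<in>K. (y n)\<^sup>2) = (\<Sum>i\<in>(\<lambda>n. n - N) ` K. (y (i + N))\<^sup>2)"
    proof -
      have "inj_on (\<lambda>n. n - N) K"
        using K unfolding inj_on_def by (metis atLeast_iff le_add_diff_inverse2 subsetD)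
      moreover have "n - N + N = n" if "n \<in> K" for n using K that by (meson atLeast_iff le_add_diff_inverse2 subsetD)
      ultimately show ?thesis by (simp add: sum.reindex)
    qed
    also have "\<dots> \<le> (\<Sum>i. (y (i + N))\<^sup>2)"
      using K summable_ignore_initial_segment[OF s] by (intro sum_le_suminf) auto
    also have "\<dots> \<le> e\<^sup>2" using N[of N] by simp
    finally show ?thesis unfolding L2_set_def using e by (intro real_le_lsqrt) auto
  qed
  then show thesis by (rule that)
qed

text \<open>Pairing a vector with itself: a bound for the inner product of \<open>y\<close> with itself by its norm times
\<open>B\<close> is a bound by \<open>B\<close>.  This reduces inequalities between vectors to scalar ones.\<close>

lemma L2_set_dual_bound:
  assumes "finite K" "B \<ge> 0" "(\<Sum>n\<in>K. (y n)\<^sup>2) \<le> L2_set y K * B"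
  shows "L2_set y K \<le> B"
proof (cases "L2_set y K = 0")
  case False
  then have p: "L2_set y K > 0" using L2_set_nonneg[of y K] by linarith
  have "L2_set y K * L2_set y K = (\<Sum>n\<in>K. (y n)\<^sup>2)"
    unfolding L2_set_def by (simp add: sum_nonneg)
  with assms(3) have "L2_set y K * L2_set y K \<le> L2_set y K * B" by linarith
  then show ?thesis using p by (rule mult_left_le_imp_le)
qed (use assms in simp)

lemma L2_set_uminus: "L2_set (\<lambda>n. - y n) K = L2_set y K"
  by (simp add: L2_set_def)

lemma L2_set_diff_le: "L2_set (\<lambda>n. x n - y n) K \<le> L2_set x K + L2_set y K"
  using L2_set_triangle_ineq[of x "\<lambda>n. - y n" K] by (simp add: L2_set_uminus)

lemma L2_set_scaled_le:
  assumes "\<And>n. n \<in> K \<Longrightarrow> \<bar>x n\<bar> \<le> C * \<bar>y n\<bar>" "C \<ge> 0"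
  shows "L2_set x K \<le> C * L2_set y K"
proof -
  have "L2_set x K = L2_set (\<lambda>n. \<bar>x n\<bar>) K" by (simp add: L2_set_def)
  also have "\<dots> \<le> L2_set (\<lambda>n. C * \<bar>y n\<bar>) K" by (rule L2_set_mono) (use assms in auto)
  also have "\<dots> = C * L2_set (\<lambda>n. \<bar>y n\<bar>) K" using assms(2) by (simp add: L2_set_right_distrib)
  also have "L2_set (\<lambda>n. \<bar>y n\<bar>) K = L2_set y K" by (simp add: L2_set_def)
  finally show ?thesis .
qed

text \<open>The mean value inequality for vectors.  Paired with the error vector \<open>v\<close>, the error becomes the
increment of one scalar function \<open>\<Phi>\<close>, to which the mean value theorem applies.\<close>

lemma L2_set_difference_quotient:
  assumes K: "finite K" and st: "s \<in> {0..T}" "t \<in> {0..T}" "s \<noteq> t"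
    and der: "\<And>n r. n \<in> K \<Longrightarrow> r \<in> {0..T} \<Longrightarrow> (x n has_real_derivative d n r) (at r within {0..T})"
    and bd: "\<And>r. r \<in> {0..T} \<Longrightarrow> \<bar>r - t\<bar> \<le> \<bar>s - t\<bar> \<Longrightarrow> L2_set (\<lambda>n. d n r - d n t) K \<le> e"
  shows "L2_set (\<lambda>n. (x n s - x n t) / (s - t) - d n t) K \<le> e"
proof -
  define v where "v n = (x n s - x n t) / (s - t) - d n t" for n
  define S where "S = L2_set v K"
  define \<Phi> where "\<Phi> r = (\<Sum>n\<in>K. v n * (x n r - r * d n t))" for r
  have e: "e \<ge> 0" using bd[OF st(1)] L2_set_nonneg order_trans by blast
  have der\<Phi>: "(\<Phi> has_derivative (\<lambda>h. (\<Sum>n\<in>K. v n * (d n r - d n t)) * h)) (at r within {0..T})" if "r \<in> {0..T}" for r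
  proof -
    have "(\<Phi> has_real_derivative (\<Sum>n\<in>K. v n * (d n r - 1 * d n t))) (at r within {0..T})"
      unfolding \<Phi>_def
      by (rule DERIV_sum, rule DERIV_cmult, rule DERIV_diff[OF der[OF _ that] DERIV_cmult_right[OF DERIV_ident]])
    then show ?thesis by (simp add: has_field_derivative_def)
  qed
  have cont: "continuous_on {a..b} \<Phi>" if "0 \<le> a" "b \<le> T" for a b
    using that by (intro continuous_on_subset[OF has_derivative_continuous_on[OF der\<Phi>]]) auto
  have int: "(\<Phi> has_derivative (\<lambda>h. (\<Sum>n\<in>K. v n * (d n r - d n t)) * h)) (at r)" if "0 < r" "r < T" for r
  proof -
    have "r \<in> {0..T}" using that by simp
    from der\<Phi>[OF this] show ?thesis unfolding at_within_Icc_at[OF that] .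
  qed
  have "\<exists>r\<in>closed_segment t s. \<Phi> s - \<Phi> t = (\<Sum>n\<in>K. v n * (d n r - d n t)) * (s - t)"
  proof (cases "t < s")
    case True
    obtain r where "t < r" "r < s" "\<Phi> s - \<Phi> t = (\<Sum>n\<in>K. v n * (d n r - d n t)) * (s - t)"
      by (rule mvt[OF True cont, of "\<lambda>r h. (\<Sum>n\<in>K. v n * (d n r - d n t)) * h"]) (use int st in auto)
    then show ?thesis by (intro bexI[of _ r]) (auto simp: closed_segment_eq_real_ivl)
  next
    case False
    then have l: "s < t" using st by simp
    obtain r where "s < r" "r < t" "\<Phi> t - \<Phi> s = (\<Sum>n\<in>K. v n * (d n r - d n t)) * (t - s)"
      by (rule mvt[OF l cont, of "\<lambda>r h. (\<Sum>n\<in>K. v n * (d n r - d n t)) * h"]) (use int st in auto)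
    then show ?thesis using l by (intro bexI[of _ r]) (auto simp: closed_segment_eq_real_ivl algebra_simps)
  qed
  then obtain r where r: "r \<in> closed_segment t s" "\<Phi> s - \<Phi> t = (\<Sum>n\<in>K. v n * (d n r - d n t)) * (s - t)" by blast
  have rT: "r \<in> {0..T}" "\<bar>r - t\<bar> \<le> \<bar>s - t\<bar>" using r(1) st by (auto simp: closed_segment_eq_real_ivl split: if_splits)
  have "(\<Sum>n\<in>K. (v n)\<^sup>2) = (\<Phi> s - \<Phi> t) / (s - t)"
  proof -
    have "\<Phi> s - \<Phi> t = (\<Sum>n\<in>K. v n * ((x n s - s * d n t) - (x n t - t * d n t)))"
      unfolding \<Phi>_def by (simp add: sum_subtractf right_diff_distrib)
    also have "\<dots> = (\<Sum>n\<in>K. v n * (v n * (s - t)))"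
      using st(3) by (intro sum.cong refl arg_cong2[of _ _ _ _ "(*)"]) (simp add: v_def field_simps)
    finally show ?thesis using st(3) by (simp add: sum_divide_distrib power2_eq_square)
  qed
  also have "\<dots> = (\<Sum>n\<in>K. v n * (d n r - d n t))" using r(2) st(3) by simp
  also have "\<dots> \<le> (\<Sum>n\<in>K. \<bar>v n\<bar> * \<bar>d n r - d n t\<bar>)" by (intro sum_mono) (metis abs_ge_self abs_mult)
  also have "\<dots> \<le> L2_set v K * L2_set (\<lambda>n. d n r - d n t) K" by (rule L2_set_mult_ineq)
  also have "\<dots> \<le> L2_set v K * e" by (intro mult_left_mono bd rT) (simp add: L2_set_nonneg)
  finally show ?thesis unfolding v_def[symmetric] using K e by (intro L2_set_dual_bound)
qed

lemma ml_kernel_integrable: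
  fixes f :: "real \<Rightarrow> real"
  assumes "\<alpha> \<ge> 1" "\<beta> > 0" "t \<ge> 0" "continuous_on {0..t} f"
  shows "set_integrable lebesgue {0..t} (\<lambda>\<tau>. f \<tau> * (t - \<tau>) powr (\<beta> - 1) * mittag_leffler \<alpha> \<beta> (- l * (t - \<tau>) powr \<alpha>))"
proof -
  have "continuous_on UNIV (mittag_leffler \<alpha> \<beta>)"
    using isCont_mittag_leffler[OF assms(1,2)] by (simp add: continuous_on_eq_continuous_at)
  then have "continuous_on {0..t} (\<lambda>\<tau>. mittag_leffler \<alpha> \<beta> (- l * (t - \<tau>) powr \<alpha>))"
    using assms(1) by (rule_tac continuous_on_compose2) (auto intro!: continuous_intros continuous_on_powr')
  then have "set_integrable lebesgue {0..t} (\<lambda>\<tau>. (t - \<tau>) powr (\<beta> - 1) * (f \<tau> * mittag_leffler \<alpha> \<beta> (- l * (t - \<tau>) powr \<alpha>)))"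
    using assms by (intro frac_integrand_integrable continuous_intros)
  then show ?thesis by (simp only: ac_simps)
qed

text \<open>Minkowski's inequality for integrals, proved by pairing with the left-hand vector.  The bound on the weighted
kernels is the same for all modes.\<close>

lemma ml_conv_L2_set_bound:
  assumes K: "finite K" and \<alpha>: "\<alpha> \<ge> 1" and \<beta>: "\<beta> > 0" and t: "t \<ge> 0" and e: "e > -1"
    and f: "\<And>n. n \<in> K \<Longrightarrow> continuous_on {0..t} (f n)"
    and \<mu>: "\<And>n. n \<in> K \<Longrightarrow> \<mu> n \<ge> 0" and C: "C \<ge> 0"
    and ker: "\<And>n s. n \<in> K \<Longrightarrow> s \<ge> 0 \<Longrightarrow> \<mu> n * (s powr (\<beta> - 1) * \<bar>mittag_leffler \<alpha> \<beta> (- l n * s powr \<alpha>)\<bar>) \<le> C * s powr e"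
  shows "L2_set (\<lambda>n. \<mu> n * ml_conv \<alpha> (l n) \<beta> (f n) t) K
     \<le> C * (LINT \<tau>:{0..t}|lebesgue. (t - \<tau>) powr e * L2_set (\<lambda>n. f n \<tau>) K)"
proof (rule L2_set_dual_bound[OF K])
  define v where "v n = \<mu> n * ml_conv \<alpha> (l n) \<beta> (f n) t" for n
  define k where "k n \<tau> = f n \<tau> * (t - \<tau>) powr (\<beta> - 1) * mittag_leffler \<alpha> \<beta> (- l n * (t - \<tau>) powr \<alpha>)" for n \<tau>
  define G where "G \<tau> = L2_set (\<lambda>n. f n \<tau>) K" for \<tau>
  have Gc: "continuous_on {0..t} G" unfolding G_def L2_set_def using f by (intro continuous_intros) auto
  have ki: "set_integrable lebesgue {0..t} (k n)" if "n \<in> K" for n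
    unfolding k_def by (rule ml_kernel_integrable[OF \<alpha> \<beta> t f[OF that]])
  have Gi: "set_integrable lebesgue {0..t} (\<lambda>\<tau>. (t - \<tau>) powr e * G \<tau>)"
    using frac_integrand_integrable[of "e + 1" t G] e t Gc by simp
  have I0: "(LINT \<tau>:{0..t}|lebesgue. (t - \<tau>) powr e * G \<tau>) \<ge> 0"
    unfolding set_lebesgue_integral_def G_def by (intro Bochner_Integration.integral_nonneg) (auto simp: L2_set_nonneg)
  then show "0 \<le> C * (LINT \<tau>:{0..t}|lebesgue. (t - \<tau>) powr e * L2_set (\<lambda>n. f n \<tau>) K)"
    using C by (simp add: G_def)
  have "(\<Sum>n\<in>K. (v n)\<^sup>2) = (\<Sum>n\<in>K. LINT \<tau>:{0..t}|lebesgue. v n * \<mu> n * k n \<tau>)"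
    by (intro sum.cong refl) (simp add: v_def ml_conv_def k_def power2_eq_square)
  also have "\<dots> = (LINT \<tau>:{0..t}|lebesgue. (\<Sum>n\<in>K. v n * \<mu> n * k n \<tau>))"
    unfolding set_lebesgue_integral_def scaleR_sum_right
    by (rule Bochner_Integration.integral_sum[symmetric])
       (use set_integrable_mult_right[OF ki] in \<open>auto simp: set_integrable_def\<close>)
  also have "\<dots> \<le> (LINT \<tau>:{0..t}|lebesgue. L2_set v K * C * ((t - \<tau>) powr e * G \<tau>))"
  proof (rule set_integral_mono)
    show "set_integrable lebesgue {0..t} (\<lambda>\<tau>. \<Sum>n\<in>K. v n * \<mu> n * k n \<tau>)"
      unfolding set_integrable_def scaleR_sum_right
      by (rule Bochner_Integration.integrable_sum) (use set_integrable_mult_right[OF ki] in \<open>auto simp: set_integrable_def\<close>)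
    show "set_integrable lebesgue {0..t} (\<lambda>\<tau>. L2_set v K * C * ((t - \<tau>) powr e * G \<tau>))" using Gi by simp
    fix \<tau> assume \<tau>: "\<tau> \<in> {0..t}"
    have "(\<Sum>n\<in>K. v n * \<mu> n * k n \<tau>) \<le> (\<Sum>n\<in>K. (\<bar>v n\<bar> * \<bar>f n \<tau>\<bar>) * (C * (t - \<tau>) powr e))"
    proof (rule sum_mono)
      fix n assume n: "n \<in> K"
      have "v n * \<mu> n * k n \<tau> \<le> \<bar>v n * \<mu> n * k n \<tau>\<bar>" by simp
      also have "\<dots> = (\<bar>v n\<bar> * \<bar>f n \<tau>\<bar>) * (\<mu> n * ((t - \<tau>) powr (\<beta> - 1) * \<bar>mittag_leffler \<alpha> \<beta> (- l n * (t - \<tau>) powr \<alpha>)\<bar>))"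
        using \<mu>[OF n] by (simp add: k_def abs_mult)
      also have "\<dots> \<le> (\<bar>v n\<bar> * \<bar>f n \<tau>\<bar>) * (C * (t - \<tau>) powr e)"
        using \<tau> by (intro mult_left_mono ker n) auto
      finally show "v n * \<mu> n * k n \<tau> \<le> (\<bar>v n\<bar> * \<bar>f n \<tau>\<bar>) * (C * (t - \<tau>) powr e)" .
    qed
    also have "\<dots> = (\<Sum>n\<in>K. \<bar>v n\<bar> * \<bar>f n \<tau>\<bar>) * (C * (t - \<tau>) powr e)" by (simp add: sum_distrib_right)
    also have "\<dots> \<le> (L2_set v K * G \<tau>) * (C * (t - \<tau>) powr e)"
      unfolding G_def using C by (intro mult_right_mono L2_set_mult_ineq) auto
    finally show "(\<Sum>n\<in>K. v n * \<mu> n * k n \<tau>) \<le> L2_set v K * C * ((t - \<tau>) powr e * G \<tau>)"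
      by (simp add: ac_simps)
  qed
  also have "\<dots> = L2_set v K * (C * (LINT \<tau>:{0..t}|lebesgue. (t - \<tau>) powr e * G \<tau>))" by simp
  finally show "(\<Sum>n\<in>K. (\<mu> n * ml_conv \<alpha> (l n) \<beta> (f n) t)\<^sup>2) \<le> L2_set (\<lambda>n. \<mu> n * ml_conv \<alpha> (l n) \<beta> (f n) t) K *
    (C * (LINT \<tau>:{0..t}|lebesgue. (t - \<tau>) powr e * L2_set (\<lambda>n. f n \<tau>) K))"
    unfolding v_def G_def .
qed


text \<open>With \<open>x = l * s powr \<alpha>\<close>, a factor \<open>l powr r\<close> is \<open>x powr r\<close> times
a power of \<open>s\<close>, and the bounds for the Mittag-Leffler functions on the half-line absorb the power
of \<open>x\<close>.  Hence the constant does not depend on \<open>l\<close>, and the remaining powers of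
\<open>s\<close> are the kernels of the convolutions below.\<close>

lemma mittag_leffler_kernel_bounds:
  assumes \<alpha>: "1 < \<alpha>" "\<alpha> < 2" 
  obtains C where "C > 0"
    "\<And>l s. l > 0 \<Longrightarrow> s \<ge> 0 \<Longrightarrow> \<bar>mittag_leffler \<alpha> 1 (- l * s powr \<alpha>)\<bar> \<le> C"
    "\<And>l s. l > 0 \<Longrightarrow> s \<ge> 0 \<Longrightarrow> l powr (1/\<alpha>) * \<bar>s * mittag_leffler \<alpha> 2 (- l * s powr \<alpha>)\<bar> \<le> C"
    "\<And>l s. l > 0 \<Longrightarrow> s \<ge> 0 \<Longrightarrow> l powr (1 - 1/\<alpha>) * \<bar>s * mittag_leffler \<alpha> 2 (- l * s powr \<alpha>)\<bar> \<le> C * s powr (2 - \<alpha>)"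
    "\<And>l s. l > 0 \<Longrightarrow> s \<ge> 0 \<Longrightarrow> l * (s powr (\<alpha> - 1) * \<bar>mittag_leffler \<alpha> \<alpha> (- l * s powr \<alpha>)\<bar>) \<le> C * l powr (1/\<alpha>)"
    "\<And>l s. l > 0 \<Longrightarrow> s \<ge> 0 \<Longrightarrow> l powr (1/\<alpha>) * (s powr (\<alpha> - 1) * \<bar>mittag_leffler \<alpha> \<alpha> (- l * s powr \<alpha>)\<bar>) \<le> C * s powr (\<alpha> - 2)"
    "\<And>l s. l > 0 \<Longrightarrow> s \<ge> 0 \<Longrightarrow> l powr (1 - 1/\<alpha>) * (s powr (\<alpha> - 1) * \<bar>mittag_leffler \<alpha> \<alpha> (- l * s powr \<alpha>)\<bar>) \<le> C * s powr 0"
    "\<And>l s. l > 0 \<Longrightarrow> s \<ge> 0 \<Longrightarrow> 1 * (s powr (\<alpha> - 1 - 1) * \<bar>mittag_leffler \<alpha> (\<alpha> - 1) (- l * s powr \<alpha>)\<bar>) \<le> C * s powr (\<alpha> - 2)"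
proof -
  obtain C where C: "C > 0"
    and b1: "\<And>x. x \<ge> 0 \<Longrightarrow> \<bar>mittag_leffler \<alpha> 1 (- x)\<bar> \<le> C"
    and b2: "\<And>x. x \<ge> 0 \<Longrightarrow> (1 + x powr (1 / \<alpha>)) * \<bar>mittag_leffler \<alpha> 2 (- x)\<bar> \<le> C"
    and b3: "\<And>x. x \<ge> 0 \<Longrightarrow> (1 + x) * \<bar>mittag_leffler \<alpha> \<alpha> (- x)\<bar> \<le> C"
    and b4: "\<And>x. x \<ge> 0 \<Longrightarrow> \<bar>mittag_leffler \<alpha> (\<alpha> - 1) (- x)\<bar> \<le> C"
    using mittag_leffler_bounds[OF \<alpha>] by blast
  define \<gamma> where "\<gamma> = 1 / \<alpha>"
  have g: "1/2 < \<gamma>" "\<gamma> < 1" "\<alpha> * \<gamma> = 1" using \<alpha> by (auto simp: \<gamma>_def field_simps)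
  have pw: "(l * s powr \<alpha>) powr r = l powr r * s powr (\<alpha> * r)" if "l > 0" "s \<ge> 0" for l s r
    using that by (simp add: powr_mult powr_powr)
  have le1: "x powr r \<le> 1 + x" if "x \<ge> 0" "0 \<le> r" "r \<le> 1" for x r :: real
  proof (cases "x \<le> 1")
    case True
    then have "x powr r \<le> 1" using that by (intro powr_le1) auto
    then show ?thesis using that by simp
  next
    case False
    then have "x powr r \<le> x powr 1" using that by (intro powr_mono) auto
    then show ?thesis using False by simp
  qed
  have le2: "x powr (1 - \<gamma>) \<le> 1 + x powr \<gamma>" if "x \<ge> 0" for x
  proof (cases "x \<le> 1")
    case True
    then have "x powr (1 - \<gamma>) \<le> 1" using that g by (intro powr_le1) auto
    also have "\<dots> \<le> 1 + x powr \<gamma>" by simp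
    finally show ?thesis .
  next
    case False
    then have "x powr (1 - \<gamma>) \<le> x powr \<gamma>" using g by (intro powr_mono) auto
    then show ?thesis by simp
  qed
  have E2: "x powr r * \<bar>mittag_leffler \<alpha> 2 (- x)\<bar> \<le> C" if "x \<ge> 0" "r = \<gamma> \<or> r = 1 - \<gamma>" for x r
  proof -
    have "x powr r * \<bar>mittag_leffler \<alpha> 2 (- x)\<bar> \<le> (1 + x powr \<gamma>) * \<bar>mittag_leffler \<alpha> 2 (- x)\<bar>"
      using that le2[of x] by (intro mult_right_mono) auto
    then show ?thesis using b2[OF that(1)] by (simp add: \<gamma>_def)
  qed
  have E3: "x powr r * \<bar>mittag_leffler \<alpha> \<alpha> (- x)\<bar> \<le> C" if "x \<ge> 0" "r = \<gamma> \<or> r = 1 - \<gamma>" for x r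
  proof -
    have "x powr r * \<bar>mittag_leffler \<alpha> \<alpha> (- x)\<bar> \<le> (1 + x) * \<bar>mittag_leffler \<alpha> \<alpha> (- x)\<bar>"
      using that le1[of x r] g by (intro mult_right_mono) auto
    then show ?thesis using b3[OF that(1)] by simp
  qed
  show thesis
  proof (rule that[OF C])
    fix l s :: real assume l: "l > 0" and s: "s \<ge> 0"
    define x where "x = l * s powr \<alpha>"
    have x: "x \<ge> 0" using l s by (simp add: x_def)
    have xm: "- l * s powr \<alpha> = - x" by (simp add: x_def)
    have xg: "x powr \<gamma> = l powr \<gamma> * s" using pw[OF l s, of \<gamma>] g s by (simp add: x_def)
    have xg': "x powr (1 - \<gamma>) = l powr (1 - \<gamma>) * s powr (\<alpha> - 1)" using pw[OF l s, of "1 - \<gamma>"] g by (simp add: x_def right_diff_distrib)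
    show "\<bar>mittag_leffler \<alpha> 1 (- l * s powr \<alpha>)\<bar> \<le> C" unfolding xm by (rule b1[OF x])
    show "l powr (1/\<alpha>) * \<bar>s * mittag_leffler \<alpha> 2 (- l * s powr \<alpha>)\<bar> \<le> C"
      using E2[OF x, of \<gamma>] s unfolding xm xg \<gamma>_def[symmetric] by (simp add: abs_mult mult.assoc)
    show "l powr (1 - 1/\<alpha>) * (s powr (\<alpha> - 1) * \<bar>mittag_leffler \<alpha> \<alpha> (- l * s powr \<alpha>)\<bar>) \<le> C * s powr 0"
    proof (cases "s = 0")
      case False
      then show ?thesis using E3[OF x, of "1 - \<gamma>"] s unfolding xm xg' \<gamma>_def[symmetric] by (simp add: mult.assoc)
    qed simp
    show "1 * (s powr (\<alpha> - 1 - 1) * \<bar>mittag_leffler \<alpha> (\<alpha> - 1) (- l * s powr \<alpha>)\<bar>) \<le> C * s powr (\<alpha> - 2)"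
      using mult_left_mono[OF b4[OF x], of "s powr (\<alpha> - 2)"] unfolding xm by (simp add: mult.commute)
    show "l powr (1 - 1/\<alpha>) * \<bar>s * mittag_leffler \<alpha> 2 (- l * s powr \<alpha>)\<bar> \<le> C * s powr (2 - \<alpha>)"
    proof -
      have "s powr (2 - \<alpha>) * s powr (\<alpha> - 1) = s" using s by (cases "s = 0") (auto simp flip: powr_add)
      then have "l powr (1 - \<gamma>) * \<bar>s * mittag_leffler \<alpha> 2 (- x)\<bar> = s powr (2 - \<alpha>) * (x powr (1 - \<gamma>) * \<bar>mittag_leffler \<alpha> 2 (- x)\<bar>)"
        unfolding xg' using s by (simp add: abs_mult mult.assoc mult.left_commute) (metis mult.assoc mult.commute)
      also have "\<dots> \<le> s powr (2 - \<alpha>) * C" by (intro mult_left_mono E2 x) auto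
      finally show ?thesis unfolding xm \<gamma>_def[symmetric] by (simp add: mult.commute)
    qed
    show "l * (s powr (\<alpha> - 1) * \<bar>mittag_leffler \<alpha> \<alpha> (- l * s powr \<alpha>)\<bar>) \<le> C * l powr (1/\<alpha>)"
    proof -
      have "l = l powr \<gamma> * l powr (1 - \<gamma>)" using l by (simp flip: powr_add)
      then have "l * (s powr (\<alpha> - 1) * \<bar>mittag_leffler \<alpha> \<alpha> (- x)\<bar>) = l powr \<gamma> * (x powr (1 - \<gamma>) * \<bar>mittag_leffler \<alpha> \<alpha> (- x)\<bar>)"
        unfolding xg' by (metis mult.assoc)
      also have "\<dots> \<le> l powr \<gamma> * C" by (intro mult_left_mono E3 x) auto
      finally show ?thesis unfolding xm \<gamma>_def[symmetric] by (simp add: mult.commute)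
    qed
    show "l powr (1/\<alpha>) * (s powr (\<alpha> - 1) * \<bar>mittag_leffler \<alpha> \<alpha> (- l * s powr \<alpha>)\<bar>) \<le> C * s powr (\<alpha> - 2)"
    proof -
      have "s * s powr (\<alpha> - 2) = s powr (\<alpha> - 1)" using s by (cases "s = 0") (auto simp: powr_diff power2_eq_square)
      then have "l powr \<gamma> * (s powr (\<alpha> - 1) * \<bar>mittag_leffler \<alpha> \<alpha> (- x)\<bar>) = s powr (\<alpha> - 2) * (x powr \<gamma> * \<bar>mittag_leffler \<alpha> \<alpha> (- x)\<bar>)"
        unfolding xg by (metis mult.assoc mult.commute)
      also have "\<dots> \<le> s powr (\<alpha> - 2) * C" by (intro mult_left_mono E3 x) auto
      finally show ?thesis unfolding xm \<gamma>_def[symmetric] by (simp add: mult.commute)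
    qed
  qed
qed

text \<open>The three conjuncts are the estimates of the solution in \<open>V\<^sub>\<gamma>\<close>, of its time
derivative in \<open>L\<^sup>2\<close> and of \<open>A\<close> applied to the solution in the dual of
\<open>V\<^sub>\<gamma>\<close>, for \<open>\<gamma> = 1/\<alpha>\<close>, restricted to the modes in
\<open>K\<close>.  The exponent \<open>0\<close> in the last one keeps the three convolution kernels in one
shape.\<close>

definition solution_bounds :: "real \<Rightarrow> (nat \<Rightarrow> real) \<Rightarrow> real \<Rightarrow> bool" where
  "solution_bounds \<alpha> l C \<longleftrightarrow> C > 0 \<and>
     (\<forall>K c d f t. finite K \<longrightarrow> t \<ge> 0 \<longrightarrow> (\<forall>n\<in>K. continuous_on {0..t} (f n)) \<longrightarrow>
      L2_set (\<lambda>n. l n powr (1/\<alpha>) * frac_sol \<alpha> (l n) (c n) (d n) (f n) t) K \<le>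
       C * (L2_set (\<lambda>n. l n powr (1/\<alpha>) * c n) K + L2_set d K + (LINT \<tau>:{0..t}|lebesgue. (t - \<tau>) powr (\<alpha> - 2) * L2_set (\<lambda>n. f n \<tau>) K)) \<and>
      L2_set (\<lambda>n. frac_sol' \<alpha> (l n) (c n) (d n) (f n) t) K \<le>
       C * (L2_set (\<lambda>n. l n powr (1/\<alpha>) * c n) K + L2_set d K + (LINT \<tau>:{0..t}|lebesgue. (t - \<tau>) powr (\<alpha> - 2) * L2_set (\<lambda>n. f n \<tau>) K)) \<and>
      L2_set (\<lambda>n. l n powr (1 - 1/\<alpha>) * frac_sol \<alpha> (l n) (c n) (d n) (f n) t) K \<le>
       C * (L2_set (\<lambda>n. l n powr (1/\<alpha>) * c n) K + t powr (2 - \<alpha>) * L2_set d K + (LINT \<tau>:{0..t}|lebesgue. (t - \<tau>) powr 0 * L2_set (\<lambda>n. f n \<tau>) K)))"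

lemma solution_boundsD:
  assumes "solution_bounds \<alpha> l C" "finite K" "t \<ge> 0" "\<And>n. n \<in> K \<Longrightarrow> continuous_on {0..t} (f n)"
  shows "L2_set (\<lambda>n. l n powr (1/\<alpha>) * frac_sol \<alpha> (l n) (c n) (d n) (f n) t) K \<le>
       C * (L2_set (\<lambda>n. l n powr (1/\<alpha>) * c n) K + L2_set d K + (LINT \<tau>:{0..t}|lebesgue. (t - \<tau>) powr (\<alpha> - 2) * L2_set (\<lambda>n. f n \<tau>) K))"
    "L2_set (\<lambda>n. frac_sol' \<alpha> (l n) (c n) (d n) (f n) t) K \<le>
       C * (L2_set (\<lambda>n. l n powr (1/\<alpha>) * c n) K + L2_set d K + (LINT \<tau>:{0..t}|lebesgue. (t - \<tau>) powr (\<alpha> - 2) * L2_set (\<lambda>n. f n \<tau>) K))"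
    "L2_set (\<lambda>n. l n powr (1 - 1/\<alpha>) * frac_sol \<alpha> (l n) (c n) (d n) (f n) t) K \<le>
       C * (L2_set (\<lambda>n. l n powr (1/\<alpha>) * c n) K + t powr (2 - \<alpha>) * L2_set d K + (LINT \<tau>:{0..t}|lebesgue. (t - \<tau>) powr 0 * L2_set (\<lambda>n. f n \<tau>) K))"
  using assms unfolding solution_bounds_def by blast+

text \<open>The lower bound for the eigenvalues enters in the last estimate only: there the initial value is weighted with
the exponent \<open>1 - 1/\<alpha>\<close> instead of the larger exponent \<open>1/\<alpha>\<close>.\<close>

lemma ex_solution_bounds:
  assumes \<alpha>: "1 < \<alpha>" "\<alpha> < 2" and l0: "l0 > 0" and l: "\<And>n. l n \<ge> l0"
  shows "\<exists>C. solution_bounds \<alpha> l C"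
proof -
  obtain C0 where C0: "C0 > 0"
    and k1: "\<And>l s. l > 0 \<Longrightarrow> s \<ge> 0 \<Longrightarrow> \<bar>mittag_leffler \<alpha> 1 (- l * s powr \<alpha>)\<bar> \<le> C0"
    and k2: "\<And>l s. l > 0 \<Longrightarrow> s \<ge> 0 \<Longrightarrow> l powr (1/\<alpha>) * \<bar>s * mittag_leffler \<alpha> 2 (- l * s powr \<alpha>)\<bar> \<le> C0"
    and k3: "\<And>l s. l > 0 \<Longrightarrow> s \<ge> 0 \<Longrightarrow> l powr (1 - 1/\<alpha>) * \<bar>s * mittag_leffler \<alpha> 2 (- l * s powr \<alpha>)\<bar> \<le> C0 * s powr (2 - \<alpha>)"
    and k4: "\<And>l s. l > 0 \<Longrightarrow> s \<ge> 0 \<Longrightarrow> l * (s powr (\<alpha> - 1) * \<bar>mittag_leffler \<alpha> \<alpha> (- l * s powr \<alpha>)\<bar>) \<le> C0 * l powr (1/\<alpha>)"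
    and k5: "\<And>l s. l > 0 \<Longrightarrow> s \<ge> 0 \<Longrightarrow> l powr (1/\<alpha>) * (s powr (\<alpha> - 1) * \<bar>mittag_leffler \<alpha> \<alpha> (- l * s powr \<alpha>)\<bar>) \<le> C0 * s powr (\<alpha> - 2)"
    and k6: "\<And>l s. l > 0 \<Longrightarrow> s \<ge> 0 \<Longrightarrow> l powr (1 - 1/\<alpha>) * (s powr (\<alpha> - 1) * \<bar>mittag_leffler \<alpha> \<alpha> (- l * s powr \<alpha>)\<bar>) \<le> C0 * s powr 0"
    and k7: "\<And>l s. l > 0 \<Longrightarrow> s \<ge> 0 \<Longrightarrow> 1 * (s powr (\<alpha> - 1 - 1) * \<bar>mittag_leffler \<alpha> (\<alpha> - 1) (- l * s powr \<alpha>)\<bar>) \<le> C0 * s powr (\<alpha> - 2)"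
    using mittag_leffler_kernel_bounds[OF \<alpha>] by blast
  \<comment> \<open>compares the powers of the eigenvalues with the exponents \<open>1 - 1/\<alpha>\<close> and
\<open>1/\<alpha>\<close>\<close>
  define R where "R = max 1 (l0 powr (1 - 2/\<alpha>))"
  define C where "C = C0 * R"
  have R: "R \<ge> 1" by (simp add: R_def)
  have C: "C > 0" "C0 \<le> C" using C0 R by (auto simp: C_def)
  have cc: "l powr (1 - 1/\<alpha>) \<le> R * l powr (1/\<alpha>)" if "l \<ge> l0" for l
  proof -
    have e: "1 - 2/\<alpha> \<le> 0" using \<alpha> by (simp add: field_simps)
    have "l powr (1 - 1/\<alpha>) = l powr (1 - 2/\<alpha>) * l powr (1/\<alpha>)" by (simp flip: powr_add)
    also have "l powr (1 - 2/\<alpha>) \<le> l0 powr (1 - 2/\<alpha>)" using that l0 e by (intro powr_mono2') auto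
    also have "\<dots> \<le> R" by (simp add: R_def)
    finally show ?thesis by (simp add: mult_right_mono)
  qed
  show ?thesis unfolding solution_bounds_def
  proof (intro exI[of _ C] conjI C(1) allI impI)
    fix K :: "nat set" and c d :: "nat \<Rightarrow> real" and f :: "nat \<Rightarrow> real \<Rightarrow> real" and t :: real
    assume K: "finite K" and t: "t \<ge> 0" and f: "\<forall>n\<in>K. continuous_on {0..t} (f n)"
    have lp: "l n > 0" if "n \<in> K" for n using l[of n] l0 by linarith
    define S1 where "S1 = L2_set (\<lambda>n. l n powr (1/\<alpha>) * c n) K"
    define S2 where "S2 = L2_set d K"
    define I where "I e = (LINT \<tau>:{0..t}|lebesgue. (t - \<tau>) powr e * L2_set (\<lambda>n. f n \<tau>) K)" for e
    have nn: "S1 \<ge> 0" "S2 \<ge> 0" "I e \<ge> 0" for e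
      unfolding S1_def S2_def I_def set_lebesgue_integral_def
      by (auto intro!: Bochner_Integration.integral_nonneg simp: L2_set_nonneg)
    have tri: "L2_set (\<lambda>n. x n + y n + z n) K \<le> L2_set x K + L2_set y K + L2_set z K" for x y z :: "nat \<Rightarrow> real"
      using L2_set_triangle_ineq[of "\<lambda>n. x n + y n" z K] L2_set_triangle_ineq[of x y K] by linarith
    have fin: "L2_set (\<lambda>n. x n + y n + z n) K \<le> C * (S1 + A * S2 + J)"
      if "L2_set x K \<le> C * S1" "L2_set y K \<le> C0 * A * S2" "L2_set z K \<le> C0 * J" "J \<ge> 0" "A \<ge> 0" for x y z :: "nat \<Rightarrow> real" and J A
    proof -
      have "C0 * A * S2 \<le> C * (A * S2)" "C0 * J \<le> C * J"
        using C(2) that nn mult_right_mono[OF C(2), of "A * S2"] by (auto simp: mult_right_mono mult.assoc)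
      then show ?thesis using tri[of x y z] that by (simp add: distrib_left)
    qed
    have "L2_set (\<lambda>n. l n powr (1/\<alpha>) * frac_sol \<alpha> (l n) (c n) (d n) (f n) t) K =
       L2_set (\<lambda>n. l n powr (1/\<alpha>) * c n * mittag_leffler \<alpha> 1 (- l n * t powr \<alpha>) + d n * (l n powr (1/\<alpha>) * (t * mittag_leffler \<alpha> 2 (- l n * t powr \<alpha>)))
          + l n powr (1/\<alpha>) * ml_conv \<alpha> (l n) \<alpha> (f n) t) K"
      by (simp add: frac_sol_def algebra_simps)
    also have "\<dots> \<le> C * (S1 + 1 * S2 + I (\<alpha> - 2))"
    proof (rule fin)
      show "L2_set (\<lambda>n. l n powr (1/\<alpha>) * c n * mittag_leffler \<alpha> 1 (- l n * t powr \<alpha>)) K \<le> C * S1"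
        unfolding S1_def
      proof (rule L2_set_scaled_le)
        fix n assume n: "n \<in> K"
        have "\<bar>mittag_leffler \<alpha> 1 (- l n * t powr \<alpha>)\<bar> \<le> C" using k1[OF lp[OF n] t] C by linarith
        then show "\<bar>l n powr (1/\<alpha>) * c n * mittag_leffler \<alpha> 1 (- l n * t powr \<alpha>)\<bar> \<le> C * \<bar>l n powr (1/\<alpha>) * c n\<bar>"
          unfolding abs_mult[of "l n powr (1/\<alpha>) * c n"] by (subst mult.commute) (rule mult_right_mono, auto)
      qed (use C in simp)
      show "L2_set (\<lambda>n. d n * (l n powr (1/\<alpha>) * (t * mittag_leffler \<alpha> 2 (- l n * t powr \<alpha>)))) K \<le> C0 * 1 * S2"
        unfolding S2_def
      proof (rule L2_set_scaled_le)
        fix n assume n: "n \<in> K"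
        have "\<bar>l n powr (1/\<alpha>) * (t * mittag_leffler \<alpha> 2 (- l n * t powr \<alpha>))\<bar> \<le> C0" using k2[OF lp[OF n] t] by (simp add: abs_mult)
        then show "\<bar>d n * (l n powr (1/\<alpha>) * (t * mittag_leffler \<alpha> 2 (- l n * t powr \<alpha>)))\<bar> \<le> C0 * 1 * \<bar>d n\<bar>"
          unfolding abs_mult[of "d n"] by (subst mult.commute) (simp add: mult_right_mono)
      qed (use C0 in simp)
      show "L2_set (\<lambda>n. l n powr (1/\<alpha>) * ml_conv \<alpha> (l n) \<alpha> (f n) t) K \<le> C0 * I (\<alpha> - 2)"
        unfolding I_def by (rule ml_conv_L2_set_bound[OF K]) (use \<alpha> t f C0 lp k5 in auto)
    qed (use nn in auto)
    finally show "L2_set (\<lambda>n. l n powr (1/\<alpha>) * frac_sol \<alpha> (l n) (c n) (d n) (f n) t) K \<le>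
       C * (L2_set (\<lambda>n. l n powr (1/\<alpha>) * c n) K + L2_set d K + (LINT \<tau>:{0..t}|lebesgue. (t - \<tau>) powr (\<alpha> - 2) * L2_set (\<lambda>n. f n \<tau>) K))"
      by (simp add: S1_def S2_def I_def)
    have "L2_set (\<lambda>n. frac_sol' \<alpha> (l n) (c n) (d n) (f n) t) K =
       L2_set (\<lambda>n. c n * (- l n * t powr (\<alpha> - 1) * mittag_leffler \<alpha> \<alpha> (- l n * t powr \<alpha>)) + d n * mittag_leffler \<alpha> 1 (- l n * t powr \<alpha>)
          + 1 * ml_conv \<alpha> (l n) (\<alpha> - 1) (f n) t) K"
      by (simp add: frac_sol'_def)
    also have "\<dots> \<le> C * (S1 + 1 * S2 + I (\<alpha> - 2))"
    proof (rule fin)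
      show "L2_set (\<lambda>n. c n * (- l n * t powr (\<alpha> - 1) * mittag_leffler \<alpha> \<alpha> (- l n * t powr \<alpha>))) K \<le> C * S1"
        unfolding S1_def
      proof (rule L2_set_scaled_le)
        fix n assume n: "n \<in> K"
        have "\<bar>l n * t powr (\<alpha> - 1) * mittag_leffler \<alpha> \<alpha> (- l n * t powr \<alpha>)\<bar> \<le> C0 * l n powr (1/\<alpha>)"
          using k4[OF lp[OF n] t] lp[OF n] by (simp add: abs_mult mult.assoc)
        also have "\<dots> \<le> C * l n powr (1/\<alpha>)" using C by (intro mult_right_mono) auto
        finally have "\<bar>c n\<bar> * \<bar>l n * t powr (\<alpha> - 1) * mittag_leffler \<alpha> \<alpha> (- l n * t powr \<alpha>)\<bar> \<le> \<bar>c n\<bar> * (C * l n powr (1/\<alpha>))"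
          by (rule mult_left_mono) simp
        then show "\<bar>c n * (- l n * t powr (\<alpha> - 1) * mittag_leffler \<alpha> \<alpha> (- l n * t powr \<alpha>))\<bar> \<le> C * \<bar>l n powr (1/\<alpha>) * c n\<bar>"
          by (simp add: abs_mult ac_simps)
      qed (use C in simp)
      show "L2_set (\<lambda>n. d n * mittag_leffler \<alpha> 1 (- l n * t powr \<alpha>)) K \<le> C0 * 1 * S2"
        unfolding S2_def
      proof (rule L2_set_scaled_le)
        fix n assume n: "n \<in> K"
        show "\<bar>d n * mittag_leffler \<alpha> 1 (- l n * t powr \<alpha>)\<bar> \<le> C0 * 1 * \<bar>d n\<bar>"
          unfolding abs_mult[of "d n"] using k1[OF lp[OF n] t] by (subst mult.commute) (simp add: mult_right_mono)
      qed (use C0 in simp)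
      show "L2_set (\<lambda>n. 1 * ml_conv \<alpha> (l n) (\<alpha> - 1) (f n) t) K \<le> C0 * I (\<alpha> - 2)"
        unfolding I_def by (rule ml_conv_L2_set_bound[OF K]) (use \<alpha> t f C0 lp k7 in auto)
    qed (use nn in auto)
    finally show "L2_set (\<lambda>n. frac_sol' \<alpha> (l n) (c n) (d n) (f n) t) K \<le>
       C * (L2_set (\<lambda>n. l n powr (1/\<alpha>) * c n) K + L2_set d K + (LINT \<tau>:{0..t}|lebesgue. (t - \<tau>) powr (\<alpha> - 2) * L2_set (\<lambda>n. f n \<tau>) K))"
      by (simp add: S1_def S2_def I_def)
    have "L2_set (\<lambda>n. l n powr (1 - 1/\<alpha>) * frac_sol \<alpha> (l n) (c n) (d n) (f n) t) K =
       L2_set (\<lambda>n. l n powr (1 - 1/\<alpha>) * c n * mittag_leffler \<alpha> 1 (- l n * t powr \<alpha>) + d n * (l n powr (1 - 1/\<alpha>) * (t * mittag_leffler \<alpha> 2 (- l n * t powr \<alpha>)))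
          + l n powr (1 - 1/\<alpha>) * ml_conv \<alpha> (l n) \<alpha> (f n) t) K"
      by (simp add: frac_sol_def algebra_simps)
    also have "\<dots> \<le> C * (S1 + t powr (2 - \<alpha>) * S2 + I 0)"
    proof (rule fin)
      show "L2_set (\<lambda>n. l n powr (1 - 1/\<alpha>) * c n * mittag_leffler \<alpha> 1 (- l n * t powr \<alpha>)) K \<le> C * S1"
        unfolding S1_def
      proof (rule L2_set_scaled_le)
        fix n assume n: "n \<in> K"
        have "l n powr (1 - 1/\<alpha>) * \<bar>mittag_leffler \<alpha> 1 (- l n * t powr \<alpha>)\<bar> \<le> (R * l n powr (1/\<alpha>)) * C0"
          using cc[OF l] k1[OF lp[OF n] t] R by (intro mult_mono) auto
        then have "\<bar>c n\<bar> * (l n powr (1 - 1/\<alpha>) * \<bar>mittag_leffler \<alpha> 1 (- l n * t powr \<alpha>)\<bar>) \<le> \<bar>c n\<bar> * ((R * l n powr (1/\<alpha>)) * C0)"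
          by (rule mult_left_mono) simp
        then show "\<bar>l n powr (1 - 1/\<alpha>) * c n * mittag_leffler \<alpha> 1 (- l n * t powr \<alpha>)\<bar> \<le> C * \<bar>l n powr (1/\<alpha>) * c n\<bar>"
          unfolding C_def by (simp add: abs_mult ac_simps)
      qed (use C in simp)
      show "L2_set (\<lambda>n. d n * (l n powr (1 - 1/\<alpha>) * (t * mittag_leffler \<alpha> 2 (- l n * t powr \<alpha>)))) K \<le> C0 * t powr (2 - \<alpha>) * S2"
        unfolding S2_def
      proof (rule L2_set_scaled_le)
        fix n assume n: "n \<in> K"
        have "\<bar>l n powr (1 - 1/\<alpha>) * (t * mittag_leffler \<alpha> 2 (- l n * t powr \<alpha>))\<bar> \<le> C0 * t powr (2 - \<alpha>)" using k3[OF lp[OF n] t] by (simp add: abs_mult)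
        then show "\<bar>d n * (l n powr (1 - 1/\<alpha>) * (t * mittag_leffler \<alpha> 2 (- l n * t powr \<alpha>)))\<bar> \<le> C0 * t powr (2 - \<alpha>) * \<bar>d n\<bar>"
          unfolding abs_mult[of "d n"] by (subst mult.commute) (rule mult_right_mono, auto)
      qed (use C0 in simp)
      show "L2_set (\<lambda>n. l n powr (1 - 1/\<alpha>) * ml_conv \<alpha> (l n) \<alpha> (f n) t) K \<le> C0 * I 0"
        unfolding I_def by (rule ml_conv_L2_set_bound[OF K]) (use \<alpha> t f C0 lp k6 in auto)
    qed (use nn in auto)
    finally show "L2_set (\<lambda>n. l n powr (1 - 1/\<alpha>) * frac_sol \<alpha> (l n) (c n) (d n) (f n) t) K \<le>
       C * (L2_set (\<lambda>n. l n powr (1/\<alpha>) * c n) K + t powr (2 - \<alpha>) * L2_set d K + (LINT \<tau>:{0..t}|lebesgue. (t - \<tau>) powr 0 * L2_set (\<lambda>n. f n \<tau>) K))"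
      by (simp add: S1_def S2_def I_def)
  qed
qed


section \<open>Convolution with the source\<close>

text \<open>Hoelder's inequality with the norm of the kernel computed.  Young's inequality is applied to the integrand
scaled by \<open>A\<close>, the norm of the kernel, and by some \<open>b > B\<close>, which is positive even
if \<open>B = 0\<close>.\<close>

lemma frac_holder:
  fixes G :: "real \<Rightarrow> real"
  assumes pq: "p > 1" "q > 1" "1/p + 1/q = 1" and e: "e * p > -1" and t: "t \<ge> 0"
    and G: "continuous_on {0..t} G" "\<And>\<tau>. \<tau> \<in> {0..t} \<Longrightarrow> G \<tau> \<ge> 0"
    and B: "B \<ge> 0" "(LINT \<tau>:{0..t}|lebesgue. G \<tau> powr q) \<le> B powr q"
  shows "(LINT \<tau>:{0..t}|lebesgue. (t - \<tau>) powr e * G \<tau>) \<le> (1 / (e * p + 1)) powr (1/p) * t powr (e + 1/p) * B"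
proof (cases "t = 0")
  case True
  have "(LINT \<tau>:{0..t}|lebesgue. (t - \<tau>) powr e * G \<tau>) = (LINT \<tau>:{0..t}|lebesgue. 0)"
    by (rule set_lebesgue_integral_cong) (use True in auto)
  then show ?thesis using B by simp
next
  case False
  then have t0: "t > 0" using t by simp
  have ep: "e * p + 1 > 0" using e by simp
  have e1: "e > -1"
  proof (rule ccontr)
    assume "\<not> e > -1"
    then have "e * p \<le> -1 * p" using pq by (intro mult_right_mono) auto
    then show False using e pq by simp
  qed
  define A where "A = (t powr (e * p + 1) / (e * p + 1)) powr (1/p)"
  have A: "A > 0" using t0 ep by (simp add: A_def)
  have Ap: "A powr p = t powr (e * p + 1) / (e * p + 1)" using t0 ep pq by (simp add: A_def powr_powr)
  have A_eq: "A = (1 / (e * p + 1)) powr (1/p) * t powr (e + 1/p)"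
  proof -
    have "(e * p + 1) / p = e + 1/p" using pq by (simp add: field_simps)
    then show ?thesis using t0 ep by (simp add: A_def powr_divide powr_powr)
  qed
  note ki = frac_kernel[of "e * p + 1" t, simplified]
  have Gq: "continuous_on {0..t} (\<lambda>\<tau>. G \<tau> powr q)"
    using G pq by (intro continuous_on_powr' continuous_intros) auto
  have Gqi: "set_integrable lebesgue {0..t} (\<lambda>\<tau>. G \<tau> powr q)"
    using absolutely_integrable_continuous_real[OF Gq] by simp
  have i: "set_integrable lebesgue {0..t} (\<lambda>\<tau>. (t - \<tau>) powr e * G \<tau>)"
    using frac_integrand_integrable[of "e + 1" t G] e1 t G by simp
  have main: "(LINT \<tau>:{0..t}|lebesgue. (t - \<tau>) powr e * G \<tau>) \<le> A * b" if b: "b > B" for b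
  proof -
    have b0: "b > 0" using b B by simp
    have pt: "(t - \<tau>) powr e * G \<tau> \<le> A * b * ((1 / (p * A powr p)) * (t - \<tau>) powr (e * p) + (1 / (q * b powr q)) * G \<tau> powr q)"
      if \<tau>: "\<tau> \<in> {0..t}" for \<tau>
    proof -
      have "((t - \<tau>) powr e / A) * (G \<tau> / b) \<le> ((t - \<tau>) powr e / A) powr p / p + (G \<tau> / b) powr q / q"
        using pq A b0 G(2)[OF \<tau>] by (intro Youngs_inequality) auto
      also have "\<dots> = (1 / (p * A powr p)) * (t - \<tau>) powr (e * p) + (1 / (q * b powr q)) * G \<tau> powr q"
        using A b0 G(2)[OF \<tau>] by (simp add: powr_divide powr_powr mult.commute)
      finally have "A * b * (((t - \<tau>) powr e / A) * (G \<tau> / b)) \<le> A * b * ((1 / (p * A powr p)) * (t - \<tau>) powr (e * p) + (1 / (q * b powr q)) * G \<tau> powr q)"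
        using A b0 by (intro mult_left_mono) auto
      then show ?thesis using A b0 by simp
    qed
    have "(LINT \<tau>:{0..t}|lebesgue. (t - \<tau>) powr e * G \<tau>) \<le>
       (LINT \<tau>:{0..t}|lebesgue. A * b * ((1 / (p * A powr p)) * (t - \<tau>) powr (e * p) + (1 / (q * b powr q)) * G \<tau> powr q))"
      by (rule set_integral_mono[OF i _ pt])
         (intro set_integrable_mult_right set_integral_add(1) Gqi, use ki ep t in auto)
    also have "\<dots> = A * b * ((1 / (p * A powr p)) * (LINT \<tau>:{0..t}|lebesgue. (t - \<tau>) powr (e * p)) + (1 / (q * b powr q)) * (LINT \<tau>:{0..t}|lebesgue. G \<tau> powr q))"
      using ki ep t Gqi by (simp add: set_integral_add(2))
    also have "(LINT \<tau>:{0..t}|lebesgue. (t - \<tau>) powr (e * p)) = A powr p" using ki ep t Ap by simp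
    also have "A * b * ((1 / (p * A powr p)) * (A powr p) + (1 / (q * b powr q)) * (LINT \<tau>:{0..t}|lebesgue. G \<tau> powr q)) \<le> A * b * (1/p + 1/q)"
    proof (intro mult_left_mono add_mono)
      show "(1 / (p * A powr p)) * (A powr p) \<le> 1/p" using A by simp
      have "(LINT \<tau>:{0..t}|lebesgue. G \<tau> powr q) \<le> b powr q"
        using B b pq powr_mono2[of q B b] by linarith
      then have "(1 / (q * b powr q)) * (LINT \<tau>:{0..t}|lebesgue. G \<tau> powr q) \<le> (1 / (q * b powr q)) * b powr q"
        using pq by (intro mult_left_mono) auto
      then show "(1 / (q * b powr q)) * (LINT \<tau>:{0..t}|lebesgue. G \<tau> powr q) \<le> 1/q" using b0 by simp
    qed (use A b0 in auto)
    finally show ?thesis using pq by simp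
  qed
  have "(LINT \<tau>:{0..t}|lebesgue. (t - \<tau>) powr e * G \<tau>) \<le> A * B"
  proof (rule field_le_epsilon)
    fix \<epsilon> :: real assume "\<epsilon> > 0"
    then show "(LINT \<tau>:{0..t}|lebesgue. (t - \<tau>) powr e * G \<tau>) \<le> A * B + \<epsilon>"
      using main[of "B + \<epsilon> / A"] A by (simp add: distrib_left)
  qed
  then show ?thesis by (simp add: A_eq)
qed

lemma frac_sup_bound:
  fixes G :: "real \<Rightarrow> real"
  assumes e: "e > -1" and t: "t \<ge> 0" and G: "continuous_on {0..t} G"
    and B: "AE \<tau> in lebesgue. \<tau> \<in> {0<..<t} \<longrightarrow> G \<tau> \<le> B"
  shows "(LINT \<tau>:{0..t}|lebesgue. (t - \<tau>) powr e * G \<tau>) \<le> (1 / (e + 1)) * t powr (e + 1) * B"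
proof -
  have i: "set_integrable lebesgue {0..t} (\<lambda>\<tau>. (t - \<tau>) powr e * G \<tau>)"
    using frac_integrand_integrable[of "e + 1" t G] e t G by simp
  note k = frac_kernel[of "e + 1" t, simplified]
  have ki: "set_integrable lebesgue {0..t} (\<lambda>\<tau>. (t - \<tau>) powr e * B)" using k(1) e t by simp
  have "(LINT \<tau>:{0..t}|lebesgue. (t - \<tau>) powr e * G \<tau>) \<le> (LINT \<tau>:{0..t}|lebesgue. (t - \<tau>) powr e * B)"
    unfolding set_lebesgue_integral_def
  proof (rule integral_mono_AE)
    have z: "AE \<tau> in lebesgue. \<tau> \<noteq> (0::real)" "AE \<tau> in lebesgue. \<tau> \<noteq> t"
      by (rule AE_completion, rule AE_lborel_singleton)+
    show "AE \<tau> in lebesgue. indicator {0..t} \<tau> *\<^sub>R ((t - \<tau>) powr e * G \<tau>) \<le> indicator {0..t} \<tau> *\<^sub>R ((t - \<tau>) powr e * B)"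
      using B z by eventually_elim (auto simp: indicator_def intro!: mult_left_mono)
  qed (use i ki in \<open>auto simp: set_integrable_def\<close>)
  also have "\<dots> = t powr (e + 1) / (e + 1) * B" using k(2) e t by simp
  finally show ?thesis by simp
qed

lemma set_integral_powr_le:
  fixes G r :: "real \<Rightarrow> real"
  assumes G: "continuous_on {0..T} G" "\<And>\<tau>. \<tau> \<in> {0..T} \<Longrightarrow> G \<tau> \<ge> 0" and q: "q > 0"
    and le: "AE \<tau> in lebesgue_on {0<..<T}. G \<tau> \<le> r \<tau>"
    and r: "integrable (lebesgue_on {0<..<T}) (\<lambda>\<tau>. r \<tau> powr q)" and t: "t \<in> {0..T}"
  shows "(LINT \<tau>:{0..t}|lebesgue. G \<tau> powr q) \<le> (LINT \<tau>|lebesgue_on {0<..<T}. r \<tau> powr q)"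
proof -
  have Gt: "continuous_on {0..t} G" using G(1) t by (auto intro: continuous_on_subset)
  have Gq: "continuous_on {0..t} (\<lambda>\<tau>. G \<tau> powr q)"
    using G Gt q t by (intro continuous_on_powr' continuous_intros) auto
  have Gqi: "set_integrable lebesgue {0..t} (\<lambda>\<tau>. G \<tau> powr q)"
    using absolutely_integrable_continuous_real[OF Gq] by simp
  have ri: "integrable lebesgue (\<lambda>\<tau>. indicator {0<..<T} \<tau> *\<^sub>R r \<tau> powr q)"
    using r by (subst (asm) integrable_restrict_space) auto
  have "(LINT \<tau>:{0..t}|lebesgue. G \<tau> powr q) \<le> (LINT \<tau>|lebesgue. indicator {0<..<T} \<tau> *\<^sub>R r \<tau> powr q)"
    unfolding set_lebesgue_integral_def
  proof (rule integral_mono_AE[OF _ ri])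
    show "integrable lebesgue (\<lambda>\<tau>. indicator {0..t} \<tau> *\<^sub>R G \<tau> powr q)" using Gqi by (simp add: set_integrable_def)
    have z: "AE \<tau> in lebesgue. \<tau> \<noteq> (0::real)" "AE \<tau> in lebesgue. \<tau> \<noteq> T"
      by (rule AE_completion, rule AE_lborel_singleton)+
    have "AE \<tau> in lebesgue. \<tau> \<in> {0<..<T} \<longrightarrow> G \<tau> \<le> r \<tau>"
      using le by (subst (asm) AE_restrict_space_iff) auto
    then show "AE \<tau> in lebesgue. indicator {0..t} \<tau> *\<^sub>R G \<tau> powr q \<le> indicator {0<..<T} \<tau> *\<^sub>R r \<tau> powr q"
      using z
    proof eventually_elim
      case (elim \<tau>)
      then show ?case using G(2)[of \<tau>] t q by (auto simp: indicator_def intro!: powr_mono2)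
    qed
  qed
  also have "\<dots> = (LINT \<tau>|lebesgue_on {0<..<T}. r \<tau> powr q)"
    by (subst integral_restrict_space) auto
  finally show ?thesis .
qed

text \<open>\<open>B\<close> bounds the norm of \<open>h\<close> in \<open>L\<^sup>q(0,T)\<close> for the exponent
\<open>q\<close> conjugate to \<open>p\<close>, where \<open>q = \<infinity>\<close> for \<open>p = 1\<close>.\<close>

definition Lq_norm_le :: "real \<Rightarrow> real \<Rightarrow> (real \<Rightarrow> real) \<Rightarrow> real \<Rightarrow> bool" where
  "Lq_norm_le T p h B \<longleftrightarrow> B \<ge> 0 \<and> h \<in> borel_measurable (lebesgue_on {0<..<T}) \<and> (\<forall>\<tau>. h \<tau> \<ge> 0) \<and>
    (if p = 1 then AE \<tau> in lebesgue_on {0<..<T}. h \<tau> \<le> B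
     else integrable (lebesgue_on {0<..<T}) (\<lambda>\<tau>. h \<tau> powr (p / (p - 1))) \<and>
       (LINT \<tau>|lebesgue_on {0<..<T}. h \<tau> powr (p / (p - 1))) \<le> B powr (p / (p - 1)))"

lemma source_convolution_bound:
  assumes p: "p \<ge> 1" and h: "Lq_norm_le T p h B"
    and f: "\<And>n. n \<in> K \<Longrightarrow> continuous_on {0..T} (f n)" and K: "finite K"
    and le: "AE \<tau> in lebesgue_on {0<..<T}. L2_set (\<lambda>n. f n \<tau>) K \<le> h \<tau>"
    and e: "e * p > -1" and t: "t \<in> {0..T}"
  shows "(LINT \<tau>:{0..t}|lebesgue. (t - \<tau>) powr e * L2_set (\<lambda>n. f n \<tau>) K) \<le> (1 / (e * p + 1)) powr (1/p) * t powr (e + 1/p) * B"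
proof -
  define G where "G \<tau> = L2_set (\<lambda>n. f n \<tau>) K" for \<tau>
  have Gc: "continuous_on {0..T} G" unfolding G_def L2_set_def using f by (intro continuous_intros) auto
  have Gt: "continuous_on {0..t} G" using Gc t by (auto intro: continuous_on_subset)
  have G0: "G \<tau> \<ge> 0" for \<tau> by (simp add: G_def L2_set_nonneg)
  have B: "B \<ge> 0" using h by (simp add: Lq_norm_le_def)
  show ?thesis unfolding G_def[symmetric]
  proof (cases "p = 1")
    case True
    have hB: "AE \<tau> in lebesgue_on {0<..<T}. h \<tau> \<le> B" using h True by (simp add: Lq_norm_le_def)
    have "AE \<tau> in lebesgue_on {0<..<T}. G \<tau> \<le> B" using le hB unfolding G_def by eventually_elim simp
    then have "AE \<tau> in lebesgue. \<tau> \<in> {0<..<T} \<longrightarrow> G \<tau> \<le> B" by (subst (asm) AE_restrict_space_iff) auto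
    then have "AE \<tau> in lebesgue. \<tau> \<in> {0<..<t} \<longrightarrow> G \<tau> \<le> B" by eventually_elim (use t in auto)
    then have "(LINT \<tau>:{0..t}|lebesgue. (t - \<tau>) powr e * G \<tau>) \<le> (1 / (e + 1)) * t powr (e + 1) * B"
      using e t True Gt by (intro frac_sup_bound) auto
    then show "(LINT \<tau>:{0..t}|lebesgue. (t - \<tau>) powr e * G \<tau>) \<le> (1 / (e * p + 1)) powr (1/p) * t powr (e + 1/p) * B"
      using True e by simp
  next
    case False
    define q where "q = p / (p - 1)"
    have q: "q > 1" "1/p + 1/q = 1" using p False by (auto simp: q_def field_simps)
    have hq: "integrable (lebesgue_on {0<..<T}) (\<lambda>\<tau>. h \<tau> powr q)" "(LINT \<tau>|lebesgue_on {0<..<T}. h \<tau> powr q) \<le> B powr q"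
      using h False by (auto simp: Lq_norm_le_def q_def)
    have "(LINT \<tau>:{0..t}|lebesgue. G \<tau> powr q) \<le> (LINT \<tau>|lebesgue_on {0<..<T}. h \<tau> powr q)"
      using Gc G0 q le hq t by (intro set_integral_powr_le) (auto simp: G_def)
    with hq(2) have "(LINT \<tau>:{0..t}|lebesgue. G \<tau> powr q) \<le> B powr q" by linarith
    then show "(LINT \<tau>:{0..t}|lebesgue. (t - \<tau>) powr e * G \<tau>) \<le> (1 / (e * p + 1)) powr (1/p) * t powr (e + 1/p) * B"
      using p False q e t Gt G0 B by (intro frac_holder[where q=q]) auto
  qed
qed

lemma L2_set_le_of_sums:
  assumes "(\<lambda>n. (y n)\<^sup>2) sums a\<^sup>2" "a \<ge> 0" "finite K" "K \<subseteq> {N..}"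
  shows "L2_set y K \<le> sqrt (max 0 (a\<^sup>2 - (\<Sum>n<N. (y n)\<^sup>2)))"
proof -
  have "(\<Sum>n\<in>K. (y n)\<^sup>2) + (\<Sum>n<N. (y n)\<^sup>2) = (\<Sum>n\<in>K \<union> {..<N}. (y n)\<^sup>2)"
    using assms(3,4) by (subst sum.union_disjoint) auto
  also have "\<dots> \<le> (\<Sum>n. (y n)\<^sup>2)"
    using assms by (intro sum_le_suminf) (auto simp: sums_iff)
  also have "\<dots> = a\<^sup>2" using assms(1) by (simp add: sums_iff)
  finally show ?thesis unfolding L2_set_def by (intro real_sqrt_le_mono) linarith
qed

text \<open>The norms \<open>r N\<close> of the tails of the source decrease to \<open>0\<close> at almost every time and
are dominated by \<open>h\<close>, so they tend to \<open>0\<close> in \<open>L\<^sup>q\<close>.\<close>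

lemma source_convolution_tail_powr:
  assumes T: "T > 0" and p: "p > 1" "q = p / (p - 1)" and e: "e * p > -1" "e + 1/p \<ge> 0"
    and h: "h \<in> borel_measurable (lebesgue_on {0<..<T})" "\<And>\<tau>. h \<tau> \<ge> 0"
    and hq: "integrable (lebesgue_on {0<..<T}) (\<lambda>\<tau>. h \<tau> powr q)"
    and f: "\<And>n::nat. continuous_on {0..T} (f n)"
    and s: "AE \<tau> in lebesgue_on {0<..<T}. (\<lambda>n. (f n \<tau>)\<^sup>2) sums (h \<tau>)\<^sup>2"
    and \<epsilon>: "\<epsilon> > 0"
  obtains N where "\<And>K t. finite K \<Longrightarrow> K \<subseteq> {N..} \<Longrightarrow> t \<in> {0..T} \<Longrightarrow>
     (LINT \<tau>:{0..t}|lebesgue. (t - \<tau>) powr e * L2_set (\<lambda>n. f n \<tau>) K) \<le> \<epsilon>"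
proof -
  have q: "q > 1" unfolding p(2) using p(1) by (simp add: less_divide_eq)
  define r where "r N \<tau> = sqrt (max 0 ((h \<tau>)\<^sup>2 - (\<Sum>n<N. (f n \<tau>)\<^sup>2)))" for N \<tau>
  have fm: "f n \<in> borel_measurable (lebesgue_on {0<..<T})" for n
    by (intro continuous_imp_measurable_on_sets_lebesgue continuous_on_subset[OF f]) auto
  have rm: "r N \<in> borel_measurable (lebesgue_on {0<..<T})" for N
    unfolding r_def using fm h(1) by measurable
  have r0: "r N \<tau> \<ge> 0" for N \<tau> by (simp add: r_def)
  have rh: "r N \<tau> \<le> h \<tau>" for N \<tau>
  proof -
    have "max 0 ((h \<tau>)\<^sup>2 - (\<Sum>n<N. (f n \<tau>)\<^sup>2)) \<le> (h \<tau>)\<^sup>2" by (simp add: sum_nonneg)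
    then show ?thesis unfolding r_def using h(2)[of \<tau>] real_le_lsqrt by blast
  qed
  have rb: "norm (r N \<tau> powr q) \<le> h \<tau> powr q" for N \<tau>
    using r0[of N \<tau>] rh[of N \<tau>] q by (simp add: powr_mono2)
  have ri: "integrable (lebesgue_on {0<..<T}) (\<lambda>\<tau>. r N \<tau> powr q)" for N
  proof (rule Bochner_Integration.integrable_bound[OF hq])
    show "(\<lambda>\<tau>. r N \<tau> powr q) \<in> borel_measurable (lebesgue_on {0<..<T})" using rm by measurable
  qed (use rb in \<open>auto intro!: always_eventually order_trans[OF rb]\<close>)
  have "(\<lambda>N. LINT \<tau>|lebesgue_on {0<..<T}. r N \<tau> powr q) \<longlonglongrightarrow> (LINT \<tau>|lebesgue_on {0<..<T}. 0)"
  proof (rule integral_dominated_convergence[OF _ _ hq])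
    show "AE \<tau> in lebesgue_on {0<..<T}. (\<lambda>N. r N \<tau> powr q) \<longlonglongrightarrow> 0" using s
    proof eventually_elim
      case (elim \<tau>)
      have "(\<lambda>N. (h \<tau>)\<^sup>2 - (\<Sum>n<N. (f n \<tau>)\<^sup>2)) \<longlonglongrightarrow> (h \<tau>)\<^sup>2 - (h \<tau>)\<^sup>2"
        using elim unfolding sums_def by (intro tendsto_intros)
      then have "(\<lambda>N. sqrt (max 0 ((h \<tau>)\<^sup>2 - (\<Sum>n<N. (f n \<tau>)\<^sup>2)))) \<longlonglongrightarrow> sqrt (max 0 ((h \<tau>)\<^sup>2 - (h \<tau>)\<^sup>2))"
        by (rule tendsto_real_sqrt[OF tendsto_max[OF tendsto_const]])
      then have "(\<lambda>N. r N \<tau>) \<longlonglongrightarrow> 0" by (simp add: r_def)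
      then show ?case using q by (intro tendsto_zero_powrI) (auto simp: r0)
    qed
    show "(\<lambda>\<tau>. r N \<tau> powr q) \<in> borel_measurable (lebesgue_on {0<..<T})" for N using rm by measurable
  qed (use rb in auto)
  then have lim: "(\<lambda>N. LINT \<tau>|lebesgue_on {0<..<T}. r N \<tau> powr q) \<longlonglongrightarrow> 0" by simp
  define M where "M = (1 / (e * p + 1)) powr (1/p) * T powr (e + 1/p)"
  have M: "M \<ge> 0" by (simp add: M_def)
  define \<delta> where "\<delta> = \<epsilon> / (M + 1)"
  have \<delta>: "\<delta> > 0" using \<epsilon> M by (simp add: \<delta>_def)
  have "eventually (\<lambda>N. (LINT \<tau>|lebesgue_on {0<..<T}. r N \<tau> powr q) < \<delta> powr q) sequentially"
    using order_tendstoD(2)[OF lim, of "\<delta> powr q"] \<delta> by simp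
  then obtain N where N: "(LINT \<tau>|lebesgue_on {0<..<T}. r N \<tau> powr q) < \<delta> powr q"
    unfolding eventually_sequentially by blast
  have "(LINT \<tau>:{0..t}|lebesgue. (t - \<tau>) powr e * L2_set (\<lambda>n. f n \<tau>) K) \<le> \<epsilon>"
    if K: "finite K" "K \<subseteq> {N..}" and t: "t \<in> {0..T}" for K t
  proof -
    have le: "AE \<tau> in lebesgue_on {0<..<T}. L2_set (\<lambda>n. f n \<tau>) K \<le> r N \<tau>"
      using s by eventually_elim (use L2_set_le_of_sums[OF _ h(2) K] in \<open>auto simp: r_def\<close>)
    have "Lq_norm_le T p (r N) \<delta>"
      unfolding Lq_norm_le_def using p \<delta> rm r0 ri N by auto
    then have "(LINT \<tau>:{0..t}|lebesgue. (t - \<tau>) powr e * L2_set (\<lambda>n. f n \<tau>) K) \<le> (1 / (e * p + 1)) powr (1/p) * t powr (e + 1/p) * \<delta>"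
      using p f K le e t by (intro source_convolution_bound[where h="r N" and T=T]) auto
    also have "\<dots> \<le> (1 / (e * p + 1)) powr (1/p) * T powr (e + 1/p) * \<delta>"
      using t \<delta> e by (intro mult_right_mono mult_left_mono powr_mono2) auto
    also have "\<dots> = \<epsilon> * (M / (M + 1))" by (simp add: M_def[symmetric] \<delta>_def)
    also have "\<dots> \<le> \<epsilon> * 1" using \<epsilon> M by (intro mult_left_mono) auto
    finally show ?thesis by simp
  qed
  then show thesis by (rule that)
qed

text \<open>For \<open>p = 1\<close> the tails of a source in \<open>L\<^sup>\<infinity>\<close> need not be small in
\<open>L\<^sup>\<infinity>\<close>.  But the condition on \<open>p\<close> is open, so \<open>p\<close> can be
enlarged, and then the conjugate exponent is finite.\<close>

lemma source_convolution_tail: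
  assumes T: "T > 0" and \<alpha>: "1 < \<alpha>" "\<alpha> < 2" and p: "p \<ge> 1" "p < 1 / (2 - \<alpha>)" and h: "Lq_norm_le T p h B"
    and f: "\<And>n::nat. continuous_on {0..T} (f n)"
    and s: "AE \<tau> in lebesgue_on {0<..<T}. (\<lambda>n. (f n \<tau>)\<^sup>2) sums (h \<tau>)\<^sup>2"
    and \<epsilon>: "\<epsilon> > 0"
  obtains N where "\<And>K t. finite K \<Longrightarrow> K \<subseteq> {N..} \<Longrightarrow> t \<in> {0..T} \<Longrightarrow>
     (LINT \<tau>:{0..t}|lebesgue. (t - \<tau>) powr (\<alpha> - 2) * L2_set (\<lambda>n. f n \<tau>) K) \<le> \<epsilon>"
proof -
  define p' where "p' = (p + 1 / (2 - \<alpha>)) / 2"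
  have pl: "(\<alpha> - 2) * p > -1" "(\<alpha> - 2) * p' > -1" "\<alpha> - 2 + 1/p \<ge> 0" "\<alpha> - 2 + 1/p' \<ge> 0" "p' > 1"
  proof -
    have i: "1 / (2 - \<alpha>) > 1" using \<alpha> by simp
    show p1: "p' > 1" using p i by (simp add: p'_def)
    have p2: "p' < 1 / (2 - \<alpha>)" using p by (simp add: p'_def)
    show "(\<alpha> - 2) * p > -1" using p \<alpha> by (simp add: field_simps)
    show "(\<alpha> - 2) * p' > -1" using p2 \<alpha> by (simp add: field_simps)
    show "\<alpha> - 2 + 1/p \<ge> 0" using p \<alpha> by (simp add: field_simps)
    show "\<alpha> - 2 + 1/p' \<ge> 0" using p2 p1 \<alpha> by (simp add: field_simps)
  qed
  have hm: "h \<in> borel_measurable (lebesgue_on {0<..<T})" "\<And>\<tau>. h \<tau> \<ge> 0" using h by (auto simp: Lq_norm_le_def)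
  show thesis
  proof (cases "p = 1")
    case False
    then have hq: "integrable (lebesgue_on {0<..<T}) (\<lambda>\<tau>. h \<tau> powr (p / (p - 1)))" using h by (simp add: Lq_norm_le_def)
    show thesis
      by (rule source_convolution_tail_powr[OF T _ refl pl(1) pl(3) hm hq f s \<epsilon>]) (use p False that in auto)
  next
    case True
    define q where "q = p' / (p' - 1)"
    have q: "q > 0" using pl(5) by (simp add: q_def)
    have hB: "AE \<tau> in lebesgue_on {0<..<T}. h \<tau> \<le> B" using h True by (simp add: Lq_norm_le_def)
    have hq: "integrable (lebesgue_on {0<..<T}) (\<lambda>\<tau>. h \<tau> powr q)"
    proof (rule Bochner_Integration.integrable_bound)
      show "integrable (lebesgue_on {0<..<T}) (\<lambda>\<tau>. B powr q)"
        by (intro finite_measure.integrable_const finite_measureI) (use T in \<open>auto simp: emeasure_restrict_space\<close>)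
      show "(\<lambda>\<tau>. h \<tau> powr q) \<in> borel_measurable (lebesgue_on {0<..<T})" using hm(1) by measurable
      show "AE \<tau> in lebesgue_on {0<..<T}. norm (h \<tau> powr q) \<le> norm (B powr q)"
        using hB by eventually_elim (use hm(2) q in \<open>auto intro!: powr_mono2\<close>)
    qed
    show thesis
      by (rule source_convolution_tail_powr[OF T pl(5) q_def pl(2) pl(4) hm hq f s \<epsilon>]) (use that in auto)
  qed
qed

section \<open>The Hilbert space of square integrable functions\<close>

lemma L2_product_integrable:
  assumes "u \<in> L2 m" "v \<in> L2 m"
  shows "integrable m (\<lambda>x. u x * v x)"
proof (rule Bochner_Integration.integrable_bound)
  show "integrable m (\<lambda>x. (u x)\<^sup>2 + (v x)\<^sup>2)" using assms by (simp add: L2_def)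
  show "(\<lambda>x. u x * v x) \<in> borel_measurable m" using assms by (auto simp: L2_def)
  show "AE x in m. norm (u x * v x) \<le> norm ((u x)\<^sup>2 + (v x)\<^sup>2)"
  proof (intro always_eventually allI)
    fix x
    have "0 \<le> (\<bar>u x\<bar> - \<bar>v x\<bar>)\<^sup>2" by simp
    then have "2 * (\<bar>u x\<bar> * \<bar>v x\<bar>) \<le> (u x)\<^sup>2 + (v x)\<^sup>2" by (simp add: power2_eq_square algebra_simps)
    moreover have "0 \<le> \<bar>u x\<bar> * \<bar>v x\<bar>" by simp
    ultimately show "norm (u x * v x) \<le> norm ((u x)\<^sup>2 + (v x)\<^sup>2)" unfolding real_norm_def abs_mult by linarith
  qed
qed

lemma L2_lincomb:
  assumes "u \<in> L2 m" "v \<in> L2 m"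
  shows "(\<lambda>x. a * u x + b * v x) \<in> L2 m"
proof -
  have "(\<lambda>x. (a * u x + b * v x)\<^sup>2) = (\<lambda>x. a\<^sup>2 * (u x)\<^sup>2 + 2 * a * b * (u x * v x) + b\<^sup>2 * (v x)\<^sup>2)"
    by (simp add: power2_eq_square algebra_simps)
  then show ?thesis using assms L2_product_integrable[OF assms] by (auto simp: L2_def)
qed

lemma L2_diff: "u \<in> L2 m \<Longrightarrow> v \<in> L2 m \<Longrightarrow> (\<lambda>x. u x - v x) \<in> L2 m"
  using L2_lincomb[of u m v 1 "-1"] by simp

lemma L2_add: "u \<in> L2 m \<Longrightarrow> v \<in> L2 m \<Longrightarrow> (\<lambda>x. u x + v x) \<in> L2 m"
  using L2_lincomb[of u m v 1 1] by simp

lemma L2_zero: "(\<lambda>x. 0) \<in> L2 m" by (simp add: L2_def)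

lemma L2_cmult: "u \<in> L2 m \<Longrightarrow> (\<lambda>x. a * u x) \<in> L2 m"
  using L2_lincomb[of u m u a 0] by simp

lemma L2_sum: "(\<And>n. n \<in> K \<Longrightarrow> e n \<in> L2 m) \<Longrightarrow> (\<lambda>x. \<Sum>n\<in>K. c n * e n x) \<in> L2 m"
  by (induction K rule: infinite_finite_induct) (auto simp: L2_zero L2_add L2_cmult)

lemma L2_inner_commute: "L2_inner m u v = L2_inner m v u"
  by (simp add: L2_inner_def mult.commute)

lemma L2_inner_lincomb:
  assumes "u \<in> L2 m" "v \<in> L2 m" "w \<in> L2 m"
  shows "L2_inner m (\<lambda>x. a * u x + b * v x) w = a * L2_inner m u w + b * L2_inner m v w"
proof -
  have "L2_inner m (\<lambda>x. a * u x + b * v x) w = (LINT x|m. a * (u x * w x) + b * (v x * w x))"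
    by (simp add: L2_inner_def algebra_simps)
  then show ?thesis using assms by (simp add: L2_inner_def L2_product_integrable)
qed

lemma L2_inner_diff:
  assumes "u \<in> L2 m" "v \<in> L2 m" "w \<in> L2 m"
  shows "L2_inner m (\<lambda>x. u x - v x) w = L2_inner m u w - L2_inner m v w"
  using L2_inner_lincomb[OF assms, of 1 "-1"] by simp

lemma L2_inner_zero: "L2_inner m (\<lambda>x. 0) w = 0" by (simp add: L2_inner_def)

lemma L2_inner_sum:
  assumes "\<And>n. n \<in> K \<Longrightarrow> e n \<in> L2 m" "w \<in> L2 m"
  shows "L2_inner m (\<lambda>x. \<Sum>n\<in>K. c n * e n x) w = (\<Sum>n\<in>K. c n * L2_inner m (e n) w)"
  using assms(1)
proof (induction K rule: infinite_finite_induct)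
  case (insert n K)
  then show ?case
    using L2_inner_lincomb[of "e n" m "\<lambda>x. \<Sum>n\<in>K. c n * e n x" w "c n" 1] assms(2)
    by (simp add: L2_sum)
qed (auto simp: L2_inner_zero)

lemma L2_inner_self_nonneg: "L2_inner m u u \<ge> 0"
  unfolding L2_inner_def by (rule Bochner_Integration.integral_nonneg) simp

lemma L2_norm_nonneg [simp]: "L2_norm m u \<ge> 0"
  by (simp add: L2_norm_def L2_inner_self_nonneg)

lemma L2_norm_square: "(L2_norm m u)\<^sup>2 = L2_inner m u u"
  by (simp add: L2_norm_def L2_inner_self_nonneg)

text \<open>The Cauchy--Schwarz inequality for the semidefinite forms below; \<open>c = 0\<close> is possible.\<close>

lemma discriminant_bound:
  fixes a b c :: real
  assumes "\<And>x. 0 \<le> a + 2 * x * b + x\<^sup>2 * c"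
  shows "b\<^sup>2 \<le> a * c"
proof (cases "c = 0")
  case True
  have "b = 0"
  proof (rule ccontr)
    assume "b \<noteq> 0"
    then show False using assms[of "- (a + 1) / (2 * b)"] True by (simp add: field_simps)
  qed
  then show ?thesis using True by simp
next
  case False
  have c: "c > 0"
  proof (rule ccontr)
    assume "\<not> c > 0"
    then have c: "c < 0" using False by simp
    \<comment> \<open>large enough for the negative leading term to win\<close>
    define x where "x = (\<bar>a\<bar> + 1 + 2 * \<bar>b\<bar>) / (- c) + 1"
    have "(\<bar>a\<bar> + 1 + 2 * \<bar>b\<bar>) / (- c) \<ge> 0" using c by (intro divide_nonneg_pos) auto
    then have x: "x \<ge> 1" by (simp add: x_def)
    have "- c * x = \<bar>a\<bar> + 1 + 2 * \<bar>b\<bar> - c" using c by (simp add: x_def field_simps)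
    then have "c * x < - (\<bar>a\<bar> + 1 + 2 * \<bar>b\<bar>)" using c by linarith
    then have "x * (c * x) \<le> x * - (\<bar>a\<bar> + 1 + 2 * \<bar>b\<bar>)" using x by (intro mult_left_mono) auto
    moreover have "x * - (\<bar>a\<bar> + 1 + 2 * \<bar>b\<bar>) \<le> - (\<bar>a\<bar> + 1) - 2 * x * \<bar>b\<bar>"
      using x mult_right_mono[OF x, of "\<bar>a\<bar> + 1"] by (simp add: algebra_simps)
    moreover have "2 * x * b \<le> 2 * x * \<bar>b\<bar>" using x by (intro mult_left_mono) auto
    ultimately show False using assms[of x] by (simp add: power2_eq_square mult.commute mult.left_commute)
  qed
  have "0 \<le> a + 2 * (- b / c) * b + (- b / c)\<^sup>2 * c" by (rule assms)
  also have "\<dots> = a - b\<^sup>2 / c" using c by (simp add: power2_eq_square field_simps)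
  finally show ?thesis using c by (simp add: field_simps)
qed

lemma L2_Cauchy_Schwarz:
  assumes "u \<in> L2 m" "v \<in> L2 m"
  shows "\<bar>L2_inner m u v\<bar> \<le> L2_norm m u * L2_norm m v"
proof -
  have "(L2_inner m u v)\<^sup>2 \<le> L2_inner m u u * L2_inner m v v"
  proof (rule discriminant_bound)
    fix x :: real
    define w where "w = (\<lambda>y. 1 * u y + x * v y)"
    have w: "w \<in> L2 m" unfolding w_def using assms by (rule L2_lincomb)
    have "0 \<le> L2_inner m w w" by (rule L2_inner_self_nonneg)
    also have "L2_inner m w w = 1 * L2_inner m u w + x * L2_inner m v w"
      using L2_inner_lincomb[OF assms w, of 1 x] by (simp add: w_def)
    also have "L2_inner m u w = 1 * L2_inner m u u + x * L2_inner m v u"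
      unfolding L2_inner_commute[of m u w] using L2_inner_lincomb[OF assms assms(1), of 1 x] by (simp add: w_def)
    also have "L2_inner m v w = 1 * L2_inner m u v + x * L2_inner m v v"
      unfolding L2_inner_commute[of m v w] using L2_inner_lincomb[OF assms assms(2), of 1 x] by (simp add: w_def)
    finally show "0 \<le> L2_inner m u u + 2 * x * L2_inner m u v + x\<^sup>2 * L2_inner m v v"
      using L2_inner_commute[of m u v] by (simp add: power2_eq_square algebra_simps)
  qed
  then show ?thesis unfolding L2_norm_def real_sqrt_mult[symmetric]
    by (metis real_sqrt_abs real_sqrt_le_mono)
qed

lemma L2_measurable: "u \<in> L2 m \<Longrightarrow> u \<in> borel_measurable m" by (simp add: L2_def)

lemma L2_inner_cong_AE:
  assumes "u \<in> L2 m" "v \<in> L2 m" "w \<in> L2 m" "ae_eq m u v"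
  shows "L2_inner m u w = L2_inner m v w"
  unfolding L2_inner_def using assms
  by (intro integral_cong_AE) (auto simp: ae_eq_def L2_def)

lemma L2_norm_eq_0_imp_ae_eq:
  assumes "u \<in> L2 m" "v \<in> L2 m" "L2_norm m (\<lambda>x. u x - v x) = 0"
  shows "ae_eq m u v"
proof -
  have i: "integrable m (\<lambda>x. (u x - v x)\<^sup>2)" using L2_diff[OF assms(1,2)] by (simp add: L2_def)
  have "(LINT x|m. (u x - v x)\<^sup>2) = 0"
    using assms(3) L2_norm_square[of m "\<lambda>x. u x - v x"] by (simp add: L2_inner_def power2_eq_square)
  then have "AE x in m. (u x - v x)\<^sup>2 = 0" using i by (subst (asm) integral_nonneg_eq_0_iff_AE) auto
  then show ?thesis unfolding ae_eq_def by eventually_elim simp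
qed

text \<open>Completeness.  Along a subsequence with geometrically small increments the sum of the increments is
integrable, as the measure is finite, so the subsequence converges almost everywhere; Fatou's lemma carries
the Cauchy estimate over to the limit.\<close>

lemma L2_bounded_Cauchy_limit:
  assumes fin: "finite_measure m" and S: "\<And>k::nat. S k \<in> L2 m"
    and C: "\<And>j k. j \<le> k \<Longrightarrow> L2_norm m (\<lambda>x. S k x - S j x) \<le> e j" and e: "e \<longlonglongrightarrow> 0"
  obtains h where "h \<in> L2 m" "(\<lambda>k. L2_norm m (\<lambda>x. S k x - h x)) \<longlonglongrightarrow> 0"
proof -
  interpret finite_measure m by (rule fin)
  have "\<forall>i::nat. \<exists>N. \<forall>k\<ge>N. e k < (1/2) ^ i"
    using order_tendstoD(2)[OF e] by (auto simp: eventually_sequentially)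
  then obtain N where N: "\<And>i k. k \<ge> N i \<Longrightarrow> e k < (1/2) ^ i" by metis
  \<comment> \<open>a monotone sequence of indices beyond \<open>N i\<close> and tending to infinity\<close>
  define r where "r i = (\<Sum>j\<le>i. N j) + i" for i
  have r_ge: "N i \<le> r i" for i
  proof -
    have "N i \<le> (\<Sum>j\<le>i. N j)" by (rule member_le_sum) auto
    then show ?thesis by (simp add: r_def)
  qed
  have r_mono: "r i \<le> r (Suc i)" for i by (simp add: r_def)
  have r_mono': "r i \<le> r j" if "i \<le> j" for i j using that by (rule lift_Suc_mono_le[of r, OF r_mono])
  have r_id: "r i \<ge> i" for i by (simp add: r_def)
  define d where "d i x = S (r (Suc i)) x - S (r i) x" for i x
  have dL: "d i \<in> L2 m" for i unfolding d_def by (intro L2_diff S)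
  have one: "(\<lambda>x. 1) \<in> L2 m" by (simp add: L2_def)
  have absL: "(\<lambda>x. \<bar>u x\<bar>) \<in> L2 m" if "u \<in> L2 m" for u using that by (auto simp: L2_def)
  have dint: "integrable m (\<lambda>x. \<bar>d i x\<bar>)" for i
    using L2_product_integrable[OF absL[OF dL] one] by simp
  have dle: "(LINT x|m. \<bar>d i x\<bar>) \<le> (1/2) ^ i * L2_norm m (\<lambda>x. 1)" for i
  proof -
    have "(LINT x|m. \<bar>d i x\<bar>) = L2_inner m (\<lambda>x. \<bar>d i x\<bar>) (\<lambda>x. 1)" by (simp add: L2_inner_def)
    also have "\<dots> \<le> L2_norm m (\<lambda>x. \<bar>d i x\<bar>) * L2_norm m (\<lambda>x. 1)"
      using L2_Cauchy_Schwarz[OF absL[OF dL] one] by (metis abs_le_D1)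
    also have "L2_norm m (\<lambda>x. \<bar>d i x\<bar>) = L2_norm m (d i)" by (simp add: L2_norm_def L2_inner_def)
    also have "\<dots> \<le> (1/2) ^ i"
      unfolding d_def using C[OF r_mono[of i]] N[OF r_ge[of i]] by (meson le_less_trans less_imp_le)
    finally show ?thesis by (simp add: mult_right_mono)
  qed
  have "(\<integral>\<^sup>+x. (\<Sum>i. ennreal \<bar>d i x\<bar>) \<partial>m) = (\<Sum>i. \<integral>\<^sup>+x. ennreal \<bar>d i x\<bar> \<partial>m)"
    using L2_measurable[OF dL] by (intro nn_integral_suminf) measurable
  also have "\<dots> = (\<Sum>i. ennreal (LINT x|m. \<bar>d i x\<bar>))"
    using dint by (intro suminf_cong nn_integral_eq_integral) auto
  also have "\<dots> \<le> (\<Sum>i. ennreal ((1/2) ^ i * L2_norm m (\<lambda>x. 1)))"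
    using dle by (intro suminf_le) (auto intro: ennreal_leI)
  also have "\<dots> = ennreal (\<Sum>i. (1/2) ^ i * L2_norm m (\<lambda>x. 1))"
    by (intro suminf_ennreal2) (auto intro!: summable_mult2 summable_geometric)
  finally have "(\<integral>\<^sup>+x. (\<Sum>i. ennreal \<bar>d i x\<bar>) \<partial>m) \<noteq> \<infinity>" by (auto simp: top_unique)
  then have "AE x in m. (\<Sum>i. ennreal \<bar>d i x\<bar>) \<noteq> \<infinity>"
    using L2_measurable[OF dL] by (intro nn_integral_PInf_AE) measurable
  then have AEsum: "AE x in m. summable (\<lambda>i. d i x)"
    by eventually_elim (auto intro!: summable_rabs_cancel[OF summable_suminf_not_top])
  define h where "h x = lim (\<lambda>i. S (r i) x)" for x
  have conv: "AE x in m. (\<lambda>i. S (r i) x) \<longlonglongrightarrow> h x" using AEsum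
  proof eventually_elim
    case (elim x)
    have "(\<Sum>i<n. d i x) = S (r n) x - S (r 0) x" for n
      unfolding d_def by (rule sum_lessThan_telescope)
    then have "(\<lambda>n. S (r n) x - S (r 0) x) \<longlonglongrightarrow> (\<Sum>i. d i x)"
      using summable_LIMSEQ[OF elim] by simp
    then have "(\<lambda>n. (S (r n) x - S (r 0) x) + S (r 0) x) \<longlonglongrightarrow> (\<Sum>i. d i x) + S (r 0) x" by (intro tendsto_intros)
    then have "convergent (\<lambda>i. S (r i) x)" by (auto simp: convergent_def)
    then show ?case by (simp add: h_def convergent_LIMSEQ_iff)
  qed
  have hm: "h \<in> borel_measurable m" unfolding h_def
    using L2_measurable[OF S] by (intro borel_measurable_lim_metric) auto
  have fatou: "(\<integral>\<^sup>+x. ennreal ((S k x - h x)\<^sup>2) \<partial>m) \<le> ennreal ((e k)\<^sup>2)" for k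
  proof -
    have "(\<integral>\<^sup>+x. ennreal ((S k x - h x)\<^sup>2) \<partial>m) = (\<integral>\<^sup>+x. liminf (\<lambda>i. ennreal ((S (r i) x - S k x)\<^sup>2)) \<partial>m)"
    proof (rule nn_integral_cong_AE, use conv in eventually_elim)
      case (elim x)
      have "(\<lambda>i. ennreal ((S (r i) x - S k x)\<^sup>2)) \<longlonglongrightarrow> ennreal ((h x - S k x)\<^sup>2)"
        by (intro tendsto_ennrealI tendsto_intros elim)
      then show "ennreal ((S k x - h x)\<^sup>2) = liminf (\<lambda>i. ennreal ((S (r i) x - S k x)\<^sup>2))"
        unfolding power2_commute[of "S k x" "h x"]
        by (rule lim_imp_Liminf[OF trivial_limit_sequentially, symmetric])
    qed
    also have "\<dots> \<le> liminf (\<lambda>i. \<integral>\<^sup>+x. ennreal ((S (r i) x - S k x)\<^sup>2) \<partial>m)"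
      using L2_measurable[OF S] by (intro nn_integral_liminf) measurable
    also have "\<dots> \<le> ennreal ((e k)\<^sup>2)"
    proof (rule Liminf_le, simp, rule eventually_sequentiallyI[of k])
      fix i assume "k \<le> i"
      then have ki: "k \<le> r i" using r_id[of i] by simp
      have dl: "(\<lambda>x. S (r i) x - S k x) \<in> L2 m" by (intro L2_diff S)
      have "(\<integral>\<^sup>+x. ennreal ((S (r i) x - S k x)\<^sup>2) \<partial>m) = ennreal (LINT x|m. (S (r i) x - S k x)\<^sup>2)"
        using dl by (intro nn_integral_eq_integral) (auto simp: L2_def)
      also have "(LINT x|m. (S (r i) x - S k x)\<^sup>2) = (L2_norm m (\<lambda>x. S (r i) x - S k x))\<^sup>2"
        unfolding L2_norm_square by (simp add: L2_inner_def power2_eq_square)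
      also have "ennreal \<dots> \<le> ennreal ((e k)\<^sup>2)"
        using C[OF ki] by (intro ennreal_leI power_mono) auto
      finally show "(\<integral>\<^sup>+x. ennreal ((S (r i) x - S k x)\<^sup>2) \<partial>m) \<le> ennreal ((e k)\<^sup>2)" .
    qed
    finally show ?thesis .
  qed
  have Skh: "(\<lambda>x. S k x - h x) \<in> L2 m" for k
  proof -
    have "integrable m (\<lambda>x. (S k x - h x)\<^sup>2)"
    proof (rule integrableI_bounded)
      show "(\<lambda>x. (S k x - h x)\<^sup>2) \<in> borel_measurable m" using L2_measurable[OF S] hm by measurable
      have "(\<integral>\<^sup>+x. ennreal (norm ((S k x - h x)\<^sup>2)) \<partial>m) \<le> ennreal ((e k)\<^sup>2)" using fatou[of k] by simp
      also have "\<dots> < \<infinity>" by simp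
      finally show "(\<integral>\<^sup>+x. ennreal (norm ((S k x - h x)\<^sup>2)) \<partial>m) < \<infinity>" .
    qed
    then show ?thesis using L2_measurable[OF S] hm by (simp add: L2_def)
  qed
  have hL: "h \<in> L2 m" using L2_diff[OF S[of 0] Skh[of 0]] by simp
  have le: "L2_norm m (\<lambda>x. S k x - h x) \<le> \<bar>e k\<bar>" for k
  proof -
    have "ennreal ((L2_norm m (\<lambda>x. S k x - h x))\<^sup>2) = (\<integral>\<^sup>+x. ennreal ((S k x - h x)\<^sup>2) \<partial>m)"
      unfolding L2_norm_square L2_inner_def using Skh[of k]
      by (subst nn_integral_eq_integral) (auto simp: L2_def power2_eq_square)
    also have "\<dots> \<le> ennreal ((e k)\<^sup>2)" by (rule fatou)
    finally have "(L2_norm m (\<lambda>x. S k x - h x))\<^sup>2 \<le> \<bar>e k\<bar>\<^sup>2" by (simp add: ennreal_le_iff)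
    then show ?thesis by (rule power2_le_imp_le) simp
  qed
  have "(\<lambda>k. L2_norm m (\<lambda>x. S k x - h x)) \<longlonglongrightarrow> 0"
    by (rule Lim_null_comparison[OF _ tendsto_rabs_zero[OF e]]) (use le in \<open>auto intro!: always_eventually\<close>)
  then show thesis by (rule that[OF hL])
qed


section \<open>Expansion in eigenfunctions\<close>

locale spectral_setting =
  fixes m :: "'a measure" and V D :: "('a \<Rightarrow> real) set"
    and E :: "('a \<Rightarrow> real) \<Rightarrow> ('a \<Rightarrow> real) \<Rightarrow> real"
    and A :: "('a \<Rightarrow> real) \<Rightarrow> ('a \<Rightarrow> real)"
    and \<Lambda> :: "nat \<Rightarrow> real" and \<phi> :: "nat \<Rightarrow> 'a \<Rightarrow> real"
  assumes fin: "finite_measure m"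
    and dir: "dirichlet_form m V E"
    and DV: "D \<subseteq> V"
    and AL: "\<And>u. u \<in> D \<Longrightarrow> A u \<in> L2 m"
    and EA: "\<And>u v. u \<in> D \<Longrightarrow> v \<in> V \<Longrightarrow> E u v = L2_inner m (A u) v"
    and eb: "eigenbasis m D A \<Lambda> \<phi>"
    and L0: "\<Lambda> 0 > 0"
    and V: "V = Vs m \<Lambda> \<phi> (1/2)"
begin

text \<open>The Fourier coefficients of \<open>h\<close>.\<close>

definition coef :: "('a \<Rightarrow> real) \<Rightarrow> nat \<Rightarrow> real" where "coef h n = L2_inner m h (\<phi> n)"

lemma V_L2: "u \<in> V \<Longrightarrow> u \<in> L2 m" using V by (auto simp: Vs_def)

lemma phi: "\<phi> n \<in> D" "\<phi> n \<in> V" "\<phi> n \<in> L2 m"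
proof -
  show 1: "\<phi> n \<in> D" using eb by (simp add: eigenbasis_def)
  then show 2: "\<phi> n \<in> V" using DV by blast
  then show "\<phi> n \<in> L2 m" by (rule V_L2)
qed

lemma Lambda_ge: "\<Lambda> 0 \<le> \<Lambda> n"
  using eb by (auto simp: eigenbasis_def incseq_def)

lemma Lambda_pos: "\<Lambda> n > 0"
  using Lambda_ge[of n] L0 by linarith

lemma coef_phi: "coef (\<phi> i) j = (if i = j then 1 else 0)"
  using eb by (simp add: eigenbasis_def coef_def)

lemma coef_lincomb:
  assumes "u \<in> L2 m" "v \<in> L2 m"
  shows "coef (\<lambda>x. a * u x + b * v x) n = a * coef u n + b * coef v n"
  unfolding coef_def by (rule L2_inner_lincomb[OF assms phi(3)])

lemma coef_diff:
  assumes "u \<in> L2 m" "v \<in> L2 m"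
  shows "coef (\<lambda>x. u x - v x) n = coef u n - coef v n"
  unfolding coef_def by (rule L2_inner_diff[OF assms phi(3)])

lemma psum_L2: "(\<lambda>x. \<Sum>n\<in>K. c n * \<phi> n x) \<in> L2 m"
  by (intro L2_sum phi)

lemma coef_psum:
  assumes "finite K"
  shows "coef (\<lambda>x. \<Sum>n\<in>K. c n * \<phi> n x) j = (if j \<in> K then c j else 0)"
proof -
  have "coef (\<lambda>x. \<Sum>n\<in>K. c n * \<phi> n x) j = (\<Sum>n\<in>K. c n * coef (\<phi> n) j)"
    unfolding coef_def by (rule L2_inner_sum) (auto intro: phi)
  also have "\<dots> = (\<Sum>n\<in>K. if j = n then c j else 0)" by (intro sum.cong) (auto simp: coef_phi)
  finally show ?thesis using assms by (simp add: sum.delta')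
qed

lemma inner_psum:
  assumes "h \<in> L2 m"
  shows "L2_inner m (\<lambda>x. \<Sum>n\<in>K. c n * \<phi> n x) h = (\<Sum>n\<in>K. c n * coef h n)"
  unfolding coef_def using L2_inner_sum[of K \<phi> m h c] assms phi by (simp add: L2_inner_commute[of m h])

lemma norm_psum:
  assumes "finite K"
  shows "L2_norm m (\<lambda>x. \<Sum>n\<in>K. c n * \<phi> n x) = L2_set c K"
proof -
  have "L2_inner m (\<lambda>x. \<Sum>n\<in>K. c n * \<phi> n x) (\<lambda>x. \<Sum>n\<in>K. c n * \<phi> n x) = (\<Sum>n\<in>K. c n * c n)"
    unfolding inner_psum[OF psum_L2] using assms by (intro sum.cong refl) (simp add: coef_psum)
  then show ?thesis by (simp add: L2_norm_def L2_set_def power2_eq_square)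
qed

lemma expansion: "h \<in> L2 m \<Longrightarrow> L2_sums m \<phi> (coef h) h"
  using eb unfolding eigenbasis_def coef_def by blast

lemma parseval_inner:
  assumes h: "h \<in> L2 m" and k: "k \<in> L2 m"
  shows "(\<lambda>n. coef h n * coef k n) sums L2_inner m h k"
  unfolding sums_def
proof -
  define S where "S N x = (\<Sum>n<N. coef h n * \<phi> n x)" for N x
  have S: "S N \<in> L2 m" for N unfolding S_def by (rule psum_L2)
  have lim: "(\<lambda>N. L2_norm m (\<lambda>x. S N x - h x)) \<longlonglongrightarrow> 0"
    using expansion[OF h] by (simp add: L2_sums_def S_def)
  have e: "L2_inner m (S N) k = (\<Sum>n<N. coef h n * coef k n)" for N unfolding S_def by (rule inner_psum[OF k])
  have "(\<lambda>N. L2_inner m (S N) k - L2_inner m h k) \<longlonglongrightarrow> 0"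
  proof (rule Lim_null_comparison)
    show "\<forall>\<^sub>F N in sequentially. norm (L2_inner m (S N) k - L2_inner m h k) \<le> L2_norm m (\<lambda>x. S N x - h x) * L2_norm m k"
      using L2_Cauchy_Schwarz[OF L2_diff[OF S h] k] by (simp add: L2_inner_diff[OF S h k])
    show "(\<lambda>N. L2_norm m (\<lambda>x. S N x - h x) * L2_norm m k) \<longlonglongrightarrow> 0" by (rule tendsto_mult_left_zero[OF lim])
  qed
  then show "(\<lambda>N. \<Sum>n<N. coef h n * coef k n) \<longlonglongrightarrow> L2_inner m h k" unfolding e by (simp add: LIM_zero_iff)
qed

lemma parseval: "h \<in> L2 m \<Longrightarrow> (\<lambda>n. (coef h n)\<^sup>2) sums (L2_norm m h)\<^sup>2"
  unfolding L2_norm_square using parseval_inner[of h h] by (simp add: power2_eq_square)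

lemma L2_set_coef_le:
  assumes "h \<in> L2 m" "finite K"
  shows "L2_set (coef h) K \<le> L2_norm m h"
  using L2_set_le_sqrt_suminf[of "coef h" K] parseval[OF assms(1)] assms(2) by (simp add: sums_iff)

lemma L2_norm_le:
  assumes "h \<in> L2 m" "\<And>K. finite K \<Longrightarrow> L2_set (coef h) K \<le> B"
  shows "L2_norm m h \<le> B"
  using L2_set_bound_imp_summable(2)[of "coef h" B] parseval[OF assms(1)] assms(2) by (simp add: sums_iff)

lemma coef_eq_imp_ae_eq:
  assumes h: "h \<in> L2 m" and k: "k \<in> L2 m" and eq: "\<And>n. coef h n = coef k n"
  shows "ae_eq m h k"
proof (rule L2_norm_eq_0_imp_ae_eq[OF h k])
  have "L2_norm m (\<lambda>x. h x - k x) \<le> 0"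
    by (rule L2_norm_le[OF L2_diff[OF h k]]) (simp add: L2_set_def coef_diff[OF h k] eq)
  then show "L2_norm m (\<lambda>x. h x - k x) = 0" using L2_norm_nonneg[of m "\<lambda>x. h x - k x"] by linarith
qed

lemma coef_cong_AE:
  assumes "h \<in> L2 m" "k \<in> L2 m" "ae_eq m h k"
  shows "coef h n = coef k n"
  unfolding coef_def by (rule L2_inner_cong_AE[OF assms(1,2) phi(3) assms(3)])

lemma riesz_fischer:
  assumes s: "summable (\<lambda>n. (c n)\<^sup>2)"
  obtains h where "h \<in> L2 m" "coef h = c"
proof -
  define S where "S N x = (\<Sum>n<N. c n * \<phi> n x)" for N x
  have S: "S N \<in> L2 m" for N unfolding S_def by (rule psum_L2)
  define e where "e j = sqrt ((\<Sum>n. (c n)\<^sup>2) - (\<Sum>n<j. (c n)\<^sup>2))" for j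
  have e0: "e \<longlonglongrightarrow> 0"
  proof -
    have "(\<lambda>j. sqrt ((\<Sum>n. (c n)\<^sup>2) - (\<Sum>n<j. (c n)\<^sup>2))) \<longlonglongrightarrow> sqrt ((\<Sum>n. (c n)\<^sup>2) - (\<Sum>n. (c n)\<^sup>2))"
      by (intro tendsto_intros summable_LIMSEQ s)
    then show ?thesis by (simp add: e_def[abs_def])
  qed
  have C: "L2_norm m (\<lambda>x. S k x - S j x) \<le> e j" if "j \<le> k" for j k
  proof -
    have "(\<lambda>x. S k x - S j x) = (\<lambda>x. \<Sum>n\<in>{j..<k}. c n * \<phi> n x)"
    proof
      fix x show "S k x - S j x = (\<Sum>n\<in>{j..<k}. c n * \<phi> n x)"
        unfolding S_def using sum_diff_nat_ivl[of 0 j k "\<lambda>n. c n * \<phi> n x"] that by (simp add: atLeast0LessThan)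
    qed
    then have "L2_norm m (\<lambda>x. S k x - S j x) = L2_set c {j..<k}" by (simp add: norm_psum)
    also have "\<dots> \<le> e j"
    proof -
      have "(\<Sum>n\<in>{j..<k}. (c n)\<^sup>2) + (\<Sum>n<j. (c n)\<^sup>2) = (\<Sum>n\<in>{j..<k} \<union> {..<j}. (c n)\<^sup>2)"
        by (subst sum.union_disjoint) auto
      also have "\<dots> \<le> (\<Sum>n. (c n)\<^sup>2)" by (intro sum_le_suminf s) auto
      finally show ?thesis unfolding L2_set_def e_def by (intro real_sqrt_le_mono) linarith
    qed
    finally show ?thesis .
  qed
  obtain h where h: "h \<in> L2 m" "(\<lambda>k. L2_norm m (\<lambda>x. S k x - h x)) \<longlonglongrightarrow> 0"
    using L2_bounded_Cauchy_limit[OF fin S C e0] by blast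
  have "coef h n = c n" for n
  proof -
    have "(\<lambda>k. coef (S k) n - coef h n) \<longlonglongrightarrow> 0"
    proof (rule Lim_null_comparison[OF _ h(2)], intro always_eventually allI)
      fix k
      have "\<bar>coef (\<lambda>x. S k x - h x) n\<bar> \<le> L2_norm m (\<lambda>x. S k x - h x)"
        using L2_set_coef_le[OF L2_diff[OF S h(1)], of "{n}"] by simp
      then show "norm (coef (S k) n - coef h n) \<le> L2_norm m (\<lambda>x. S k x - h x)" by (simp add: coef_diff[OF S h(1)])
    qed
    moreover have "eventually (\<lambda>k. coef (S k) n - coef h n = c n - coef h n) sequentially"
      using eventually_gt_at_top[of n] by eventually_elim (simp add: S_def[abs_def] coef_psum)
    ultimately have "(\<lambda>k. c n - coef h n) \<longlonglongrightarrow> 0" by (rule Lim_transform_eventually)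
    then have "c n - coef h n = 0" using LIMSEQ_const_iff by blast
    then show ?thesis by simp
  qed
  then show thesis using that[of h] h(1) by auto
qed

lemma weight_square: "(coef h n)\<^sup>2 * \<Lambda> n powr (2 * s) = (\<Lambda> n powr s * coef h n)\<^sup>2"
proof -
  have "\<Lambda> n powr (2 * s) = \<Lambda> n powr s * \<Lambda> n powr s" by (simp flip: powr_add)
  then show ?thesis by (simp add: power2_eq_square)
qed

lemma Vs_L2: "h \<in> Vs m \<Lambda> \<phi> s \<Longrightarrow> h \<in> L2 m" by (simp add: Vs_def)

text \<open>Together with the next lemma this makes the norm of \<open>V\<^sub>s\<close> the supremum of weighted
\<open>L2_set\<close> norms over finite sets of modes.\<close>

lemma Vs_I:
  assumes "h \<in> L2 m" "\<And>K. finite K \<Longrightarrow> L2_set (\<lambda>n. \<Lambda> n powr s * coef h n) K \<le> B"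
  shows "h \<in> Vs m \<Lambda> \<phi> s" "Vs_norm m \<Lambda> \<phi> s h \<le> B"
  using L2_set_bound_imp_summable[OF assms(2)] assms(1)
  unfolding Vs_def Vs_norm_def coef_def[symmetric] weight_square by auto

lemma L2_set_Vs_le:
  assumes "h \<in> Vs m \<Lambda> \<phi> s" "finite K"
  shows "L2_set (\<lambda>n. \<Lambda> n powr s * coef h n) K \<le> Vs_norm m \<Lambda> \<phi> s h"
  using assms L2_set_le_sqrt_suminf[of "\<lambda>n. \<Lambda> n powr s * coef h n" K]
  unfolding Vs_def Vs_norm_def coef_def[symmetric] weight_square by auto

lemma Vs_lincomb:
  assumes u: "u \<in> Vs m \<Lambda> \<phi> s" and v: "v \<in> Vs m \<Lambda> \<phi> s"
  shows "(\<lambda>x. a * u x + b * v x) \<in> Vs m \<Lambda> \<phi> s"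
proof (rule Vs_I(1))
  show "(\<lambda>x. a * u x + b * v x) \<in> L2 m" by (intro L2_lincomb Vs_L2[OF u] Vs_L2[OF v])
  fix K :: "nat set" assume K: "finite K"
  have "L2_set (\<lambda>n. \<Lambda> n powr s * coef (\<lambda>x. a * u x + b * v x) n) K =
     L2_set (\<lambda>n. a * (\<Lambda> n powr s * coef u n) + b * (\<Lambda> n powr s * coef v n)) K"
    by (simp add: coef_lincomb[OF Vs_L2[OF u] Vs_L2[OF v]] algebra_simps)
  also have "\<dots> \<le> L2_set (\<lambda>n. a * (\<Lambda> n powr s * coef u n)) K + L2_set (\<lambda>n. b * (\<Lambda> n powr s * coef v n)) K"
    by (rule L2_set_triangle_ineq)
  also have "\<dots> \<le> \<bar>a\<bar> * L2_set (\<lambda>n. \<Lambda> n powr s * coef u n) K + \<bar>b\<bar> * L2_set (\<lambda>n. \<Lambda> n powr s * coef v n) K"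
    by (intro add_mono L2_set_scaled_le) (auto simp: abs_mult)
  also have "\<dots> \<le> \<bar>a\<bar> * Vs_norm m \<Lambda> \<phi> s u + \<bar>b\<bar> * Vs_norm m \<Lambda> \<phi> s v"
    by (intro add_mono mult_left_mono L2_set_Vs_le u v K) auto
  finally show "L2_set (\<lambda>n. \<Lambda> n powr s * coef (\<lambda>x. a * u x + b * v x) n) K \<le> \<bar>a\<bar> * Vs_norm m \<Lambda> \<phi> s u + \<bar>b\<bar> * Vs_norm m \<Lambda> \<phi> s v" .
qed

lemma psum_Vs:
  assumes "finite K"
  shows "(\<lambda>x. \<Sum>n\<in>K. c n * \<phi> n x) \<in> Vs m \<Lambda> \<phi> s"
    and "Vs_norm m \<Lambda> \<phi> s (\<lambda>x. \<Sum>n\<in>K. c n * \<phi> n x) \<le> L2_set (\<lambda>n. \<Lambda> n powr s * c n) K"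
proof -
  have b: "L2_set (\<lambda>n. \<Lambda> n powr s * coef (\<lambda>x. \<Sum>n\<in>K. c n * \<phi> n x) n) J \<le> L2_set (\<lambda>n. \<Lambda> n powr s * c n) K" if J: "finite J" for J
  proof -
    have "(\<Sum>n\<in>J. (\<Lambda> n powr s * coef (\<lambda>x. \<Sum>n\<in>K. c n * \<phi> n x) n)\<^sup>2) = (\<Sum>n\<in>J. if n \<in> K then (\<Lambda> n powr s * c n)\<^sup>2 else 0)"
      by (intro sum.cong refl) (simp add: coef_psum[OF assms])
    also have "\<dots> = (\<Sum>n\<in>J \<inter> K. (\<Lambda> n powr s * c n)\<^sup>2)" using J by (simp add: sum.inter_restrict)
    also have "\<dots> \<le> (\<Sum>n\<in>K. (\<Lambda> n powr s * c n)\<^sup>2)" using assms by (intro sum_mono2) auto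
    finally show ?thesis unfolding L2_set_def by (rule real_sqrt_le_mono)
  qed
  show "(\<lambda>x. \<Sum>n\<in>K. c n * \<phi> n x) \<in> Vs m \<Lambda> \<phi> s"
    by (rule Vs_I(1)[OF psum_L2]) (rule b)
  show "Vs_norm m \<Lambda> \<phi> s (\<lambda>x. \<Sum>n\<in>K. c n * \<phi> n x) \<le> L2_set (\<lambda>n. \<Lambda> n powr s * c n) K"
    by (rule Vs_I(2)[OF psum_L2]) (rule b)
qed

lemma phi_Vs: "\<phi> n \<in> Vs m \<Lambda> \<phi> s"
  using psum_Vs(1)[of "{n}" "\<lambda>_. 1" s] by simp

lemma weight_compare:
  assumes "s \<le> r"
  shows "\<bar>\<Lambda> n powr s * y\<bar> \<le> \<Lambda> 0 powr (s - r) * \<bar>\<Lambda> n powr r * y\<bar>"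
proof -
  have "\<Lambda> n powr s = \<Lambda> n powr (s - r) * \<Lambda> n powr r" by (simp flip: powr_add)
  also have "\<dots> \<le> \<Lambda> 0 powr (s - r) * \<Lambda> n powr r"
    using Lambda_ge[of n] L0 assms by (intro mult_right_mono powr_mono2') auto
  finally have "\<Lambda> n powr s * \<bar>y\<bar> \<le> (\<Lambda> 0 powr (s - r) * \<Lambda> n powr r) * \<bar>y\<bar>" by (rule mult_right_mono) simp
  then show ?thesis by (simp add: abs_mult mult.assoc)
qed

lemma L2_set_weight_compare:
  assumes "s \<le> r"
  shows "L2_set (\<lambda>n. \<Lambda> n powr s * y n) K \<le> \<Lambda> 0 powr (s - r) * L2_set (\<lambda>n. \<Lambda> n powr r * y n) K"
  by (rule L2_set_scaled_le) (auto intro: weight_compare[OF assms])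

lemma Vs_antimono:
  assumes "s \<le> r"
  shows "Vs m \<Lambda> \<phi> r \<subseteq> Vs m \<Lambda> \<phi> s"
proof
  fix h assume h: "h \<in> Vs m \<Lambda> \<phi> r"
  show "h \<in> Vs m \<Lambda> \<phi> s"
  proof (rule Vs_I(1)[OF Vs_L2[OF h]])
    fix K :: "nat set" assume K: "finite K"
    have "L2_set (\<lambda>n. \<Lambda> n powr s * coef h n) K \<le> \<Lambda> 0 powr (s - r) * L2_set (\<lambda>n. \<Lambda> n powr r * coef h n) K"
      by (rule L2_set_weight_compare[OF assms])
    also have "\<dots> \<le> \<Lambda> 0 powr (s - r) * Vs_norm m \<Lambda> \<phi> r h" by (intro mult_left_mono L2_set_Vs_le h K) simp
    finally show "L2_set (\<lambda>n. \<Lambda> n powr s * coef h n) K \<le> \<Lambda> 0 powr (s - r) * Vs_norm m \<Lambda> \<phi> r h" .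
  qed
qed

lemma form_lincomb: "u \<in> V \<Longrightarrow> v \<in> V \<Longrightarrow> w \<in> V \<Longrightarrow> E (\<lambda>x. a * u x + b * v x) w = a * E u w + b * E v w"
  using dir unfolding dirichlet_form_def by blast
lemma form_sym: "u \<in> V \<Longrightarrow> v \<in> V \<Longrightarrow> E u v = E v u"
  using dir unfolding dirichlet_form_def by blast
lemma form_nonneg: "u \<in> V \<Longrightarrow> 0 \<le> E u u"
  using dir unfolding dirichlet_form_def by blast
lemma form_cong_AE: "u \<in> V \<Longrightarrow> u' \<in> V \<Longrightarrow> v \<in> V \<Longrightarrow> ae_eq m u u' \<Longrightarrow> E u v = E u' v"
  using dir unfolding dirichlet_form_def by blast
lemma V_lincomb: "u \<in> V \<Longrightarrow> v \<in> V \<Longrightarrow> (\<lambda>x. a * u x + b * v x) \<in> V"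
  unfolding V by (rule Vs_lincomb)
lemma V_diff: "u \<in> V \<Longrightarrow> v \<in> V \<Longrightarrow> (\<lambda>x. u x - v x) \<in> V"
  using V_lincomb[of u v 1 "-1"] by simp
lemma form_diff: "u \<in> V \<Longrightarrow> v \<in> V \<Longrightarrow> w \<in> V \<Longrightarrow> E (\<lambda>x. u x - v x) w = E u w - E v w"
  using form_lincomb[of u v w 1 "-1"] by simp

lemma form_phi:
  assumes "v \<in> V"
  shows "E (\<phi> n) v = \<Lambda> n * coef v n"
proof -
  have vL: "v \<in> L2 m" by (rule V_L2[OF assms])
  have "E (\<phi> n) v = L2_inner m (A (\<phi> n)) v" by (rule EA[OF phi(1) assms])
  also have "\<dots> = L2_inner m (\<lambda>x. \<Lambda> n * \<phi> n x) v"
    using eb by (intro L2_inner_cong_AE AL phi L2_cmult vL) (simp add: eigenbasis_def)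
  also have "\<dots> = \<Lambda> n * coef v n"
    using L2_inner_lincomb[of "\<phi> n" m "\<phi> n" v "\<Lambda> n" 0] phi(3) vL by (simp add: coef_def L2_inner_commute[of m v])
  finally show ?thesis .
qed

lemma form_psum:
  assumes "finite K" "v \<in> V"
  shows "E (\<lambda>x. \<Sum>n\<in>K. c n * \<phi> n x) v = (\<Sum>n\<in>K. c n * (\<Lambda> n * coef v n))"
  using assms(1)
proof (induction K rule: finite_induct)
  case empty
  have "E (\<lambda>x. 0 * \<phi> 0 x + 0 * \<phi> 0 x) v = 0" using form_lincomb[OF phi(2) phi(2) assms(2), of 0 0 0 0] by simp
  then show ?case by simp
next
  case (insert n K)
  have "(\<lambda>x. \<Sum>n\<in>K. c n * \<phi> n x) \<in> V" unfolding V by (rule psum_Vs(1)[OF insert(1)])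
  then show ?case using form_lincomb[OF phi(2) _ assms(2), of _ "c n" n 1] insert by (simp add: form_phi[OF assms(2)])
qed

lemma form_Cauchy_Schwarz:
  assumes "u \<in> V" "v \<in> V"
  shows "\<bar>E u v\<bar> \<le> sqrt (E u u) * sqrt (E v v)"
proof -
  have "(E u v)\<^sup>2 \<le> E u u * E v v"
  proof (rule discriminant_bound)
    fix x :: real
    define w where "w = (\<lambda>y. 1 * u y + x * v y)"
    have w: "w \<in> V" unfolding w_def using assms by (rule V_lincomb)
    have "0 \<le> E w w" by (rule form_nonneg[OF w])
    also have "E w w = 1 * E u w + x * E v w"
      using form_lincomb[OF assms w, of 1 x] by (simp add: w_def)
    also have "E u w = 1 * E u u + x * E v u"
      unfolding form_sym[OF assms(1) w] using form_lincomb[OF assms assms(1), of 1 x] by (simp add: w_def)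
    also have "E v w = 1 * E u v + x * E v v"
      unfolding form_sym[OF assms(2) w] using form_lincomb[OF assms assms(2), of 1 x] by (simp add: w_def)
    finally show "0 \<le> E u u + 2 * x * E u v + x\<^sup>2 * E v v"
      using form_sym[OF assms] by (simp add: power2_eq_square algebra_simps)
  qed
  then show ?thesis unfolding real_sqrt_mult[symmetric]
    by (metis real_sqrt_abs real_sqrt_le_mono)
qed

text \<open>The partial sums of the expansion of \<open>u\<close> form a Cauchy sequence in the form norm, because
\<open>u\<close> lies in \<open>V\<^sub>1\<^sub>/\<^sub>2\<close>.  The form is closed, so they converge in
the form norm, and the limit is \<open>u\<close> since it has the same coefficients.  On partial sums the
formula follows from the eigenvalue equation.\<close>

lemma form_sums:
  assumes u: "u \<in> V" and v: "v \<in> V"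
  shows "(\<lambda>n. coef u n * (\<Lambda> n * coef v n)) sums E u v"
proof -
  define S where "S N x = (\<Sum>n<N. coef u n * \<phi> n x)" for N x
  have SV: "S N \<in> V" for N unfolding V S_def by (rule psum_Vs(1)) simp
  have uL: "u \<in> L2 m" by (rule V_L2[OF u])
  have su: "summable (\<lambda>n. (\<Lambda> n powr (1/2) * coef u n)\<^sup>2)"
    using u unfolding V Vs_def coef_def[symmetric] weight_square by auto
  have dn: "form_norm m E 1 (\<lambda>x. S i x - S j x) < e"
    if N: "\<And>K. finite K \<Longrightarrow> K \<subseteq> {N..} \<Longrightarrow> L2_set (\<lambda>n. \<Lambda> n powr (1/2) * coef u n) K \<le> e / (2 * (1 + \<Lambda> 0 powr (-1/2)))"
      and ij: "i \<ge> N" "j \<ge> N" and e: "e > 0" for i j N e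
  proof -
    define K where "K = {min i j..<max i j}"
    have K: "finite K" "K \<subseteq> {N..}" using ij by (auto simp: K_def)
    define d where "d x = (\<Sum>n\<in>K. coef u n * \<phi> n x)" for x
    have dV: "d \<in> V" unfolding V d_def by (rule psum_Vs(1)[OF K(1)])
    have sgn: "(\<lambda>x. S i x - S j x) = d \<or> (\<lambda>x. S i x - S j x) = (\<lambda>x. - d x)"
    proof (cases "j \<le> i")
      case True
      have "S i x - S j x = d x" for x
        unfolding S_def d_def K_def using sum_diff_nat_ivl[of 0 j i "\<lambda>n. coef u n * \<phi> n x"] True by (simp add: atLeast0LessThan min_def max_def)
      then show ?thesis by auto
    next
      case False
      have "S i x - S j x = - d x" for x
        unfolding S_def d_def K_def using sum_diff_nat_ivl[of 0 i j "\<lambda>n. coef u n * \<phi> n x"] False by (simp add: atLeast0LessThan min_def max_def)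
      then show ?thesis by auto
    qed
    have Em: "E (\<lambda>x. - d x) (\<lambda>x. - d x) = E d d"
    proof -
      have mV: "(\<lambda>x. - d x) \<in> V" using V_lincomb[OF dV dV, of "-1" 0] by simp
      have "E (\<lambda>x. - d x) w = - E d w" if "w \<in> V" for w using form_lincomb[OF dV dV that, of "-1" 0] by simp
      then show ?thesis using mV dV form_sym[OF dV mV] by simp
    qed
    have fn: "form_norm m E 1 (\<lambda>x. S i x - S j x) = sqrt (E d d + L2_inner m d d)"
    proof -
      have "L2_inner m (\<lambda>x. - d x) (\<lambda>x. - d x) = L2_inner m d d" by (simp add: L2_inner_def)
      then have "form_norm m E 1 (\<lambda>x. - d x) = sqrt (E d d + L2_inner m d d)" by (simp add: form_norm_def Em)
      moreover have "form_norm m E 1 d = sqrt (E d d + L2_inner m d d)" by (simp add: form_norm_def)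
      ultimately show ?thesis using sgn by (elim disjE) (simp_all only:)
    qed
    have "E d d = (\<Sum>n\<in>K. coef u n * (\<Lambda> n * coef d n))" unfolding d_def by (rule form_psum[OF K(1) dV[unfolded d_def]])
    also have "\<dots> = (\<Sum>n\<in>K. (\<Lambda> n powr (1/2) * coef u n)\<^sup>2)"
    proof (rule sum.cong[OF refl])
      fix n assume n: "n \<in> K"
      have "\<Lambda> n = (\<Lambda> n powr (1/2))\<^sup>2" using Lambda_pos[of n] by (simp add: powr_half_sqrt)
      moreover have "coef d n = coef u n" unfolding d_def using n by (simp add: coef_psum[OF K(1)])
      ultimately show "coef u n * (\<Lambda> n * coef d n) = (\<Lambda> n powr (1/2) * coef u n)\<^sup>2" by (simp add: power2_eq_square)
    qed
    finally have E2: "sqrt (E d d) = L2_set (\<lambda>n. \<Lambda> n powr (1/2) * coef u n) K" by (simp add: L2_set_def)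
    have "sqrt (L2_inner m d d) = L2_set (coef u) K"
      using norm_psum[OF K(1), of "coef u"] by (simp add: L2_norm_def d_def[abs_def])
    also have "\<dots> \<le> \<Lambda> 0 powr (-1/2) * L2_set (\<lambda>n. \<Lambda> n powr (1/2) * coef u n) K"
    proof -
      have "\<Lambda> n powr 0 = 1" for n using Lambda_pos[of n] by simp
      then show ?thesis using L2_set_weight_compare[of 0 "1/2" "coef u" K] by simp
    qed
    finally have "sqrt (E d d) + sqrt (L2_inner m d d) \<le> (1 + \<Lambda> 0 powr (-1/2)) * L2_set (\<lambda>n. \<Lambda> n powr (1/2) * coef u n) K"
      using E2 by (simp add: distrib_right)
    also have "\<dots> \<le> (1 + \<Lambda> 0 powr (-1/2)) * (e / (2 * (1 + \<Lambda> 0 powr (-1/2))))"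
      by (intro mult_left_mono N K) simp
    also have "\<dots> = e / 2"
    proof -
      have "1 + \<Lambda> 0 powr (-1/2) > 0" by (simp add: add_pos_nonneg)
      then show ?thesis by (simp add: field_simps)
    qed
    also have "\<dots> < e" using e by simp
    finally show ?thesis unfolding fn
      using sqrt_add_le_add_sqrt[OF form_nonneg[OF dV] L2_inner_self_nonneg[of m d]] by linarith
  qed
  have Cauchy: "\<exists>N. \<forall>i\<ge>N. \<forall>j\<ge>N. form_norm m E 1 (\<lambda>x. S i x - S j x) < e" if e: "e > 0" for e
  proof -
    have p: "1 + \<Lambda> 0 powr (-1/2) > 0" by (simp add: add_pos_nonneg)
    have "e / (2 * (1 + \<Lambda> 0 powr (-1/2))) > 0" using e p by simp
    from L2_set_tail_le[OF su this] obtain N where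
      N: "\<And>K. finite K \<Longrightarrow> K \<subseteq> {N..} \<Longrightarrow> L2_set (\<lambda>n. \<Lambda> n powr (1/2) * coef u n) K \<le> e / (2 * (1 + \<Lambda> 0 powr (-1/2)))" by blast
    show ?thesis
    proof (intro exI[of _ N] allI impI)
      fix i j assume "N \<le> i" "N \<le> j"
      then show "form_norm m E 1 (\<lambda>x. S i x - S j x) < e"
        by (intro dn[where N = N and e = e] N e)
    qed
  qed
  have "closed_form m V E" using dir by (simp add: dirichlet_form_def)
  then have "\<exists>w\<in>V. (\<lambda>n. form_norm m E 1 (\<lambda>x. S n x - w x)) \<longlonglongrightarrow> 0"
    unfolding closed_form_def using SV Cauchy zero_less_one[where 'a = real] by simp
  then obtain w where w: "w \<in> V" "(\<lambda>n. form_norm m E 1 (\<lambda>x. S n x - w x)) \<longlonglongrightarrow> 0" by blast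
  have wL: "w \<in> L2 m" by (rule V_L2[OF w(1)])
  have dV: "(\<lambda>x. S n x - w x) \<in> V" for n by (rule V_diff[OF SV w(1)])
  have parts: "sqrt (E (\<lambda>x. S n x - w x) (\<lambda>x. S n x - w x)) \<le> form_norm m E 1 (\<lambda>x. S n x - w x)"
     "L2_norm m (\<lambda>x. S n x - w x) \<le> form_norm m E 1 (\<lambda>x. S n x - w x)" for n
    unfolding form_norm_def L2_norm_def
    using form_nonneg[OF dV[of n]] L2_inner_self_nonneg[of m "\<lambda>x. S n x - w x"] by (auto intro!: real_sqrt_le_mono)
  have "ae_eq m w u"
  proof (rule coef_eq_imp_ae_eq[OF wL uL])
    fix n
    have "(\<lambda>k. coef (S k) n - coef w n) \<longlonglongrightarrow> 0"
    proof (rule Lim_null_comparison[OF _ w(2)], intro always_eventually allI)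
      fix k
      have "\<bar>coef (\<lambda>x. S k x - w x) n\<bar> \<le> L2_norm m (\<lambda>x. S k x - w x)"
        using L2_set_coef_le[OF V_L2[OF dV], of "{n}" k] by simp
      then show "norm (coef (S k) n - coef w n) \<le> form_norm m E 1 (\<lambda>x. S k x - w x)"
        using parts(2)[of k] by (simp add: coef_diff[OF V_L2[OF SV] wL])
    qed
    moreover have "eventually (\<lambda>k. coef (S k) n - coef w n = coef u n - coef w n) sequentially"
      using eventually_gt_at_top[of n] by eventually_elim (simp add: S_def[abs_def] coef_psum)
    ultimately have "(\<lambda>k. coef u n - coef w n) \<longlonglongrightarrow> 0" by (rule Lim_transform_eventually)
    then have "coef u n - coef w n = 0" using LIMSEQ_const_iff by blast
    then show "coef w n = coef u n" by simp
  qed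
  then have Ew: "E w v = E u v" by (rule form_cong_AE[OF w(1) u v])
  have "(\<lambda>k. E (S k) v - E w v) \<longlonglongrightarrow> 0"
  proof (rule Lim_null_comparison)
    show "\<forall>\<^sub>F k in sequentially. norm (E (S k) v - E w v) \<le> form_norm m E 1 (\<lambda>x. S k x - w x) * sqrt (E v v)"
    proof (intro always_eventually allI)
      fix k
      have "\<bar>E (\<lambda>x. S k x - w x) v\<bar> \<le> sqrt (E (\<lambda>x. S k x - w x) (\<lambda>x. S k x - w x)) * sqrt (E v v)"
        by (rule form_Cauchy_Schwarz[OF dV v])
      also have "\<dots> \<le> form_norm m E 1 (\<lambda>x. S k x - w x) * sqrt (E v v)"
        by (intro mult_right_mono parts) (simp add: form_nonneg v)
      finally show "norm (E (S k) v - E w v) \<le> form_norm m E 1 (\<lambda>x. S k x - w x) * sqrt (E v v)"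
        by (simp add: form_diff[OF SV w(1) v])
    qed
    show "(\<lambda>k. form_norm m E 1 (\<lambda>x. S k x - w x) * sqrt (E v v)) \<longlonglongrightarrow> 0" by (rule tendsto_mult_left_zero[OF w(2)])
  qed
  then have "(\<lambda>k. E (S k) v) \<longlonglongrightarrow> E w v" by (simp add: LIM_zero_iff)
  moreover have "E (S k) v = (\<Sum>n<k. coef u n * (\<Lambda> n * coef v n))" for k
    unfolding S_def by (rule form_psum[OF _ v]) simp
  ultimately show ?thesis unfolding sums_def Ew by simp
qed

end


section \<open>Square summable paths\<close>

text \<open>Continuity in time of the path of sequences \<open>\<lambda>n. x n t\<close> in the norm of square summable
sequences, without reference to a space of sequences.\<close>

definition l2_continuous :: "real \<Rightarrow> (nat \<Rightarrow> real \<Rightarrow> real) \<Rightarrow> bool" where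
  "l2_continuous T x \<longleftrightarrow> (\<forall>t\<in>{0..T}. \<forall>\<epsilon>>0. \<exists>\<delta>>0. \<forall>s\<in>{0..T}. \<bar>s - t\<bar> < \<delta> \<longrightarrow>
     (\<forall>K. finite K \<longrightarrow> L2_set (\<lambda>n. x n s - x n t) K \<le> \<epsilon>))"

lemma l2_continuousD:
  assumes "l2_continuous T x" "t \<in> {0..T}" "\<epsilon> > 0"
  obtains \<delta> where "\<delta> > 0" "\<And>s K. s \<in> {0..T} \<Longrightarrow> \<bar>s - t\<bar> < \<delta> \<Longrightarrow> finite K \<Longrightarrow> L2_set (\<lambda>n. x n s - x n t) K \<le> \<epsilon>"
  using assms unfolding l2_continuous_def by metis

lemma l2_continuousI:
  assumes "\<And>t \<epsilon>. t \<in> {0..T} \<Longrightarrow> \<epsilon> > 0 \<Longrightarrow>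
    \<exists>\<delta>>0. \<forall>s\<in>{0..T}. \<bar>s - t\<bar> < \<delta> \<longrightarrow> (\<forall>K. finite K \<longrightarrow> L2_set (\<lambda>n. x n s - x n t) K \<le> \<epsilon>)"
  shows "l2_continuous T x"
  using assms unfolding l2_continuous_def by blast

lemma L2_set_subset: "finite L \<Longrightarrow> K \<subseteq> L \<Longrightarrow> L2_set y K \<le> L2_set y L"
  unfolding L2_set_def by (intro real_sqrt_le_mono sum_mono2) auto

lemma L2_set_split:
  fixes y :: "nat \<Rightarrow> real"
  assumes "finite K"
  shows "L2_set y K \<le> L2_set y (K \<inter> {..<N}) + L2_set y (K \<inter> {N..})"
proof -
  have "(\<Sum>n\<in>K. (y n)\<^sup>2) = (\<Sum>n\<in>(K \<inter> {..<N}) \<union> (K \<inter> {N..}). (y n)\<^sup>2)" by (rule sum.cong) auto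
  also have "\<dots> = (\<Sum>n\<in>K \<inter> {..<N}. (y n)\<^sup>2) + (\<Sum>n\<in>K \<inter> {N..}. (y n)\<^sup>2)"
    using assms by (intro sum.union_disjoint) auto
  finally show ?thesis unfolding L2_set_def by (simp add: sqrt_add_le_add_sqrt sum_nonneg)
qed

lemma l2_continuous_of_uniform_tails:
  assumes cont: "\<And>n. continuous_on {0..T} (x n)"
    and tail: "\<And>\<epsilon>. \<epsilon> > 0 \<Longrightarrow> \<exists>N. \<forall>K t. finite K \<longrightarrow> K \<subseteq> {N..} \<longrightarrow> t \<in> {0..T} \<longrightarrow> L2_set (\<lambda>n. x n t) K \<le> \<epsilon>"
  shows "l2_continuous T x"
proof (rule l2_continuousI)
  fix t \<epsilon> :: real assume t: "t \<in> {0..T}" and \<epsilon>: "\<epsilon> > 0"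
  have "\<epsilon> / 4 > 0" using \<epsilon> by simp
  from tail[OF this] obtain N where
    N: "\<And>K t. finite K \<Longrightarrow> K \<subseteq> {N..} \<Longrightarrow> t \<in> {0..T} \<Longrightarrow> L2_set (\<lambda>n. x n t) K \<le> \<epsilon> / 4" by blast
  have "continuous_on {0..T} (\<lambda>s. L2_set (\<lambda>n. x n s - x n t) {..<N})"
    unfolding L2_set_def by (intro continuous_intros cont)
  then have "((\<lambda>s. L2_set (\<lambda>n. x n s - x n t) {..<N}) \<longlongrightarrow> L2_set (\<lambda>n. x n t - x n t) {..<N}) (at t within {0..T})"
    using t unfolding continuous_on_def by blast
  then have "((\<lambda>s. L2_set (\<lambda>n. x n s - x n t) {..<N}) \<longlongrightarrow> 0) (at t within {0..T})" by (simp add: L2_set_def)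
  then have "eventually (\<lambda>s. L2_set (\<lambda>n. x n s - x n t) {..<N} < \<epsilon> / 2) (at t within {0..T})"
    using \<epsilon> by (intro order_tendstoD) auto
  then obtain \<delta> where \<delta>: "\<delta> > 0" "\<And>s. s \<in> {0..T} \<Longrightarrow> s \<noteq> t \<Longrightarrow> dist s t < \<delta> \<Longrightarrow> L2_set (\<lambda>n. x n s - x n t) {..<N} < \<epsilon> / 2"
    unfolding eventually_at by blast
  have "L2_set (\<lambda>n. x n s - x n t) K \<le> \<epsilon>" if s: "s \<in> {0..T}" "\<bar>s - t\<bar> < \<delta>" and K: "finite K" for s K
  proof (cases "s = t")
    case False
    have "L2_set (\<lambda>n. x n s - x n t) K \<le> L2_set (\<lambda>n. x n s - x n t) (K \<inter> {..<N}) + L2_set (\<lambda>n. x n s - x n t) (K \<inter> {N..})"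
      by (rule L2_set_split[OF K])
    also have "L2_set (\<lambda>n. x n s - x n t) (K \<inter> {..<N}) \<le> L2_set (\<lambda>n. x n s - x n t) {..<N}" by (rule L2_set_subset) auto
    also have "\<dots> \<le> \<epsilon> / 2" using \<delta>(2)[OF s(1) False] s(2) by (simp add: dist_real_def)
    also have "L2_set (\<lambda>n. x n s - x n t) (K \<inter> {N..}) \<le> L2_set (\<lambda>n. x n s) (K \<inter> {N..}) + L2_set (\<lambda>n. x n t) (K \<inter> {N..})"
      by (rule L2_set_diff_le)
    also have "\<dots> \<le> \<epsilon> / 4 + \<epsilon> / 4" by (intro add_mono N s t) (use K in auto)
    finally show ?thesis by simp
  qed (use \<epsilon> in \<open>simp add: L2_set_def\<close>)
  then show "\<exists>\<delta>>0. \<forall>s\<in>{0..T}. \<bar>s - t\<bar> < \<delta> \<longrightarrow> (\<forall>K. finite K \<longrightarrow> L2_set (\<lambda>n. x n s - x n t) K \<le> \<epsilon>)"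
    using \<delta>(1) by blast
qed

lemma l2_continuous_diff:
  assumes "l2_continuous T x" "l2_continuous T y"
  shows "l2_continuous T (\<lambda>n t. x n t - y n t)"
proof (rule l2_continuousI)
  fix t \<epsilon> :: real assume t: "t \<in> {0..T}" and \<epsilon>: "\<epsilon> > 0"
  have e: "\<epsilon> / 2 > 0" using \<epsilon> by simp
  obtain d1 where d1: "d1 > 0" "\<And>s K. s \<in> {0..T} \<Longrightarrow> \<bar>s - t\<bar> < d1 \<Longrightarrow> finite K \<Longrightarrow> L2_set (\<lambda>n. x n s - x n t) K \<le> \<epsilon> / 2"
    using l2_continuousD[OF assms(1) t e] by blast
  obtain d2 where d2: "d2 > 0" "\<And>s K. s \<in> {0..T} \<Longrightarrow> \<bar>s - t\<bar> < d2 \<Longrightarrow> finite K \<Longrightarrow> L2_set (\<lambda>n. y n s - y n t) K \<le> \<epsilon> / 2"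
    using l2_continuousD[OF assms(2) t e] by blast
  have "L2_set (\<lambda>n. (x n s - y n s) - (x n t - y n t)) K \<le> \<epsilon>" if "s \<in> {0..T}" "\<bar>s - t\<bar> < min d1 d2" "finite K" for s K
  proof -
    have "L2_set (\<lambda>n. (x n s - y n s) - (x n t - y n t)) K = L2_set (\<lambda>n. (x n s - x n t) - (y n s - y n t)) K"
      by (simp add: algebra_simps)
    also have "\<dots> \<le> L2_set (\<lambda>n. x n s - x n t) K + L2_set (\<lambda>n. y n s - y n t) K" by (rule L2_set_diff_le)
    also have "\<dots> \<le> \<epsilon> / 2 + \<epsilon> / 2" using that by (intro add_mono d1 d2) auto
    finally show ?thesis by simp
  qed
  then show "\<exists>\<delta>>0. \<forall>s\<in>{0..T}. \<bar>s - t\<bar> < \<delta> \<longrightarrow> (\<forall>K. finite K \<longrightarrow> L2_set (\<lambda>n. (x n s - y n s) - (x n t - y n t)) K \<le> \<epsilon>)"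
    using d1(1) d2(1) by (intro exI[of _ "min d1 d2"]) auto
qed

lemma l2_continuous_scaled:
  assumes x: "l2_continuous T x" and le: "\<And>n s t. \<bar>y n s - y n t\<bar> \<le> C * \<bar>x n s - x n t\<bar>" and C: "C \<ge> 0"
  shows "l2_continuous T y"
proof (rule l2_continuousI)
  fix t \<epsilon> :: real assume t: "t \<in> {0..T}" and \<epsilon>: "\<epsilon> > 0"
  have e: "\<epsilon> / (C + 1) > 0" using \<epsilon> C by simp
  obtain d where d: "d > 0" "\<And>s K. s \<in> {0..T} \<Longrightarrow> \<bar>s - t\<bar> < d \<Longrightarrow> finite K \<Longrightarrow> L2_set (\<lambda>n. x n s - x n t) K \<le> \<epsilon> / (C + 1)"
    using l2_continuousD[OF x t e] by blast
  have "L2_set (\<lambda>n. y n s - y n t) K \<le> \<epsilon>" if "s \<in> {0..T}" "\<bar>s - t\<bar> < d" "finite K" for s K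
  proof -
    have "L2_set (\<lambda>n. y n s - y n t) K \<le> C * L2_set (\<lambda>n. x n s - x n t) K" by (rule L2_set_scaled_le[OF le C])
    also have "\<dots> \<le> C * (\<epsilon> / (C + 1))" by (intro mult_left_mono d that C)
    also have "\<dots> \<le> \<epsilon>" using \<epsilon> C by (simp add: field_simps)
    finally show ?thesis .
  qed
  then show "\<exists>\<delta>>0. \<forall>s\<in>{0..T}. \<bar>s - t\<bar> < \<delta> \<longrightarrow> (\<forall>K. finite K \<longrightarrow> L2_set (\<lambda>n. y n s - y n t) K \<le> \<epsilon>)"
    using d(1) by blast
qed

text \<open>Differentiability mode by mode is differentiability in norm as soon as the derivatives form a path that is
continuous in norm, by the mean value inequality for vectors.\<close>

lemma l2_difference_quotient:
  assumes der: "\<And>n r. r \<in> {0..T} \<Longrightarrow> (x n has_real_derivative d n r) (at r within {0..T})"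
    and d: "l2_continuous T d" and t: "t \<in> {0..T}" and \<epsilon>: "\<epsilon> > 0"
  obtains \<delta> where "\<delta> > 0" "\<And>s K. s \<in> {0..T} \<Longrightarrow> s \<noteq> t \<Longrightarrow> \<bar>s - t\<bar> < \<delta> \<Longrightarrow> finite K \<Longrightarrow>
     L2_set (\<lambda>n. (x n s - x n t) / (s - t) - d n t) K \<le> \<epsilon>"
proof -
  obtain \<delta> where \<delta>: "\<delta> > 0" "\<And>s K. s \<in> {0..T} \<Longrightarrow> \<bar>s - t\<bar> < \<delta> \<Longrightarrow> finite K \<Longrightarrow> L2_set (\<lambda>n. d n s - d n t) K \<le> \<epsilon>"
    using l2_continuousD[OF d t \<epsilon>] by blast
  show thesis
  proof (rule that[OF \<delta>(1)])
    fix s K assume s: "s \<in> {0..T}" "s \<noteq> t" "\<bar>s - t\<bar> < \<delta>" and K: "finite (K :: nat set)"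
    show "L2_set (\<lambda>n. (x n s - x n t) / (s - t) - d n t) K \<le> \<epsilon>"
      by (rule L2_set_difference_quotient[OF K s(1) t s(2) der]) (use \<delta>(2) s(3) K in auto)
  qed
qed

lemma l2_continuous_of_derivative:
  assumes der: "\<And>n r. r \<in> {0..T} \<Longrightarrow> (x n has_real_derivative d n r) (at r within {0..T})"
    and d: "l2_continuous T d" and B: "\<And>t K. t \<in> {0..T} \<Longrightarrow> finite K \<Longrightarrow> L2_set (\<lambda>n. d n t) K \<le> B"
  shows "l2_continuous T x"
proof (rule l2_continuousI)
  fix t \<epsilon> :: real assume t: "t \<in> {0..T}" and \<epsilon>: "\<epsilon> > 0"
  have B0: "B \<ge> 0" using B[OF t, of "{}"] by simp
  obtain \<delta> where \<delta>: "\<delta> > 0" "\<And>s K. s \<in> {0..T} \<Longrightarrow> s \<noteq> t \<Longrightarrow> \<bar>s - t\<bar> < \<delta> \<Longrightarrow> finite K \<Longrightarrow>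
     L2_set (\<lambda>n. (x n s - x n t) / (s - t) - d n t) K \<le> 1"
    using l2_difference_quotient[OF der d t zero_less_one] by blast
  define \<eta> where "\<eta> = min \<delta> (\<epsilon> / (B + 1))"
  have "L2_set (\<lambda>n. x n s - x n t) K \<le> \<epsilon>" if s: "s \<in> {0..T}" "\<bar>s - t\<bar> < \<eta>" and K: "finite K" for s K
  proof (cases "s = t")
    case False
    have "L2_set (\<lambda>n. x n s - x n t) K = L2_set (\<lambda>n. (s - t) * (((x n s - x n t) / (s - t) - d n t) + d n t)) K"
      using False by simp
    also have "\<dots> \<le> \<bar>s - t\<bar> * L2_set (\<lambda>n. ((x n s - x n t) / (s - t) - d n t) + d n t) K"
      by (rule L2_set_scaled_le) (auto simp: abs_mult)
    also have "\<dots> \<le> \<bar>s - t\<bar> * (L2_set (\<lambda>n. (x n s - x n t) / (s - t) - d n t) K + L2_set (\<lambda>n. d n t) K)"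
      by (intro mult_left_mono L2_set_triangle_ineq) simp
    also have "\<dots> \<le> \<bar>s - t\<bar> * (1 + B)"
      using s K t False by (intro mult_left_mono add_mono \<delta>(2) B) (auto simp: \<eta>_def)
    also have "\<dots> \<le> \<epsilon> / (B + 1) * (1 + B)" using s(2) B0 by (intro mult_right_mono) (auto simp: \<eta>_def)
    also have "\<dots> = \<epsilon>" using B0 by (simp add: field_simps)
    finally show ?thesis .
  qed (use \<epsilon> in \<open>simp add: L2_set_def\<close>)
  moreover have "\<eta> > 0" using \<delta>(1) \<epsilon> B0 by (simp add: \<eta>_def)
  ultimately show "\<exists>\<delta>>0. \<forall>s\<in>{0..T}. \<bar>s - t\<bar> < \<delta> \<longrightarrow> (\<forall>K. finite K \<longrightarrow> L2_set (\<lambda>n. x n s - x n t) K \<le> \<epsilon>)"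
    by blast
qed

lemma tendsto_0_within_of_bound:
  fixes N :: "real \<Rightarrow> real"
  assumes "\<And>\<epsilon>. \<epsilon> > 0 \<Longrightarrow> \<exists>\<delta>>0. \<forall>s\<in>S. s \<noteq> t \<longrightarrow> \<bar>s - t\<bar> < \<delta> \<longrightarrow> N s \<le> \<epsilon>" and "\<And>s. s \<in> S \<Longrightarrow> s \<noteq> t \<Longrightarrow> N s \<ge> 0"
  shows "(N \<longlongrightarrow> 0) (at t within S)"
proof (rule tendstoI)
  fix e :: real assume e: "e > 0"
  then obtain \<delta> where \<delta>: "\<delta> > 0" "\<And>s. s \<in> S \<Longrightarrow> s \<noteq> t \<Longrightarrow> \<bar>s - t\<bar> < \<delta> \<Longrightarrow> N s \<le> e / 2"
    using assms(1)[of "e / 2"] by auto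
  have "dist (N s) 0 < e" if "s \<in> S" "s \<noteq> t" "dist s t < \<delta>" for s
    using \<delta>(2)[of s] that assms(2)[of s] e by (simp add: dist_real_def)
  then show "\<forall>\<^sub>F s in at t within S. dist (N s) 0 < e"
    unfolding eventually_at using \<delta>(1) by blast
qed

section \<open>The dual spaces\<close>

context spectral_setting
begin

lemma dual_weight_square: "(F (\<phi> n))\<^sup>2 * \<Lambda> n powr (- 2 * s) = (\<Lambda> n powr (- s) * F (\<phi> n))\<^sup>2"
proof -
  have "\<Lambda> n powr (- 2 * s) = \<Lambda> n powr (- s) * \<Lambda> n powr (- s)" by (simp flip: powr_add)
  then show ?thesis by (simp add: power2_eq_square)
qed

lemma Vs_norm_nonneg: "h \<in> Vs m \<Lambda> \<phi> s \<Longrightarrow> Vs_norm m \<Lambda> \<phi> s h \<ge> 0"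
  using L2_set_Vs_le[of h s "{}"] by simp

lemma Vdual_psum:
  assumes F: "F \<in> Vdual m \<Lambda> \<phi> s" and K: "finite K"
  shows "F (\<lambda>x. \<Sum>n\<in>K. c n * \<phi> n x) = (\<Sum>n\<in>K. c n * F (\<phi> n))"
proof -
  have lin: "F (\<lambda>x. a * u x + b * v x) = a * F u + b * F v" if "u \<in> Vs m \<Lambda> \<phi> s" "v \<in> Vs m \<Lambda> \<phi> s" for u v a b
    using F that unfolding Vdual_def by blast
  show ?thesis using K
  proof (induction K rule: finite_induct)
    case empty
    then show ?case using lin[OF phi_Vs phi_Vs, of 0 0 0 0] by simp
  next
    case (insert n K)
    then show ?case using lin[OF phi_Vs psum_Vs(1)[OF insert(1)], of "c n" n 1 c] by simp
  qed
qed

text \<open>\<open>F\<close> is tested with the partial sums of its Riesz representative in \<open>V\<^sub>s\<close>,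
whose coefficients are \<open>\<Lambda> n powr (- 2 * s) * F (\<phi> n)\<close>.\<close>

lemma Vdual_summable:
  assumes F: "F \<in> Vdual m \<Lambda> \<phi> s"
  shows "summable (\<lambda>n. (\<Lambda> n powr (- s) * F (\<phi> n))\<^sup>2)"
proof -
  obtain C where C: "\<And>v. v \<in> Vs m \<Lambda> \<phi> s \<Longrightarrow> \<bar>F v\<bar> \<le> C * Vs_norm m \<Lambda> \<phi> s v"
    using F unfolding Vdual_def by blast
  have "L2_set (\<lambda>n. \<Lambda> n powr (- s) * F (\<phi> n)) K \<le> \<bar>C\<bar>" if K: "finite K" for K
  proof (rule L2_set_dual_bound[OF K])
    define c where "c n = \<Lambda> n powr (- s) * (\<Lambda> n powr (- s) * F (\<phi> n))" for n
    have "(\<Sum>n\<in>K. (\<Lambda> n powr (- s) * F (\<phi> n))\<^sup>2) = F (\<lambda>x. \<Sum>n\<in>K. c n * \<phi> n x)"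
      unfolding Vdual_psum[OF F K] by (simp add: c_def power2_eq_square mult.assoc mult.left_commute)
    also have "\<dots> \<le> C * Vs_norm m \<Lambda> \<phi> s (\<lambda>x. \<Sum>n\<in>K. c n * \<phi> n x)"
      using C[OF psum_Vs(1)[OF K]] by (metis abs_le_D1)
    also have "\<dots> \<le> \<bar>C\<bar> * Vs_norm m \<Lambda> \<phi> s (\<lambda>x. \<Sum>n\<in>K. c n * \<phi> n x)"
      by (intro mult_right_mono Vs_norm_nonneg psum_Vs K) simp
    also have "\<dots> \<le> \<bar>C\<bar> * L2_set (\<lambda>n. \<Lambda> n powr s * c n) K" by (intro mult_left_mono psum_Vs K) simp
    also have "(\<lambda>n. \<Lambda> n powr s * c n) = (\<lambda>n. \<Lambda> n powr (- s) * F (\<phi> n))"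
    proof
      fix n
      have "\<Lambda> n powr s * \<Lambda> n powr (- s) = 1" using Lambda_pos[of n] by (simp flip: powr_add)
      then show "\<Lambda> n powr s * c n = \<Lambda> n powr (- s) * F (\<phi> n)" by (simp add: c_def mult.assoc[symmetric])
    qed
    finally show "(\<Sum>n\<in>K. (\<Lambda> n powr (- s) * F (\<phi> n))\<^sup>2) \<le> L2_set (\<lambda>n. \<Lambda> n powr (- s) * F (\<phi> n)) K * \<bar>C\<bar>"
      by (simp add: mult.commute)
  qed simp
  then show ?thesis by (rule L2_set_bound_imp_summable(1))
qed

lemma L2_set_Vdual_le:
  assumes "F \<in> Vdual m \<Lambda> \<phi> s" "finite K"
  shows "L2_set (\<lambda>n. \<Lambda> n powr (- s) * F (\<phi> n)) K \<le> Vdual_norm \<Lambda> \<phi> s F"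
  using L2_set_le_sqrt_suminf[OF Vdual_summable[OF assms(1)] assms(2)]
  unfolding Vdual_norm_def dual_weight_square .

lemma Vdual_norm_le:
  assumes "\<And>K. finite K \<Longrightarrow> L2_set (\<lambda>n. \<Lambda> n powr (- s) * F (\<phi> n)) K \<le> B"
  shows "Vdual_norm \<Lambda> \<phi> s F \<le> B"
  using L2_set_bound_imp_summable(2)[OF assms] unfolding Vdual_norm_def dual_weight_square .

lemma Vdual_norm_nonneg: "F \<in> Vdual m \<Lambda> \<phi> s \<Longrightarrow> Vdual_norm \<Lambda> \<phi> s F \<ge> 0"
  using L2_set_Vdual_le[of F s "{}"] by simp

lemma Vdual_I:
  assumes "\<And>u v a b. u \<in> Vs m \<Lambda> \<phi> s \<Longrightarrow> v \<in> Vs m \<Lambda> \<phi> s \<Longrightarrow> F (\<lambda>x. a * u x + b * v x) = a * F u + b * F v"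
    and "\<And>v. v \<in> Vs m \<Lambda> \<phi> s \<Longrightarrow> \<bar>F v\<bar> \<le> C * Vs_norm m \<Lambda> \<phi> s v"
  shows "F \<in> Vdual m \<Lambda> \<phi> s"
  using assms unfolding Vdual_def by blast

lemma Vdual_lincomb:
  assumes F: "F \<in> Vdual m \<Lambda> \<phi> s" and G: "G \<in> Vdual m \<Lambda> \<phi> s"
  shows "(\<lambda>v. a * F v + b * G v) \<in> Vdual m \<Lambda> \<phi> s"
proof -
  obtain C1 where C1: "\<And>v. v \<in> Vs m \<Lambda> \<phi> s \<Longrightarrow> \<bar>F v\<bar> \<le> C1 * Vs_norm m \<Lambda> \<phi> s v" using F unfolding Vdual_def by blast
  obtain C2 where C2: "\<And>v. v \<in> Vs m \<Lambda> \<phi> s \<Longrightarrow> \<bar>G v\<bar> \<le> C2 * Vs_norm m \<Lambda> \<phi> s v" using G unfolding Vdual_def by blast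
  show ?thesis
  proof (rule Vdual_I)
    fix u v :: "'a \<Rightarrow> real" and c d :: real assume uv: "u \<in> Vs m \<Lambda> \<phi> s" "v \<in> Vs m \<Lambda> \<phi> s"
    have "F (\<lambda>x. c * u x + d * v x) = c * F u + d * F v" "G (\<lambda>x. c * u x + d * v x) = c * G u + d * G v"
      using F G uv unfolding Vdual_def by blast+
    then show "a * F (\<lambda>x. c * u x + d * v x) + b * G (\<lambda>x. c * u x + d * v x) = c * (a * F u + b * G u) + d * (a * F v + b * G v)"
      by (simp add: algebra_simps)
  next
    fix v assume v: "v \<in> Vs m \<Lambda> \<phi> s"
    have "\<bar>a * F v + b * G v\<bar> \<le> \<bar>a\<bar> * \<bar>F v\<bar> + \<bar>b\<bar> * \<bar>G v\<bar>" by (metis abs_mult abs_triangle_ineq)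
    also have "\<dots> \<le> \<bar>a\<bar> * (C1 * Vs_norm m \<Lambda> \<phi> s v) + \<bar>b\<bar> * (C2 * Vs_norm m \<Lambda> \<phi> s v)"
      by (intro add_mono mult_left_mono C1 C2 v) auto
    finally show "\<bar>a * F v + b * G v\<bar> \<le> (\<bar>a\<bar> * C1 + \<bar>b\<bar> * C2) * Vs_norm m \<Lambda> \<phi> s v" by (simp add: algebra_simps)
  qed
qed

text \<open>The functional with the values \<open>y n\<close> at the eigenfunctions.\<close>

definition dual_of :: "(nat \<Rightarrow> real) \<Rightarrow> ('a \<Rightarrow> real) \<Rightarrow> real" where "dual_of y v = (\<Sum>n. y n * coef v n)"

lemma dual_pairing:
  assumes y: "\<And>K. finite K \<Longrightarrow> L2_set (\<lambda>n. \<Lambda> n powr (- s) * y n) K \<le> B" and v: "v \<in> Vs m \<Lambda> \<phi> s"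
  shows "summable (\<lambda>n. y n * coef v n)" "\<bar>\<Sum>n. y n * coef v n\<bar> \<le> B * Vs_norm m \<Lambda> \<phi> s v"
proof -
  have b: "(\<Sum>n<N. \<bar>y n * coef v n\<bar>) \<le> B * Vs_norm m \<Lambda> \<phi> s v" for N
  proof -
    have "\<bar>y n * coef v n\<bar> = \<bar>\<Lambda> n powr (- s) * y n\<bar> * \<bar>\<Lambda> n powr s * coef v n\<bar>" for n
    proof -
      have "\<Lambda> n powr (- s) * \<Lambda> n powr s = 1" using Lambda_pos[of n] by (simp flip: powr_add)
      then show ?thesis unfolding abs_mult[symmetric]
        by (metis (no_types, opaque_lifting) mult.assoc mult.left_commute mult_1)
    qed
    then have "(\<Sum>n<N. \<bar>y n * coef v n\<bar>) = (\<Sum>n<N. \<bar>\<Lambda> n powr (- s) * y n\<bar> * \<bar>\<Lambda> n powr s * coef v n\<bar>)" by simp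
    also have "\<dots> \<le> L2_set (\<lambda>n. \<Lambda> n powr (- s) * y n) {..<N} * L2_set (\<lambda>n. \<Lambda> n powr s * coef v n) {..<N}"
      by (rule L2_set_mult_ineq)
    also have "\<dots> \<le> B * Vs_norm m \<Lambda> \<phi> s v"
      using y[of "{}"] by (intro mult_mono y L2_set_Vs_le v) (auto simp: L2_set_nonneg)
    finally show ?thesis .
  qed
  have s: "summable (\<lambda>n. \<bar>y n * coef v n\<bar>)" by (rule summableI_nonneg_bounded[OF _ b]) simp
  then show "summable (\<lambda>n. y n * coef v n)" by (rule summable_rabs_cancel)
  have "\<bar>\<Sum>n. y n * coef v n\<bar> \<le> (\<Sum>n. \<bar>y n * coef v n\<bar>)" by (rule summable_rabs[OF s])
  also have "\<dots> \<le> B * Vs_norm m \<Lambda> \<phi> s v" by (rule suminf_le_const[OF s b])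
  finally show "\<bar>\<Sum>n. y n * coef v n\<bar> \<le> B * Vs_norm m \<Lambda> \<phi> s v" .
qed

lemma dual_of_Vdual:
  assumes y: "\<And>K. finite K \<Longrightarrow> L2_set (\<lambda>n. \<Lambda> n powr (- s) * y n) K \<le> B"
  shows "dual_of y \<in> Vdual m \<Lambda> \<phi> s"
proof (rule Vdual_I)
  fix u v :: "'a \<Rightarrow> real" and a b :: real assume uv: "u \<in> Vs m \<Lambda> \<phi> s" "v \<in> Vs m \<Lambda> \<phi> s"
  have "dual_of y (\<lambda>x. a * u x + b * v x) = (\<Sum>n. a * (y n * coef u n) + b * (y n * coef v n))"
    unfolding dual_of_def by (simp add: coef_lincomb[OF Vs_L2[OF uv(1)] Vs_L2[OF uv(2)]] algebra_simps)
  also have "\<dots> = (\<Sum>n. a * (y n * coef u n)) + (\<Sum>n. b * (y n * coef v n))"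
    by (rule suminf_add[symmetric]; intro summable_mult dual_pairing(1)[OF y] uv)
  also have "\<dots> = a * dual_of y u + b * dual_of y v"
    unfolding dual_of_def using dual_pairing(1)[OF y uv(1)] dual_pairing(1)[OF y uv(2)] by (simp add: suminf_mult)
  finally show "dual_of y (\<lambda>x. a * u x + b * v x) = a * dual_of y u + b * dual_of y v" .
next
  fix v assume v: "v \<in> Vs m \<Lambda> \<phi> s"
  show "\<bar>dual_of y v\<bar> \<le> B * Vs_norm m \<Lambda> \<phi> s v"
    unfolding dual_of_def by (rule dual_pairing(2)[OF _ v]) (rule y)
qed

lemma dual_of_phi: "dual_of y (\<phi> n) = y n"
proof -
  have "dual_of y (\<phi> n) = (\<Sum>j\<in>{n}. y j * coef (\<phi> n) j)"
    unfolding dual_of_def by (rule suminf_finite) (auto simp: coef_phi)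
  then show ?thesis by (simp add: coef_phi)
qed

end


section \<open>Paths in coordinates\<close>

text \<open>\<open>L\<^sup>2\<close>, \<open>V\<^sub>s\<close> and its dual are normed by the square sum of weighted
coordinates.  The notions of continuous and differentiable paths in these spaces are therefore determined by
the coordinates.\<close>

locale l2_coordinates =
  fixes V :: "('b \<Rightarrow> real) set" and N :: "('b \<Rightarrow> real) \<Rightarrow> real" and \<kappa> :: "('b \<Rightarrow> real) \<Rightarrow> nat \<Rightarrow> real"
  assumes V_lin: "\<And>u v a b. u \<in> V \<Longrightarrow> v \<in> V \<Longrightarrow> (\<lambda>x. a * u x + b * v x) \<in> V"
    and \<kappa>_lin: "\<And>u v a b n. u \<in> V \<Longrightarrow> v \<in> V \<Longrightarrow> \<kappa> (\<lambda>x. a * u x + b * v x) n = a * \<kappa> u n + b * \<kappa> v n"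
    and le: "\<And>z K. z \<in> V \<Longrightarrow> finite K \<Longrightarrow> L2_set (\<kappa> z) K \<le> N z"
    and bd: "\<And>z B. z \<in> V \<Longrightarrow> (\<And>K. finite K \<Longrightarrow> L2_set (\<kappa> z) K \<le> B) \<Longrightarrow> N z \<le> B"
begin

lemma N_nonneg: "z \<in> V \<Longrightarrow> N z \<ge> 0"
  using le[of z "{}"] by simp

lemma diff: "u \<in> V \<Longrightarrow> v \<in> V \<Longrightarrow> (\<lambda>x. u x - v x) \<in> V" "u \<in> V \<Longrightarrow> v \<in> V \<Longrightarrow> \<kappa> (\<lambda>x. u x - v x) n = \<kappa> u n - \<kappa> v n"
  using V_lin[of u v 1 "-1"] \<kappa>_lin[of u v 1 "-1" n] by simp_all

lemma quot:
  assumes "u \<in> V" "v \<in> V" "w \<in> V"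
  shows "(\<lambda>x. (u x - v x) / r - w x) \<in> V" "\<kappa> (\<lambda>x. (u x - v x) / r - w x) n = (\<kappa> u n - \<kappa> v n) / r - \<kappa> w n"
proof -
  have "(\<lambda>x. (1/r) * (u x - v x) + (-1) * w x) \<in> V" by (rule V_lin[OF diff(1)[OF assms(1,2)] assms(3)])
  then show "(\<lambda>x. (u x - v x) / r - w x) \<in> V" by simp
  have "\<kappa> (\<lambda>x. (1/r) * (u x - v x) + (-1) * w x) n = (1/r) * (\<kappa> u n - \<kappa> v n) + (-1) * \<kappa> w n"
    using \<kappa>_lin[OF diff(1)[OF assms(1,2)] assms(3), of "1/r" "-1" n] diff(2)[OF assms(1,2)] by simp
  then show "\<kappa> (\<lambda>x. (u x - v x) / r - w x) n = (\<kappa> u n - \<kappa> v n) / r - \<kappa> w n" by simp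
qed

lemma cont_path_norm_continuous:
  assumes w: "cont_path V N T w"
  shows "continuous_on {0..T} (\<lambda>t. N (w t))"
  unfolding continuous_on_def
proof (intro ballI)
  fix t assume t: "t \<in> {0..T}"
  have wV: "w s \<in> V" if "s \<in> {0..T}" for s using w that by (simp add: cont_path_def)
  have tri: "N u \<le> N v + N (\<lambda>x. u x - v x)" if uv: "u \<in> V" "v \<in> V" for u v
  proof (rule bd[OF uv(1)])
    fix K :: "nat set" assume K: "finite K"
    have "L2_set (\<kappa> u) K = L2_set (\<lambda>n. \<kappa> v n + \<kappa> (\<lambda>x. u x - v x) n) K" by (simp add: diff(2)[OF uv])
    also have "\<dots> \<le> L2_set (\<kappa> v) K + L2_set (\<kappa> (\<lambda>x. u x - v x)) K" by (rule L2_set_triangle_ineq)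
    also have "\<dots> \<le> N v + N (\<lambda>x. u x - v x)" by (intro add_mono le diff uv K)
    finally show "L2_set (\<kappa> u) K \<le> N v + N (\<lambda>x. u x - v x)" .
  qed
  have sym: "N (\<lambda>x. u x - v x) \<le> N (\<lambda>x. v x - u x)" if uv: "u \<in> V" "v \<in> V" for u v
  proof (rule bd[OF diff(1)[OF uv]])
    fix K :: "nat set" assume K: "finite K"
    have "L2_set (\<kappa> (\<lambda>x. u x - v x)) K = L2_set (\<kappa> (\<lambda>x. v x - u x)) K"
      by (simp add: diff(2) uv L2_set_def power2_commute)
    then show "L2_set (\<kappa> (\<lambda>x. u x - v x)) K \<le> N (\<lambda>x. v x - u x)" using le[OF diff(1)[OF uv(2,1)] K] by simp
  qed
  have lim: "((\<lambda>s. N (\<lambda>x. w s x - w t x)) \<longlongrightarrow> 0) (at t within {0..T})" using w t by (simp add: cont_path_def)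
  have "((\<lambda>s. N (w s) - N (w t)) \<longlongrightarrow> 0) (at t within {0..T})"
  proof (rule Lim_null_comparison[OF _ lim])
    show "\<forall>\<^sub>F s in at t within {0..T}. norm (N (w s) - N (w t)) \<le> N (\<lambda>x. w s x - w t x)"
    proof (subst eventually_at_filter, intro always_eventually allI impI)
      fix s assume "s \<in> {0..T}"
      then have "w s \<in> V" "w t \<in> V" using wV t by auto
      from tri[OF this] tri[OF this(2,1)] sym[OF this(2,1)]
      show "norm (N (w s) - N (w t)) \<le> N (\<lambda>x. w s x - w t x)" by simp
    qed
  qed
  then show "((\<lambda>t. N (w t)) \<longlongrightarrow> N (w t)) (at t within {0..T})" by (simp add: LIM_zero_iff)
qed

lemma component_le: "z \<in> V \<Longrightarrow> \<bar>\<kappa> z n\<bar> \<le> N z"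
  using le[of z "{n}"] by simp

lemma cont_path_D:
  assumes w: "cont_path V N T w"
  shows "l2_continuous T (\<lambda>n t. \<kappa> (w t) n)"
proof (rule l2_continuousI)
  fix t \<epsilon> :: real assume t: "t \<in> {0..T}" and \<epsilon>: "\<epsilon> > 0"
  have wV: "w s \<in> V" if "s \<in> {0..T}" for s using w that by (simp add: cont_path_def)
  have "((\<lambda>s. N (\<lambda>x. w s x - w t x)) \<longlongrightarrow> 0) (at t within {0..T})" using w t by (simp add: cont_path_def)
  then have "eventually (\<lambda>s. N (\<lambda>x. w s x - w t x) < \<epsilon>) (at t within {0..T})" using \<epsilon> by (rule order_tendstoD)
  then obtain \<delta> where \<delta>: "\<delta> > 0" "\<And>s. s \<in> {0..T} \<Longrightarrow> s \<noteq> t \<Longrightarrow> dist s t < \<delta> \<Longrightarrow> N (\<lambda>x. w s x - w t x) < \<epsilon>"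
    unfolding eventually_at by blast
  have "L2_set (\<lambda>n. \<kappa> (w s) n - \<kappa> (w t) n) K \<le> \<epsilon>" if s: "s \<in> {0..T}" "\<bar>s - t\<bar> < \<delta>" and K: "finite K" for s K
  proof (cases "s = t")
    case False
    have "L2_set (\<kappa> (\<lambda>x. w s x - w t x)) K \<le> N (\<lambda>x. w s x - w t x)" by (rule le[OF diff(1)[OF wV wV] K]) (use s t in auto)
    also have "\<dots> \<le> \<epsilon>" using \<delta>(2)[OF s(1) False] s(2) by (simp add: dist_real_def)
    finally show ?thesis using diff(2)[OF wV[OF s(1)] wV[OF t]] by (simp add: L2_set_def)
  qed (use \<epsilon> in \<open>simp add: L2_set_def\<close>)
  then show "\<exists>\<delta>>0. \<forall>s\<in>{0..T}. \<bar>s - t\<bar> < \<delta> \<longrightarrow> (\<forall>K. finite K \<longrightarrow> L2_set (\<lambda>n. \<kappa> (w s) n - \<kappa> (w t) n) K \<le> \<epsilon>)"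
    using \<delta>(1) by blast
qed

lemma cont_path_I:
  assumes wV: "\<And>t. t \<in> {0..T} \<Longrightarrow> w t \<in> V" and c: "l2_continuous T (\<lambda>n t. \<kappa> (w t) n)"
  shows "cont_path V N T w"
  unfolding cont_path_def
proof (intro ballI conjI wV)
  fix t assume t: "t \<in> {0..T}"
  show "((\<lambda>s. N (\<lambda>x. w s x - w t x)) \<longlongrightarrow> 0) (at t within {0..T})"
  proof (rule tendsto_0_within_of_bound)
    fix \<epsilon> :: real assume \<epsilon>: "\<epsilon> > 0"
    obtain \<delta> where \<delta>: "\<delta> > 0" "\<And>s K. s \<in> {0..T} \<Longrightarrow> \<bar>s - t\<bar> < \<delta> \<Longrightarrow> finite K \<Longrightarrow> L2_set (\<lambda>n. \<kappa> (w s) n - \<kappa> (w t) n) K \<le> \<epsilon>"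
      using l2_continuousD[OF c t \<epsilon>] by blast
    have "N (\<lambda>x. w s x - w t x) \<le> \<epsilon>" if s: "s \<in> {0..T}" "\<bar>s - t\<bar> < \<delta>" for s
    proof (rule bd[OF diff(1)[OF wV[OF s(1)] wV[OF t]]])
      fix K :: "nat set" assume "finite K"
      from \<delta>(2)[OF s this] show "L2_set (\<kappa> (\<lambda>x. w s x - w t x)) K \<le> \<epsilon>"
        using diff(2)[OF wV[OF s(1)] wV[OF t]] by (simp add: L2_set_def)
    qed
    then show "\<exists>\<delta>>0. \<forall>s\<in>{0..T}. s \<noteq> t \<longrightarrow> \<bar>s - t\<bar> < \<delta> \<longrightarrow> N (\<lambda>x. w s x - w t x) \<le> \<epsilon>" using \<delta>(1) by blast
  qed (intro N_nonneg diff(1) wV t)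
qed

text \<open>Derivatives of the coordinates together with continuity in norm of the candidate \<open>w'\<close> yield
differentiability in norm.\<close>

lemma deriv_path_I:
  assumes wV: "\<And>t. t \<in> {0..T} \<Longrightarrow> w t \<in> V" and w'V: "\<And>t. t \<in> {0..T} \<Longrightarrow> w' t \<in> V"
    and der: "\<And>n t. t \<in> {0..T} \<Longrightarrow> ((\<lambda>s. \<kappa> (w s) n) has_real_derivative \<kappa> (w' t) n) (at t within {0..T})"
    and c: "l2_continuous T (\<lambda>n t. \<kappa> (w' t) n)"
  shows "deriv_path V N T w w'"
  unfolding deriv_path_def
proof (intro ballI conjI wV w'V)
  fix t assume t: "t \<in> {0..T}"
  show "((\<lambda>s. N (\<lambda>x. (w s x - w t x) / (s - t) - w' t x)) \<longlongrightarrow> 0) (at t within {0..T})"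
  proof (rule tendsto_0_within_of_bound)
    fix \<epsilon> :: real assume \<epsilon>: "\<epsilon> > 0"
    obtain \<delta> where \<delta>: "\<delta> > 0" "\<And>s K. s \<in> {0..T} \<Longrightarrow> s \<noteq> t \<Longrightarrow> \<bar>s - t\<bar> < \<delta> \<Longrightarrow> finite K \<Longrightarrow>
       L2_set (\<lambda>n. (\<kappa> (w s) n - \<kappa> (w t) n) / (s - t) - \<kappa> (w' t) n) K \<le> \<epsilon>"
      using l2_difference_quotient[OF der c t \<epsilon>] by blast
    have "N (\<lambda>x. (w s x - w t x) / (s - t) - w' t x) \<le> \<epsilon>" if s: "s \<in> {0..T}" "s \<noteq> t" "\<bar>s - t\<bar> < \<delta>" for s
    proof (rule bd[OF quot(1)[OF wV[OF s(1)] wV[OF t] w'V[OF t]]])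
      fix K :: "nat set" assume "finite K"
      from \<delta>(2)[OF s this] show "L2_set (\<kappa> (\<lambda>x. (w s x - w t x) / (s - t) - w' t x)) K \<le> \<epsilon>"
        using quot(2)[OF wV[OF s(1)] wV[OF t] w'V[OF t]] by (simp add: L2_set_def)
    qed
    then show "\<exists>\<delta>>0. \<forall>s\<in>{0..T}. s \<noteq> t \<longrightarrow> \<bar>s - t\<bar> < \<delta> \<longrightarrow> N (\<lambda>x. (w s x - w t x) / (s - t) - w' t x) \<le> \<epsilon>"
      using \<delta>(1) by blast
  qed (intro N_nonneg quot(1) wV w'V t)
qed

lemma deriv_path_D:
  assumes w: "deriv_path V N T w w'" and t: "t \<in> {0..T}"
  shows "((\<lambda>s. \<kappa> (w s) n) has_real_derivative \<kappa> (w' t) n) (at t within {0..T})"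
proof -
  have wV: "w s \<in> V" "w' s \<in> V" if "s \<in> {0..T}" for s using w that by (auto simp: deriv_path_def)
  have lim: "((\<lambda>s. N (\<lambda>x. (w s x - w t x) / (s - t) - w' t x)) \<longlongrightarrow> 0) (at t within {0..T})"
    using w t by (simp add: deriv_path_def)
  have "((\<lambda>s. (\<kappa> (w s) n - \<kappa> (w t) n) / (s - t) - \<kappa> (w' t) n) \<longlongrightarrow> 0) (at t within {0..T})"
  proof (rule Lim_null_comparison[OF _ lim])
    show "\<forall>\<^sub>F s in at t within {0..T}. norm ((\<kappa> (w s) n - \<kappa> (w t) n) / (s - t) - \<kappa> (w' t) n) \<le> N (\<lambda>x. (w s x - w t x) / (s - t) - w' t x)"
    proof (subst eventually_at_filter, intro always_eventually allI impI)
      fix s assume "s \<in> {0..T}"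
      then show "norm ((\<kappa> (w s) n - \<kappa> (w t) n) / (s - t) - \<kappa> (w' t) n) \<le> N (\<lambda>x. (w s x - w t x) / (s - t) - w' t x)"
        using component_le[OF quot(1)[OF wV(1) wV(1)[OF t] wV(2)[OF t]], of s "s - t" n]
          quot(2)[OF wV(1) wV(1)[OF t] wV(2)[OF t], of s "s - t" n] by simp
    qed
  qed
  then show ?thesis unfolding has_field_derivative_iff by (simp add: LIM_zero_iff)
qed

end

lemma l2_continuous_component:
  assumes "l2_continuous T x"
  shows "continuous_on {0..T} (x n)"
  unfolding continuous_on_def
proof (intro ballI)
  fix t assume t: "t \<in> {0..T}"
  have "((\<lambda>s. \<bar>x n s - x n t\<bar>) \<longlongrightarrow> 0) (at t within {0..T})"
  proof (rule tendsto_0_within_of_bound)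
    fix \<epsilon> :: real assume \<epsilon>: "\<epsilon> > 0"
    obtain \<delta> where \<delta>: "\<delta> > 0" "\<And>s K. s \<in> {0..T} \<Longrightarrow> \<bar>s - t\<bar> < \<delta> \<Longrightarrow> finite K \<Longrightarrow> L2_set (\<lambda>n. x n s - x n t) K \<le> \<epsilon>"
      using l2_continuousD[OF assms t \<epsilon>] by blast
    have "\<bar>x n s - x n t\<bar> \<le> \<epsilon>" if "s \<in> {0..T}" "\<bar>s - t\<bar> < \<delta>" for s using \<delta>(2)[OF that, of "{n}"] by simp
    then show "\<exists>\<delta>>0. \<forall>s\<in>{0..T}. s \<noteq> t \<longrightarrow> \<bar>s - t\<bar> < \<delta> \<longrightarrow> \<bar>x n s - x n t\<bar> \<le> \<epsilon>" using \<delta>(1) by blast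
  qed simp
  then show "(x n \<longlongrightarrow> x n t) (at t within {0..T})"
    by (simp add: tendsto_rabs_zero_iff LIM_zero_iff)
qed

context spectral_setting
begin

lemma L2_coordinates: "l2_coordinates (L2 m) (L2_norm m) coef"
  by unfold_locales (auto intro: L2_lincomb coef_lincomb L2_set_coef_le L2_norm_le)

lemma Vs_coordinates: "l2_coordinates (Vs m \<Lambda> \<phi> s) (Vs_norm m \<Lambda> \<phi> s) (\<lambda>z n. \<Lambda> n powr s * coef z n)"
  by unfold_locales (auto intro: Vs_lincomb Vs_I(2) L2_set_Vs_le simp: coef_lincomb Vs_L2 algebra_simps)

lemma Vdual_coordinates: "l2_coordinates (Vdual m \<Lambda> \<phi> s) (Vdual_norm \<Lambda> \<phi> s) (\<lambda>F n. \<Lambda> n powr (- s) * F (\<phi> n))"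
  by unfold_locales (auto intro: Vdual_lincomb Vdual_norm_le L2_set_Vdual_le simp: distrib_left mult.left_commute)

end

section \<open>Coordinates of the solution\<close>

lemma conjugate_exponent:
  assumes p: "p \<ge> 1" and q: "1 / ennreal p + 1 / q = (1::ennreal)"
  shows "p = 1 \<Longrightarrow> q = \<infinity>" "p > 1 \<Longrightarrow> q \<noteq> \<infinity> \<and> enn2real q = p / (p - 1)"
proof -
  assume "p = 1"
  then have "1 + 1 / q = 1 + 0" using q by simp
  then have "1 / q = 0" by (subst (asm) ennreal_add_left_cancel) auto
  then show "q = \<infinity>" by (simp add: ennreal_divide_eq_0_iff)
next
  assume p1: "p > 1"
  have ip: "1 / ennreal p = ennreal (1 / p)" using p by (simp add: divide_ennreal flip: ennreal_1)
  have qi: "q \<noteq> \<infinity>"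
  proof
    assume "q = \<infinity>"
    then have "ennreal (1 / p) = ennreal 1" using q ip by simp
    then show False using p1 by (subst (asm) ennreal_inj) auto
  qed
  then obtain r where r: "q = ennreal r" "r \<ge> 0" by (cases q) auto
  have r0: "r > 0"
  proof (rule ccontr)
    assume "\<not> r > 0"
    then have "q = 0" using r by simp
    then show False using q ip by (simp add: ennreal_divide_zero)
  qed
  have "1 / q = ennreal (1 / r)" unfolding r(1) using r0 by (simp add: divide_ennreal flip: ennreal_1)
  then have "ennreal (1 / p + 1 / r) = ennreal 1" using q ip p r0 by (simp flip: ennreal_plus)
  then have "1 / p + 1 / r = 1" using p r0 by (subst (asm) ennreal_inj) auto
  then have "r = p / (p - 1)" using p1 r0 by (simp add: field_simps)
  then show "q \<noteq> \<infinity> \<and> enn2real q = p / (p - 1)" using qi r by simp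
qed

lemma LqL2_imp_Lq_norm_le:
  assumes T: "T > 0" and p: "p \<ge> 1" and q: "1 / ennreal p + 1 / q = (1::ennreal)" and g: "g \<in> LqL2 m T q"
  shows "Lq_norm_le T p (\<lambda>t. L2_norm m (g t)) (LqL2_norm m T q g)"
proof (cases "p = 1")
  case True
  have qi: "q = \<infinity>" by (rule conjugate_exponent(1)[OF p q True])
  define M where "M = lebesgue_on {0<..<T}"
  define e where "e = esssup M (\<lambda>t. ereal (L2_norm m (g t)))"
  have e: "e < \<infinity>" using g qi unfolding LqL2_def e_def M_def by simp
  have me: "(\<lambda>t. ereal (L2_norm m (g t))) \<in> borel_measurable M"
    using e esssup_non_measurable[of "\<lambda>t. ereal (L2_norm m (g t))" M] unfolding e_def by (auto simp: top_ereal_def)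
  then have "(\<lambda>t. real_of_ereal (ereal (L2_norm m (g t)))) \<in> borel_measurable M" by measurable
  then have mh: "(\<lambda>t. L2_norm m (g t)) \<in> borel_measurable M" by simp
  have ae: "AE t in M. ereal (L2_norm m (g t)) \<le> e" unfolding e_def by (rule esssup_AE)
  have "emeasure M (space M) \<noteq> 0" using T by (simp add: M_def emeasure_restrict_space space_restrict_space)
  then have nb: "\<not> (AE t in M. False)" by (simp add: ae_filter_eq_bot_iff[symmetric] trivial_limit_def[symmetric])
  have e0: "e \<ge> 0"
  proof (rule ccontr)
    assume "\<not> e \<ge> 0"
    have "AE t in M. False" using ae
    proof eventually_elim
      case (elim t)
      then have "ereal (L2_norm m (g t)) < 0" using \<open>\<not> e \<ge> 0\<close> by (meson le_less_trans not_le)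
      then show False using L2_norm_nonneg[of m "g t"] by simp
    qed
    then show False using nb by simp
  qed
  have "LqL2_norm m T q g = real_of_ereal e" by (simp add: LqL2_norm_def qi e_def M_def)
  moreover have "AE t in M. L2_norm m (g t) \<le> real_of_ereal e"
    using ae by eventually_elim (use e e0 in \<open>cases e; auto\<close>)
  ultimately show ?thesis unfolding Lq_norm_le_def M_def using True mh[unfolded M_def] e0 by (auto simp: real_of_ereal_pos)
next
  case False
  then have p1: "p > 1" using p by simp
  have qq: "q \<noteq> \<infinity>" "enn2real q = p / (p - 1)" using conjugate_exponent(2)[OF p q p1] by auto
  define r where "r = p / (p - 1)"
  have r: "r > 0" using p1 by (simp add: r_def)
  have i: "integrable (lebesgue_on {0<..<T}) (\<lambda>t. L2_norm m (g t) powr r)" using g qq by (simp add: LqL2_def r_def)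
  have "(\<lambda>t. (L2_norm m (g t) powr r) powr (1 / r)) \<in> borel_measurable (lebesgue_on {0<..<T})"
    using borel_measurable_integrable[OF i] by measurable
  then have mh: "(\<lambda>t. L2_norm m (g t)) \<in> borel_measurable (lebesgue_on {0<..<T})"
    using r by (simp add: powr_powr)
  have n: "LqL2_norm m T q g = (LINT t|lebesgue_on {0<..<T}. L2_norm m (g t) powr r) powr (1 / r)"
    using qq by (simp add: LqL2_norm_def r_def)
  have I0: "(LINT t|lebesgue_on {0<..<T}. L2_norm m (g t) powr r) \<ge> 0" by (rule Bochner_Integration.integral_nonneg) simp
  have "LqL2_norm m T q g powr r = (LINT t|lebesgue_on {0<..<T}. L2_norm m (g t) powr r)"
    unfolding n using r I0 by (simp add: powr_powr)
  then show ?thesis unfolding Lq_norm_le_def using False mh i n by (simp add: r_def)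
qed

text \<open>The data of the problem.  The constant \<open>C0\<close> is a parameter, so that it cannot depend on
\<open>u0\<close>, \<open>u1\<close>, \<open>f\<close> and \<open>g\<close>.\<close>

locale fractional_data = spectral_setting m V D E A \<Lambda> \<phi>
  for m :: "'a measure" and V D :: "('a \<Rightarrow> real) set"
    and E :: "('a \<Rightarrow> real) \<Rightarrow> ('a \<Rightarrow> real) \<Rightarrow> real"
    and A :: "('a \<Rightarrow> real) \<Rightarrow> ('a \<Rightarrow> real)"
    and \<Lambda> :: "nat \<Rightarrow> real" and \<phi> :: "nat \<Rightarrow> 'a \<Rightarrow> real" +
  fixes \<alpha> T p C0 :: real and q :: ennreal
    and u0 u1 :: "'a \<Rightarrow> real" and f :: "real \<Rightarrow> ('a \<Rightarrow> real) \<Rightarrow> real" and g :: "real \<Rightarrow> 'a \<Rightarrow> real"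
  assumes \<alpha>: "1 < \<alpha>" "\<alpha> < 2" and T: "T > 0"
    and p: "1 \<le> p" "p < 1 / (2 - \<alpha>)" and q: "1 / ennreal p + 1 / q = 1"
    and u0: "u0 \<in> Vs m \<Lambda> \<phi> (1/\<alpha>)" and u1: "u1 \<in> L2 m"
    and src: "source_term m \<Lambda> \<phi> (1/\<alpha>) T q f g"
    and bounds: "solution_bounds \<alpha> \<Lambda> C0"
begin

lemma C0: "C0 > 0" using bounds by (simp add: solution_bounds_def)

lemmas solution_le = solution_boundsD[OF bounds]

text \<open>In the mode \<open>n\<close>, \<open>F\<close> is the source, \<open>x\<close> the solution, \<open>x'\<close>
its velocity and \<open>W\<close> its Caputo derivative, as dictated by the equation.
\<open>\<kappa>\<^sub>p * t powr (1/p + \<alpha> - 2)\<close> is the norm of the kernel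
\<open>(t - \<tau>) powr (\<alpha> - 2)\<close> in \<open>L\<^sup>p(0,t)\<close>.\<close>

definition "F n t = f t (\<phi> n)"
definition "x n = frac_sol \<alpha> (\<Lambda> n) (coef u0 n) (coef u1 n) (F n)"
definition "x' n = frac_sol' \<alpha> (\<Lambda> n) (coef u0 n) (coef u1 n) (F n)"
definition "W n t = F n t - \<Lambda> n * x n t"
definition "B = LqL2_norm m T q g"
definition "\<kappa>\<^sub>p = (1 / ((\<alpha> - 2) * p + 1)) powr (1/p)"

lemma gamma_bounds: "0 < 1/\<alpha>" "1/2 < 1/\<alpha>" "1/\<alpha> < 1" "1 - 1/\<alpha> \<le> 1/\<alpha>" "0 < 1 - 1/\<alpha>"
  using \<alpha> by (auto simp: field_simps)

lemma Vgamma_V: "Vs m \<Lambda> \<phi> (1/\<alpha>) \<subseteq> V"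
  unfolding V using gamma_bounds by (intro Vs_antimono) auto

lemma f_path: "cont_path (Vdual m \<Lambda> \<phi> (1/\<alpha>)) (Vdual_norm \<Lambda> \<phi> (1/\<alpha>)) T f"
  using src by (simp add: source_term_def)

lemma f_Vdual: "t \<in> {0..T} \<Longrightarrow> f t \<in> Vdual m \<Lambda> \<phi> (1/\<alpha>)"
  using f_path by (simp add: cont_path_def)

lemma F_l2: "l2_continuous T (\<lambda>n t. \<Lambda> n powr (- (1/\<alpha>)) * F n t)"
  using l2_coordinates.cont_path_D[OF Vdual_coordinates f_path] by (simp add: F_def)

lemma F_cont: "continuous_on {0..T} (F n)"
proof -
  have "continuous_on {0..T} (\<lambda>t. \<Lambda> n powr (1/\<alpha>) * (\<Lambda> n powr (- (1/\<alpha>)) * F n t))"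
    by (intro continuous_intros l2_continuous_component[OF F_l2])
  moreover have "\<Lambda> n powr (1/\<alpha>) * \<Lambda> n powr (- (1/\<alpha>)) = 1" using Lambda_pos[of n] by (simp flip: powr_add)
  ultimately show ?thesis by (simp add: mult.assoc[symmetric])
qed

lemma F_cont': "t \<in> {0..T} \<Longrightarrow> continuous_on {0..t} (F n)"
  by (rule continuous_on_subset[OF F_cont]) auto

lemma F_AE: "AE \<tau> in lebesgue_on {0<..<T}. g \<tau> \<in> L2 m \<and> (\<forall>n. F n \<tau> = coef (g \<tau>) n)"
proof -
  have "AE \<tau> in lebesgue_on {0<..<T}. g \<tau> \<in> L2 m" using src by (simp add: source_term_def LqL2_def)
  moreover have "AE \<tau> in lebesgue_on {0<..<T}. \<forall>v\<in>Vs m \<Lambda> \<phi> (1/\<alpha>). f \<tau> v = L2_inner m (g \<tau>) v"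
    using src by (simp add: source_term_def)
  ultimately show ?thesis by eventually_elim (auto simp: F_def coef_def phi_Vs)
qed

lemma F_sums: "AE \<tau> in lebesgue_on {0<..<T}. (\<lambda>n. (F n \<tau>)\<^sup>2) sums (L2_norm m (g \<tau>))\<^sup>2"
  using F_AE by eventually_elim (use parseval in auto)

lemma F_le: "finite K \<Longrightarrow> AE \<tau> in lebesgue_on {0<..<T}. L2_set (\<lambda>n. F n \<tau>) K \<le> L2_norm m (g \<tau>)"
  using F_AE by eventually_elim (use L2_set_coef_le in auto)

lemma g_Lq: "Lq_norm_le T p (\<lambda>t. L2_norm m (g t)) B"
  unfolding B_def using src by (intro LqL2_imp_Lq_norm_le T p q) (simp add: source_term_def)

lemma B_nonneg: "B \<ge> 0" using g_Lq by (simp add: Lq_norm_le_def)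

lemma exponent_bounds: "(\<alpha> - 2) * p > -1" "\<alpha> - 2 + 1/p = 1/p + \<alpha> - 2"
  using p \<alpha> by (auto simp: field_simps)

lemma kappa_nonneg: "\<kappa>\<^sub>p \<ge> 0" by (simp add: \<kappa>\<^sub>p_def)

lemma conv_bound:
  assumes "finite K" "t \<in> {0..T}"
  shows "(LINT \<tau>:{0..t}|lebesgue. (t - \<tau>) powr (\<alpha> - 2) * L2_set (\<lambda>n. F n \<tau>) K) \<le> \<kappa>\<^sub>p * t powr (1/p + \<alpha> - 2) * B"
  and "(LINT \<tau>:{0..t}|lebesgue. (t - \<tau>) powr 0 * L2_set (\<lambda>n. F n \<tau>) K) \<le> t powr (1/p) * B"
proof -
  show "(LINT \<tau>:{0..t}|lebesgue. (t - \<tau>) powr (\<alpha> - 2) * L2_set (\<lambda>n. F n \<tau>) K) \<le> \<kappa>\<^sub>p * t powr (1/p + \<alpha> - 2) * B"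
    using source_convolution_bound[OF p(1) g_Lq F_cont assms(1) F_le[OF assms(1)] exponent_bounds(1) assms(2)]
    unfolding \<kappa>\<^sub>p_def exponent_bounds(2) by simp
  have e0: "0 * p > -1" by simp
  show "(LINT \<tau>:{0..t}|lebesgue. (t - \<tau>) powr 0 * L2_set (\<lambda>n. F n \<tau>) K) \<le> t powr (1/p) * B"
    using source_convolution_bound[OF p(1) g_Lq F_cont assms(1) F_le[OF assms(1)] e0 assms(2)] by simp
qed

lemma x_bound:
  assumes K: "finite K" and t: "t \<in> {0..T}"
  shows "L2_set (\<lambda>n. \<Lambda> n powr (1/\<alpha>) * x n t) K \<le> C0 * (Vs_norm m \<Lambda> \<phi> (1/\<alpha>) u0 + L2_norm m u1 + \<kappa>\<^sub>p * t powr (1/p + \<alpha> - 2) * B)"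
    and "L2_set (\<lambda>n. x' n t) K \<le> C0 * (Vs_norm m \<Lambda> \<phi> (1/\<alpha>) u0 + L2_norm m u1 + \<kappa>\<^sub>p * t powr (1/p + \<alpha> - 2) * B)"
    and "L2_set (\<lambda>n. \<Lambda> n powr (1 - 1/\<alpha>) * x n t) K \<le> C0 * (Vs_norm m \<Lambda> \<phi> (1/\<alpha>) u0 + t powr (2 - \<alpha>) * L2_norm m u1 + t powr (1/p) * B)"
proof -
  have t0: "t \<ge> 0" using t by simp
  have data: "L2_set (\<lambda>n. \<Lambda> n powr (1/\<alpha>) * coef u0 n) K \<le> Vs_norm m \<Lambda> \<phi> (1/\<alpha>) u0" "L2_set (coef u1) K \<le> L2_norm m u1"
    by (rule L2_set_Vs_le[OF u0 K], rule L2_set_coef_le[OF u1 K])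
  show "L2_set (\<lambda>n. \<Lambda> n powr (1/\<alpha>) * x n t) K \<le> C0 * (Vs_norm m \<Lambda> \<phi> (1/\<alpha>) u0 + L2_norm m u1 + \<kappa>\<^sub>p * t powr (1/p + \<alpha> - 2) * B)"
    unfolding x_def by (rule order_trans[OF solution_le(1)[OF K t0 F_cont'[OF t]] mult_left_mono])
      (use data conv_bound[OF K t] C0 in \<open>auto intro!: add_mono\<close>)
  show "L2_set (\<lambda>n. x' n t) K \<le> C0 * (Vs_norm m \<Lambda> \<phi> (1/\<alpha>) u0 + L2_norm m u1 + \<kappa>\<^sub>p * t powr (1/p + \<alpha> - 2) * B)"
    unfolding x'_def by (rule order_trans[OF solution_le(2)[OF K t0 F_cont'[OF t]] mult_left_mono])
      (use data conv_bound[OF K t] C0 in \<open>auto intro!: add_mono\<close>)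
  show "L2_set (\<lambda>n. \<Lambda> n powr (1 - 1/\<alpha>) * x n t) K \<le> C0 * (Vs_norm m \<Lambda> \<phi> (1/\<alpha>) u0 + t powr (2 - \<alpha>) * L2_norm m u1 + t powr (1/p) * B)"
    unfolding x_def by (rule order_trans[OF solution_le(3)[OF K t0 F_cont'[OF t]] mult_left_mono])
      (use data conv_bound(2)[OF K t] C0 in \<open>auto intro!: add_mono mult_left_mono\<close>)
qed

text \<open>The tails of the solution are small uniformly in time.  Continuity of each mode then gives continuity in norm.\<close>

lemma x_tail:
  assumes \<epsilon>: "\<epsilon> > 0"
  shows "\<exists>N. \<forall>K t. finite K \<longrightarrow> K \<subseteq> {N..} \<longrightarrow> t \<in> {0..T} \<longrightarrow>
     L2_set (\<lambda>n. \<Lambda> n powr (1/\<alpha>) * x n t) K \<le> \<epsilon> \<and> L2_set (\<lambda>n. x' n t) K \<le> \<epsilon>"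
proof -
  define \<delta> where "\<delta> = \<epsilon> / (3 * C0)"
  have \<delta>: "\<delta> > 0" using \<epsilon> C0 by (simp add: \<delta>_def)
  have s0: "summable (\<lambda>n. (\<Lambda> n powr (1/\<alpha>) * coef u0 n)\<^sup>2)"
    using u0 unfolding Vs_def coef_def[symmetric] weight_square by auto
  have s1: "summable (\<lambda>n. (coef u1 n)\<^sup>2)" using parseval[OF u1] by (rule sums_summable)
  obtain N0 where N0: "\<And>K. finite K \<Longrightarrow> K \<subseteq> {N0..} \<Longrightarrow> L2_set (\<lambda>n. \<Lambda> n powr (1/\<alpha>) * coef u0 n) K \<le> \<delta>"
    using L2_set_tail_le[OF s0 \<delta>] by blast
  obtain N1 where N1: "\<And>K. finite K \<Longrightarrow> K \<subseteq> {N1..} \<Longrightarrow> L2_set (coef u1) K \<le> \<delta>"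
    using L2_set_tail_le[OF s1 \<delta>] by blast
  obtain N2 where N2: "\<And>K t. finite K \<Longrightarrow> K \<subseteq> {N2..} \<Longrightarrow> t \<in> {0..T} \<Longrightarrow>
     (LINT \<tau>:{0..t}|lebesgue. (t - \<tau>) powr (\<alpha> - 2) * L2_set (\<lambda>n. F n \<tau>) K) \<le> \<delta>"
    using source_convolution_tail[OF T \<alpha> p g_Lq F_cont F_sums \<delta>] by blast
  define N where "N = max N0 (max N1 N2)"
  have "L2_set (\<lambda>n. \<Lambda> n powr (1/\<alpha>) * x n t) K \<le> \<epsilon> \<and> L2_set (\<lambda>n. x' n t) K \<le> \<epsilon>"
    if K: "finite K" "K \<subseteq> {N..}" and t: "t \<in> {0..T}" for K t
  proof -
    have t0: "t \<ge> 0" using t by simp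
    have sub: "K \<subseteq> {N0..}" "K \<subseteq> {N1..}" "K \<subseteq> {N2..}" using K(2) by (auto simp: N_def)
    have le: "C0 * (L2_set (\<lambda>n. \<Lambda> n powr (1/\<alpha>) * coef u0 n) K + L2_set (coef u1) K + (LINT \<tau>:{0..t}|lebesgue. (t - \<tau>) powr (\<alpha> - 2) * L2_set (\<lambda>n. F n \<tau>) K))
       \<le> C0 * (\<delta> + \<delta> + \<delta>)"
      using C0 by (intro mult_left_mono add_mono N0 N1 N2 K sub t) auto
    have "C0 * (\<delta> + \<delta> + \<delta>) = \<epsilon>" using C0 by (simp add: \<delta>_def field_simps)
    then show ?thesis unfolding x_def x'_def
      using order_trans[OF solution_le(1)[OF K(1) t0 F_cont'[OF t]] le] order_trans[OF solution_le(2)[OF K(1) t0 F_cont'[OF t]] le] by simp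
  qed
  then show ?thesis by blast
qed

lemma x_cont: "continuous_on {0..T} (x n)" "continuous_on {0..T} (x' n)"
  unfolding x_def x'_def by (intro continuous_on_frac_sol \<alpha> F_cont)+

lemma x_l2: "l2_continuous T (\<lambda>n t. \<Lambda> n powr (1/\<alpha>) * x n t)" "l2_continuous T x'"
proof -
  show "l2_continuous T (\<lambda>n t. \<Lambda> n powr (1/\<alpha>) * x n t)"
  proof (rule l2_continuous_of_uniform_tails)
    show "continuous_on {0..T} (\<lambda>t. \<Lambda> n powr (1/\<alpha>) * x n t)" for n by (intro continuous_intros x_cont)
    fix \<epsilon> :: real assume "\<epsilon> > 0"
    from x_tail[OF this] show "\<exists>N. \<forall>K t. finite K \<longrightarrow> K \<subseteq> {N..} \<longrightarrow> t \<in> {0..T} \<longrightarrow> L2_set (\<lambda>n. \<Lambda> n powr (1/\<alpha>) * x n t) K \<le> \<epsilon>" by blast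
  qed
  show "l2_continuous T x'"
  proof (rule l2_continuous_of_uniform_tails[OF x_cont(2)])
    fix \<epsilon> :: real assume "\<epsilon> > 0"
    from x_tail[OF this] show "\<exists>N. \<forall>K t. finite K \<longrightarrow> K \<subseteq> {N..} \<longrightarrow> t \<in> {0..T} \<longrightarrow> L2_set (\<lambda>n. x' n t) K \<le> \<epsilon>" by blast
  qed
qed

lemma x_l2_weight:
  assumes "s \<le> 1/\<alpha>"
  shows "l2_continuous T (\<lambda>n t. \<Lambda> n powr s * x n t)"
proof (rule l2_continuous_scaled[OF x_l2(1)])
  show "\<bar>\<Lambda> n powr s * x n r - \<Lambda> n powr s * x n t\<bar> \<le> \<Lambda> 0 powr (s - 1/\<alpha>) * \<bar>\<Lambda> n powr (1/\<alpha>) * x n r - \<Lambda> n powr (1/\<alpha>) * x n t\<bar>" for n r t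
    using weight_compare[OF assms, of n "x n r - x n t"] by (simp add: right_diff_distrib)
qed simp

lemma W_weight: "\<Lambda> n powr (- (1/\<alpha>)) * W n t = \<Lambda> n powr (- (1/\<alpha>)) * F n t - \<Lambda> n powr (1 - 1/\<alpha>) * x n t"
proof -
  have "\<Lambda> n powr (1 - 1/\<alpha>) = \<Lambda> n powr (- (1/\<alpha>)) * \<Lambda> n" using Lambda_pos[of n] powr_add[of "\<Lambda> n" "- (1/\<alpha>)" 1] by simp
  then show ?thesis by (simp add: W_def right_diff_distrib)
qed

lemma W_l2: "l2_continuous T (\<lambda>n t. \<Lambda> n powr (- (1/\<alpha>)) * W n t)"
  unfolding W_weight by (rule l2_continuous_diff[OF F_l2 x_l2_weight[OF gamma_bounds(4)]])

lemma W_cont: "continuous_on {0..T} (W n)"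
  unfolding W_def by (intro continuous_intros F_cont x_cont)

lemma f_sup: "t \<in> {0..T} \<Longrightarrow> Vdual_norm \<Lambda> \<phi> (1/\<alpha>) (f t) \<le> (SUP s\<in>{0..T}. Vdual_norm \<Lambda> \<phi> (1/\<alpha>) (f s))"
proof (rule cSUP_upper)
  have "continuous_on {0..T} (\<lambda>t. Vdual_norm \<Lambda> \<phi> (1/\<alpha>) (f t))"
    by (rule l2_coordinates.cont_path_norm_continuous[OF Vdual_coordinates f_path])
  then show "bdd_above ((\<lambda>s. Vdual_norm \<Lambda> \<phi> (1/\<alpha>) (f s)) ` {0..T})"
    by (intro bounded_imp_bdd_above compact_imp_bounded compact_continuous_image compact_Icc)
qed

lemma W_bound:
  assumes K: "finite K" and t: "t \<in> {0..T}"
  shows "L2_set (\<lambda>n. \<Lambda> n powr (- (1/\<alpha>)) * W n t) K \<le> (SUP s\<in>{0..T}. Vdual_norm \<Lambda> \<phi> (1/\<alpha>) (f s))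
     + C0 * (Vs_norm m \<Lambda> \<phi> (1/\<alpha>) u0 + t powr (2 - \<alpha>) * L2_norm m u1 + t powr (1/p) * B)"
proof -
  have "L2_set (\<lambda>n. \<Lambda> n powr (- (1/\<alpha>)) * W n t) K \<le> L2_set (\<lambda>n. \<Lambda> n powr (- (1/\<alpha>)) * F n t) K + L2_set (\<lambda>n. \<Lambda> n powr (1 - 1/\<alpha>) * x n t) K"
    unfolding W_weight by (rule L2_set_diff_le)
  moreover have "L2_set (\<lambda>n. \<Lambda> n powr (- (1/\<alpha>)) * F n t) K \<le> Vdual_norm \<Lambda> \<phi> (1/\<alpha>) (f t)"
    unfolding F_def by (rule L2_set_Vdual_le[OF f_Vdual[OF t] K])
  ultimately show ?thesis using f_sup[OF t] x_bound(3)[OF K t] by linarith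
qed

text \<open>Bounds uniform in time, for \<open>x\<close> and \<open>x'\<close> and for \<open>W\<close>.\<close>

definition "Bx = C0 * (Vs_norm m \<Lambda> \<phi> (1/\<alpha>) u0 + L2_norm m u1 + \<kappa>\<^sub>p * T powr (1/p + \<alpha> - 2) * B)"
definition "Bw = (SUP s\<in>{0..T}. Vdual_norm \<Lambda> \<phi> (1/\<alpha>) (f s))
     + C0 * (Vs_norm m \<Lambda> \<phi> (1/\<alpha>) u0 + T powr (2 - \<alpha>) * L2_norm m u1 + T powr (1/p) * B)"

lemma exponent_nonneg: "1/p + \<alpha> - 2 \<ge> 0" using p \<alpha> by (simp add: field_simps)

lemma uniform_bounds:
  assumes K: "finite K" and t: "t \<in> {0..T}"
  shows "L2_set (\<lambda>n. \<Lambda> n powr (1/\<alpha>) * x n t) K \<le> Bx" "L2_set (\<lambda>n. x' n t) K \<le> Bx"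
    "L2_set (\<lambda>n. \<Lambda> n powr (- (1/\<alpha>)) * W n t) K \<le> Bw"
proof -
  have "\<kappa>\<^sub>p * t powr (1/p + \<alpha> - 2) * B \<le> \<kappa>\<^sub>p * T powr (1/p + \<alpha> - 2) * B"
    using t exponent_nonneg B_nonneg kappa_nonneg by (intro mult_right_mono mult_left_mono powr_mono2) auto
  then have "C0 * (Vs_norm m \<Lambda> \<phi> (1/\<alpha>) u0 + L2_norm m u1 + \<kappa>\<^sub>p * t powr (1/p + \<alpha> - 2) * B) \<le> Bx"
    unfolding Bx_def using C0 by (intro mult_left_mono) auto
  then show "L2_set (\<lambda>n. \<Lambda> n powr (1/\<alpha>) * x n t) K \<le> Bx" "L2_set (\<lambda>n. x' n t) K \<le> Bx"
    using x_bound(1,2)[OF K t] by linarith+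
  have "C0 * (Vs_norm m \<Lambda> \<phi> (1/\<alpha>) u0 + t powr (2 - \<alpha>) * L2_norm m u1 + t powr (1/p) * B) \<le>
    C0 * (Vs_norm m \<Lambda> \<phi> (1/\<alpha>) u0 + T powr (2 - \<alpha>) * L2_norm m u1 + T powr (1/p) * B)"
    using C0 t \<alpha> p B_nonneg by (intro mult_left_mono add_mono mult_right_mono powr_mono2) auto
  then show "L2_set (\<lambda>n. \<Lambda> n powr (- (1/\<alpha>)) * W n t) K \<le> Bw"
    using W_bound[OF K t] unfolding Bw_def by linarith
qed

text \<open>\<open>J\<close> is the mode of the Caputo integral of the solution, and \<open>j\<close> is its first
derivative.\<close>

definition "j n = frac_int 1 (W n)"
definition "J n = frac_int (2 - \<alpha>) (\<lambda>s. x n s - coef u0 n - s * coef u1 n)"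

text \<open>The Volterra equation says that \<open>x\<close> minus its initial terms is the integral of order
\<open>\<alpha>\<close> of \<open>W\<close>; another integral of order \<open>2 - \<alpha>\<close> gives the
double integral of \<open>W\<close>.\<close>

lemma J_eq: "t \<in> {0..T} \<Longrightarrow> J n t = frac_int 1 (j n) t"
proof -
  assume t: "t \<in> {0..T}"
  have Wc: "continuous_on {0..s} (W n)" if "s \<in> {0..T}" for s by (rule continuous_on_subset[OF W_cont]) (use that in auto)
  have "J n t = frac_int (2 - \<alpha>) (frac_int \<alpha> (W n)) t"
    unfolding J_def
  proof (rule frac_int_cong)
    fix s assume s: "s \<in> {0..t}"
    have "x n s - coef u0 n - coef u1 n * s = frac_int \<alpha> (\<lambda>s. F n s - \<Lambda> n * x n s) s"
      unfolding x_def using s t by (intro frac_sol_volterra \<alpha> F_cont') auto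
    then show "x n s - coef u0 n - s * coef u1 n = frac_int \<alpha> (W n) s" by (simp add: W_def[abs_def] mult.commute)
  qed
  also have "\<dots> = frac_int 1 (j n) t"
    unfolding j_def using \<alpha> t Wc[OF t] by (simp add: frac_int_frac_int)
  finally show ?thesis .
qed

lemma j_deriv: "t \<in> {0..T} \<Longrightarrow> (j n has_real_derivative W n t) (at t within {0..T})"
  unfolding j_def by (rule frac_int_1_has_derivative[OF W_cont])

lemma j_cont: "continuous_on {0..T} (j n)"
  unfolding j_def by (rule continuous_on_frac_int[OF zero_less_one W_cont])

lemma J_deriv: "t \<in> {0..T} \<Longrightarrow> (J n has_real_derivative j n t) (at t within {0..T})"
  using frac_int_1_has_derivative[OF j_cont, of t n]
  by (rule has_field_derivative_transform_within[OF _ zero_less_one]) (auto simp: J_eq)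

lemma j_l2: "l2_continuous T (\<lambda>n t. \<Lambda> n powr (- (1/\<alpha>)) * j n t)"
  by (rule l2_continuous_of_derivative[OF DERIV_cmult[OF j_deriv] W_l2 uniform_bounds(3)])

lemma j_0: "j n 0 = 0"
  using frac_int_bound[of 1 0 "W n" "\<bar>W n 0\<bar>"] by (simp add: j_def)

text \<open>As \<open>j\<close> vanishes at \<open>0\<close>, it is \<open>t\<close> times a difference quotient of
\<open>j\<close>, whose distance from \<open>W\<close> is bounded by the mean value inequality.  This replaces
the integration of sequences.\<close>

lemma j_bound:
  assumes t: "t \<in> {0..T}"
  shows "\<exists>C. \<forall>K. finite K \<longrightarrow> L2_set (\<lambda>n. \<Lambda> n powr (- (1/\<alpha>)) * j n t) K \<le> C"
proof -
  obtain \<delta> where \<delta>: "\<delta> > 0" "\<And>s K. s \<in> {0..T} \<Longrightarrow> s \<noteq> t \<Longrightarrow> \<bar>s - t\<bar> < \<delta> \<Longrightarrow> finite K \<Longrightarrow>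
     L2_set (\<lambda>n. (\<Lambda> n powr (- (1/\<alpha>)) * j n s - \<Lambda> n powr (- (1/\<alpha>)) * j n t) / (s - t) - \<Lambda> n powr (- (1/\<alpha>)) * W n t) K \<le> 1"
    using l2_difference_quotient[OF DERIV_cmult[OF j_deriv] W_l2 t zero_less_one] by blast
  have "L2_set (\<lambda>n. \<Lambda> n powr (- (1/\<alpha>)) * j n t) K \<le> T * (Bw + Bw + Bw)" if K: "finite K" for K
  proof (cases "t = 0")
    case True
    have "Bw \<ge> 0" using uniform_bounds(3)[of "{}" 0] T by simp
    then show ?thesis using True T by (simp add: j_0 L2_set_def)
  next
    case False
    have t0: "0 \<in> {0..T}" using T by simp
    have "L2_set (\<lambda>n. (\<Lambda> n powr (- (1/\<alpha>)) * j n 0 - \<Lambda> n powr (- (1/\<alpha>)) * j n t) / (0 - t) - \<Lambda> n powr (- (1/\<alpha>)) * W n t) K \<le> Bw + Bw"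
    proof (rule L2_set_difference_quotient[OF K t0 t _ DERIV_cmult[OF j_deriv]])
      fix r assume r: "r \<in> {0..T}"
      show "L2_set (\<lambda>n. \<Lambda> n powr (- (1/\<alpha>)) * W n r - \<Lambda> n powr (- (1/\<alpha>)) * W n t) K \<le> Bw + Bw"
        by (rule order_trans[OF L2_set_diff_le add_mono[OF uniform_bounds(3)[OF K r] uniform_bounds(3)[OF K t]]])
    qed (use False in auto)
    then have q: "L2_set (\<lambda>n. \<Lambda> n powr (- (1/\<alpha>)) * j n t / t - \<Lambda> n powr (- (1/\<alpha>)) * W n t) K \<le> Bw + Bw" by (simp add: j_0)
    have "L2_set (\<lambda>n. \<Lambda> n powr (- (1/\<alpha>)) * j n t) K = L2_set (\<lambda>n. t * ((\<Lambda> n powr (- (1/\<alpha>)) * j n t / t - \<Lambda> n powr (- (1/\<alpha>)) * W n t) + \<Lambda> n powr (- (1/\<alpha>)) * W n t)) K"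
      using False by simp
    also have "\<dots> \<le> t * L2_set (\<lambda>n. (\<Lambda> n powr (- (1/\<alpha>)) * j n t / t - \<Lambda> n powr (- (1/\<alpha>)) * W n t) + \<Lambda> n powr (- (1/\<alpha>)) * W n t) K"
      by (rule L2_set_scaled_le) (use t in \<open>auto simp: abs_mult\<close>)
    also have "\<dots> \<le> t * ((Bw + Bw) + Bw)"
      using t by (intro mult_left_mono order_trans[OF L2_set_triangle_ineq] add_mono q uniform_bounds(3) K) auto
    also have "\<dots> \<le> T * (Bw + Bw + Bw)"
      using t uniform_bounds(3)[of "{}" 0] T by (intro mult_right_mono) auto
    finally show ?thesis .
  qed
  then show ?thesis by blast
qed

text \<open>The Riesz--Fischer theorem, at each time.\<close>

lemma ex_solution_elements:
  "\<exists>U U'. \<forall>t\<in>{0..T}. U t \<in> Vs m \<Lambda> \<phi> (1/\<alpha>) \<and> U' t \<in> L2 m \<and> coef (U t) = (\<lambda>n. x n t) \<and> coef (U' t) = (\<lambda>n. x' n t)"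
proof -
  have "\<exists>h. h \<in> L2 m \<and> coef h = (\<lambda>n. x n t)" if t: "t \<in> {0..T}" for t
  proof -
    have "L2_set (\<lambda>n. x n t) K \<le> \<Lambda> 0 powr (0 - 1/\<alpha>) * Bx" if K: "finite K" for K
    proof -
      have "L2_set (\<lambda>n. \<Lambda> n powr 0 * x n t) K \<le> \<Lambda> 0 powr (0 - 1/\<alpha>) * L2_set (\<lambda>n. \<Lambda> n powr (1/\<alpha>) * x n t) K"
        by (rule L2_set_weight_compare) (use gamma_bounds in auto)
      also have "\<dots> \<le> \<Lambda> 0 powr (0 - 1/\<alpha>) * Bx" by (intro mult_left_mono uniform_bounds K t) simp
      also have "(\<lambda>n. \<Lambda> n powr 0 * x n t) = (\<lambda>n. x n t)" using Lambda_pos by (auto simp: less_imp_neq[symmetric])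
      finally show ?thesis .
    qed
    from riesz_fischer[OF L2_set_bound_imp_summable(1)[OF this]] show ?thesis by blast
  qed
  then obtain U where U: "\<And>t. t \<in> {0..T} \<Longrightarrow> U t \<in> L2 m \<and> coef (U t) = (\<lambda>n. x n t)" by metis
  have "\<exists>h. h \<in> L2 m \<and> coef h = (\<lambda>n. x' n t)" if t: "t \<in> {0..T}" for t
    using riesz_fischer[OF L2_set_bound_imp_summable(1)[OF uniform_bounds(2)[OF _ t]]] by blast
  then obtain U' where U': "\<And>t. t \<in> {0..T} \<Longrightarrow> U' t \<in> L2 m \<and> coef (U' t) = (\<lambda>n. x' n t)" by metis
  have UV: "U t \<in> Vs m \<Lambda> \<phi> (1/\<alpha>)" if t: "t \<in> {0..T}" for t
    by (rule Vs_I(1)[where B = Bx]) (use U[OF t] uniform_bounds(1)[OF _ t] in auto)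
  show ?thesis by (intro exI[of _ U] exI[of _ U'] ballI conjI UV) (simp_all add: U U')
qed

end


section \<open>The Caputo derivative of a path\<close>

context spectral_setting
begin

lemma inner_cont_path:
  assumes w: "cont_path (L2 m) (L2_norm m) T w" and v: "v \<in> L2 m"
  shows "continuous_on {0..T} (\<lambda>s. L2_inner m (w s) v)"
  unfolding continuous_on_def
proof (intro ballI)
  fix t assume t: "t \<in> {0..T}"
  have wL: "w s \<in> L2 m" if "s \<in> {0..T}" for s using w that by (simp add: cont_path_def)
  have lim: "((\<lambda>s. L2_norm m (\<lambda>x. w s x - w t x) * L2_norm m v) \<longlongrightarrow> 0) (at t within {0..T})"
    using w t by (intro tendsto_mult_left_zero) (simp add: cont_path_def)
  have "((\<lambda>s. L2_inner m (w s) v - L2_inner m (w t) v) \<longlongrightarrow> 0) (at t within {0..T})"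
  proof (rule Lim_null_comparison[OF _ lim])
    show "\<forall>\<^sub>F s in at t within {0..T}. norm (L2_inner m (w s) v - L2_inner m (w t) v) \<le> L2_norm m (\<lambda>x. w s x - w t x) * L2_norm m v"
      unfolding eventually_at_filter
    proof (intro always_eventually allI impI)
      fix s assume s: "s \<in> {0..T}"
      show "norm (L2_inner m (w s) v - L2_inner m (w t) v) \<le> L2_norm m (\<lambda>x. w s x - w t x) * L2_norm m v"
        using L2_Cauchy_Schwarz[OF L2_diff[OF wL[OF s] wL[OF t]] v] L2_inner_diff[OF wL[OF s] wL[OF t] v] by simp
    qed
  qed
  then show "((\<lambda>s. L2_inner m (w s) v) \<longlongrightarrow> L2_inner m (w t) v) (at t within {0..T})"
    by (simp add: LIM_zero_iff)
qed

lemma L2_norm_le_Vs_norm: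
  assumes s: "s \<ge> 0" and v: "v \<in> Vs m \<Lambda> \<phi> s"
  shows "L2_norm m v \<le> \<Lambda> 0 powr (- s) * Vs_norm m \<Lambda> \<phi> s v"
proof (rule L2_norm_le[OF Vs_L2[OF v]])
  fix K :: "nat set" assume K: "finite K"
  have "L2_set (\<lambda>n. \<Lambda> n powr 0 * coef v n) K \<le> \<Lambda> 0 powr (0 - s) * L2_set (\<lambda>n. \<Lambda> n powr s * coef v n) K"
    by (rule L2_set_weight_compare[OF s])
  also have "\<dots> \<le> \<Lambda> 0 powr (0 - s) * Vs_norm m \<Lambda> \<phi> s v" by (intro mult_left_mono L2_set_Vs_le v K) simp
  also have "(\<lambda>n. \<Lambda> n powr 0 * coef v n) = coef v" using Lambda_pos by (auto simp: less_imp_neq[symmetric])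
  finally show "L2_set (coef v) K \<le> \<Lambda> 0 powr (- s) * Vs_norm m \<Lambda> \<phi> s v" by simp
qed

lemma inner_Vdual:
  assumes s: "s \<ge> 0" and z: "z \<in> L2 m"
  shows "L2_inner m z \<in> Vdual m \<Lambda> \<phi> s"
proof (rule Vdual_I)
  fix u v :: "'a \<Rightarrow> real" and a b :: real assume uv: "u \<in> Vs m \<Lambda> \<phi> s" "v \<in> Vs m \<Lambda> \<phi> s"
  show "L2_inner m z (\<lambda>x. a * u x + b * v x) = a * L2_inner m z u + b * L2_inner m z v"
    using L2_inner_lincomb[OF Vs_L2[OF uv(1)] Vs_L2[OF uv(2)] z, of a b] by (simp add: L2_inner_commute[of m z])
next
  fix v assume v: "v \<in> Vs m \<Lambda> \<phi> s"
  have "\<bar>L2_inner m z v\<bar> \<le> L2_norm m z * L2_norm m v" by (rule L2_Cauchy_Schwarz[OF z Vs_L2[OF v]])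
  also have "\<dots> \<le> L2_norm m z * (\<Lambda> 0 powr (- s) * Vs_norm m \<Lambda> \<phi> s v)" by (intro mult_left_mono L2_norm_le_Vs_norm s v) simp
  finally show "\<bar>L2_inner m z v\<bar> \<le> (L2_norm m z * \<Lambda> 0 powr (- s)) * Vs_norm m \<Lambda> \<phi> s v" by (simp add: mult.assoc)
qed

lemma caputo_integral_eq_frac_int:
  assumes u: "\<And>s. s \<in> {0..T} \<Longrightarrow> u s \<in> L2 m" and u'0: "u' 0 \<in> L2 m" and v: "v \<in> L2 m" and t: "t \<in> {0..T}"
  shows "caputo_integral m \<alpha> u u' t v =
     frac_int (2 - \<alpha>) (\<lambda>s. L2_inner m (u s) v - L2_inner m (u 0) v - s * L2_inner m (u' 0) v) t"
proof -
  have e: "L2_inner m (\<lambda>x. u s x - u 0 x - s * u' 0 x) v =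
      L2_inner m (u s) v - L2_inner m (u 0) v - s * L2_inner m (u' 0) v" if s: "s \<in> {0..t}" for s
  proof -
    have L: "u s \<in> L2 m" "u 0 \<in> L2 m" using s t by (auto intro: u)
    have "L2_inner m (\<lambda>x. s * u' 0 x) v = s * L2_inner m (u' 0) v" by (simp add: L2_inner_def mult.assoc)
    then show ?thesis
      by (simp add: L2_inner_diff[OF L2_diff[OF L] L2_cmult[OF u'0] v] L2_inner_diff[OF L v])
  qed
  have "caputo_integral m \<alpha> u u' t v = frac_int (2 - \<alpha>) (\<lambda>s. L2_inner m (\<lambda>x. u s x - u 0 x - s * u' 0 x) v) t"
    by (simp add: caputo_integral_def frac_int_def)
  also have "\<dots> = frac_int (2 - \<alpha>) (\<lambda>s. L2_inner m (u s) v - L2_inner m (u 0) v - s * L2_inner m (u' 0) v) t"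
    by (rule frac_int_cong) (rule e)
  finally show ?thesis .
qed

text \<open>The pairings with \<open>u\<close> are bounded by the norms of \<open>u\<close>, which are bounded on
\<open>{0..T}\<close> by continuity.\<close>

lemma caputo_integral_Vdual:
  assumes \<alpha>: "\<alpha> < 2" and s: "s \<ge> 0" and u: "cont_path (L2 m) (L2_norm m) T u" and u'0: "u' 0 \<in> L2 m" and t: "t \<in> {0..T}"
  shows "caputo_integral m \<alpha> u u' t \<in> Vdual m \<Lambda> \<phi> s"
proof -
  have uL: "u r \<in> L2 m" if "r \<in> {0..T}" for r using u that by (simp add: cont_path_def)
  define y where "y v r = L2_inner m (u r) v - L2_inner m (u 0) v - r * L2_inner m (u' 0) v" for v r
  have eq: "caputo_integral m \<alpha> u u' t v = frac_int (2 - \<alpha>) (y v) t" if "v \<in> L2 m" for v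
    unfolding y_def by (rule caputo_integral_eq_frac_int[where u = u and u' = u' and T = T]) (use uL u'0 that t in auto)
  have yc: "continuous_on {0..t} (y v)" if v: "v \<in> L2 m" for v
    unfolding y_def by (intro continuous_intros continuous_on_subset[OF inner_cont_path[OF u v]]) (use t in auto)
  have t0: "0 \<in> {0..T}" "t \<ge> 0" using t by auto
  obtain M where M: "M > 0" "\<And>r. r \<in> {0..T} \<Longrightarrow> \<bar>L2_norm m (u r)\<bar> \<le> M"
    using continuous_image_bounded[OF l2_coordinates.cont_path_norm_continuous[OF L2_coordinates u]] by blast
  define R where "R = M + M + T * L2_norm m (u' 0)"
  have yb: "\<bar>y v r\<bar> \<le> R * L2_norm m v" if v: "v \<in> L2 m" and r: "r \<in> {0..t}" for v r
  proof -
    have rT: "r \<in> {0..T}" using r t by auto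
    have "\<bar>L2_inner m (u q) v\<bar> \<le> M * L2_norm m v" if q: "q \<in> {0..T}" for q
      by (rule order_trans[OF L2_Cauchy_Schwarz[OF uL[OF q] v] mult_right_mono]) (use M(2)[OF q] in auto)
    note b = this[OF rT] this[OF t0(1)]
    have "\<bar>r * L2_inner m (u' 0) v\<bar> \<le> T * (L2_norm m (u' 0) * L2_norm m v)"
      unfolding abs_mult using rT by (intro mult_mono L2_Cauchy_Schwarz u'0 v) auto
    then have "\<bar>y v r\<bar> \<le> M * L2_norm m v + M * L2_norm m v + T * (L2_norm m (u' 0) * L2_norm m v)"
      unfolding y_def using b by linarith
    then show ?thesis by (simp add: R_def algebra_simps)
  qed
  define G where "G = R * t powr (2 - \<alpha>) / Gamma (2 - \<alpha> + 1)"
  have G: "G \<ge> 0" unfolding G_def R_def using M(1) t \<alpha> Gamma_real_pos[of "2 - \<alpha> + 1"] by simp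
  show ?thesis
  proof (rule Vdual_I)
    fix v w :: "'a \<Rightarrow> real" and a b :: real assume vw: "v \<in> Vs m \<Lambda> \<phi> s" "w \<in> Vs m \<Lambda> \<phi> s"
    note L = Vs_L2[OF vw(1)] Vs_L2[OF vw(2)]
    have "frac_int (2 - \<alpha>) (y (\<lambda>x. a * v x + b * w x)) t = frac_int (2 - \<alpha>) (\<lambda>r. a * y v r + b * y w r) t"
    proof (rule frac_int_cong)
      fix r assume r: "r \<in> {0..t}"
      have "L2_inner m z (\<lambda>x. a * v x + b * w x) = a * L2_inner m z v + b * L2_inner m z w" if "z \<in> L2 m" for z
        using L2_inner_lincomb[OF L that, of a b] by (simp add: L2_inner_commute[of m z])
      from this[OF uL, of r] this[OF uL, of 0] this[OF u'0]
      show "y (\<lambda>x. a * v x + b * w x) r = a * y v r + b * y w r"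
        unfolding y_def using r t by (simp add: algebra_simps)
    qed
    also have "\<dots> = a * frac_int (2 - \<alpha>) (y v) t + b * frac_int (2 - \<alpha>) (y w) t"
      using \<alpha> t0 by (simp add: frac_int_add frac_int_cmult continuous_on_mult_left yc[OF L(1)] yc[OF L(2)])
    finally show "caputo_integral m \<alpha> u u' t (\<lambda>x. a * v x + b * w x) = a * caputo_integral m \<alpha> u u' t v + b * caputo_integral m \<alpha> u u' t w"
      by (simp add: eq L2_lincomb[OF L] L)
  next
    fix v assume v: "v \<in> Vs m \<Lambda> \<phi> s"
    have "\<bar>frac_int (2 - \<alpha>) (y v) t\<bar> \<le> R * L2_norm m v * t powr (2 - \<alpha>) / Gamma (2 - \<alpha> + 1)"
      using \<alpha> t0 by (intro frac_int_bound yc yb Vs_L2[OF v]) auto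
    also have "\<dots> = G * L2_norm m v" by (simp add: G_def)
    also have "\<dots> \<le> G * (\<Lambda> 0 powr (- s) * Vs_norm m \<Lambda> \<phi> s v)" by (intro mult_left_mono L2_norm_le_Vs_norm s v G)
    finally show "\<bar>caputo_integral m \<alpha> u u' t v\<bar> \<le> (G * \<Lambda> 0 powr (- s)) * Vs_norm m \<Lambda> \<phi> s v"
      by (simp add: eq[OF Vs_L2[OF v]] mult.assoc)
  qed
qed

end

lemma real_derivative_unique_within_Icc:
  assumes "(f has_real_derivative a) (at t within {0..T})" "(f has_real_derivative b) (at t within {0..T})" "0 < T" "t \<in> {0..T}"
  shows "a = b"
  using vector_derivative_unique_within_closed_interval[of 0 T t f a b] assms
  by (simp add: has_real_derivative_iff_has_vector_derivative)

lemma continuous_AE_zero: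
  fixes h :: "real \<Rightarrow> real"
  assumes h: "continuous_on {0..T} h" and T: "T > 0" and ae: "AE t in lebesgue_on {0<..<T}. h t = 0" and t: "t \<in> {0..T}"
  shows "h t = 0"
proof -
  define S where "S = {t \<in> {0<..<T}. h t \<in> - {0}}"
  have "open S" unfolding S_def
  proof -
    have "continuous_on {0<..<T} h" by (rule continuous_on_subset[OF h]) auto
    then have "open ({0<..<T} \<inter> h -` (- {0}))" by (intro continuous_open_preimage) auto
    then show "open {t \<in> {0<..<T}. h t \<in> - {0}}" by (simp add: vimage_def Int_def)
  qed
  have "AE t in lebesgue. t \<in> {0<..<T} \<longrightarrow> h t = 0"
    using ae by (subst (asm) AE_restrict_space_iff) auto
  then obtain N where N: "{t \<in> space lebesgue. \<not> (t \<in> {0<..<T} \<longrightarrow> h t = 0)} \<subseteq> N" "emeasure lebesgue N = 0" "N \<in> sets lebesgue"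
    by (rule AE_E)
  have "negligible N" using N by (simp add: negligible_iff_null_sets null_setsI)
  then have "negligible S" by (rule negligible_subset) (use N(1) in \<open>auto simp: S_def\<close>)
  then have "S = {}" using \<open>open S\<close> open_not_negligible by blast
  then have "h x = 0" if "x \<in> {0<..<T}" for x using that by (auto simp: S_def)
  moreover have "closure {0<..<T} = {0..T}" using T by (simp add: closure_greaterThanLessThan)
  ultimately show ?thesis using continuous_constant_on_closure[of "{0<..<T}" h 0 t] h t by auto
qed


section \<open>Existence\<close>

context fractional_data
begin

lemma x_0: "x n 0 = coef u0 n" "x' n 0 = coef u1 n"
  unfolding x_def x'_def using \<alpha> by (simp_all add: frac_sol_0)

lemma x_deriv: "t \<in> {0..T} \<Longrightarrow> (x n has_real_derivative x' n t) (at t within {0..T})"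
  unfolding x_def x'_def by (rule frac_sol_has_derivative[OF \<alpha>(1) F_cont])

text \<open>The equation holds for the functional with coordinates \<open>W\<close> by construction, because the form has
the coordinates \<open>\<Lambda> n * x n t\<close>.\<close>

lemma pairing_source_and_form:
  assumes u: "u \<in> Vs m \<Lambda> \<phi> (1/\<alpha>)" "\<And>n. coef u n = x n t" and v: "v \<in> Vs m \<Lambda> \<phi> (1/\<alpha>)"
    and g: "g t \<in> L2 m" "\<And>n. F n t = coef (g t) n"
  shows "dual_of (\<lambda>n. W n t) v + E u v = L2_inner m (g t) v"
proof -
  have uV: "u \<in> V" "v \<in> V" using u v Vgamma_V by auto
  have s1: "(\<lambda>n. coef (g t) n * coef v n) sums L2_inner m (g t) v" by (rule parseval_inner[OF g(1) Vs_L2[OF v]])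
  have s2: "(\<lambda>n. coef u n * (\<Lambda> n * coef v n)) sums E u v" by (rule form_sums[OF uV])
  have "(\<lambda>n. coef (g t) n * coef v n - coef u n * (\<Lambda> n * coef v n)) sums (L2_inner m (g t) v - E u v)"
    by (rule sums_diff[OF s1 s2])
  also have "(\<lambda>n. coef (g t) n * coef v n - coef u n * (\<Lambda> n * coef v n)) = (\<lambda>n. W n t * coef v n)"
    by (simp add: W_def g(2) u(2) algebra_simps)
  finally show ?thesis by (simp add: dual_of_def sums_iff)
qed

context
  fixes U U'
  assumes U: "\<And>t. t \<in> {0..T} \<Longrightarrow> U t \<in> Vs m \<Lambda> \<phi> (1/\<alpha>)" "\<And>t n. t \<in> {0..T} \<Longrightarrow> coef (U t) n = x n t"
    and U': "\<And>t. t \<in> {0..T} \<Longrightarrow> U' t \<in> L2 m" "\<And>t n. t \<in> {0..T} \<Longrightarrow> coef (U' t) n = x' n t"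
begin

lemma zero_in: "0 \<in> {0..T}" using T by simp

lemma U_L2: "t \<in> {0..T} \<Longrightarrow> U t \<in> L2 m" by (rule Vs_L2[OF U(1)])

lemma l2_continuous_cong: "(\<And>n t. t \<in> {0..T} \<Longrightarrow> y n t = z n t) \<Longrightarrow> l2_continuous T z \<Longrightarrow> l2_continuous T y"
  unfolding l2_continuous_def by simp

lemma U_path: "cont_path (Vs m \<Lambda> \<phi> (1/\<alpha>)) (Vs_norm m \<Lambda> \<phi> (1/\<alpha>)) T U"
  by (rule l2_coordinates.cont_path_I[OF Vs_coordinates U(1)])
    (auto intro!: l2_continuous_cong[OF _ x_l2(1)] simp: U(2))

lemma U'_path: "cont_path (L2 m) (L2_norm m) T U'"
  by (rule l2_coordinates.cont_path_I[OF L2_coordinates U'(1)])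
    (auto intro!: l2_continuous_cong[OF _ x_l2(2)] simp: U'(2))

lemma U_L2_path: "cont_path (L2 m) (L2_norm m) T U"
proof (rule l2_coordinates.cont_path_I[OF L2_coordinates U_L2])
  have "l2_continuous T (\<lambda>n t. \<Lambda> n powr 0 * x n t)" by (rule x_l2_weight) (use \<alpha> in auto)
  then have "l2_continuous T x" using Lambda_pos by (simp add: less_imp_neq[symmetric])
  then show "l2_continuous T (\<lambda>n t. coef (U t) n)" by (rule l2_continuous_cong[rotated]) (simp add: U(2))
qed

lemma U_deriv_path: "deriv_path (L2 m) (L2_norm m) T U U'"
proof (rule l2_coordinates.deriv_path_I[OF L2_coordinates U_L2 U'(1)])
  fix n t assume t: "t \<in> {0..T}"
  show "((\<lambda>s. coef (U s) n) has_real_derivative coef (U' t) n) (at t within {0..T})"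
    unfolding U'(2)[OF t]
    by (rule has_field_derivative_transform_within[OF x_deriv[OF t] zero_less_one t]) (simp add: U(2))
next
  show "l2_continuous T (\<lambda>n t. coef (U' t) n)" by (rule l2_continuous_cong[OF _ x_l2(2)]) (simp add: U'(2))
qed

lemma caputo_integral_phi:
  assumes u': "u' 0 \<in> L2 m" "\<And>n. coef (u' 0) n = coef u1 n" and t: "t \<in> {0..T}"
  shows "caputo_integral m \<alpha> U u' t (\<phi> n) = J n t"
proof -
  have "caputo_integral m \<alpha> U u' t (\<phi> n) = frac_int (2 - \<alpha>) (\<lambda>s. L2_inner m (U s) (\<phi> n) - L2_inner m (U 0) (\<phi> n) - s * L2_inner m (u' 0) (\<phi> n)) t"
    by (rule caputo_integral_eq_frac_int[where T = T]) (use U_L2 u' t phi in auto)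
  also have "\<dots> = J n t"
    unfolding J_def coef_def[symmetric]
    by (rule frac_int_cong) (use t in \<open>auto simp: U(2) zero_in x_0 u'(2)\<close>)
  finally show ?thesis .
qed

lemma j_Vdual: "t \<in> {0..T} \<Longrightarrow> dual_of (\<lambda>n. j n t) \<in> Vdual m \<Lambda> \<phi> (1/\<alpha>)"
  using j_bound[of t] dual_of_Vdual[of "1/\<alpha>" "\<lambda>n. j n t"] by blast

lemma W_Vdual: "t \<in> {0..T} \<Longrightarrow> dual_of (\<lambda>n. W n t) \<in> Vdual m \<Lambda> \<phi> (1/\<alpha>)"
  using dual_of_Vdual[OF uniform_bounds(3)] by blast

lemma U_caputo: "caputo_derivative m \<Lambda> \<phi> (1/\<alpha>) T \<alpha> U U' (\<lambda>t. dual_of (\<lambda>n. W n t))"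
  unfolding caputo_derivative_def
proof (intro exI conjI)
  have U'1: "coef (U' 0) n = coef u1 n" for n by (simp add: U'(2)[OF zero_in] x_0)
  have CI: "caputo_integral m \<alpha> U U' t \<in> Vdual m \<Lambda> \<phi> (1/\<alpha>)" if "t \<in> {0..T}" for t
    by (rule caputo_integral_Vdual[where u' = U', OF \<alpha>(2) less_imp_le[OF gamma_bounds(1)] U_L2_path U'(1)[OF zero_in] that])
  show "deriv_path (Vdual m \<Lambda> \<phi> (1/\<alpha>)) (Vdual_norm \<Lambda> \<phi> (1/\<alpha>)) T (caputo_integral m \<alpha> U U') (\<lambda>t. dual_of (\<lambda>n. j n t))"
  proof (rule l2_coordinates.deriv_path_I[OF Vdual_coordinates CI j_Vdual])
    fix n t assume t: "t \<in> {0..T}"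
    show "((\<lambda>s. \<Lambda> n powr - (1 / \<alpha>) * caputo_integral m \<alpha> U U' s (\<phi> n)) has_real_derivative \<Lambda> n powr - (1 / \<alpha>) * dual_of (\<lambda>n. j n t) (\<phi> n)) (at t within {0..T})"
      unfolding dual_of_phi
      by (rule has_field_derivative_transform_within[OF DERIV_cmult[OF J_deriv[OF t]] zero_less_one t])
        (simp add: caputo_integral_phi[where u' = U', OF U'(1)[OF zero_in] U'1])
  next
    show "l2_continuous T (\<lambda>n t. \<Lambda> n powr - (1 / \<alpha>) * dual_of (\<lambda>n. j n t) (\<phi> n))" unfolding dual_of_phi by (rule j_l2)
  qed
  show "deriv_path (Vdual m \<Lambda> \<phi> (1/\<alpha>)) (Vdual_norm \<Lambda> \<phi> (1/\<alpha>)) T (\<lambda>t. dual_of (\<lambda>n. j n t)) (\<lambda>t. dual_of (\<lambda>n. W n t))"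
  proof (rule l2_coordinates.deriv_path_I[OF Vdual_coordinates j_Vdual W_Vdual])
    fix n t assume t: "t \<in> {0..T}"
    show "((\<lambda>s. \<Lambda> n powr - (1 / \<alpha>) * dual_of (\<lambda>n. j n s) (\<phi> n)) has_real_derivative \<Lambda> n powr - (1 / \<alpha>) * dual_of (\<lambda>n. W n t) (\<phi> n)) (at t within {0..T})"
      unfolding dual_of_phi by (rule DERIV_cmult[OF j_deriv[OF t]])
  next
    show "l2_continuous T (\<lambda>n t. \<Lambda> n powr - (1 / \<alpha>) * dual_of (\<lambda>n. W n t) (\<phi> n))" unfolding dual_of_phi by (rule W_l2)
  qed
qed

lemma W_path: "cont_path (Vdual m \<Lambda> \<phi> (1/\<alpha>)) (Vdual_norm \<Lambda> \<phi> (1/\<alpha>)) T (\<lambda>t. dual_of (\<lambda>n. W n t))"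
  by (rule l2_coordinates.cont_path_I[OF Vdual_coordinates W_Vdual]) (auto simp: dual_of_phi intro: W_l2)

lemma U_initial: "ae_eq m (U 0) u0" "ae_eq m (U' 0) u1"
  by (rule coef_eq_imp_ae_eq[OF U_L2[OF zero_in] Vs_L2[OF u0]], simp add: U(2)[OF zero_in] x_0)
    (rule coef_eq_imp_ae_eq[OF U'(1)[OF zero_in] u1], simp add: U'(2)[OF zero_in] x_0)

lemma U_limit: "((\<lambda>t. Vs_norm m \<Lambda> \<phi> 0 (\<lambda>x. U t x - u0 x)) \<longlongrightarrow> 0) (at_right 0)"
proof -
  have d: "(\<lambda>x. U t x - u0 x) \<in> Vs m \<Lambda> \<phi> 0" if "t \<in> {0..T}" for t
    using Vs_lincomb[OF U(1)[OF that] u0, of 1 "-1"] Vs_antimono[of 0 "1/\<alpha>"] \<alpha> by auto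
  have "((\<lambda>t. Vs_norm m \<Lambda> \<phi> 0 (\<lambda>x. U t x - u0 x)) \<longlongrightarrow> 0) (at 0 within {0..T})"
  proof (rule tendsto_0_within_of_bound)
    fix \<epsilon> :: real assume \<epsilon>: "\<epsilon> > 0"
    have l2: "l2_continuous T (\<lambda>n t. \<Lambda> n powr 0 * x n t)" by (rule x_l2_weight) (use \<alpha> in auto)
    obtain \<delta> where \<delta>: "\<delta> > 0" "\<And>s K. s \<in> {0..T} \<Longrightarrow> \<bar>s - 0\<bar> < \<delta> \<Longrightarrow> finite K \<Longrightarrow> L2_set (\<lambda>n. \<Lambda> n powr 0 * x n s - \<Lambda> n powr 0 * x n 0) K \<le> \<epsilon>"
      using l2_continuousD[OF l2 zero_in \<epsilon>] by blast
    have "Vs_norm m \<Lambda> \<phi> 0 (\<lambda>x. U s x - u0 x) \<le> \<epsilon>" if s: "s \<in> {0..T}" "\<bar>s - 0\<bar> < \<delta>" for s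
      using \<delta>(2)[OF s] by (intro Vs_I(2)[OF Vs_L2[OF d[OF s(1)]]])
        (simp add: coef_diff[OF U_L2[OF s(1)] Vs_L2[OF u0]] U(2)[OF s(1)] x_0 right_diff_distrib)
    then show "\<exists>\<delta>>0. \<forall>s\<in>{0..T}. s \<noteq> 0 \<longrightarrow> \<bar>s - 0\<bar> < \<delta> \<longrightarrow> Vs_norm m \<Lambda> \<phi> 0 (\<lambda>x. U s x - u0 x) \<le> \<epsilon>" using \<delta>(1) by blast
  qed (rule Vs_norm_nonneg[OF d])
  then show ?thesis using T by (simp add: at_within_Icc_at_right)
qed

lemma U'_limit: "((\<lambda>t. Vdual_norm \<Lambda> \<phi> (1 - 1/\<alpha>) (\<lambda>v. L2_inner m (\<lambda>x. U' t x - u1 x) v)) \<longlongrightarrow> 0) (at_right 0)"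
proof -
  have d: "(\<lambda>x. U' t x - u1 x) \<in> L2 m" if "t \<in> {0..T}" for t by (rule L2_diff[OF U'(1)[OF that] u1])
  have V: "L2_inner m (\<lambda>x. U' t x - u1 x) \<in> Vdual m \<Lambda> \<phi> (1 - 1/\<alpha>)" if "t \<in> {0..T}" for t
    by (rule inner_Vdual[OF less_imp_le[OF gamma_bounds(5)] d[OF that]])
  have "((\<lambda>t. Vdual_norm \<Lambda> \<phi> (1 - 1/\<alpha>) (\<lambda>v. L2_inner m (\<lambda>x. U' t x - u1 x) v)) \<longlongrightarrow> 0) (at 0 within {0..T})"
  proof (rule tendsto_0_within_of_bound)
    fix \<epsilon> :: real assume \<epsilon>: "\<epsilon> > 0"
    define c where "c = \<Lambda> 0 powr (- (1 - 1/\<alpha>))"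
    have c: "c > 0" using L0 by (simp add: c_def)
    have e: "\<epsilon> / c > 0" using \<epsilon> c by simp
    obtain \<delta> where \<delta>: "\<delta> > 0" "\<And>s K. s \<in> {0..T} \<Longrightarrow> \<bar>s - 0\<bar> < \<delta> \<Longrightarrow> finite K \<Longrightarrow> L2_set (\<lambda>n. x' n s - x' n 0) K \<le> \<epsilon> / c"
      using l2_continuousD[OF x_l2(2) zero_in e] by blast
    have "Vdual_norm \<Lambda> \<phi> (1 - 1/\<alpha>) (\<lambda>v. L2_inner m (\<lambda>x. U' s x - u1 x) v) \<le> \<epsilon>" if s: "s \<in> {0..T}" "\<bar>s - 0\<bar> < \<delta>" for s
    proof (rule Vdual_norm_le)
      fix K :: "nat set" assume K: "finite K"
      have "L2_set (\<lambda>n. \<Lambda> n powr (- (1 - 1/\<alpha>)) * L2_inner m (\<lambda>x. U' s x - u1 x) (\<phi> n)) K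
          = L2_set (\<lambda>n. \<Lambda> n powr (- (1 - 1/\<alpha>)) * (x' n s - x' n 0)) K"
        by (simp add: coef_def[symmetric] coef_diff[OF U'(1)[OF s(1)] u1] U'(2)[OF s(1)] x_0)
      also have "\<dots> \<le> \<Lambda> 0 powr (- (1 - 1/\<alpha>) - 0) * L2_set (\<lambda>n. \<Lambda> n powr 0 * (x' n s - x' n 0)) K"
        by (rule L2_set_weight_compare) (use gamma_bounds(5) in linarith)
      also have "(\<lambda>n. \<Lambda> n powr 0 * (x' n s - x' n 0)) = (\<lambda>n. x' n s - x' n 0)"
        using Lambda_pos by (simp add: less_imp_neq[symmetric])
      also have "\<Lambda> 0 powr (- (1 - 1/\<alpha>) - 0) * L2_set (\<lambda>n. x' n s - x' n 0) K \<le> c * (\<epsilon> / c)"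
        unfolding c_def[symmetric] diff_zero using c by (intro mult_left_mono \<delta>(2) s K) auto
      also have "\<dots> = \<epsilon>" using c by simp
      finally show "L2_set (\<lambda>n. \<Lambda> n powr (- (1 - 1/\<alpha>)) * L2_inner m (\<lambda>x. U' s x - u1 x) (\<phi> n)) K \<le> \<epsilon>" .
    qed
    then show "\<exists>\<delta>>0. \<forall>s\<in>{0..T}. s \<noteq> 0 \<longrightarrow> \<bar>s - 0\<bar> < \<delta> \<longrightarrow> Vdual_norm \<Lambda> \<phi> (1 - 1/\<alpha>) (\<lambda>v. L2_inner m (\<lambda>x. U' s x - u1 x) v) \<le> \<epsilon>" using \<delta>(1) by blast
  qed (rule Vdual_norm_nonneg[OF V])
  then show ?thesis using T by (simp add: at_within_Icc_at_right)
qed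

lemma U_equation:
  assumes "\<eta> \<in> Vs m \<Lambda> \<phi> (1/\<alpha>)"
  shows "AE t in lebesgue_on {0<..<T}. dual_of (\<lambda>n. W n t) \<eta> + E (U t) \<eta> = L2_inner m (g t) \<eta>"
proof -
  have "AE t in lebesgue_on {0<..<T}. t \<in> {0..T}" by (rule AE_I2) (auto simp: space_restrict_space)
  with F_AE show ?thesis
    by eventually_elim (use pairing_source_and_form[OF U(1) U(2) assms] in blast)
qed

text \<open>The initial conditions hold in norm with \<open>\<sigma> = 0\<close> and the largest admissible
\<open>\<beta>\<close>.\<close>

lemma U_weak_solution: "weak_solution m E \<Lambda> \<phi> (1/\<alpha>) T \<alpha> u0 u1 g U"
proof -
  have "\<exists>\<sigma> \<beta>. 0 \<le> \<sigma> \<and> \<sigma> < 1 / \<alpha> \<and> 0 < \<beta> \<and> \<beta> \<le> 1 - 1 / \<alpha> \<and>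
        ((\<lambda>t. Vs_norm m \<Lambda> \<phi> \<sigma> (\<lambda>x. U t x - u0 x)) \<longlongrightarrow> 0) (at_right 0) \<and>
        ((\<lambda>t. Vdual_norm \<Lambda> \<phi> \<beta> (\<lambda>v. L2_inner m (\<lambda>x. U' t x - u1 x) v)) \<longlongrightarrow> 0) (at_right 0)"
    using U_limit U'_limit gamma_bounds(1,5) by (intro exI[of _ 0] exI[of _ "1 - 1/\<alpha>"]) simp
  then show ?thesis unfolding weak_solution_def C1_path_def
    by (intro exI[of _ U'] exI[of _ "\<lambda>t. dual_of (\<lambda>n. W n t)"] conjI U_path U_deriv_path U'_path U_caputo W_path U_initial ballI U_equation)
qed

end
end


section \<open>Uniqueness, series and estimates\<close>

lemma (in complete_measure) borel_measurable_cong_AE: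
  fixes f g :: "'a \<Rightarrow> real"
  assumes f: "f \<in> borel_measurable M" and eq: "AE x in M. g x = f x"
  shows "g \<in> borel_measurable M"
proof (rule measurableI)
  fix S :: "real set" assume S: "S \<in> sets borel"
  show "g -` S \<inter> space M \<in> sets M"
  proof (rule in_sets_AE)
    show "AE x in M. x \<in> f -` S \<inter> space M \<longleftrightarrow> x \<in> g -` S \<inter> space M" using eq by eventually_elim auto
    show "f -` S \<inter> space M \<in> sets M" by (rule measurable_sets[OF f S])
  qed auto
qed simp

lemma DERIV_cancel_cmult:
  assumes "((\<lambda>s. c * y s) has_real_derivative c * d) (at t within S)" "c \<noteq> 0"
  shows "(y has_real_derivative d) (at t within S)"
  using DERIV_cmult[OF assms(1), of "inverse c"] assms(2) by (simp add: mult.assoc[symmetric])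

context spectral_setting
begin

lemma C1_path_coordinates:
  assumes "C1_path (L2 m) (L2_norm m) T v v'"
  shows "t \<in> {0..T} \<Longrightarrow> v t \<in> L2 m" "t \<in> {0..T} \<Longrightarrow> v' t \<in> L2 m"
    "t \<in> {0..T} \<Longrightarrow> ((\<lambda>s. coef (v s) n) has_real_derivative coef (v' t) n) (at t within {0..T})"
    "continuous_on {0..T} (\<lambda>t. coef (v' t) n)" "continuous_on {0..T} (\<lambda>t. coef (v t) n)"
proof -
  have d: "deriv_path (L2 m) (L2_norm m) T v v'" and c: "cont_path (L2 m) (L2_norm m) T v'"
    using assms by (auto simp: C1_path_def)
  show "t \<in> {0..T} \<Longrightarrow> v t \<in> L2 m" "t \<in> {0..T} \<Longrightarrow> v' t \<in> L2 m" using d by (auto simp: deriv_path_def)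
  show der: "((\<lambda>s. coef (v s) n) has_real_derivative coef (v' t) n) (at t within {0..T})" if "t \<in> {0..T}" for t
    by (rule l2_coordinates.deriv_path_D[OF L2_coordinates d that])
  show "continuous_on {0..T} (\<lambda>t. coef (v' t) n)"
    by (rule l2_continuous_component[OF l2_coordinates.cont_path_D[OF L2_coordinates c]])
  show "continuous_on {0..T} (\<lambda>t. coef (v t) n)" by (rule DERIV_continuous_on[OF der])
qed

text \<open>Both derivatives in the dual space are tested with the eigenfunctions.\<close>

lemma caputo_derivative_coordinates:
  assumes C1: "C1_path (L2 m) (L2_norm m) T v v'" and cd: "caputo_derivative m \<Lambda> \<phi> s T \<alpha> v v' w" and T: "T > 0"
  shows "\<exists>J'. \<forall>n. \<forall>t\<in>{0..T}. (frac_int (2 - \<alpha>) (\<lambda>r. coef (v r) n - coef (v 0) n - r * coef (v' 0) n) has_real_derivative J' t (\<phi> n)) (at t within {0..T}) \<and>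
    ((\<lambda>r. J' r (\<phi> n)) has_real_derivative w t (\<phi> n)) (at t within {0..T})"
proof -
  note L = C1_path_coordinates(1,2)[OF C1]
  obtain J' where J': "deriv_path (Vdual m \<Lambda> \<phi> s) (Vdual_norm \<Lambda> \<phi> s) T (caputo_integral m \<alpha> v v') J'"
    "deriv_path (Vdual m \<Lambda> \<phi> s) (Vdual_norm \<Lambda> \<phi> s) T J' w"
    using cd unfolding caputo_derivative_def by blast
  have z: "\<Lambda> n powr - s \<noteq> 0" for n using Lambda_pos[of n] by simp
  show ?thesis
  proof (intro exI[of _ J'] allI ballI conjI)
    fix n t assume t: "t \<in> {0..T}"
    have "((\<lambda>r. caputo_integral m \<alpha> v v' r (\<phi> n)) has_real_derivative J' t (\<phi> n)) (at t within {0..T})"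
      by (rule DERIV_cancel_cmult[OF l2_coordinates.deriv_path_D[OF Vdual_coordinates J'(1) t] z])
    then show "(frac_int (2 - \<alpha>) (\<lambda>r. coef (v r) n - coef (v 0) n - r * coef (v' 0) n) has_real_derivative J' t (\<phi> n)) (at t within {0..T})"
    proof (rule has_field_derivative_transform_within[OF _ zero_less_one t])
      fix r assume r: "r \<in> {0..T}"
      show "caputo_integral m \<alpha> v v' r (\<phi> n) = frac_int (2 - \<alpha>) (\<lambda>r. coef (v r) n - coef (v 0) n - r * coef (v' 0) n) r"
        unfolding coef_def by (rule caputo_integral_eq_frac_int[where T = T]) (use L T r phi in auto)
    qed
    show "((\<lambda>r. J' r (\<phi> n)) has_real_derivative w t (\<phi> n)) (at t within {0..T})"
      by (rule DERIV_cancel_cmult[OF l2_coordinates.deriv_path_D[OF Vdual_coordinates J'(2) t] z])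
  qed
qed

lemma riesz_fischer_weighted:
  assumes b: "\<And>K. finite K \<Longrightarrow> L2_set (\<lambda>n. \<Lambda> n powr s * c n) K \<le> B" and s: "s \<ge> 0"
  obtains h where "h \<in> L2 m" "coef h = c"
proof -
  have "L2_set c K \<le> \<Lambda> 0 powr (0 - s) * B" if K: "finite K" for K
  proof -
    have "L2_set (\<lambda>n. \<Lambda> n powr 0 * c n) K \<le> \<Lambda> 0 powr (0 - s) * L2_set (\<lambda>n. \<Lambda> n powr s * c n) K"
      by (rule L2_set_weight_compare[OF s])
    also have "\<dots> \<le> \<Lambda> 0 powr (0 - s) * B" by (intro mult_left_mono b K) simp
    also have "(\<lambda>n. \<Lambda> n powr 0 * c n) = c" using Lambda_pos by (auto simp: less_imp_neq[symmetric])
    finally show ?thesis .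
  qed
  from riesz_fischer[OF L2_set_bound_imp_summable(1)[OF this]] that show thesis by blast
qed

end

context fractional_data
begin

text \<open>Tested with an eigenfunction, a weak solution satisfies the scalar equation, first almost everywhere and then
everywhere by continuity.  The scalar equation implies the Volterra equation, which \<open>x\<close> satisfies
as well and which has only one solution.\<close>

lemma weak_solution_coordinates:
  assumes ws: "weak_solution m E \<Lambda> \<phi> (1/\<alpha>) T \<alpha> u0 u1 g v" and t: "t \<in> {0..T}"
  shows "v t \<in> L2 m" "coef (v t) n = x n t"
proof -
  obtain v' w where v: "cont_path (Vs m \<Lambda> \<phi> (1/\<alpha>)) (Vs_norm m \<Lambda> \<phi> (1/\<alpha>)) T v"
    and C1: "C1_path (L2 m) (L2_norm m) T v v'"
    and cd: "caputo_derivative m \<Lambda> \<phi> (1/\<alpha>) T \<alpha> v v' w"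
    and w: "cont_path (Vdual m \<Lambda> \<phi> (1/\<alpha>)) (Vdual_norm \<Lambda> \<phi> (1/\<alpha>)) T w"
    and i: "ae_eq m (v 0) u0" "ae_eq m (v' 0) u1"
    and eq: "\<And>\<eta>. \<eta> \<in> Vs m \<Lambda> \<phi> (1/\<alpha>) \<Longrightarrow> AE t in lebesgue_on {0<..<T}. w t \<eta> + E (v t) \<eta> = L2_inner m (g t) \<eta>"
    using ws unfolding weak_solution_def by blast
  note C = C1_path_coordinates[OF C1]
  show "v t \<in> L2 m" by (rule C(1)[OF t])
  have zero: "0 \<in> {0..T}" using T by simp
  have v0: "coef (v 0) n = coef u0 n" by (rule coef_cong_AE[OF C(1)[OF zero] Vs_L2[OF u0] i(1)])
  have v'0: "coef (v' 0) n = coef u1 n" by (rule coef_cong_AE[OF C(2)[OF zero] u1 i(2)])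
  define y where "y s = coef (v s) n - coef u0 n - s * coef u1 n" for s
  have yc: "continuous_on {0..T} y" unfolding y_def by (intro continuous_intros C(5))
  have wc: "continuous_on {0..T} (\<lambda>s. w s (\<phi> n))"
  proof -
    have "continuous_on {0..T} (\<lambda>s. \<Lambda> n powr (1/\<alpha>) * (\<Lambda> n powr (- (1/\<alpha>)) * w s (\<phi> n)))"
      by (intro continuous_intros l2_continuous_component[OF l2_coordinates.cont_path_D[OF Vdual_coordinates w]])
    moreover have "\<Lambda> n powr (1/\<alpha>) * \<Lambda> n powr (- (1/\<alpha>)) = 1" using Lambda_pos[of n] by (simp flip: powr_add)
    ultimately show ?thesis by (simp add: mult.assoc[symmetric])
  qed
  \<comment> \<open>the equation tested with the eigenfunction holds at every time, by continuity\<close>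
  have weq: "w s (\<phi> n) = F n s - \<Lambda> n * coef (v s) n" if s: "s \<in> {0..T}" for s
  proof -
    have "AE s in lebesgue_on {0<..<T}. s \<in> {0..T}" by (rule AE_I2) (auto simp: space_restrict_space)
    with eq[OF phi_Vs[of n]] F_AE have "AE s in lebesgue_on {0<..<T}. w s (\<phi> n) - (F n s - \<Lambda> n * coef (v s) n) = 0"
    proof eventually_elim
      case (elim s)
      have vV: "v s \<in> V" using v elim(3) Vgamma_V by (auto simp: cont_path_def)
      have "E (v s) (\<phi> n) = \<Lambda> n * coef (v s) n" using form_sym[OF vV phi(2)] form_phi[OF vV] by simp
      with elim(1,2) show ?case by (simp add: coef_def)
    qed
    then have "w s (\<phi> n) - (F n s - \<Lambda> n * coef (v s) n) = 0"
      by (rule continuous_AE_zero[rotated 2]) (intro continuous_intros wc F_cont C(5) T s)+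
    then show ?thesis by simp
  qed
  obtain M where M: "M > 0" "\<And>s. s \<in> {0..T} \<Longrightarrow> \<bar>coef (v' s) n\<bar> \<le> M" using continuous_image_bounded[OF C(4)] by blast
  \<comment> \<open>\<open>y\<close> vanishes at least linearly at \<open>0\<close> since the velocity is bounded\<close>
  have small: "\<bar>y s\<bar> \<le> (M + \<bar>coef u1 n\<bar>) * s" if s: "s \<in> {0..T}" for s
  proof -
    have "coef (v s) n - coef u0 n = frac_int 1 (\<lambda>s. coef (v' s) n) s"
      by (rule eq_frac_int_1_of_derivative[OF _ C(4) _ s]) (auto intro!: derivative_eq_intros C(3) simp: v0)
    moreover have "\<bar>frac_int 1 (\<lambda>s. coef (v' s) n) s\<bar> \<le> M * s powr 1 / Gamma (1 + 1)"
      by (rule frac_int_bound) (use s M(2) in \<open>auto intro: continuous_on_subset[OF C(4)]\<close>)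
    moreover have "Gamma (1 + 1 :: real) = 1" using Gamma_fact[of 1, where 'a = real] by simp
    moreover have "\<bar>s * coef u1 n\<bar> = \<bar>coef u1 n\<bar> * s" using s by (simp add: abs_mult)
    ultimately show ?thesis unfolding y_def using s by (simp add: distrib_right)
  qed
  obtain J' where "\<forall>n. \<forall>t\<in>{0..T}. (frac_int (2 - \<alpha>) (\<lambda>r. coef (v r) n - coef (v 0) n - r * coef (v' 0) n) has_real_derivative J' t (\<phi> n)) (at t within {0..T}) \<and>
     ((\<lambda>r. J' r (\<phi> n)) has_real_derivative w t (\<phi> n)) (at t within {0..T})"
    using caputo_derivative_coordinates[OF C1 cd T] by (rule exE)
  note J' = this[rule_format, THEN conjunct1] this[rule_format, THEN conjunct2]
  have volterra: "y s = frac_int \<alpha> (\<lambda>s. F n s - \<Lambda> n * coef (v s) n) s" if s: "s \<in> {0..T}" for s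
  proof -
    have "y s = frac_int \<alpha> (\<lambda>s. w s (\<phi> n)) s"
      by (rule caputo_imp_volterra[OF \<alpha> T yc wc _ J'(2) small s]) (use J'(1)[of _ n] in \<open>simp_all add: y_def[abs_def] v0 v'0\<close>)
    also have "\<dots> = frac_int \<alpha> (\<lambda>s. F n s - \<Lambda> n * coef (v s) n) s"
      by (rule frac_int_cong) (use s in \<open>auto intro: weq\<close>)
    finally show ?thesis .
  qed
  have "coef (v t) n - x n t = 0"
  proof (rule volterra_homogeneous_zero[OF _ _ _ t])
    show "1 \<le> \<alpha>" using \<alpha> by simp
    show "continuous_on {0..T} (\<lambda>t. coef (v t) n - x n t)" by (intro continuous_intros C(5) x_cont)
    fix s assume s: "s \<in> {0..T}"
    have sub: "{0..s} \<subseteq> {0..T}" using s by auto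
    have c: "continuous_on {0..s} (\<lambda>s. F n s - \<Lambda> n * coef (v s) n)" "continuous_on {0..s} (\<lambda>s. F n s - \<Lambda> n * x n s)"
      by (intro continuous_intros continuous_on_subset[OF _ sub] F_cont C(5) x_cont)+
    have "x n s - coef u0 n - coef u1 n * s = frac_int \<alpha> (\<lambda>s. F n s - \<Lambda> n * x n s) s"
      unfolding x_def using s by (intro frac_sol_volterra \<alpha> F_cont') auto
    then have "coef (v s) n - x n s = frac_int \<alpha> (\<lambda>s. F n s - \<Lambda> n * coef (v s) n) s - frac_int \<alpha> (\<lambda>s. F n s - \<Lambda> n * x n s) s"
      using volterra[OF s] unfolding y_def by (simp only: mult.commute[of s])
    also have "\<dots> = frac_int \<alpha> (\<lambda>s. (F n s - \<Lambda> n * coef (v s) n) - (F n s - \<Lambda> n * x n s)) s"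
      by (rule frac_int_diff[OF _ _ c, symmetric]) (use \<alpha> s in auto)
    also have "(\<lambda>s. (F n s - \<Lambda> n * coef (v s) n) - (F n s - \<Lambda> n * x n s)) = (\<lambda>s. - \<Lambda> n * (coef (v s) n - x n s))"
      by (simp add: algebra_simps)
    also have "frac_int \<alpha> (\<lambda>s. - \<Lambda> n * (coef (v s) n - x n s)) s = - \<Lambda> n * frac_int \<alpha> (\<lambda>s. coef (v s) n - x n s) s"
      by (rule frac_int_cmult)
    finally show "coef (v s) n - x n s = - \<Lambda> n * frac_int \<alpha> (\<lambda>s. coef (v s) n - x n s) s" .
  qed
  then show "coef (v t) n = x n t" by simp
qed

text \<open>At almost every time the coefficient of \<open>g\<close> equals the continuous function \<open>F n\<close>.
As the Lebesgue measure is complete, this makes the integrand on the left measurable.\<close>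

lemma source_integral_eq_ml_conv:
  assumes t: "t \<in> {0..T}"
  shows "(LINT \<tau>:{0..t}|lebesgue. L2_inner m (g \<tau>) (\<phi> n) * (t - \<tau>) powr (\<alpha> - 1) * mittag_leffler \<alpha> \<alpha> (- \<Lambda> n * (t - \<tau>) powr \<alpha>))
     = ml_conv \<alpha> (\<Lambda> n) \<alpha> (F n) t"
proof -
  have mi: "(\<lambda>\<tau>. indicator {0..t} \<tau> *\<^sub>R (F n \<tau> * (t - \<tau>) powr (\<alpha> - 1) * mittag_leffler \<alpha> \<alpha> (- \<Lambda> n * (t - \<tau>) powr \<alpha>))) \<in> borel_measurable lebesgue"
    using ml_kernel_integrable[OF _ _ _ F_cont'[OF t], where l = "\<Lambda> n" and \<alpha> = \<alpha> and \<beta> = \<alpha>] \<alpha> t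
    unfolding set_integrable_def by (intro borel_measurable_integrable) auto
  have "AE \<tau> in lebesgue. \<tau> \<in> {0<..<T} \<longrightarrow> F n \<tau> = L2_inner m (g \<tau>) (\<phi> n)"
  proof -
    have "AE \<tau> in lebesgue_on {0<..<T}. F n \<tau> = L2_inner m (g \<tau>) (\<phi> n)"
      using F_AE by eventually_elim (simp add: coef_def)
    then show ?thesis by (subst (asm) AE_restrict_space_iff) auto
  qed
  moreover have "AE \<tau> in lebesgue. \<tau> \<noteq> 0" "AE \<tau> in lebesgue. \<tau> \<noteq> T"
    by (intro AE_completion AE_lborel_singleton)+
  ultimately have eq: "AE \<tau> in lebesgue. indicator {0..t} \<tau> *\<^sub>R (L2_inner m (g \<tau>) (\<phi> n) * (t - \<tau>) powr (\<alpha> - 1) * mittag_leffler \<alpha> \<alpha> (- \<Lambda> n * (t - \<tau>) powr \<alpha>))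
     = indicator {0..t} \<tau> *\<^sub>R (F n \<tau> * (t - \<tau>) powr (\<alpha> - 1) * mittag_leffler \<alpha> \<alpha> (- \<Lambda> n * (t - \<tau>) powr \<alpha>))"
  proof eventually_elim
    case (elim \<tau>)
    then show ?case using t by (cases "\<tau> \<in> {0..t}") auto
  qed
  show ?thesis unfolding ml_conv_def set_lebesgue_integral_def
    by (rule integral_cong_AE[OF completion.borel_measurable_cong_AE[OF mi eq] mi eq])
qed

lemma frac_sol_summands:
  assumes "t \<ge> 0"
  shows "frac_sol \<alpha> l c 0 (\<lambda>_. 0) t = c * mittag_leffler \<alpha> 1 (- l * t powr \<alpha>)"
    "frac_sol \<alpha> l 0 d (\<lambda>_. 0) t = d * t * mittag_leffler \<alpha> 2 (- l * t powr \<alpha>)"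
  by (simp_all add: frac_sol_def ml_conv_def)

text \<open>The series of the initial data converge by the estimates for vanishing source.  The third sum is defined as
the remainder: its coefficients are the convolutions with the source.\<close>

lemma solution_series:
  assumes t: "t \<in> {0..T}" and u: "u \<in> L2 m" "\<And>n. coef u n = x n t"
  shows "\<exists>S\<^sub>1 S\<^sub>2 S\<^sub>3.
        L2_sums m \<phi> (\<lambda>n. L2_inner m u0 (\<phi> n) * mittag_leffler \<alpha> 1 (- \<Lambda> n * t powr \<alpha>)) S\<^sub>1 \<and>
        L2_sums m \<phi> (\<lambda>n. L2_inner m u1 (\<phi> n) * t * mittag_leffler \<alpha> 2 (- \<Lambda> n * t powr \<alpha>)) S\<^sub>2 \<and>
        L2_sums m \<phi> (\<lambda>n. LINT \<tau>:{0..t}|lebesgue. L2_inner m (g \<tau>) (\<phi> n) *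
          (t - \<tau>) powr (\<alpha> - 1) * mittag_leffler \<alpha> \<alpha> (- \<Lambda> n * (t - \<tau>) powr \<alpha>)) S\<^sub>3 \<and>
        ae_eq m u (\<lambda>x. S\<^sub>1 x + S\<^sub>2 x + S\<^sub>3 x)"
proof -
  have t0: "t \<ge> 0" using t by simp
  have g0: "1/\<alpha> \<ge> 0" using \<alpha> by simp
  have "L2_set (\<lambda>n. \<Lambda> n powr (1/\<alpha>) * frac_sol \<alpha> (\<Lambda> n) (coef u0 n) 0 (\<lambda>_. 0) t) K \<le> C0 * Vs_norm m \<Lambda> \<phi> (1/\<alpha>) u0" if K: "finite K" for K
  proof -
    have "L2_set (\<lambda>n. \<Lambda> n powr (1/\<alpha>) * frac_sol \<alpha> (\<Lambda> n) (coef u0 n) 0 (\<lambda>_. 0) t) K \<le> C0 * L2_set (\<lambda>n. \<Lambda> n powr (1/\<alpha>) * coef u0 n) K"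
      using solution_le(1)[OF K t0, of "\<lambda>_ _. 0" "coef u0" "\<lambda>_. 0"] by (simp add: L2_set_def)
    also have "\<dots> \<le> C0 * Vs_norm m \<Lambda> \<phi> (1/\<alpha>) u0" using C0 by (intro mult_left_mono L2_set_Vs_le u0 K) auto
    finally show ?thesis .
  qed
  from riesz_fischer_weighted[OF this g0] obtain S1 where
    S1: "S1 \<in> L2 m" "coef S1 = (\<lambda>n. frac_sol \<alpha> (\<Lambda> n) (coef u0 n) 0 (\<lambda>_. 0) t)" by blast
  have "L2_set (\<lambda>n. \<Lambda> n powr (1/\<alpha>) * frac_sol \<alpha> (\<Lambda> n) 0 (coef u1 n) (\<lambda>_. 0) t) K \<le> C0 * L2_norm m u1" if K: "finite K" for K
  proof -
    have "L2_set (\<lambda>n. \<Lambda> n powr (1/\<alpha>) * frac_sol \<alpha> (\<Lambda> n) 0 (coef u1 n) (\<lambda>_. 0) t) K \<le> C0 * L2_set (coef u1) K"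
      using solution_le(1)[OF K t0, of "\<lambda>_ _. 0" "\<lambda>_. 0" "coef u1"] by (simp add: L2_set_def)
    also have "\<dots> \<le> C0 * L2_norm m u1" using C0 by (intro mult_left_mono L2_set_coef_le u1 K) auto
    finally show ?thesis .
  qed
  from riesz_fischer_weighted[OF this g0] obtain S2 where
    S2: "S2 \<in> L2 m" "coef S2 = (\<lambda>n. frac_sol \<alpha> (\<Lambda> n) 0 (coef u1 n) (\<lambda>_. 0) t)" by blast
  define S3 where "S3 = (\<lambda>x. (u x - S1 x) - S2 x)"
  have S3: "S3 \<in> L2 m" unfolding S3_def by (intro L2_diff u S1 S2)
  have "coef S3 n = ml_conv \<alpha> (\<Lambda> n) \<alpha> (F n) t" for n
    unfolding S3_def coef_diff[OF L2_diff[OF u(1) S1(1)] S2(1)] coef_diff[OF u(1) S1(1)] u(2) S1(2) S2(2) x_def frac_sol_summands[OF t0]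
    by (simp add: frac_sol_def)
  then have "coef S3 = (\<lambda>n. LINT \<tau>:{0..t}|lebesgue. L2_inner m (g \<tau>) (\<phi> n) *
          (t - \<tau>) powr (\<alpha> - 1) * mittag_leffler \<alpha> \<alpha> (- \<Lambda> n * (t - \<tau>) powr \<alpha>))"
    unfolding source_integral_eq_ml_conv[OF t] by (intro ext)
  then show ?thesis
    using expansion[OF S1(1)] expansion[OF S2(1)] expansion[OF S3]
    unfolding S1(2) S2(2) frac_sol_summands[OF t0] coef_def
    by (intro exI[of _ S1] exI[of _ S2] exI[of _ S3]) (simp add: ae_eq_def S3_def)
qed

text \<open>The derivatives of the coordinates on \<open>{0..T}\<close> are unique, so any velocity and any Caputo
derivative of \<open>U\<close> have the coordinates \<open>x'\<close> and \<open>W\<close>.\<close>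

lemma solution_estimates:
  assumes U: "\<And>t. t \<in> {0..T} \<Longrightarrow> U t \<in> Vs m \<Lambda> \<phi> (1/\<alpha>)" "\<And>t n. t \<in> {0..T} \<Longrightarrow> coef (U t) n = x n t"
    and C1: "C1_path (L2 m) (L2_norm m) T U u'" and cd: "caputo_derivative m \<Lambda> \<phi> (1/\<alpha>) T \<alpha> U u' w"
    and t: "t \<in> {0..T}"
  shows "Vs_norm m \<Lambda> \<phi> (1/\<alpha>) (U t) + L2_norm m (u' t) \<le>
      2 * (C0 * (Vs_norm m \<Lambda> \<phi> (1/\<alpha>) u0 + L2_norm m u1 + \<kappa>\<^sub>p * t powr (1/p + \<alpha> - 2) * B))"
    and "Vdual_norm \<Lambda> \<phi> (1/\<alpha>) (w t) \<le> (SUP s\<in>{0..T}. Vdual_norm \<Lambda> \<phi> (1/\<alpha>) (f s))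
     + C0 * (Vs_norm m \<Lambda> \<phi> (1/\<alpha>) u0 + t powr (2 - \<alpha>) * L2_norm m u1 + t powr (1/p) * B)"
proof -
  note C = C1_path_coordinates[OF C1]
  have zero: "0 \<in> {0..T}" using T by simp
  have u': "coef (u' s) n = x' n s" if s: "s \<in> {0..T}" for s n
  proof (rule real_derivative_unique_within_Icc[OF C(3)[OF s] _ T s])
    show "((\<lambda>s. coef (U s) n) has_real_derivative x' n s) (at s within {0..T})"
      by (rule has_field_derivative_transform_within[OF x_deriv[OF s] zero_less_one s]) (simp add: U(2))
  qed
  obtain J' where "\<forall>n. \<forall>t\<in>{0..T}. (frac_int (2 - \<alpha>) (\<lambda>r. coef (U r) n - coef (U 0) n - r * coef (u' 0) n) has_real_derivative J' t (\<phi> n)) (at t within {0..T}) \<and>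
     ((\<lambda>r. J' r (\<phi> n)) has_real_derivative w t (\<phi> n)) (at t within {0..T})"
    using caputo_derivative_coordinates[OF C1 cd T] by (rule exE)
  note J' = this[rule_format, THEN conjunct1] this[rule_format, THEN conjunct2]
  have J'j: "J' s (\<phi> n) = j n s" if s: "s \<in> {0..T}" for s n
  proof (rule real_derivative_unique_within_Icc[OF J'(1)[OF s] _ T s])
    show "(frac_int (2 - \<alpha>) (\<lambda>r. coef (U r) n - coef (U 0) n - r * coef (u' 0) n) has_real_derivative j n s) (at s within {0..T})"
    proof (rule has_field_derivative_transform_within[OF J_deriv[OF s] zero_less_one s])
      fix r assume r: "r \<in> {0..T}"
      show "J n r = frac_int (2 - \<alpha>) (\<lambda>r. coef (U r) n - coef (U 0) n - r * coef (u' 0) n) r"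
        unfolding J_def by (rule frac_int_cong) (use r in \<open>auto simp: U(2) u' x_0 zero\<close>)
    qed
  qed
  have w: "w t (\<phi> n) = W n t" for n
  proof (rule real_derivative_unique_within_Icc[OF J'(2)[OF t] _ T t])
    show "((\<lambda>r. J' r (\<phi> n)) has_real_derivative W n t) (at t within {0..T})"
      by (rule has_field_derivative_transform_within[OF j_deriv[OF t] zero_less_one t]) (simp add: J'j)
  qed
  have "Vs_norm m \<Lambda> \<phi> (1/\<alpha>) (U t) \<le> C0 * (Vs_norm m \<Lambda> \<phi> (1/\<alpha>) u0 + L2_norm m u1 + \<kappa>\<^sub>p * t powr (1/p + \<alpha> - 2) * B)"
    by (rule Vs_I(2)[OF Vs_L2[OF U(1)[OF t]]]) (use x_bound(1)[OF _ t] in \<open>simp add: U(2)[OF t]\<close>)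
  moreover have "L2_norm m (u' t) \<le> C0 * (Vs_norm m \<Lambda> \<phi> (1/\<alpha>) u0 + L2_norm m u1 + \<kappa>\<^sub>p * t powr (1/p + \<alpha> - 2) * B)"
    by (rule L2_norm_le[OF C(2)[OF t]]) (use x_bound(2)[OF _ t] in \<open>simp add: u'[OF t] cong: L2_set_cong\<close>)
  ultimately show "Vs_norm m \<Lambda> \<phi> (1/\<alpha>) (U t) + L2_norm m (u' t) \<le>
      2 * (C0 * (Vs_norm m \<Lambda> \<phi> (1/\<alpha>) u0 + L2_norm m u1 + \<kappa>\<^sub>p * t powr (1/p + \<alpha> - 2) * B))" by linarith
  show "Vdual_norm \<Lambda> \<phi> (1/\<alpha>) (w t) \<le> (SUP s\<in>{0..T}. Vdual_norm \<Lambda> \<phi> (1/\<alpha>) (f s))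
     + C0 * (Vs_norm m \<Lambda> \<phi> (1/\<alpha>) u0 + t powr (2 - \<alpha>) * L2_norm m u1 + t powr (1/p) * B)"
    unfolding add.commute[of "SUP s\<in>{0..T}. Vdual_norm \<Lambda> \<phi> (1/\<alpha>) (f s)"]
    by (rule Vdual_norm_le) (use W_bound[OF _ t] in \<open>simp add: w add.commute\<close>)
qed

end

section \<open>Well-posedness of the linear problem\<close>

theorem theorem3p2:
  fixes X :: "'a::metric_space set"
    and m :: "'a measure"
    and V D :: "('a \<Rightarrow> real) set"
    and E :: "('a \<Rightarrow> real) \<Rightarrow> ('a \<Rightarrow> real) \<Rightarrow> real"
    and A :: "('a \<Rightarrow> real) \<Rightarrow> ('a \<Rightarrow> real)"
    and \<Lambda> :: "nat \<Rightarrow> real"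
    and \<phi> :: "nat \<Rightarrow> 'a \<Rightarrow> real"
    and q\<^sub>A \<alpha> \<gamma> T p :: real
    and q :: ennreal
  assumes "compact (closure X)"
    and "radon_measure_on X m"
    and "measure_support X m = X"
    and "emeasure m X < \<infinity>"
    and "dirichlet_form m V E"
    and "selfadjoint_operator m D A"
    and "nonneg_operator m D A"
    and "D \<subseteq> V"
    and "\<forall>u\<in>D. \<forall>v\<in>V. E u v = L2_inner m (A u) v"
    and "compactly_embedded m V E"
    and "q\<^sub>A > 1"
    and "embedded_in_Lp m V E (2 * q\<^sub>A)"
    and "eigenbasis m D A \<Lambda> \<phi>"
    and "\<Lambda> 0 > 0"
    and "V = Vs m \<Lambda> \<phi> (1/2)"
    and "1 < \<alpha>" "\<alpha> < 2"
    and "\<gamma> = 1 / \<alpha>"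
    and "T > 0"
    and "1 \<le> p" "p < 1 / (2 - \<alpha>)"
    and "1 / ennreal p + 1 / q = 1"
  shows "\<exists>C>0. \<forall>u\<^sub>0\<in>Vs m \<Lambda> \<phi> \<gamma>. \<forall>u\<^sub>1\<in>L2 m. \<forall>f g. source_term m \<Lambda> \<phi> \<gamma> T q f g \<longrightarrow>
    (\<exists>u. weak_solution m E \<Lambda> \<phi> \<gamma> T \<alpha> u\<^sub>0 u\<^sub>1 g u \<and>
      (\<forall>v. weak_solution m E \<Lambda> \<phi> \<gamma> T \<alpha> u\<^sub>0 u\<^sub>1 g v \<longrightarrow> (\<forall>t\<in>{0..T}. ae_eq m (v t) (u t))) \<and>
      (\<forall>t\<in>{0..T}. \<exists>S\<^sub>1 S\<^sub>2 S\<^sub>3.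
        L2_sums m \<phi> (\<lambda>n. L2_inner m u\<^sub>0 (\<phi> n) * mittag_leffler \<alpha> 1 (- \<Lambda> n * t powr \<alpha>)) S\<^sub>1 \<and>
        L2_sums m \<phi> (\<lambda>n. L2_inner m u\<^sub>1 (\<phi> n) * t * mittag_leffler \<alpha> 2 (- \<Lambda> n * t powr \<alpha>)) S\<^sub>2 \<and>
        L2_sums m \<phi> (\<lambda>n. LINT \<tau>:{0..t}|lebesgue. L2_inner m (g \<tau>) (\<phi> n) *
          (t - \<tau>) powr (\<alpha> - 1) * mittag_leffler \<alpha> \<alpha> (- \<Lambda> n * (t - \<tau>) powr \<alpha>)) S\<^sub>3 \<and>
        ae_eq m (u t) (\<lambda>x. S\<^sub>1 x + S\<^sub>2 x + S\<^sub>3 x)) \<and>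
      (\<forall>u' w. C1_path (L2 m) (L2_norm m) T u u' \<and> caputo_derivative m \<Lambda> \<phi> \<gamma> T \<alpha> u u' w \<longrightarrow>
        (\<forall>t\<in>{0..T}.
          Vs_norm m \<Lambda> \<phi> \<gamma> (u t) + L2_norm m (u' t)
            \<le> C * (Vs_norm m \<Lambda> \<phi> \<gamma> u\<^sub>0 + L2_norm m u\<^sub>1
                    + t powr (1 / p + \<alpha> - 2) * LqL2_norm m T q g) \<and>
          Vdual_norm \<Lambda> \<phi> \<gamma> (w t)
            \<le> C * (Vs_norm m \<Lambda> \<phi> \<gamma> u\<^sub>0 + t powr (2 - \<alpha>) * L2_norm m u\<^sub>1
                    + t powr (1 / p) * LqL2_norm m T q g
                    + (SUP s\<in>{0..T}. Vdual_norm \<Lambda> \<phi> \<gamma> (f s))))))"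
proof -
  have "space m = X" using assms(2) by (simp add: radon_measure_on_def)
  then have fin: "finite_measure m" using assms(4) by (intro finite_measureI) auto
  have AL: "A u \<in> L2 m" if "u \<in> D" for u using assms(6) that unfolding selfadjoint_operator_def by blast
  interpret spectral_setting m V D E A \<Lambda> \<phi>
    by (rule spectral_setting.intro) (use fin AL assms(5,8,9,13-15) in simp_all)
  obtain C0 where bounds: "solution_bounds \<alpha> \<Lambda> C0"
    using ex_solution_bounds[OF assms(16,17) L0 Lambda_ge] by (rule exE)
  then have C0: "C0 > 0" by (simp add: solution_bounds_def)
  have data: "fractional_data m V D E A \<Lambda> \<phi> \<alpha> T p C0 q u0 u1 f g"
    if "u0 \<in> Vs m \<Lambda> \<phi> (1/\<alpha>)" "u1 \<in> L2 m" "source_term m \<Lambda> \<phi> (1/\<alpha>) T q f g" for u0 u1 f g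
    by (rule fractional_data.intro[OF spectral_setting_axioms fractional_data_axioms.intro])
      (rule assms that bounds)+
  define k where "k = (1 / ((\<alpha> - 2) * p + 1)) powr (1/p)"
  \<comment> \<open>\<open>2\<close> for the sum of two norms, \<open>k\<close> for the norm of the kernel, \<open>1\<close> for
the supremum of \<open>f\<close>\<close>
  define C where "C = 2 * C0 * (1 + k) + 1"
  have k: "k \<ge> 0" by (simp add: k_def)
  have le: "C0 \<le> C" "1 \<le> C" "2 * C0 \<le> C" "2 * C0 * k \<le> C" and C: "C > 0"
    using C0 k mult_nonneg_nonneg[of C0 k] unfolding C_def by (auto simp: algebra_simps intro: add_pos_nonneg)
  show ?thesis unfolding \<open>\<gamma> = 1 / \<alpha>\<close>
  proof (intro exI[of _ C] conjI C ballI allI impI)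
    fix u0 u1 f g
    assume d: "u0 \<in> Vs m \<Lambda> \<phi> (1/\<alpha>)" "u1 \<in> L2 m" "source_term m \<Lambda> \<phi> (1/\<alpha>) T q f g"
    interpret fractional_data m V D E A \<Lambda> \<phi> \<alpha> T p C0 q u0 u1 f g by (rule data[OF d])
    obtain U U' where UU': "\<forall>t\<in>{0..T}. U t \<in> Vs m \<Lambda> \<phi> (1/\<alpha>) \<and> U' t \<in> L2 m \<and> coef (U t) = (\<lambda>n. x n t) \<and> coef (U' t) = (\<lambda>n. x' n t)"
      using ex_solution_elements by (elim exE)
    have U: "U t \<in> Vs m \<Lambda> \<phi> (1/\<alpha>)" "coef (U t) n = x n t" and U': "U' t \<in> L2 m" "coef (U' t) n = x' n t" if "t \<in> {0..T}" for t n
      using UU' that by auto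
    let ?N0 = "Vs_norm m \<Lambda> \<phi> (1/\<alpha>) u0" and ?N1 = "L2_norm m u1" and ?Nf = "SUP s\<in>{0..T}. Vdual_norm \<Lambda> \<phi> (1/\<alpha>) (f s)"
    have N: "?N0 \<ge> 0" "?N1 \<ge> 0" by (simp_all add: Vs_norm_nonneg d)
    have Nf: "?Nf \<ge> 0" using f_sup[of 0] Vdual_norm_nonneg[OF f_Vdual[of 0]] T by simp
    show "\<exists>u. weak_solution m E \<Lambda> \<phi> (1/\<alpha>) T \<alpha> u0 u1 g u \<and>
      (\<forall>v. weak_solution m E \<Lambda> \<phi> (1/\<alpha>) T \<alpha> u0 u1 g v \<longrightarrow> (\<forall>t\<in>{0..T}. ae_eq m (v t) (u t))) \<and>
      (\<forall>t\<in>{0..T}. \<exists>S\<^sub>1 S\<^sub>2 S\<^sub>3.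
        L2_sums m \<phi> (\<lambda>n. L2_inner m u0 (\<phi> n) * mittag_leffler \<alpha> 1 (- \<Lambda> n * t powr \<alpha>)) S\<^sub>1 \<and>
        L2_sums m \<phi> (\<lambda>n. L2_inner m u1 (\<phi> n) * t * mittag_leffler \<alpha> 2 (- \<Lambda> n * t powr \<alpha>)) S\<^sub>2 \<and>
        L2_sums m \<phi> (\<lambda>n. LINT \<tau>:{0..t}|lebesgue. L2_inner m (g \<tau>) (\<phi> n) *
          (t - \<tau>) powr (\<alpha> - 1) * mittag_leffler \<alpha> \<alpha> (- \<Lambda> n * (t - \<tau>) powr \<alpha>)) S\<^sub>3 \<and>
        ae_eq m (u t) (\<lambda>x. S\<^sub>1 x + S\<^sub>2 x + S\<^sub>3 x)) \<and>
      (\<forall>u' w. C1_path (L2 m) (L2_norm m) T u u' \<and> caputo_derivative m \<Lambda> \<phi> (1/\<alpha>) T \<alpha> u u' w \<longrightarrow>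
        (\<forall>t\<in>{0..T}.
          Vs_norm m \<Lambda> \<phi> (1/\<alpha>) (u t) + L2_norm m (u' t)
            \<le> C * (?N0 + ?N1 + t powr (1 / p + \<alpha> - 2) * LqL2_norm m T q g) \<and>
          Vdual_norm \<Lambda> \<phi> (1/\<alpha>) (w t)
            \<le> C * (?N0 + t powr (2 - \<alpha>) * ?N1 + t powr (1 / p) * LqL2_norm m T q g + ?Nf)))"
    proof (intro exI[of _ U] conjI allI impI ballI)
      show "weak_solution m E \<Lambda> \<phi> (1/\<alpha>) T \<alpha> u0 u1 g U" by (rule U_weak_solution[OF U U'])
    next
      fix v t assume v: "weak_solution m E \<Lambda> \<phi> (1/\<alpha>) T \<alpha> u0 u1 g v" and t: "t \<in> {0..T}"
      show "ae_eq m (v t) (U t)"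
        by (rule coef_eq_imp_ae_eq[OF weak_solution_coordinates(1)[OF v t] Vs_L2[OF U(1)[OF t]]])
          (simp add: weak_solution_coordinates(2)[OF v t] U(2)[OF t])
    next
      fix t assume t: "t \<in> {0..T}"
      show "\<exists>S\<^sub>1 S\<^sub>2 S\<^sub>3.
        L2_sums m \<phi> (\<lambda>n. L2_inner m u0 (\<phi> n) * mittag_leffler \<alpha> 1 (- \<Lambda> n * t powr \<alpha>)) S\<^sub>1 \<and>
        L2_sums m \<phi> (\<lambda>n. L2_inner m u1 (\<phi> n) * t * mittag_leffler \<alpha> 2 (- \<Lambda> n * t powr \<alpha>)) S\<^sub>2 \<and>
        L2_sums m \<phi> (\<lambda>n. LINT \<tau>:{0..t}|lebesgue. L2_inner m (g \<tau>) (\<phi> n) *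
          (t - \<tau>) powr (\<alpha> - 1) * mittag_leffler \<alpha> \<alpha> (- \<Lambda> n * (t - \<tau>) powr \<alpha>)) S\<^sub>3 \<and>
        ae_eq m (U t) (\<lambda>x. S\<^sub>1 x + S\<^sub>2 x + S\<^sub>3 x)"
        by (rule solution_series[OF t Vs_L2[OF U(1)[OF t]] U(2)[OF t]])
    next
      fix u' w t assume c: "C1_path (L2 m) (L2_norm m) T U u' \<and> caputo_derivative m \<Lambda> \<phi> (1/\<alpha>) T \<alpha> U u' w" and t: "t \<in> {0..T}"
      note est = solution_estimates[OF U conjunct1[OF c] conjunct2[OF c] t]
      have P: "t powr (1/p + \<alpha> - 2) * B \<ge> 0" "t powr (1/p) * B \<ge> 0" "t powr (2 - \<alpha>) * ?N1 \<ge> 0" using B_nonneg N by simp_all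
      have "2 * (C0 * (?N0 + ?N1 + \<kappa>\<^sub>p * t powr (1/p + \<alpha> - 2) * B)) =
          2 * C0 * ?N0 + 2 * C0 * ?N1 + 2 * C0 * k * (t powr (1/p + \<alpha> - 2) * B)"
        by (simp add: \<kappa>\<^sub>p_def k_def algebra_simps)
      also have "\<dots> \<le> C * ?N0 + C * ?N1 + C * (t powr (1/p + \<alpha> - 2) * B)"
        by (intro add_mono mult_right_mono le N P)
      finally show "Vs_norm m \<Lambda> \<phi> (1/\<alpha>) (U t) + L2_norm m (u' t) \<le> C * (?N0 + ?N1 + t powr (1 / p + \<alpha> - 2) * LqL2_norm m T q g)"
        using est(1) unfolding B_def[symmetric] distrib_left by linarith
      have "?Nf + C0 * (?N0 + t powr (2 - \<alpha>) * ?N1 + t powr (1/p) * B) =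
          1 * ?Nf + (C0 * ?N0 + C0 * (t powr (2 - \<alpha>) * ?N1) + C0 * (t powr (1/p) * B))"
        by (simp add: distrib_left)
      also have "\<dots> \<le> C * ?Nf + (C * ?N0 + C * (t powr (2 - \<alpha>) * ?N1) + C * (t powr (1/p) * B))"
        by (intro add_mono mult_right_mono le N P Nf)
      finally show "Vdual_norm \<Lambda> \<phi> (1/\<alpha>) (w t) \<le> C * (?N0 + t powr (2 - \<alpha>) * ?N1 + t powr (1 / p) * LqL2_norm m T q g + ?Nf)"
        using est(2) unfolding B_def[symmetric] distrib_left by linarith
    qed
  qed
qed

end
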